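(* Fix an integer $d\ge2$, $\kappa_*>0$, $0<\kappa\le\kappa_*$, $T>0$ and $N\ge 2$. Let $\rho$ be a probability-density-valued solution of $$\partial_t\rho+\nabla\cdot(\rho u_\rho^\kappa)=0,\qquad u_\rho^\kappa=-\nabla g_{\kappa,d}*\rho,$$ on $[0,T]$ with $\rho\in C([0,T];(\mathcal P_2(\mathbb R^d),W_2))$ and $$\Lambda_T:=1+\sup_{t\le T}\bigl(\|\rho(t)\|_{L^\infty}+\|u_\rho^\kappa(t)\|_{W^{1,\infty}}\bigr)<\infty.$$ Let $\rho_N^0\in\mathcal P_2((\mathbb R^d)^N)$ be symmetric, let $B=B(d,\kappa_*,\Lambda_T)$ and $\eta_0=\eta_0(d,\kappa_* )$ be the fixed commutator constants described in the context, let $0<\eta<\eta_0$, set $$\mathfrak E_N^{\kappa,0}(\eta):=\frac1N W_2^2(\rho_N^0,\rho(0)^{\otimes N})+\int\bigl[\mathcal F_N^{\kappa,\sharp}(X_N,\rho(0))+B\varepsilon_N^\kappa(\eta)\bigr]\,d\rho_N^0(X_N),$$ and assume $\mathfrak E_N^{\kappa,0}(\eta)<\infty$. Then, with $\rho_N(t)$ the law at time $t$ of the particle system with initial law $\rho_N^0$, $$\sup_{0\le t\le T}\Bigl\{\frac1N W_2^2(\rho_N(t),\rho(t)^{\otimes N})+\int\bigl[\mathcal F_N^{\kappa,\sharp}(X_N,\rho(t))+B\varepsilon_N^\kappa(\eta)\bigr]\,d\rho_N(t)\Bigr\}+\int_0^T\!\!\int\mathcal D_N^\kappa(X_N,\rho(t))\,d\rho_N(t)\,dt\le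 C_T\,\mathfrak E_N^{\kappa,0}(\eta).$$ In particular $$\sup_{0\le t\le T}\frac1N W_2^2(\rho_N(t),\rho(t)^{\otimes N})\le C_T\,\mathfrak E_N^{\kappa,0}(\eta),$$ and for every $1\le k\le N$, $$\sup_{0\le t\le T}W_2^2(\rho_{N:k}(t),\rho(t)^{\otimes k})\le C_T\,k\,\mathfrak E_N^{\kappa,0}(\eta).$$ Here $C_T=C(d,T,\kappa_*,\Lambda_T)$ is the same for every $N$, every $1\le k\le N$ and every $0<\eta<\eta_0$; in particular, for a family of limiting solutions with a common value of $\Lambda_T$, it is uniform over $0<\kappa\le\kappa_*$ and depends on the individual solution only through that common bound.
   Context: Yukawa kernel: for $\kappa>0$, $g_{\kappa,d}(x)=(2\pi)^{-d/2}\left(\frac{\kappa}{|x|}\right)^{\nu_d}K_{\nu_d}(\kappa|x|)$, $\nu_d=\frac d2-1$, with $K_\nu$ the modified Bessel function of the second kind; $(-\Delta+\kappa^2)g_{\kappa,d}=\delta_0$. Particle system: $\dot x_i=-\frac1N\sum_{j\ne i}\nabla g_{\kappa,d}(x_i-x_j)$, $i=1,\dots,N$. It has a unique global smooth collision-free flow $\Phi_t^{N,\kappa}$ on $(\mathbb R^d)^N\setminus\Delta_N$, where $\Delta_N=\{X_N:\exists i\neq j,\ x_i=x_j\}$. Finiteness of $\mathfrak E_N^{\kappa,0}(\eta)$ implies $\rho_N^0(\Delta_N)=0$, and $\rho_N(t)=(\Phi_t^{N,\kappa})_\#\rho_N^0$; $\rho_{N:k}(t)$ is its $k$-particle marginal.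 $W_2$ is the quadratic Wasserstein distance for the Euclidean cost; on $(\mathbb R^d)^N$ the cost is $\sum_{i=1}^N|x_i-y_i|^2$. $\mathcal P_2$ denotes probability measures with finite second moment. "Symmetric" means invariant under permutations of the particles. For $X_N\notin\Delta_N$, $\mu_{X_N}=\frac1N\sum_i\delta_{x_i}$, $$\mathcal F_N^{g_{\kappa,d}}(X_N,\rho)=\iint_{x\ne y}g_{\kappa,d}(x-y)\,d(\mu_{X_N}-\rho)(x)\,d(\mu_{X_N}-\rho)(y),$$ $$\mathcal H_N^{g_{\kappa,d}}(X_N,\rho;u)=\iint_{x\ne y}(u(x)-u(y))\cdot\nabla g_{\kappa,d}(x-y)\,d(\mu_{X_N}-\rho)(x)\,d(\mu_{X_N}-\rho)(y),$$ $\mathcal F_N^{\kappa,\sharp}=\mathcal F_N^{g_{\kappa,d}}-c_{\kappa,d}/N$ with $c_{\kappa,d}=0$ for $d\ge3$, $c_{\kappa,2}=\frac{\log\kappa}{2\pi}$, and $$\mathcal D_N^\kappa(X_N,\rho)=\frac1N\sum_{i=1}^N\Bigl|\frac1N\sum_{j\ne i}\nabla g_{\kappa,d}(x_i-x_j)-\nabla g_{\kappa,d}*\rho(x_i)\Bigr|^2.$$ $\mathcal F_N^{\kappa,\sharp}$ and $\mathcal D_N^\kappa$ are set equal to $+\infty$ on $\Delta_N$. Error: $\ell_2(r)=1+\log_+(1/r)$, $\ell_d(r)=r^{2-d}$ for $d\ge3$, $\varepsilon_N^\kappa(\eta)=\frac{\ell_d(\eta)}N+\eta^2+\kappa^2\eta^2$.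 Commutator constants (fixed once and for all, as functions of the indicated parameters): $\eta_0=\eta_0(d,\kappa_* )>0$ and $B,C_{\rm com}\ge1$ depending only on $(d,\kappa_*,\Lambda)$ are such that for all $N\ge2$, $0<\kappa\le\kappa_*$, $0<\eta<\eta_0$, all probability densities $\rho$ with $\|\rho\|_{L^\infty}\le\Lambda$, all $X_N\notin\Delta_N$ and all globally Lipschitz $u$: $\mathcal F_N^{\kappa,\sharp}(X_N,\rho)+B\varepsilon_N^\kappa(\eta)\ge\varepsilon_N^\kappa(\eta)\ge0$ and $|\mathcal H_N^{g_{\kappa,d}}(X_N,\rho;u)|\le C_{\rm com}\|\nabla u\|_{L^\infty}(\mathcal F_N^{\kappa,\sharp}(X_N,\rho)+B\varepsilon_N^\kappa(\eta))$. (Such constants exist by the paper's uniform commutator theorem; they are used with $\Lambda=\Lambda_T$.) *)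

theory Defs
  imports "HOL-Probability.Probability"
begin

coinductive smooth :: "('a::real_normed_vector \<Rightarrow> real) \<Rightarrow> bool" where
  "\<lbrakk>\<And>x. f differentiable (at x); \<And>v. smooth (\<lambda>x. frechet_derivative f (at x) v)\<rbrakk> \<Longrightarrow> smooth f"

definition test_function :: "'a::real_normed_vector set \<Rightarrow> ('a \<Rightarrow> real) \<Rightarrow> bool" where
  "test_function S \<phi> \<longleftrightarrow>
     smooth \<phi> \<and> compact (closure {x. \<phi> x \<noteq> 0}) \<and> closure {x. \<phi> x \<noteq> 0} \<subseteq> S"

definition grad :: "('a::euclidean_space \<Rightarrow> real) \<Rightarrow> 'a \<Rightarrow> 'a" where
  "grad f x = (THE D. GDERIV f x :> D)"

definition Linf_norm :: "(real^'n \<Rightarrow> 'b::real_normed_vector) \<Rightarrow> ennreal" where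
  "Linf_norm f = esssup lborel (\<lambda>x. ennreal (norm (f x)))"

definition locally_integrable ::
  "(real^'n \<Rightarrow> 'b::{banach, second_countable_topology}) \<Rightarrow> bool" where
  "locally_integrable f \<longleftrightarrow> f \<in> borel_measurable borel \<and> (\<forall>K. compact K \<longrightarrow> set_integrable lborel K f)"

definition weak_gradient :: "(real^'n \<Rightarrow> real^'n) \<Rightarrow> (real^'n \<Rightarrow> real^'n^'n) \<Rightarrow> bool" where
  "weak_gradient u G \<longleftrightarrow> locally_integrable u \<and> locally_integrable G \<and>
     (\<forall>\<phi> i j. test_function UNIV \<phi> \<longrightarrow>
        (LINT x|lborel. u x $ i * frechet_derivative \<phi> (at x) (axis j 1)) =
        - (LINT x|lborel. G x $ i $ j * \<phi> x))"

text \<open>The weak gradient is unique up to null sets, so the infimum only serves to select it; it is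
  infinite if there is none. Matrices carry the operator norm.\<close>

definition grad_Linf_norm :: "(real^'n \<Rightarrow> real^'n) \<Rightarrow> ennreal" where
  "grad_Linf_norm u =
     (INF G\<in>{G. weak_gradient u G}. esssup lborel (\<lambda>x. ennreal (onorm (\<lambda>v. G x *v v))))"

definition W1inf_norm :: "(real^'n \<Rightarrow> real^'n) \<Rightarrow> ennreal" where
  "W1inf_norm u = Linf_norm u + grad_Linf_norm u"

definition couplings :: "'a measure \<Rightarrow> 'b measure \<Rightarrow> ('a \<times> 'b) measure set" where
  "couplings \<mu> \<nu> =
     {\<pi>. sets \<pi> = sets (\<mu> \<Otimes>\<^sub>M \<nu>) \<and> distr \<pi> \<mu> fst = \<mu> \<and> distr \<pi> \<nu> snd = \<nu>}"

definition esqrt :: "ennreal \<Rightarrow> ennreal" where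
  "esqrt a = (if a = \<infinity> then \<infinity> else ennreal (sqrt (enn2real a)))"

text \<open>The distance function is a parameter because configurations are functions on an index set,
  which do not form a metric space type.\<close>

definition W2 :: "('a \<Rightarrow> 'a \<Rightarrow> real) \<Rightarrow> 'a measure \<Rightarrow> 'a measure \<Rightarrow> ennreal" where
  "W2 \<delta> \<mu> \<nu> =
     esqrt (INF \<pi>\<in>couplings \<mu> \<nu>. \<integral>\<^sup>+ p. ennreal ((\<delta> (fst p) (snd p))\<^sup>2) \<partial>\<pi>)"

lemma esqrt_power2: "(esqrt a)\<^sup>2 = a"
proof (cases "a = \<infinity>")
  case False
  then have "(esqrt a)\<^sup>2 = ennreal (enn2real a)"
    by (simp add: esqrt_def ennreal_power)
  with False show ?thesis
    by (simp add: top.not_eq_extremum)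
qed (simp add: esqrt_def)

lemma W2_power2:
  "(W2 \<delta> \<mu> \<nu>)\<^sup>2 = (INF \<pi>\<in>couplings \<mu> \<nu>. \<integral>\<^sup>+ p. ennreal ((\<delta> (fst p) (snd p))\<^sup>2) \<partial>\<pi>)"
  by (simp add: W2_def esqrt_power2)

text \<open>Modified Bessel function of the second kind, by its integral representation for
  positive argument.\<close>

definition Bessel_K :: "real \<Rightarrow> real \<Rightarrow> real" where
  "Bessel_K \<nu> z = (LINT t:{0..}|lborel. exp (- z * cosh t) * cosh (\<nu> * t))"

definition yukawa :: "real \<Rightarrow> real^'n \<Rightarrow> real" where
  "yukawa \<kappa> x =
     (let d = real CARD('n); \<nu> = d / 2 - 1
      in (2 * pi) powr (- d / 2) * (\<kappa> / norm x) powr \<nu> * Bessel_K \<nu> (\<kappa> * norm x))"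

definition grad_yukawa_conv :: "real \<Rightarrow> (real^'n) measure \<Rightarrow> real^'n \<Rightarrow> real^'n" where
  "grad_yukawa_conv \<kappa> \<mu> x = (LINT y|\<mu>. grad (yukawa \<kappa>) (x - y))"

text \<open>Configurations of \<open>N\<close> particles are the extensional functions on the index
  set \<open>{..<N}\<close>, so that \<open>N\<close> may vary inside the statement.\<close>

abbreviation config_space :: "nat \<Rightarrow> (nat \<Rightarrow> real^'n) measure" where
  "config_space N \<equiv> PiM {..<N} (\<lambda>_. borel)"

definition config_dist :: "nat \<Rightarrow> (nat \<Rightarrow> real^'n) \<Rightarrow> (nat \<Rightarrow> real^'n) \<Rightarrow> real" where
  "config_dist N X Y = L2_set (\<lambda>i. dist (X i) (Y i)) {..<N}"

definition collisions :: "nat \<Rightarrow> (nat \<Rightarrow> real^'n) set" where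
  "collisions N = {X. \<exists>i<N. \<exists>j<N. i \<noteq> j \<and> X i = X j}"

definition trajectory :: "real \<Rightarrow> nat \<Rightarrow> (nat \<Rightarrow> real^'n) \<Rightarrow> (real \<Rightarrow> nat \<Rightarrow> real^'n) \<Rightarrow> bool" where
  "trajectory \<kappa> N X0 x \<longleftrightarrow> x 0 = X0 \<and>
     (\<forall>t\<ge>0. x t \<in> space (config_space N) \<and> x t \<notin> collisions N \<and>
       (\<forall>i<N. ((\<lambda>s. x s i) has_vector_derivative
          - (1 / real N) *\<^sub>R (\<Sum>j\<in>{..<N} - {i}. grad (yukawa \<kappa>) (x t i - x t j)))
          (at t within {0..})))"

text \<open>The value on the collision set is irrelevant (it is a null set of the initial law); it is
  chosen so that the map stays measurable.\<close>

definition flow :: "real \<Rightarrow> nat \<Rightarrow> real \<Rightarrow> (nat \<Rightarrow> real^'n) \<Rightarrow> (nat \<Rightarrow> real^'n)" where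
  "flow \<kappa> N t X0 =
     (if X0 \<in> collisions N then X0 else (THE Y. \<exists>x. trajectory \<kappa> N X0 x \<and> Y = x t))"

definition law_at :: "real \<Rightarrow> nat \<Rightarrow> (nat \<Rightarrow> real^'n) measure \<Rightarrow> real \<Rightarrow> (nat \<Rightarrow> real^'n) measure" where
  "law_at \<kappa> N P0 t = distr P0 (config_space N) (flow \<kappa> N t)"

definition marginal :: "nat \<Rightarrow> (nat \<Rightarrow> real^'n) measure \<Rightarrow> (nat \<Rightarrow> real^'n) measure" where
  "marginal k P = distr P (config_space k) (\<lambda>X. restrict X {..<k})"

definition config_P2 :: "nat \<Rightarrow> (nat \<Rightarrow> real^'n) measure \<Rightarrow> bool" where
  "config_P2 N P \<longleftrightarrow> prob_space P \<and> sets P = sets (config_space N :: (nat \<Rightarrow> real^'n) measure) \<and>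
     (\<integral>\<^sup>+ X. ennreal (\<Sum>i<N. (norm (X i))\<^sup>2) \<partial>P) < \<infinity>"

definition symmetric_law :: "nat \<Rightarrow> (nat \<Rightarrow> real^'n) measure \<Rightarrow> bool" where
  "symmetric_law N P \<longleftrightarrow>
     (\<forall>\<sigma>. \<sigma> permutes {..<N} \<longrightarrow> distr P (config_space N) (\<lambda>X. X \<circ> \<sigma>) = P)"

definition prob_density :: "(real^'n \<Rightarrow> real) \<Rightarrow> bool" where
  "prob_density f \<longleftrightarrow> f \<in> borel_measurable borel \<and> (\<forall>x. 0 \<le> f x) \<and>
     (\<integral>\<^sup>+ x. ennreal (f x) \<partial>lborel) = 1"

abbreviation density_law :: "(real^'n \<Rightarrow> real) \<Rightarrow> (real^'n) measure" where
  "density_law f \<equiv> density lborel (\<lambda>x. ennreal (f x))"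

abbreviation tensor_power :: "nat \<Rightarrow> (real^'n \<Rightarrow> real) \<Rightarrow> (nat \<Rightarrow> real^'n) measure" where
  "tensor_power N f \<equiv> PiM {..<N} (\<lambda>_. density_law f)"

definition velocity :: "real \<Rightarrow> (real^'n \<Rightarrow> real) \<Rightarrow> real^'n \<Rightarrow> real^'n" where
  "velocity \<kappa> f x = - grad_yukawa_conv \<kappa> (density_law f) x"

text \<open>The equation holds in the sense of distributions on \<open>(0,T) \<times> \<real>\<^sup>d\<close>;
  the derivative of \<open>\<phi>\<close> in direction \<open>(1, u)\<close> is
  \<open>\<partial>\<^sub>t \<phi> + u \<bullet> \<nabla>\<phi>\<close>.\<close>

definition continuity_equation :: "real \<Rightarrow> real \<Rightarrow> (real \<Rightarrow> real^'n \<Rightarrow> real) \<Rightarrow> bool" where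
  "continuity_equation \<kappa> T \<rho> \<longleftrightarrow>
     (\<forall>\<phi>. test_function ({0<..<T} \<times> UNIV) \<phi> \<longrightarrow>
        (LINT t:{0..T}|lborel.
           (LINT x|density_law (\<rho> t). frechet_derivative \<phi> (at (t, x)) (1, velocity \<kappa> (\<rho> t) x))) = 0)"

definition solution :: "real \<Rightarrow> real \<Rightarrow> (real \<Rightarrow> real^'n \<Rightarrow> real) \<Rightarrow> bool" where
  "solution \<kappa> T \<rho> \<longleftrightarrow>
     (\<forall>t\<in>{0..T}. prob_density (\<rho> t) \<and>
        (\<integral>\<^sup>+ x. ennreal ((norm x)\<^sup>2) \<partial>density_law (\<rho> t)) < \<infinity>) \<and>
     (\<forall>s\<in>{0..T}. ((\<lambda>t. W2 dist (density_law (\<rho> t)) (density_law (\<rho> s))) \<longlongrightarrow> 0)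
        (at s within {0..T})) \<and>
     continuity_equation \<kappa> T \<rho>"

definition Lambda_bound :: "real \<Rightarrow> real \<Rightarrow> (real \<Rightarrow> real^'n \<Rightarrow> real) \<Rightarrow> ennreal" where
  "Lambda_bound \<kappa> T \<rho> =
     1 + (SUP t\<in>{0..T}. Linf_norm (\<rho> t) + W1inf_norm (velocity \<kappa> (\<rho> t)))"

definition empirical :: "nat \<Rightarrow> (nat \<Rightarrow> real^'n) \<Rightarrow> (real^'n) measure" where
  "empirical N X = distr (uniform_count_measure {..<N}) borel X"

text \<open>Off-diagonal double integral against \<open>(\<mu> - \<nu>) \<otimes> (\<mu> - \<nu>)\<close>.\<close>

definition offdiag_integral ::
  "(real^'n) measure \<Rightarrow> (real^'n) measure \<Rightarrow> (real^'n \<Rightarrow> real^'n \<Rightarrow> real) \<Rightarrow> real" where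
  "offdiag_integral \<mu> \<nu> h =
     (let I = (\<lambda>\<alpha> \<beta>. LINT p:{p. fst p \<noteq> snd p}|(\<alpha> \<Otimes>\<^sub>M \<beta>). h (fst p) (snd p))
      in I \<mu> \<mu> - I \<mu> \<nu> - I \<nu> \<mu> + I \<nu> \<nu>)"

definition mod_energy :: "real \<Rightarrow> nat \<Rightarrow> (nat \<Rightarrow> real^'n) \<Rightarrow> (real^'n \<Rightarrow> real) \<Rightarrow> real" where
  "mod_energy \<kappa> N X f =
     offdiag_integral (empirical N X) (density_law f) (\<lambda>x y. yukawa \<kappa> (x - y))"

definition commutator ::
  "real \<Rightarrow> nat \<Rightarrow> (nat \<Rightarrow> real^'n) \<Rightarrow> (real^'n \<Rightarrow> real) \<Rightarrow> (real^'n \<Rightarrow> real^'n) \<Rightarrow> real" where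
  "commutator \<kappa> N X f u =
     offdiag_integral (empirical N X) (density_law f)
       (\<lambda>x y. (u x - u y) \<bullet> grad (yukawa \<kappa>) (x - y))"

definition self_const :: "nat \<Rightarrow> real \<Rightarrow> real" where
  "self_const d \<kappa> = (if d = 2 then ln \<kappa> / (2 * pi) else 0)"

definition mod_energy_sharp :: "real \<Rightarrow> nat \<Rightarrow> (nat \<Rightarrow> real^'n) \<Rightarrow> (real^'n \<Rightarrow> real) \<Rightarrow> ereal" where
  "mod_energy_sharp \<kappa> N X f =
     (if X \<in> collisions N then \<infinity>
      else ereal (mod_energy \<kappa> N X f - self_const CARD('n) \<kappa> / real N))"

definition dissipation :: "real \<Rightarrow> nat \<Rightarrow> (nat \<Rightarrow> real^'n) \<Rightarrow> (real^'n \<Rightarrow> real) \<Rightarrow> ennreal" where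
  "dissipation \<kappa> N X f =
     (if X \<in> collisions N then \<infinity>
      else ennreal (1 / real N * (\<Sum>i<N.
        (norm ((1 / real N) *\<^sub>R (\<Sum>j\<in>{..<N} - {i}. grad (yukawa \<kappa>) (X i - X j))
               - grad_yukawa_conv \<kappa> (density_law f) (X i)))\<^sup>2)))"

definition ell :: "nat \<Rightarrow> real \<Rightarrow> real" where
  "ell d r = (if d = 2 then 1 + max 0 (ln (1 / r)) else r powi (2 - int d))"

definition eps :: "nat \<Rightarrow> nat \<Rightarrow> real \<Rightarrow> real \<Rightarrow> real" where
  "eps d N \<kappa> \<eta> = ell d \<eta> / real N + \<eta>\<^sup>2 + \<kappa>\<^sup>2 * \<eta>\<^sup>2"

definition commutator_constants ::
  "'n::finite itself \<Rightarrow> real \<Rightarrow> real \<Rightarrow> real \<Rightarrow> real \<Rightarrow> real \<Rightarrow> bool" where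
  "commutator_constants _ \<kappa>s \<Lambda> \<eta>\<^sub>0 B C \<longleftrightarrow> \<eta>\<^sub>0 > 0 \<and> B \<ge> 1 \<and> C \<ge> 1 \<and>
     (\<forall>N \<kappa> \<eta> (f :: real^'n \<Rightarrow> real) X u.
        2 \<le> N \<and> 0 < \<kappa> \<and> \<kappa> \<le> \<kappa>s \<and> 0 < \<eta> \<and> \<eta> < \<eta>\<^sub>0 \<and>
        prob_density f \<and> Linf_norm f \<le> ennreal \<Lambda> \<and>
        X \<in> space (config_space N) \<and> X \<notin> collisions N \<and> (\<exists>L. L-lipschitz_on UNIV u) \<longrightarrow>
          mod_energy_sharp \<kappa> N X f + ereal (B * eps CARD('n) N \<kappa> \<eta>) \<ge> ereal (eps CARD('n) N \<kappa> \<eta>) \<and>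
          eps CARD('n) N \<kappa> \<eta> \<ge> 0 \<and>
          ennreal \<bar>commutator \<kappa> N X f u\<bar> \<le>
            ennreal C * grad_Linf_norm u *
            e2ennreal (mod_energy_sharp \<kappa> N X f + ereal (B * eps CARD('n) N \<kappa> \<eta>)))"

text \<open>The bracket is nonnegative for every density bounded by \<open>\<Lambda>\<close> when \<open>B\<close> is a
  commutator constant for \<open>\<Lambda>\<close>, so the conversion by \<open>e2ennreal\<close> truncates nothing there.\<close>

definition total_error ::
  "real \<Rightarrow> nat \<Rightarrow> real \<Rightarrow> real \<Rightarrow> (nat \<Rightarrow> real^'n) measure \<Rightarrow> (real^'n \<Rightarrow> real) \<Rightarrow> ennreal" where
  "total_error \<kappa> N B \<eta> P f =
     (W2 (config_dist N) P (tensor_power N f))\<^sup>2 / of_nat N +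
     (\<integral>\<^sup>+ X. e2ennreal (mod_energy_sharp \<kappa> N X f + ereal (B * eps CARD('n) N \<kappa> \<eta>)) \<partial>P)"

end

theory Submission
  imports Defs
begin

text \<open>Let \<open>Y\<close> be the flow of the velocity field \<open>u\<close> of the mean-field solution. For a
  configuration moving with the particle system and initial positions \<open>z\<close> moving with \<open>Y\<close>, the
  sum of the mean square displacement and of the modulated energy grows at most exponentially: the modulated
  energy changes at the rate \<open>- 2 D + H\<close>, where \<open>D\<close> is the dissipation and the commutator
  \<open>H\<close> is bounded by the modulated energy itself, while the displacement changes by at most
  \<open>D\<close> plus a multiple of the displacement, by Young's inequality and the Lipschitz bound on
  \<open>u\<close>. So one copy of \<open>D\<close> remains on the left. Integrating the resulting Gronwall estimate
  against a coupling of the initial laws and then optimising the coupling gives the bound on the laws,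
  because the particle flow and \<open>Y\<close> transport the coupling to one at time \<open>t\<close>.

  The latter requires that \<open>\<rho>(t)\<close> is the image of \<open>\<rho>(0)\<close> under \<open>Y\<close>. This is uniqueness for
  the linear continuity equation with a Lipschitz field, proved by testing the equation with mollifications
  of observables that are constant along characteristics.

  The kernel is a mixture of Gaussians, hence a convex decreasing function of \<open>|x|\<^sup>2\<close> with
  all derivatives explicit; continuing it by a tangent below \<open>|x|\<^sup>2 = \<delta>\<close> gives a globally Lipschitz
  force. The interaction energy keeps the particles apart, so that their trajectories do not notice
  the truncation.\<close>

section \<open>Smooth functions and mollification\<close>

text \<open>The density is merely bounded and continuous in time for \<open>W2\<close>, so the
  mean-field velocity is continuous in time and Lipschitz in space but need not be differentiable,
  and the kernel is singular. Two consequences shape the proof. Averaged energies are not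
  differentiated pointwise: their evolution laws equate an increment with a time integral, and
  Gronwall's inequality is applied in integral form. And an observable carried along characteristics
  is only Lipschitz, hence no test function: it is mollified in space and time jointly, and the
  error in the transport equation is controlled by continuity of the field instead of its
  derivatives.

  The Lipschitz constant of the field has to be controlled by \<Lambda> alone. It is extracted from
  the weak gradient, and the summand 1 in \<open>Lambda_bound\<close> supplies the strict inequality
  needed to pick one weak gradient.

  The final constant is \<open>2 * exp (rate * T)\<close>; the factor 2 appears because the supremum
  in time and the integrated dissipation are bounded separately by the same pathwise
  estimate.\<close>

primrec ndiff :: "nat \<Rightarrow> ('a::real_normed_vector \<Rightarrow> real) \<Rightarrow> bool" where
  "ndiff 0 f \<longleftrightarrow> True"
| "ndiff (Suc n) f \<longleftrightarrow>
     (\<forall>x. f differentiable (at x)) \<and> (\<forall>v. ndiff n (\<lambda>x. frechet_derivative f (at x) v))"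

lemma smooth_differentiable: "smooth f \<Longrightarrow> f differentiable (at x)"
  by (auto elim: smooth.cases)

lemma smooth_frechet_derivative: "smooth f \<Longrightarrow> smooth (\<lambda>x. frechet_derivative f (at x) v)"
  by (auto elim: smooth.cases)

lemma smooth_has_derivative: "smooth f \<Longrightarrow> (f has_derivative frechet_derivative f (at x)) (at x)"
  using smooth_differentiable frechet_derivative_works by blast

lemma smooth_continuous_on: "smooth f \<Longrightarrow> continuous_on S f"
  by (meson continuous_at_imp_continuous_on differentiable_imp_continuous_within
      smooth_differentiable)

text \<open>Splitting the coinductive predicate into finite orders lets closure under products,
  composition and convolution be proved by induction on the order. A direct coinduction would need a
  relation closed under sums, since the product rule leaves the set of products.\<close>

lemma smooth_iff_ndiff: "smooth f \<longleftrightarrow> (\<forall>n. ndiff n f)"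
proof
  show "\<forall>n. ndiff n f" if "smooth f"
  proof
    show "ndiff n f" for n
      using that by (induction n arbitrary: f)
        (auto simp: smooth_differentiable smooth_frechet_derivative)
  qed
next
  assume "\<forall>n. ndiff n f"
  then show "smooth f"
  proof (coinduction arbitrary: f)
    case smooth
    have "f differentiable (at x)" for x
      using smooth[rule_format, of "Suc 0"] by simp
    moreover have "ndiff n (\<lambda>x. frechet_derivative f (at x) v)" for n v
      using smooth[rule_format, of "Suc n"] by simp
    ultimately show ?case by blast
  qed
qed

lemma ndiff_SucI:
  assumes "\<And>x. (f has_derivative f' x) (at x)" and "\<And>v. ndiff n (\<lambda>x. f' x v)"
  shows "ndiff (Suc n) f"
proof -
  have "frechet_derivative f (at x) = f' x" for x
    using frechet_derivative_at[OF assms(1)] by simp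
  then show ?thesis
    using assms by (auto simp: differentiable_def)
qed

lemma ndiff_SucD:
  assumes "ndiff (Suc n) f"
  shows "(f has_derivative frechet_derivative f (at x)) (at x)"
    "ndiff n (\<lambda>x. frechet_derivative f (at x) v)"
  using assms by (auto simp: frechet_derivative_works)

lemma ndiff_antimono: "ndiff (Suc n) f \<Longrightarrow> ndiff n f"
  by (induction n arbitrary: f) auto

lemma ndiff_const: "ndiff n (\<lambda>x. c)"
proof (induction n arbitrary: c)
  case (Suc n)
  show ?case by (rule ndiff_SucI[where f'="\<lambda>_ _. 0"]) (auto simp: Suc)
qed simp

lemma ndiff_add: "ndiff n f \<Longrightarrow> ndiff n g \<Longrightarrow> ndiff n (\<lambda>x. f x + g x)"
proof (induction n arbitrary: f g)
  case (Suc n)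
  show ?case
    by (rule ndiff_SucI[OF has_derivative_add[OF ndiff_SucD(1)[OF Suc.prems(1)] ndiff_SucD(1)[OF Suc.prems(2)]]])
      (intro Suc.IH ndiff_SucD(2)[OF Suc.prems(1)] ndiff_SucD(2)[OF Suc.prems(2)])
qed simp

lemma ndiff_mult: "ndiff n f \<Longrightarrow> ndiff n g \<Longrightarrow> ndiff n (\<lambda>x. f x * g x)"
proof (induction n arbitrary: f g)
  case (Suc n)
  show ?case
    by (rule ndiff_SucI[OF has_derivative_mult[OF ndiff_SucD(1)[OF Suc.prems(1)] ndiff_SucD(1)[OF Suc.prems(2)]]])
      (intro ndiff_add Suc.IH ndiff_SucD(2)[OF Suc.prems(1)] ndiff_SucD(2)[OF Suc.prems(2)]
        ndiff_antimono[OF Suc.prems(1)] ndiff_antimono[OF Suc.prems(2)])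
qed simp

lemma ndiff_compose:
  fixes h :: "real \<Rightarrow> real"
  shows "ndiff n h \<Longrightarrow> ndiff n f \<Longrightarrow> ndiff n (\<lambda>x. h (f x))"
proof (induction n arbitrary: h f)
  case (Suc n)
  note h = ndiff_SucD[OF Suc.prems(1)] and f = ndiff_SucD[OF Suc.prems(2)]
  \<comment> \<open>A linear map on the reals is multiplication by its value at 1, which turns the
    chain rule into a product of two functions of lower order.\<close>
  have eq: "frechet_derivative h (at y) r = r * frechet_derivative h (at y) 1" for y r
    using linear_cmul[OF has_derivative_linear[OF h(1)], of y r 1] by simp
  show ?case
  proof (rule ndiff_SucI)
    show "((\<lambda>x. h (f x)) has_derivative
        (\<lambda>v. frechet_derivative h (at (f x)) (frechet_derivative f (at x) v))) (at x)" for x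
      by (rule has_derivative_compose[OF f(1) h(1)])
    show "ndiff n (\<lambda>x. frechet_derivative h (at (f x)) (frechet_derivative f (at x) v))" for v
      by (subst eq) (rule ndiff_mult[OF f(2) Suc.IH[OF h(2) ndiff_antimono[OF Suc.prems(2)]]])
  qed
qed simp

lemma ndiff_affine:
  fixes b :: "'a::real_normed_vector"
  shows "ndiff n f \<Longrightarrow> ndiff n (\<lambda>x. f (c *\<^sub>R x + b))"
proof (induction n arbitrary: f)
  case (Suc n)
  note f = ndiff_SucD[OF Suc.prems]
  have "((\<lambda>x. c *\<^sub>R x + b) has_derivative (\<lambda>v. c *\<^sub>R v)) (at x)" for x :: 'a
    by (auto intro!: derivative_eq_intros)
  note * = has_derivative_compose[OF this f(1)]
  have eq: "frechet_derivative f (at y) (c *\<^sub>R v) = c * frechet_derivative f (at y) v" for y v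
    using linear_cmul[OF has_derivative_linear[OF f(1)]] by simp
  show ?case
    by (rule ndiff_SucI[OF *], unfold eq) (rule ndiff_mult[OF ndiff_const Suc.IH[OF f(2)]])
qed simp

lemma ndiff_inner_self: "ndiff n (\<lambda>x::'a::real_inner. x \<bullet> x)"
proof (cases n)
  case (Suc m)
  have lin: "ndiff m (\<lambda>x::'a. c * (x \<bullet> v))" for c v
  proof (cases m)
    case (Suc k)
    show ?thesis unfolding Suc
      by (rule ndiff_SucI[where f'="\<lambda>_ w. c * (w \<bullet> v)"])
        (auto intro!: derivative_eq_intros ndiff_const)
  qed simp
  show ?thesis unfolding Suc
  proof (rule ndiff_SucI[where f'="\<lambda>x v. 2 * (x \<bullet> v)"])
    show "((\<lambda>x. x \<bullet> x) has_derivative (\<lambda>v. 2 * (x \<bullet> v))) (at x)" for x :: 'a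
      by (auto intro!: derivative_eq_intros simp: inner_commute)
  qed (rule lin)
qed simp

text \<open>The functions \<open>e\<^sup>-\<^sup>1\<^sup>/\<^sup>s / s\<^sup>k\<close>, extended by zero, are closed under
  differentiation up to linear combinations.\<close>

definition flat_exp :: "nat \<Rightarrow> real \<Rightarrow> real" where
  "flat_exp k s = (if s > 0 then exp (- 1 / s) / s ^ k else 0)"

lemma flat_exp_nonneg: "0 \<le> flat_exp k s"
  by (simp add: flat_exp_def)

lemma power_le_fact_exp:
  fixes x :: real
  assumes "0 \<le> x"
  shows "x ^ n / fact n \<le> exp x"
proof -
  have "(\<Sum>k\<in>{n}. x ^ k /\<^sub>R fact k) \<le> (\<Sum>k. x ^ k /\<^sub>R fact k)"
    by (rule sum_le_suminf[OF summable_exp_generic]) (use assms in auto)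
  then show ?thesis by (simp add: exp_def field_simps)
qed

text \<open>The term of order \<open>k + 2\<close> in the series of \<open>exp (1 / s)\<close> beats
  \<open>s ^ k\<close> with two powers to spare. A quadratic bound is what makes the derivative at
  the junction point vanish.\<close>

lemma flat_exp_le:
  assumes "0 < s"
  shows "flat_exp k s \<le> fact (k + 2) * s\<^sup>2"
proof -
  have "(1 / s) ^ (k + 2) / fact (k + 2) \<le> exp (1 / s)"
    by (rule power_le_fact_exp) (use assms in simp)
  then have "(1 / s) ^ (k + 2) \<le> exp (1 / s) * fact (k + 2)"
    by (subst (asm) pos_divide_le_eq) (simp_all del: fact_Suc add_2_eq_Suc')
  then have "exp (- (1 / s)) * (1 / s) ^ (k + 2) \<le> exp (- (1 / s)) * (exp (1 / s) * fact (k + 2))"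
    by (rule mult_left_mono) simp
  also have "\<dots> = fact (k + 2)"
    by (simp only: mult.assoc[symmetric] exp_add[symmetric]) simp
  finally have "exp (- (1 / s)) * (1 / s) ^ (k + 2) \<le> fact (k + 2)" .
  then have "exp (- (1 / s)) * (1 / s) ^ (k + 2) * s\<^sup>2 \<le> fact (k + 2) * s\<^sup>2"
    by (rule mult_right_mono) simp
  moreover have "exp (- (1 / s)) * (1 / s) ^ (k + 2) * s\<^sup>2 = flat_exp k s"
    using assms by (simp add: flat_exp_def power_add field_simps power2_eq_square)
  ultimately show ?thesis by simp
qed

lemma flat_exp_deriv:
  "(flat_exp k has_real_derivative flat_exp (k + 2) s - real k * flat_exp (k + 1) s) (at s)"
proof (cases s "0::real" rule: linorder_cases)
  case less
  have "((\<lambda>_. 0) has_real_derivative 0) (at s)" by simp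
  then have "(flat_exp k has_real_derivative 0) (at s)"
    by (rule has_field_derivative_transform_within_open[where S="{..<0}"])
      (use less in \<open>auto simp: flat_exp_def\<close>)
  then show ?thesis using less by (simp add: flat_exp_def)
next
  case greater
  have "((\<lambda>s. exp (- 1 / s) / s ^ k) has_real_derivative
      (exp (- 1 / s) * (1 / s\<^sup>2) * s ^ k - exp (- 1 / s) * (real k * s ^ (k - 1))) / (s ^ k)\<^sup>2) (at s)"
    using greater by (auto intro!: derivative_eq_intros simp: power2_eq_square)
  moreover have "(exp (- 1 / s) * (1 / s\<^sup>2) * s ^ k - exp (- 1 / s) * (real k * s ^ (k - 1))) / (s ^ k)\<^sup>2
      = flat_exp (k + 2) s - real k * flat_exp (k + 1) s"
    using greater by (cases k) (simp_all add: flat_exp_def field_simps power2_eq_square)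
  ultimately have "((\<lambda>s. exp (- 1 / s) / s ^ k) has_real_derivative
      flat_exp (k + 2) s - real k * flat_exp (k + 1) s) (at s)"
    by simp
  then show ?thesis
    by (rule has_field_derivative_transform_within_open[where S="{0<..}"])
      (use greater in \<open>auto simp: flat_exp_def\<close>)
next
  case equal
  have "\<bar>flat_exp k y\<bar> \<le> fact (k + 2) * y\<^sup>2" for y
    using flat_exp_le[of y k] by (cases "y > 0") (auto simp: flat_exp_def)
  then have "(flat_exp k has_derivative (\<lambda>_. 0)) (at 0)"
    unfolding has_derivative_at_alt
  proof (intro conjI allI impI)
    fix e :: real
    assume e: "0 < e" and b: "\<And>y. \<bar>flat_exp k y\<bar> \<le> fact (k + 2) * y\<^sup>2"
    let ?d = "e / fact (k + 2)"
    have "norm (flat_exp k y - flat_exp k 0 - 0) \<le> e * norm (y - 0)" if "norm (y - 0) < ?d" for y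
    proof -
      have "fact (k + 2) * \<bar>y\<bar> \<le> e"
        using that by (simp add: pos_less_divide_eq mult.commute del: fact_Suc add_2_eq_Suc')
      then have "fact (k + 2) * \<bar>y\<bar> * \<bar>y\<bar> \<le> e * \<bar>y\<bar>"
        by (rule mult_right_mono) simp
      moreover have "flat_exp k 0 = 0" by (simp add: flat_exp_def)
      ultimately show ?thesis
        using b[of y] by (simp add: power2_eq_square abs_mult_self_eq mult.assoc)
    qed
    then show "\<exists>d>0. \<forall>y. norm (y - 0) < d \<longrightarrow> norm (flat_exp k y - flat_exp k 0 - 0) \<le> e * norm (y - 0)"
      using e by (intro exI[of _ ?d]) auto
  qed auto
  then have "(flat_exp k has_real_derivative 0) (at 0)"
    by (simp add: has_field_derivative_def lambda_zero)
  then show ?thesis using equal by (simp add: flat_exp_def)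
qed

lemma ndiff_flat_exp: "ndiff n (flat_exp k)"
proof (induction n arbitrary: k)
  case (Suc n)
  show ?case
  proof (rule ndiff_SucI)
    show "(flat_exp k has_derivative
      (\<lambda>v. (flat_exp (k + 2) x + (- real k) * flat_exp (k + 1) x) * v)) (at x)" for x
      using flat_exp_deriv[of k x] by (simp add: has_field_derivative_def)
    show "ndiff n (\<lambda>x. (flat_exp (k + 2) x + (- real k) * flat_exp (k + 1) x) * v)" for v
      by (rule ndiff_mult[OF ndiff_add[OF Suc ndiff_mult[OF ndiff_const Suc]] ndiff_const])
  qed
qed simp

section \<open>Bump functions, mollifiers and test functions\<close>

text \<open>The standard bump \<open>exp (-1 / (r^2 - |z|^2))\<close> on the ball of radius
  \<open>r\<close>; it is a function of \<open>z \<bullet> z\<close>, so there is no question of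
  smoothness at the origin.\<close>

definition bump :: "real \<Rightarrow> 'a::euclidean_space \<Rightarrow> real" where
  "bump r z = flat_exp 0 (r\<^sup>2 - z \<bullet> z)"

definition mollifier :: "real \<Rightarrow> 'a::euclidean_space \<Rightarrow> real" where
  "mollifier r z = bump r z / (LINT x|lborel. bump r (x::'a))"

lemma smooth_bump: "smooth (bump r)"
proof -
  have "ndiff n (\<lambda>z::'a. flat_exp 0 (r\<^sup>2 + (-1) * (z \<bullet> z)))" for n
    by (rule ndiff_compose[OF ndiff_flat_exp ndiff_add[OF ndiff_const ndiff_mult[OF ndiff_const ndiff_inner_self]]])
  then show ?thesis
    by (simp add: smooth_iff_ndiff bump_def[abs_def])
qed

lemma bump_nonneg: "0 \<le> bump r z"
  by (simp add: bump_def flat_exp_nonneg)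

lemma bump_pos_iff: "0 < r \<Longrightarrow> 0 < bump r z \<longleftrightarrow> norm z < r"
proof -
  assume r: "0 < r"
  have "z \<bullet> z < r\<^sup>2 \<longleftrightarrow> norm z < r"
    using r power_strict_mono[of "norm z" r 2] power2_less_imp_less[of "norm z" r]
    by (auto simp: power2_norm_eq_inner[symmetric])
  then show ?thesis
    by (simp add: bump_def flat_exp_def)
qed

text \<open>The closure of the support has to lie in \<open>S\<close>; a closed set
  \<open>S'\<close> placed in between spares the computation of that closure.\<close>

lemma test_functionI:
  fixes \<phi> :: "'a::euclidean_space \<Rightarrow> real"
  assumes "smooth \<phi>" and "\<And>x. \<phi> x \<noteq> 0 \<Longrightarrow> norm x \<le> R" and "\<And>x. \<phi> x \<noteq> 0 \<Longrightarrow> x \<in> S'" "closed S'" "S' \<subseteq> S"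
  shows "test_function S \<phi>"
proof -
  have "{x. \<phi> x \<noteq> 0} \<subseteq> cball 0 R" using assms(2) by auto
  then have "bounded {x. \<phi> x \<noteq> 0}" using bounded_cball bounded_subset by blast
  moreover have "closure {x. \<phi> x \<noteq> 0} \<subseteq> S'"
    using assms(3,4) by (intro closure_minimal) auto
  ultimately show ?thesis
    using assms by (auto simp: test_function_def)
qed

lemma test_function_bounded_support:
  fixes \<phi> :: "'a::euclidean_space \<Rightarrow> real"
  assumes "test_function S \<phi>"
  shows "\<exists>R>0. \<forall>x. \<phi> x \<noteq> 0 \<longrightarrow> norm x \<le> R"
proof -
  have "bounded (closure {x. \<phi> x \<noteq> 0})"
    using assms compact_imp_bounded by (auto simp: test_function_def)
  then obtain R where "0 < R" "\<forall>x\<in>closure {x. \<phi> x \<noteq> 0}. norm x \<le> R"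
    using bounded_pos by blast
  then show ?thesis using closure_subset[of "{x. \<phi> x \<noteq> 0}"] by blast
qed

lemma integrable_continuous_bounded_support:
  fixes \<phi> :: "'a::euclidean_space \<Rightarrow> real"
  assumes "continuous_on UNIV \<phi>" "\<And>x. \<phi> x \<noteq> 0 \<Longrightarrow> norm x \<le> R"
  shows "integrable lborel \<phi>"
proof -
  have "integrable lborel (\<lambda>x. indicator (cball 0 R) x *\<^sub>R \<phi> x)"
    by (rule borel_integrable_compact) (use continuous_on_subset[OF assms(1)] in auto)
  moreover have "(\<lambda>x. indicator (cball 0 R) x *\<^sub>R \<phi> x) = \<phi>"
    using assms(2) by (auto simp: indicator_def fun_eq_iff)
  ultimately show ?thesis by simp
qed

lemma integrable_bump:
  assumes "0 < r" shows "integrable lborel (bump r)"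
proof (rule integrable_continuous_bounded_support)
  show "bump r x \<noteq> 0 \<Longrightarrow> norm x \<le> r" for x
    using bump_pos_iff[OF assms, of x] bump_nonneg[of r x] by (cases "bump r x" "0::real" rule: linorder_cases) auto
qed (rule smooth_continuous_on[OF smooth_bump])

text \<open>A vanishing integral would make the bump zero almost everywhere, so that an open ball
  would be a null set.\<close>

lemma integral_bump_pos:
  assumes "0 < r" shows "0 < (LINT x|lborel. bump r (x::'a::euclidean_space))"
proof (rule ccontr)
  assume "\<not> ?thesis"
  moreover have "0 \<le> (LINT x|lborel. bump r (x::'a))"
    by (intro Bochner_Integration.integral_nonneg bump_nonneg)
  ultimately have "(LINT x|lborel. bump r (x::'a)) = 0" by simp
  then have "AE x in lborel. bump r (x::'a) = 0"
    using integral_nonneg_eq_0_iff_AE[OF integrable_bump[OF assms]] bump_nonneg by auto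
  then have "AE x in lborel. (x::'a) \<notin> ball 0 r"
    by eventually_elim (use bump_pos_iff[OF assms, where 'a='a] in force)
  then have "emeasure lborel (ball (0::'a) r) = 0"
    by (subst (asm) AE_iff_measurable[of "ball 0 r"]) auto
  then have "ball (0::'a) r \<in> null_sets lborel" by auto
  then show False
    using assms open_not_negligible[of "ball (0::'a) r"]
    by (auto simp: negligible_iff_null_sets null_sets_completionI)
qed


lemma smooth_affine: "smooth f \<Longrightarrow> smooth (\<lambda>x. f (c *\<^sub>R x + b))"
  by (simp add: smooth_iff_ndiff ndiff_affine)

lemma smooth_cmult: "smooth f \<Longrightarrow> smooth (\<lambda>x. c * f x)"
  by (simp add: smooth_iff_ndiff ndiff_mult ndiff_const)

lemma smooth_mult: "smooth f \<Longrightarrow> smooth g \<Longrightarrow> smooth (\<lambda>x. f x * g x)"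
  by (simp add: smooth_iff_ndiff ndiff_mult)

lemma mollifier_nonneg: "0 < r \<Longrightarrow> 0 \<le> mollifier r z"
  by (simp add: mollifier_def bump_nonneg integral_bump_pos less_imp_le)

lemma mollifier_support: "0 < r \<Longrightarrow> mollifier r z \<noteq> 0 \<Longrightarrow> norm z \<le> r"
  using bump_pos_iff[of r z] bump_nonneg[of r z] by (fastforce simp: mollifier_def)

lemma smooth_mollifier: "smooth (mollifier r)"
  using smooth_cmult[OF smooth_bump, of "1 / (LINT x|lborel. bump r (x::'a::euclidean_space))" r]
  by (simp add: mollifier_def[abs_def])

lemma test_function_mollifier: "0 < r \<Longrightarrow> test_function UNIV (mollifier r)"
  by (rule test_functionI[where R=r and S'=UNIV])
    (auto simp: smooth_mollifier mollifier_support)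

lemma integrable_mollifier: "0 < r \<Longrightarrow> integrable lborel (mollifier r)"
  unfolding mollifier_def by (intro integrable_divide_zero integrable_bump impI)

lemma integral_mollifier: "0 < r \<Longrightarrow> (LINT x|lborel. mollifier r (x::'a::euclidean_space)) = 1"
  unfolding mollifier_def using integral_bump_pos[of r, where 'a='a] by simp

lemma test_function_affine:
  fixes \<phi> :: "'a::euclidean_space \<Rightarrow> real"
  assumes "test_function UNIV \<phi>" "c \<noteq> 0"
  shows "test_function UNIV (\<lambda>x. \<phi> (c *\<^sub>R x + b))"
proof -
  from test_function_bounded_support[OF assms(1)]
  obtain R where R0: "0 < R" and "\<forall>x. \<phi> x \<noteq> 0 \<longrightarrow> norm x \<le> R" by (elim exE conjE)
  then have R: "\<phi> x \<noteq> 0 \<Longrightarrow> norm x \<le> R" for x by (elim allE impE)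
  show ?thesis
  proof (rule test_functionI[where R="(R + norm b) / \<bar>c\<bar>" and S'=UNIV])
    show "smooth (\<lambda>x. \<phi> (c *\<^sub>R x + b))"
      using assms by (intro smooth_affine) (simp add: test_function_def)
    fix x assume "\<phi> (c *\<^sub>R x + b) \<noteq> 0"
    then have "norm (c *\<^sub>R x + b) \<le> R" by (rule R)
    then have "\<bar>c\<bar> * norm x \<le> R + norm b"
      using norm_triangle_sub[of "c *\<^sub>R x" "- b"] by simp
    then show "norm x \<le> (R + norm b) / \<bar>c\<bar>"
      using assms(2) by (simp add: field_simps)
  qed auto
qed

lemma test_function_frechet_derivative:
  fixes \<phi> :: "'a::euclidean_space \<Rightarrow> real"
  assumes "test_function S \<phi>"
  shows "test_function S (\<lambda>x. frechet_derivative \<phi> (at x) v)"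
proof -
  let ?K = "closure {x. \<phi> x \<noteq> 0}"
  from test_function_bounded_support[OF assms(1)]
  obtain R where R0: "0 < R" and "\<forall>x. \<phi> x \<noteq> 0 \<longrightarrow> norm x \<le> R" by (elim exE conjE)
  then have R: "\<phi> x \<noteq> 0 \<Longrightarrow> norm x \<le> R" for x by (elim allE impE)
  have KR: "?K \<subseteq> cball 0 R"
    by (rule closure_minimal) (use R in \<open>auto simp: dist_norm\<close>)
  have zero: "frechet_derivative \<phi> (at x) v = 0" if "x \<notin> ?K" for x
  proof -
    have "(\<phi> has_derivative (\<lambda>_. 0)) (at x)"
    proof (rule has_derivative_transform_within_open[OF has_derivative_const, of "- ?K"])
      show "\<And>x. x \<in> - ?K \<Longrightarrow> 0 = \<phi> x" using closure_subset[of "{x. \<phi> x \<noteq> 0}"] by auto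
    qed (use that in auto)
    then have "(\<lambda>_. 0) = frechet_derivative \<phi> (at x)" by (rule frechet_derivative_at)
    from fun_cong[OF this, of v] show ?thesis by simp
  qed
  show ?thesis
  proof (rule test_functionI[where R=R and S'="?K"])
    show "smooth (\<lambda>x. frechet_derivative \<phi> (at x) v)"
      using assms smooth_frechet_derivative by (auto simp: test_function_def)
    fix x assume "frechet_derivative \<phi> (at x) v \<noteq> 0"
    then show "x \<in> ?K" using zero by blast
    then show "norm x \<le> R" using KR by auto
  qed (use assms in \<open>auto simp: test_function_def\<close>)
qed

text \<open>Turns bounds on finitely many partial derivatives, each uniform in the base point, into
  a uniform bound on the differential.\<close>

lemma linear_abs_le_sum_Basis:
  fixes l :: "'a::euclidean_space \<Rightarrow> real"
  assumes "linear l" "\<And>b. b \<in> Basis \<Longrightarrow> \<bar>l b\<bar> \<le> C b"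
  shows "\<bar>l v\<bar> \<le> (\<Sum>b\<in>Basis. C b) * norm v"
proof -
  have "l v = l (\<Sum>b\<in>Basis. (v \<bullet> b) *\<^sub>R b)"
    by (rule arg_cong[OF euclidean_representation[symmetric]])
  also have "\<dots> = (\<Sum>b\<in>Basis. (v \<bullet> b) * l b)"
    by (simp only: linear_sum[OF assms(1)] linear_scale[OF assms(1)] real_scaleR_def)
  finally have "\<bar>l v\<bar> = \<bar>\<Sum>b\<in>Basis. (v \<bullet> b) * l b\<bar>" by simp
  also have "\<dots> \<le> (\<Sum>b\<in>Basis. \<bar>(v \<bullet> b) * l b\<bar>)" by (rule sum_abs)
  also have "\<dots> \<le> (\<Sum>b\<in>Basis. norm v * C b)"
    by (intro sum_mono) (use assms(2) Basis_le_norm in \<open>auto simp: abs_mult intro!: mult_mono\<close>)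
  finally show ?thesis by (simp add: sum_distrib_left mult.commute)
qed

lemma test_function_abs_bounded:
  fixes \<phi> :: "'a::euclidean_space \<Rightarrow> real"
  assumes "test_function S \<phi>"
  shows "\<exists>C. \<forall>x. \<bar>\<phi> x\<bar> \<le> C"
proof -
  from test_function_bounded_support[OF assms(1)]
  obtain R where R0: "0 < R" and "\<forall>x. \<phi> x \<noteq> 0 \<longrightarrow> norm x \<le> R" by (elim exE conjE)
  then have R: "\<phi> x \<noteq> 0 \<Longrightarrow> norm x \<le> R" for x by (elim allE impE)
  have "continuous_on (cball 0 R) \<phi>"
    using assms by (intro smooth_continuous_on) (simp add: test_function_def)
  then have "bounded (\<phi> ` cball 0 R)"
    by (intro compact_imp_bounded compact_continuous_image compact_cball)
  then obtain C where "0 < C" "\<forall>y\<in>\<phi> ` cball 0 R. norm y \<le> C"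
    unfolding bounded_pos by blast
  then have C: "\<And>x. norm x \<le> R \<Longrightarrow> \<bar>\<phi> x\<bar> \<le> C" "C > 0"
    by auto
  have "\<bar>\<phi> x\<bar> \<le> C" for x using R[of x] C by (cases "\<phi> x = 0") auto
  then show ?thesis by blast
qed

lemma test_function_lipschitz:
  fixes \<phi> :: "'a::euclidean_space \<Rightarrow> real"
  assumes "test_function S \<phi>"
  shows "\<exists>L\<ge>0. (\<forall>x y. \<bar>\<phi> x - \<phi> y\<bar> \<le> L * norm (x - y)) \<and>
    (\<forall>x v. \<bar>frechet_derivative \<phi> (at x) v\<bar> \<le> L * norm v)"
proof -
  have sm: "smooth \<phi>" using assms by (simp add: test_function_def)
  have "\<forall>b. \<exists>C. \<forall>x. \<bar>frechet_derivative \<phi> (at x) b\<bar> \<le> C"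
    using test_function_abs_bounded[OF test_function_frechet_derivative[OF assms]] by blast
  from choice[OF this] obtain C where C: "\<And>b x. \<bar>frechet_derivative \<phi> (at x) b\<bar> \<le> C b"
    by auto
  define L where "L = (\<Sum>b\<in>Basis. C b)"
  have D: "\<bar>frechet_derivative \<phi> (at x) v\<bar> \<le> L * norm v" for x v
    unfolding L_def
    by (rule linear_abs_le_sum_Basis[OF has_derivative_linear[OF smooth_has_derivative[OF sm]] C])
  have L0: "0 \<le> L"
    unfolding L_def by (intro sum_nonneg) (use C abs_ge_zero order_trans in blast)
  have "norm (\<phi> x - \<phi> y) \<le> L * norm (x - y)" for x y
  proof (rule differentiable_bound[where S=UNIV and f'="\<lambda>x. frechet_derivative \<phi> (at x)"])
    show "onorm (frechet_derivative \<phi> (at x)) \<le> L" for x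
      by (rule onorm_le) (use D in auto)
  qed (auto intro: has_derivative_at_withinI[OF smooth_has_derivative[OF sm]])
  with L0 D show ?thesis by (metis real_norm_def)
qed

text \<open>Partial derivatives of a test function are test functions, hence Lipschitz. Subtracting
  the linear part at \<open>z\<close> and applying the mean value inequality on the ball of radius
  \<open>norm h\<close> gives a quadratic remainder, uniformly in \<open>z\<close>; the uniformity
  permits differentiation of a convolution under the integral.\<close>

lemma test_function_taylor:
  fixes \<phi> :: "'a::euclidean_space \<Rightarrow> real"
  assumes "test_function S \<phi>"
  shows "\<exists>C\<ge>0. \<forall>z h. \<bar>\<phi> (z + h) - \<phi> z - frechet_derivative \<phi> (at z) h\<bar> \<le> C * (norm h)\<^sup>2"
proof -
  have sm: "smooth \<phi>" using assms by (simp add: test_function_def)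
  have "\<forall>b. \<exists>L. 0 \<le> L \<and> (\<forall>x y. \<bar>frechet_derivative \<phi> (at x) b - frechet_derivative \<phi> (at y) b\<bar> \<le> L * norm (x - y))"
    using test_function_lipschitz[OF test_function_frechet_derivative[OF assms]] by meson
  from choice[OF this] obtain L where L: "\<And>b. 0 \<le> L b"
    "\<And>b x y. \<bar>frechet_derivative \<phi> (at x) b - frechet_derivative \<phi> (at y) b\<bar> \<le> L b * norm (x - y)"
    by auto
  define C where "C = (\<Sum>b\<in>Basis. L b)"
  have C0: "0 \<le> C" unfolding C_def by (intro sum_nonneg L)
  have lin: "linear (frechet_derivative \<phi> (at x))" for x
    by (rule has_derivative_linear[OF smooth_has_derivative[OF sm]])
  have D: "\<bar>frechet_derivative \<phi> (at x) v - frechet_derivative \<phi> (at y) v\<bar> \<le> C * norm (x - y) * norm v" for x y v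
  proof -
    have "linear (\<lambda>v. frechet_derivative \<phi> (at x) v - frechet_derivative \<phi> (at y) v)"
      by (intro linear_compose_sub lin)
    then have "\<bar>frechet_derivative \<phi> (at x) v - frechet_derivative \<phi> (at y) v\<bar>
        \<le> (\<Sum>b\<in>Basis. L b * norm (x - y)) * norm v"
      by (rule linear_abs_le_sum_Basis) (rule L)
    then show ?thesis by (simp add: C_def sum_distrib_right)
  qed
  have "\<bar>\<phi> (z + h) - \<phi> z - frechet_derivative \<phi> (at z) h\<bar> \<le> C * (norm h)\<^sup>2" for z h
  proof -
    let ?S = "cball z (norm h)"
    let ?g = "\<lambda>x. \<phi> x - frechet_derivative \<phi> (at z) x"
    have "norm (?g (z + h) - ?g z) \<le> (C * norm h) * norm (z + h - z)"
    proof (rule differentiable_bound[where S="?S"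
          and f'="\<lambda>x v. frechet_derivative \<phi> (at x) v - frechet_derivative \<phi> (at z) v"])
      show "(?g has_derivative (\<lambda>v. frechet_derivative \<phi> (at x) v - frechet_derivative \<phi> (at z) v)) (at x within ?S)" for x
        by (intro has_derivative_diff has_derivative_at_withinI[OF smooth_has_derivative[OF sm]]
            bounded_linear_imp_has_derivative has_derivative_bounded_linear[OF smooth_has_derivative[OF sm]])
      show "onorm (\<lambda>v. frechet_derivative \<phi> (at x) v - frechet_derivative \<phi> (at z) v) \<le> C * norm h"
        if "x \<in> ?S" for x
      proof (rule onorm_le)
        fix v :: 'a
        have "C * norm (x - z) * norm v \<le> C * norm h * norm v"
          using that C0 by (intro mult_right_mono mult_left_mono) (auto simp: dist_norm norm_minus_commute)
        then show "norm (frechet_derivative \<phi> (at x) v - frechet_derivative \<phi> (at z) v) \<le> C * norm h * norm v"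
          using D[of x v z] by simp
      qed
    qed (auto simp: dist_norm)
    moreover have "frechet_derivative \<phi> (at z) (z + h) = frechet_derivative \<phi> (at z) z + frechet_derivative \<phi> (at z) h"
      using lin linear_add by blast
    ultimately show ?thesis by (simp add: power2_eq_square mult.assoc algebra_simps)
  qed
  with C0 show ?thesis by blast
qed

section \<open>Convolution of bounded functions with test functions\<close>

definition convolve :: "('a::euclidean_space \<Rightarrow> real) \<Rightarrow> ('a \<Rightarrow> real) \<Rightarrow> 'a \<Rightarrow> real" where
  "convolve f \<phi> z = (LINT y|lborel. f y * \<phi> (z - y))"

lemma lborel_distr_reflect:
  fixes z :: "'a::euclidean_space"
  shows "distr lborel borel (\<lambda>y. z - y) = lborel"
  using lborel_affine[of "-1" z] by (simp add: density_1)

lemma lborel_integral_reflect: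
  fixes f :: "'a::euclidean_space \<Rightarrow> 'b::{banach, second_countable_topology}"
  assumes "f \<in> borel_measurable borel"
  shows "(LINT y|lborel. f (z - y)) = (LINT y|lborel. f y)"
  using integral_distr[of "\<lambda>y. z - y" lborel borel f] assms by (simp add: lborel_distr_reflect)

lemma lborel_integrable_reflect:
  fixes f :: "'a::euclidean_space \<Rightarrow> 'b::{banach, second_countable_topology}"
  assumes "integrable lborel f"
  shows "integrable lborel (\<lambda>y. f (z - y))"
  using integrable_distr[of "\<lambda>y. z - y" lborel borel f] assms by (simp add: lborel_distr_reflect)

lemma test_function_smooth: "test_function S \<phi> \<Longrightarrow> smooth \<phi>"
  by (simp add: test_function_def)

lemma test_function_measurable:
  fixes \<phi> :: "'a::euclidean_space \<Rightarrow> real"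
  shows "test_function S \<phi> \<Longrightarrow> \<phi> \<in> borel_measurable borel"
  by (intro borel_measurable_continuous_onI smooth_continuous_on test_function_smooth)

lemma test_function_integrable:
  fixes \<phi> :: "'a::euclidean_space \<Rightarrow> real"
  assumes "test_function S \<phi>"
  shows "integrable lborel \<phi>"
proof -
  from test_function_bounded_support[OF assms]
  obtain R where "\<forall>x. \<phi> x \<noteq> 0 \<longrightarrow> norm x \<le> R" by blast
  then show ?thesis
    by (intro integrable_continuous_bounded_support[where R=R] smooth_continuous_on
        test_function_smooth[OF assms]) auto
qed

lemma integrable_bounded_mult:
  fixes f g :: "'a \<Rightarrow> real"
  assumes f: "f \<in> borel_measurable M" "\<And>y. \<bar>f y\<bar> \<le> C" and g: "integrable M g"
  shows "integrable M (\<lambda>y. f y * g y)"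
proof (rule Bochner_Integration.integrable_bound[where f="\<lambda>y. C * g y"])
  show "(\<lambda>y. f y * g y) \<in> borel_measurable M"
    using f(1) borel_measurable_integrable[OF g] by measurable
  have "\<bar>f y\<bar> * \<bar>g y\<bar> \<le> \<bar>C\<bar> * \<bar>g y\<bar>" for y
    using f(2)[of y] by (intro mult_right_mono) auto
  then show "AE y in M. norm (f y * g y) \<le> norm (C * g y)"
    by (simp add: abs_mult)
qed (use g in simp)

lemma convolve_integrable:
  fixes f \<phi> :: "'a::euclidean_space \<Rightarrow> real"
  assumes f: "f \<in> borel_measurable borel" "\<And>y. \<bar>f y\<bar> \<le> M" and \<phi>: "test_function S \<phi>"
  shows "integrable lborel (\<lambda>y. f y * \<phi> (z - y))"
  by (rule integrable_bounded_mult[OF _ f(2) lborel_integrable_reflect[OF test_function_integrable[OF \<phi>]]])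
    (use f in simp)

lemma convolve_shift:
  fixes f \<phi> :: "'a::euclidean_space \<Rightarrow> real"
  assumes "f \<in> borel_measurable borel" "\<phi> \<in> borel_measurable borel"
  shows "convolve f \<phi> z = (LINT y|lborel. f (z - y) * \<phi> y)"
proof -
  have "(\<lambda>y. f (z - y) * \<phi> y) \<in> borel_measurable borel"
    using assms by measurable
  from lborel_integral_reflect[OF this, of z] show ?thesis
    by (simp add: convolve_def)
qed

lemma has_derivative_quadratic_error:
  fixes F :: "'a::real_normed_vector \<Rightarrow> real"
  assumes "bounded_linear F'" "0 < r" "0 \<le> C"
    and "\<And>h. norm h \<le> r \<Longrightarrow> \<bar>F (z + h) - F z - F' h\<bar> \<le> C * (norm h)\<^sup>2"
  shows "(F has_derivative F') (at z)"
  unfolding has_derivative_at_alt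
proof (intro conjI allI impI)
  fix e :: real assume e: "0 < e"
  define d where "d = min r (e / (C + 1))"
  have "norm (F y - F z - F' (y - z)) \<le> e * norm (y - z)" if y: "norm (y - z) < d" for y
  proof -
    have "C * norm (y - z) \<le> (C + 1) * (e / (C + 1))"
      using y assms(3) by (intro mult_mono) (auto simp: d_def)
    then have "C * norm (y - z) * norm (y - z) \<le> e * norm (y - z)"
      using assms(3) by (intro mult_right_mono) auto
    then show ?thesis
      using assms(4)[of "y - z"] y by (simp add: d_def power2_eq_square)
  qed
  moreover have "0 < d" using e assms by (auto simp: d_def)
  ultimately show "\<exists>d>0. \<forall>y. norm (y - z) < d \<longrightarrow> norm (F y - F z - F' (y - z)) \<le> e * norm (y - z)"
    by blast
qed (rule assms(1))

lemma convolve_has_derivative: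
  fixes f \<phi> :: "'a::euclidean_space \<Rightarrow> real"
  assumes f: "f \<in> borel_measurable borel" "\<And>y. \<bar>f y\<bar> \<le> M" and \<phi>: "test_function S \<phi>"
  shows "(convolve f \<phi> has_derivative (\<lambda>v. convolve f (\<lambda>x. frechet_derivative \<phi> (at x) v) z)) (at z)"
proof -
  from test_function_bounded_support[OF \<phi>]
  obtain R where R: "0 < R" "\<forall>x. \<phi> x \<noteq> 0 \<longrightarrow> norm x \<le> R" by blast
  from test_function_taylor[OF \<phi>]
  obtain C where C: "0 \<le> C"
    "\<forall>z h. \<bar>\<phi> (z + h) - \<phi> z - frechet_derivative \<phi> (at z) h\<bar> \<le> C * (norm h)\<^sup>2" by blast
  note \<phi>' = test_function_frechet_derivative[OF \<phi>]
  have lin: "bounded_linear (frechet_derivative \<phi> (at x))" for x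
    by (rule has_derivative_bounded_linear[OF smooth_has_derivative[OF test_function_smooth[OF \<phi>]]])
  have bl: "bounded_linear (\<lambda>v. convolve f (\<lambda>x. frechet_derivative \<phi> (at x) v) z)"
  proof (intro linear_conv_bounded_linear[THEN iffD1] linearI)
    note int = convolve_integrable[OF f \<phi>', of z]
    show "convolve f (\<lambda>x. frechet_derivative \<phi> (at x) (v + w)) z =
        convolve f (\<lambda>x. frechet_derivative \<phi> (at x) v) z + convolve f (\<lambda>x. frechet_derivative \<phi> (at x) w) z" for v w
      unfolding convolve_def
      by (subst Bochner_Integration.integral_add[OF int int, symmetric])
        (simp add: linear_simps(1)[OF lin] distrib_left)
    show "convolve f (\<lambda>x. frechet_derivative \<phi> (at x) (r *\<^sub>R v)) z =
        r *\<^sub>R convolve f (\<lambda>x. frechet_derivative \<phi> (at x) v) z" for r v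
      unfolding convolve_def
      by (simp add: linear_simps(5)[OF lin] mult.left_commute[of _ r])
  qed
  have M0: "0 \<le> M" using f(2) abs_ge_zero order_trans by blast
  show ?thesis
  \<comment> \<open>The radius \<open>R + 1\<close> leaves room for shifts with
    \<open>norm h \<le> 1\<close>: outside this ball all three terms of the Taylor remainder
    vanish.\<close>
  proof (rule has_derivative_quadratic_error[OF bl, of 1 "M * C * measure lborel (cball z (R + 1))"])
    fix h :: 'a assume h: "norm h \<le> 1"
    let ?k = "\<lambda>y. f y * (\<phi> (z + h - y) - \<phi> (z - y) - frechet_derivative \<phi> (at (z - y)) h)"
    have int1: "integrable lborel (\<lambda>y. f y * \<phi> (z + h - y))" "integrable lborel (\<lambda>y. f y * \<phi> (z - y))"
        "integrable lborel (\<lambda>y. f y * frechet_derivative \<phi> (at (z - y)) h)"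
      by (rule convolve_integrable[OF f \<phi>] convolve_integrable[OF f \<phi>'])+
    then have int: "integrable lborel ?k"
      unfolding right_diff_distrib by (intro Bochner_Integration.integrable_diff)
    have eq: "convolve f \<phi> (z + h) - convolve f \<phi> z - convolve f (\<lambda>x. frechet_derivative \<phi> (at x) h) z
        = (LINT y|lborel. ?k y)"
      unfolding convolve_def right_diff_distrib using int1 by simp
    have fin: "emeasure lborel (cball z (R + 1)) < \<infinity>"
      by (rule emeasure_bounded_finite) simp
    have bound: "norm (?k y) \<le> (M * C * (norm h)\<^sup>2) * indicator (cball z (R + 1)) y" for y
    proof (cases "y \<in> cball z (R + 1)")
      case True
      have "\<bar>\<phi> (z - y + h) - \<phi> (z - y) - frechet_derivative \<phi> (at (z - y)) h\<bar> \<le> C * (norm h)\<^sup>2"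
        using C by blast
      then have "\<bar>f y\<bar> * \<bar>\<phi> (z - y + h) - \<phi> (z - y) - frechet_derivative \<phi> (at (z - y)) h\<bar>
          \<le> M * (C * (norm h)\<^sup>2)"
        using f(2)[of y] M0 by (intro mult_mono) auto
      moreover have "norm (?k y) = \<bar>f y\<bar> * \<bar>\<phi> (z - y + h) - \<phi> (z - y) - frechet_derivative \<phi> (at (z - y)) h\<bar>"
        by (simp add: abs_mult[symmetric] add_diff_eq diff_add_eq)
      ultimately show ?thesis
        using True by (simp add: mult.assoc)
    next
      case False
      then have y: "R + 1 < norm (z - y)" by (simp add: dist_norm)
      have nz: "\<phi> x = 0" if "R < norm x" for x using R(2) that by force
      have "\<phi> (z + h - y) = 0"
        using h y norm_triangle_ineq2[of "z - y" "- h"] by (intro nz) (simp add: algebra_simps)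
      moreover have "\<phi> (z - y) = 0" using y by (intro nz) simp
      moreover have "frechet_derivative \<phi> (at (z - y)) h = 0"
      proof -
        have "(\<phi> has_derivative (\<lambda>_. 0)) (at (z - y))"
        proof (rule has_derivative_transform_within_open[OF has_derivative_const, of "- cball 0 R"])
          show "\<And>x. x \<in> - cball 0 R \<Longrightarrow> 0 = \<phi> x" using nz by (auto simp: dist_norm)
        qed (use y in \<open>auto simp: dist_norm norm_minus_commute\<close>)
        then have "(\<lambda>_. 0) = frechet_derivative \<phi> (at (z - y))" by (rule frechet_derivative_at)
        from fun_cong[OF this, of h] show ?thesis by simp
      qed
      ultimately show ?thesis using False by simp
    qed
    have ind: "integrable lborel (\<lambda>y. (M * C * (norm h)\<^sup>2) * indicator (cball z (R + 1)) y)"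
      using fin by (intro integrable_mult_right integrable_real_indicator) auto
    have "\<bar>LINT y|lborel. ?k y\<bar> \<le> (LINT y|lborel. norm (?k y))"
      using integral_norm_bound[of lborel ?k] by simp
    also have "\<dots> \<le> (LINT y|lborel. (M * C * (norm h)\<^sup>2) * indicator (cball z (R + 1)) y)"
      using int ind bound by (intro integral_mono integrable_norm)
    also have "\<dots> = M * C * measure lborel (cball z (R + 1)) * (norm h)\<^sup>2"
      by simp
    finally show "\<bar>convolve f \<phi> (z + h) - convolve f \<phi> z - convolve f (\<lambda>x. frechet_derivative \<phi> (at x) h) z\<bar>
        \<le> M * C * measure lborel (cball z (R + 1)) * (norm h)\<^sup>2"
      unfolding eq .
  qed (use M0 C in auto)
qed

lemma frechet_derivative_convolve:
  fixes f \<phi> :: "'a::euclidean_space \<Rightarrow> real"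
  assumes f: "f \<in> borel_measurable borel" "\<And>y. \<bar>f y\<bar> \<le> M" and \<phi>: "test_function S \<phi>"
  shows "frechet_derivative (convolve f \<phi>) (at z) v = convolve f (\<lambda>x. frechet_derivative \<phi> (at x) v) z"
  by (metis frechet_derivative_at[OF convolve_has_derivative[OF assms]])

lemma smooth_convolve:
  fixes f \<phi> :: "'a::euclidean_space \<Rightarrow> real"
  assumes f: "f \<in> borel_measurable borel" "\<And>y. \<bar>f y\<bar> \<le> M" and \<phi>: "test_function S \<phi>"
  shows "smooth (convolve f \<phi>)"
proof -
  have "ndiff n (convolve f \<phi>)" for n
    using \<phi>
  proof (induction n arbitrary: \<phi>)
    case (Suc n)
    show ?case
      by (rule ndiff_SucI[OF convolve_has_derivative[OF f Suc.prems]])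
        (rule Suc.IH[OF test_function_frechet_derivative[OF Suc.prems]])
  qed simp
  then show ?thesis by (simp add: smooth_iff_ndiff)
qed

lemma convolve_nonzeroD:
  assumes "convolve f \<phi> z \<noteq> 0"
  shows "\<exists>y. f y \<noteq> 0 \<and> \<phi> (z - y) \<noteq> 0"
proof (rule ccontr)
  assume "\<not> ?thesis"
  then have "(\<lambda>y. f y * \<phi> (z - y)) = (\<lambda>y. 0)" by auto
  then show False using assms by (simp add: convolve_def)
qed

lemma mollifier_weighted_bound:
  fixes g :: "'a::euclidean_space \<Rightarrow> real"
  assumes r: "0 < r" and g: "g \<in> borel_measurable borel" "\<And>y. norm y \<le> r \<Longrightarrow> \<bar>g y\<bar> \<le> c"
  shows "\<bar>LINT y|lborel. g y * mollifier r y\<bar> \<le> c"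
proof (cases "integrable lborel (\<lambda>y. g y * mollifier r y)")
  case True
  have "\<bar>LINT y|lborel. g y * mollifier r y\<bar> \<le> (LINT y|lborel. norm (g y * mollifier r y))"
    using integral_norm_bound[of lborel "\<lambda>y. g y * mollifier r y"] by simp
  also have "\<dots> \<le> (LINT y|lborel. c * mollifier r (y::'a))"
  proof (rule integral_mono)
    fix y :: 'a
    show "norm (g y * mollifier r y) \<le> c * mollifier r y"
      using g(2)[of y] mollifier_support[OF r, of y] mollifier_nonneg[OF r, of y]
      by (cases "mollifier r y = 0") (auto simp: abs_mult intro!: mult_right_mono)
  qed (use True integrable_mollifier[OF r] in auto)
  finally show ?thesis by (simp add: integral_mollifier[OF r])
next
  \<comment> \<open>A function that is not integrable has integral 0 by convention, so only
    \<open>0 \<le> c\<close> remains to be seen.\<close>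
  case False
  have "0 \<le> c" using g(2)[of 0] r abs_ge_zero order_trans by (metis norm_zero less_imp_le)
  then show ?thesis using False by (simp add: not_integrable_integral_eq)
qed

lemma convolve_mollifier_close:
  fixes f :: "'a::euclidean_space \<Rightarrow> real"
  assumes r: "0 < r" and f: "f \<in> borel_measurable borel" "\<And>y. \<bar>f y\<bar> \<le> M"
    and close: "\<And>y. norm (y - z) \<le> r \<Longrightarrow> \<bar>f y - f z\<bar> \<le> c"
  shows "\<bar>convolve f (mollifier r) z - f z\<bar> \<le> c"
proof -
  note m = test_function_measurable[OF test_function_mollifier[OF r]]
  have i: "integrable lborel (\<lambda>y. f (z - y) * mollifier r y)"
    by (rule integrable_bounded_mult[OF _ f(2) integrable_mollifier[OF r]]) (use f in measurable)
  have "convolve f (mollifier r) z - f z = (LINT y|lborel. (f (z - y) - f z) * mollifier r y)"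
    unfolding convolve_shift[OF f(1) m] left_diff_distrib
    using integrable_mollifier[OF r] i
    by (subst Bochner_Integration.integral_diff) (auto simp: integral_mollifier[OF r])
  also have "\<bar>\<dots>\<bar> \<le> c"
    by (rule mollifier_weighted_bound[OF r]) (use f close[of "z - _"] in auto)
  finally show ?thesis .
qed

text \<open>The difference quotient of the convolution is moved onto the rough factor
  \<open>f\<close>, so that a bound on increments of \<open>f\<close> near \<open>z\<close> controls
  the derivative of the smooth function. That derivative is taken as a limit from the right, because
  transport along characteristics only supplies forward increments.\<close>

lemma convolve_mollifier_directional_bound:
  fixes f :: "'a::euclidean_space \<Rightarrow> real"
  assumes r: "0 < r" and f: "f \<in> borel_measurable borel" "\<And>y. \<bar>f y\<bar> \<le> M" and h0: "0 < h0"
    and step: "\<And>y h. norm (y - z) \<le> r \<Longrightarrow> 0 < h \<Longrightarrow> h < h0 \<Longrightarrow> \<bar>f (y + h *\<^sub>R v) - f y\<bar> \<le> h * c"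
  shows "\<bar>frechet_derivative (convolve f (mollifier r)) (at z) v\<bar> \<le> c"
proof -
  let ?F = "convolve f (mollifier r)"
  note m = test_function_measurable[OF test_function_mollifier[OF r]]
  have D: "(?F has_derivative frechet_derivative ?F (at z)) (at z)"
    by (rule smooth_has_derivative[OF smooth_convolve[OF f test_function_mollifier[OF r]]])
  have i: "integrable lborel (\<lambda>y. f (w - y) * mollifier r y)" for w
    by (rule integrable_bounded_mult[OF _ f(2) integrable_mollifier[OF r]]) (use f in measurable)
  have quot: "\<bar>(?F (z + h *\<^sub>R v) - ?F z) / h\<bar> \<le> c" if h: "0 < h" "h < h0" for h
  proof -
    have "?F (z + h *\<^sub>R v) - ?F z = (LINT y|lborel. (f (z + h *\<^sub>R v - y) - f (z - y)) * mollifier r y)"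
      unfolding convolve_shift[OF f(1) m] left_diff_distrib
      by (rule Bochner_Integration.integral_diff[OF i i, symmetric])
    also have "\<bar>\<dots>\<bar> \<le> h * c"
    proof (rule mollifier_weighted_bound[OF r])
      show "(\<lambda>y. f (z + h *\<^sub>R v - y) - f (z - y)) \<in> borel_measurable borel"
        using f by measurable
      fix y :: 'a assume "norm y \<le> r"
      then show "\<bar>f (z + h *\<^sub>R v - y) - f (z - y)\<bar> \<le> h * c"
        using step[of "z - y" h] h by (simp add: algebra_simps)
    qed
    finally show ?thesis using h by (simp add: abs_divide field_simps)
  qed
  have lim: "((\<lambda>h. (?F (z + h *\<^sub>R v) - ?F z) / h) \<longlongrightarrow> frechet_derivative ?F (at z) v) (at 0)"
  proof -
    have "((\<lambda>h. z + h *\<^sub>R v) has_derivative (\<lambda>h. h *\<^sub>R v)) (at (0::real))"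
      by (auto intro!: derivative_eq_intros)
    from has_derivative_compose[OF this, of ?F "frechet_derivative ?F (at z)"] D
    have "((\<lambda>h. ?F (z + h *\<^sub>R v)) has_derivative (\<lambda>h. frechet_derivative ?F (at z) (h *\<^sub>R v))) (at 0)"
      by simp
    moreover have "(\<lambda>h. frechet_derivative ?F (at z) (h *\<^sub>R v)) = (*) (frechet_derivative ?F (at z) v)"
      using linear_simps(5)[OF has_derivative_bounded_linear[OF D]] by (simp add: fun_eq_iff)
    ultimately have "((\<lambda>h. ?F (z + h *\<^sub>R v)) has_real_derivative frechet_derivative ?F (at z) v) (at 0)"
      unfolding has_field_derivative_def by metis
    then show ?thesis by (simp add: DERIV_def)
  qed
  have lim': "((\<lambda>h. \<bar>(?F (z + h *\<^sub>R v) - ?F z) / h\<bar>) \<longlongrightarrow> \<bar>frechet_derivative ?F (at z) v\<bar>) (at_right 0)"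
    by (rule tendsto_rabs[OF filterlim_mono[OF lim order_refl at_le]]) simp
  show ?thesis
  proof (rule tendsto_upperbound[OF lim'])
    show "\<forall>\<^sub>F h in at_right 0. \<bar>(?F (z + h *\<^sub>R v) - ?F z) / h\<bar> \<le> c"
      using eventually_at_right_less[of 0] eventually_at_rightI[of 0 h0 "\<lambda>h. h < h0"] h0 quot
      by (auto elim!: eventually_elim2)
  qed simp
qed


section \<open>Weak gradients and Lipschitz bounds\<close>

lemma integrable_locally_integrable_mult:
  fixes G :: "real^'n \<Rightarrow> real^'n^'n"
  assumes "locally_integrable G" "test_function S \<phi>"
  shows "integrable lborel (\<lambda>y. G y $ i $ j * \<phi> (z - y))"
proof -
  from test_function_bounded_support[OF assms(2)]
  obtain R where R: "0 < R" "\<forall>x. \<phi> x \<noteq> 0 \<longrightarrow> norm x \<le> R" by blast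
  from test_function_abs_bounded[OF assms(2)] obtain C where C: "\<forall>x. \<bar>\<phi> x\<bar> \<le> C" by blast
  have "integrable lborel (\<lambda>y. indicator (cball z R) y *\<^sub>R G y)"
    using assms(1) by (simp add: locally_integrable_def set_integrable_def)
  moreover have "bounded_linear (\<lambda>A::real^'n^'n. A $ i $ j)"
    using bounded_linear_compose[OF bounded_linear_vec_nth bounded_linear_vec_nth] .
  ultimately have "integrable lborel (\<lambda>y. (indicator (cball z R) y *\<^sub>R G y) $ i $ j)"
    by (rule integrable_bounded_linear[rotated])
  then have "integrable lborel (\<lambda>y. \<phi> (z - y) * (indicator (cball z R) y *\<^sub>R G y) $ i $ j)"
    by (rule integrable_bounded_mult[rotated -1])
      (use C test_function_measurable[OF assms(2)] in auto)
  moreover have "\<phi> (z - y) * (indicator (cball z R) y *\<^sub>R G y) $ i $ j = G y $ i $ j * \<phi> (z - y)" for y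
    using R(2)[rule_format, of "z - y"] by (cases "\<phi> (z - y) = 0") (auto simp: dist_norm indicator_def)
  ultimately show ?thesis by (simp only:)
qed

text \<open>The mollification of \<open>a \<bullet> u\<close> has as its gradient the mollification
  of \<open>G\<close> contracted with \<open>a\<close>, of size at most \<open>norm a * M\<close>
  since the mollifier has mass one; continuity of \<open>u\<close> then removes the mollification.
  Working with \<open>a \<bullet> u\<close> instead of single components keeps the operator norm as
  the constant, without a dimensional factor.\<close>

lemma weak_gradient_inner_bound:
  fixes u :: "real^'n \<Rightarrow> real^'n"
  assumes u: "continuous_on UNIV u" "\<And>x. norm (u x) \<le> K" and G: "weak_gradient u G"
    and M: "AE x in lborel. onorm (\<lambda>v. G x *v v) \<le> M"
  shows "a \<bullet> (u x - u y) \<le> norm a * M * norm (x - y)"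
proof -
  let ?f = "\<lambda>x. a \<bullet> u x"
  have f1: "?f \<in> borel_measurable borel"
    by (intro borel_measurable_continuous_onI continuous_intros u)
  have f2: "\<bar>?f y\<bar> \<le> norm a * K" for y
    using Cauchy_Schwarz_ineq2[of a "u y"] mult_left_mono[OF u(2)[of y] norm_ge_zero[of a]] by linarith
  note f = f1 f2
  have li: "locally_integrable G" using G by (simp add: weak_gradient_def)
  have M0: "0 \<le> M"
  proof -
    have "AE x in (lborel :: (real^'n) measure). 0 \<le> M"
      using M by (rule eventually_mono)
        (rule order_trans[OF onorm_pos_le[OF matrix_vector_mul_bounded_linear]])
    then show ?thesis by (auto simp: eventually_const_iff ae_filter_eq_bot_iff)
  qed
  have lip: "\<bar>convolve ?f (mollifier r) x - convolve ?f (mollifier r) y\<bar> \<le> norm a * M * norm (x - y)"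
    if r: "0 < r" for r
  proof -
    let ?m = "mollifier r :: real^'n \<Rightarrow> real"
    note tm = test_function_mollifier[OF r]
    have sm: "smooth ?m" by (rule smooth_mollifier)
    have deriv: "\<bar>convolve ?f (\<lambda>x. frechet_derivative ?m (at x) v) z\<bar> \<le> norm a * M * norm v" for z v :: "real^'n"
    proof -
      have lin: "frechet_derivative ?m (at w) v = (\<Sum>j\<in>UNIV. v $ j * frechet_derivative ?m (at w) (axis j 1))" for w
      proof -
        have l: "linear (frechet_derivative ?m (at w))"
          by (rule has_derivative_linear[OF smooth_has_derivative[OF sm]])
        have "frechet_derivative ?m (at w) v = frechet_derivative ?m (at w) (\<Sum>j\<in>UNIV. v $ j *\<^sub>R axis j 1)"
          using basis_expansion[of v] by (simp add: scalar_mult_eq_scaleR)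
        also have "\<dots> = (\<Sum>j\<in>UNIV. v $ j * frechet_derivative ?m (at w) (axis j 1))"
          by (simp only: linear_sum[OF l] linear_scale[OF l] real_scaleR_def)
        finally show ?thesis .
      qed
      \<comment> \<open>The weak gradient is tested with the reflected mollifier centred at
        \<open>z\<close>; the sign from the reflection cancels the sign in the integration by
        parts.\<close>
      have weak: "(LINT y|lborel. u y $ i * frechet_derivative ?m (at (z - y)) (axis j 1)) = (LINT y|lborel. G y $ i $ j * ?m (z - y))" for i j
      proof -
        have tf: "test_function UNIV (\<lambda>y. ?m ((-1) *\<^sub>R y + z))"
          by (rule test_function_affine[OF tm]) simp
        have fd: "frechet_derivative (\<lambda>y. ?m ((-1) *\<^sub>R y + z)) (at y) w = - frechet_derivative ?m (at (z - y)) w" for y w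
        proof -
          have "((\<lambda>y. (-1) *\<^sub>R y + z) has_derivative (\<lambda>w. (-1) *\<^sub>R w)) (at y)"
            by (auto intro!: derivative_eq_intros)
          from has_derivative_compose[OF this smooth_has_derivative[OF sm]]
          have "((\<lambda>y. ?m ((-1) *\<^sub>R y + z)) has_derivative (\<lambda>w. frechet_derivative ?m (at (z - y)) ((-1) *\<^sub>R w))) (at y)"
            by simp
          from fun_cong[OF frechet_derivative_at[OF this], of w]
          have "frechet_derivative (\<lambda>y. ?m ((-1) *\<^sub>R y + z)) (at y) w = frechet_derivative ?m (at (z - y)) ((-1) *\<^sub>R w)"
            by (rule sym)
          also have "\<dots> = - frechet_derivative ?m (at (z - y)) w"
            by (simp add: linear_neg[OF has_derivative_linear[OF smooth_has_derivative[OF sm]]])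
          finally show ?thesis .
        qed
        from G tf have "(LINT y|lborel. u y $ i * frechet_derivative (\<lambda>y. ?m ((-1) *\<^sub>R y + z)) (at y) (axis j 1)) =
            - (LINT y|lborel. G y $ i $ j * ?m ((-1) *\<^sub>R y + z))"
          unfolding weak_gradient_def by blast
        from this[unfolded fd] show ?thesis by simp
      qed
      have iu: "integrable lborel (\<lambda>y. u y $ i * frechet_derivative ?m (at (z - y)) (axis j 1))" for i j
      proof (rule convolve_integrable[OF _ _ test_function_frechet_derivative[OF tm]])
        show "(\<lambda>y. u y $ i) \<in> borel_measurable borel"
          by (intro borel_measurable_continuous_onI continuous_intros u)
        show "\<bar>u y $ i\<bar> \<le> K" for y
          using component_le_norm_cart[of "u y" i] u(2)[of y] by linarith
      qed
      have iG: "integrable lborel (\<lambda>y. G y $ i $ j * ?m (z - y))" for i j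
        by (rule integrable_locally_integrable_mult[OF li tm])
      have "convolve ?f (\<lambda>x. frechet_derivative ?m (at x) v) z =
          (LINT y|lborel. (\<Sum>i\<in>UNIV. \<Sum>j\<in>UNIV. (a $ i * v $ j) * (u y $ i * frechet_derivative ?m (at (z - y)) (axis j 1))))"
        unfolding convolve_def
        by (rule Bochner_Integration.integral_cong)
          (simp_all add: lin inner_vec_def sum_distrib_left sum_distrib_right mult_ac,
            rule sum.swap)
      also have "\<dots> = (\<Sum>i\<in>UNIV. \<Sum>j\<in>UNIV. (a $ i * v $ j) * (LINT y|lborel. G y $ i $ j * ?m (z - y)))"
        using iu by (simp add: weak)
      also have "\<dots> = (LINT y|lborel. (\<Sum>i\<in>UNIV. \<Sum>j\<in>UNIV. (a $ i * v $ j) * (G y $ i $ j * ?m (z - y))))"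
        using iG by simp
      also have "\<dots> = (LINT y|lborel. (a \<bullet> (G y *v v)) * ?m (z - y))"
        by (rule Bochner_Integration.integral_cong)
          (simp_all add: inner_vec_def matrix_vector_mult_def sum_distrib_left sum_distrib_right mult_ac)
      finally have eq: "convolve ?f (\<lambda>x. frechet_derivative ?m (at x) v) z = (LINT y|lborel. (a \<bullet> (G y *v v)) * ?m (z - y))" .
      have iaG: "integrable lborel (\<lambda>y. (a \<bullet> (G y *v v)) * ?m (z - y))"
      proof -
        have "integrable lborel (\<lambda>y. (\<Sum>i\<in>UNIV. \<Sum>j\<in>UNIV. (a $ i * v $ j) * (G y $ i $ j * ?m (z - y))))"
          using iG by simp
        moreover have "(\<lambda>y. (\<Sum>i\<in>UNIV. \<Sum>j\<in>UNIV. (a $ i * v $ j) * (G y $ i $ j * ?m (z - y)))) = (\<lambda>y. (a \<bullet> (G y *v v)) * ?m (z - y))"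
          by (simp add: fun_eq_iff inner_vec_def matrix_vector_mult_def sum_distrib_left sum_distrib_right mult_ac)
        ultimately show ?thesis by simp
      qed
      have "\<bar>LINT y|lborel. (a \<bullet> (G y *v v)) * ?m (z - y)\<bar> \<le> (LINT y|lborel. norm ((a \<bullet> (G y *v v)) * ?m (z - y)))"
        using integral_norm_bound[of lborel "\<lambda>y. (a \<bullet> (G y *v v)) * ?m (z - y)"] by simp
      also have "\<dots> \<le> (LINT y|lborel. (norm a * M * norm v) * ?m (z - y))"
      proof (rule integral_mono_AE)
        show "AE y in lborel. norm ((a \<bullet> (G y *v v)) * ?m (z - y)) \<le> (norm a * M * norm v) * ?m (z - y)"
          using M
        proof eventually_elim
          case (elim y)
          have "norm (G y *v v) \<le> M * norm v"
            using onorm[OF matrix_vector_mul_bounded_linear, of "G y" v] elim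
            by (meson mult_right_mono norm_ge_zero order_trans)
          then have "\<bar>a \<bullet> (G y *v v)\<bar> \<le> norm a * (M * norm v)"
            using Cauchy_Schwarz_ineq2[of a "G y *v v"] by (meson mult_left_mono norm_ge_zero order_trans)
          then show ?case
            using mult_right_mono[OF _ mollifier_nonneg[OF r, of "z - y"]] mollifier_nonneg[OF r, of "z - y"]
            by (fastforce simp: abs_mult mult.assoc)
        qed
      qed (use iaG lborel_integrable_reflect[OF integrable_mollifier[OF r]] in auto)
      also have "\<dots> = norm a * M * norm v"
        using lborel_integral_reflect[OF test_function_measurable[OF tm], of z] by (simp add: integral_mollifier[OF r])
      finally show ?thesis unfolding eq .
    qed
    have "norm (convolve ?f ?m x - convolve ?f ?m y) \<le> (norm a * M) * norm (x - y)"
    proof (rule differentiable_bound[where S=UNIV and f'="\<lambda>z v. convolve ?f (\<lambda>x. frechet_derivative ?m (at x) v) z"])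
      show "(convolve ?f ?m has_derivative (\<lambda>v. convolve ?f (\<lambda>x. frechet_derivative ?m (at x) v) z)) (at z within UNIV)" for z
        using convolve_has_derivative[OF f tm] by simp
      show "onorm (\<lambda>v. convolve ?f (\<lambda>x. frechet_derivative ?m (at x) v) z) \<le> norm a * M" for z
        by (rule onorm_le) (use deriv in auto)
    qed auto
    then show ?thesis by simp
  qed
  show ?thesis
  proof (rule field_le_epsilon)
    fix e :: real assume e: "0 < e"
    have "\<exists>r>0. \<forall>w. norm (w - z) \<le> r \<longrightarrow> \<bar>?f w - ?f z\<bar> \<le> e / 2" for z
    proof -
      have "continuous_on UNIV ?f" by (intro continuous_intros u)
      then have "isCont ?f z" by (simp add: continuous_on_eq_continuous_at)
      then obtain d where d: "d > 0" "\<forall>w. dist w z < d \<longrightarrow> dist (?f w) (?f z) < e / 2"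
        using e unfolding continuous_at_eps_delta by (metis half_gt_zero)
      show ?thesis
        by (rule exI[of _ "d / 2"]) (use d in \<open>auto simp: dist_norm intro!: less_imp_le\<close>)
    qed
    then obtain r1 r2 where r: "0 < r1" "0 < r2"
      "\<forall>w. norm (w - x) \<le> r1 \<longrightarrow> \<bar>?f w - ?f x\<bar> \<le> e / 2" "\<forall>w. norm (w - y) \<le> r2 \<longrightarrow> \<bar>?f w - ?f y\<bar> \<le> e / 2"
      by meson
    let ?r = "min r1 r2"
    have r0: "0 < ?r" using r by simp
    have "\<bar>convolve ?f (mollifier ?r) x - ?f x\<bar> \<le> e / 2" "\<bar>convolve ?f (mollifier ?r) y - ?f y\<bar> \<le> e / 2"
      by (rule convolve_mollifier_close[OF r0 f], use r in simp)+
    with lip[OF r0] show "a \<bullet> (u x - u y) \<le> norm a * M * norm (x - y) + e"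
      unfolding inner_diff_right by linarith
  qed
qed

text \<open>The infimum over weak gradients may fail to be attained, hence the strict inequality.
  For \<open>a = u x - u y\<close> the directional bound reads
  \<open>norm a ^ 2 \<le> norm a * M * norm (x - y)\<close>, and cancelling one factor leaves
  exactly the constant \<open>M\<close>.\<close>

lemma grad_Linf_norm_lipschitz:
  fixes u :: "real^'n \<Rightarrow> real^'n"
  assumes u: "continuous_on UNIV u" "\<And>x. norm (u x) \<le> K" and M: "grad_Linf_norm u < ennreal M"
  shows "M-lipschitz_on UNIV u"
proof -
  obtain G where G: "weak_gradient u G" and less: "esssup lborel (\<lambda>x. ennreal (onorm (\<lambda>v. G x *v v))) < ennreal M"
    using M unfolding grad_Linf_norm_def INF_less_iff by blast
  have meas: "(\<lambda>x. ennreal (onorm (\<lambda>v. G x *v v))) \<in> borel_measurable lborel"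
    using less esssup_non_measurable[of "\<lambda>x. ennreal (onorm (\<lambda>v. G x *v v))" lborel] by fastforce
  have M0: "0 \<le> M" using less by (cases "0 \<le> M") (auto simp: ennreal_neg)
  have "AE x in lborel. ennreal (onorm (\<lambda>v. G x *v v)) \<le> esssup lborel (\<lambda>x. ennreal (onorm (\<lambda>v. G x *v v)))"
    by (rule esssup_AE)
  then have AE: "AE x in lborel. onorm (\<lambda>v. G x *v v) \<le> M"
    by eventually_elim (use less M0 in \<open>meson ennreal_le_iff order_le_less_trans less_imp_le\<close>)
  show ?thesis
  proof (rule lipschitz_onI)
    fix x y :: "real^'n"
    have "(norm (u x - u y))\<^sup>2 \<le> norm (u x - u y) * (M * norm (x - y))"
      using weak_gradient_inner_bound[OF u G AE, of "u x - u y" x y] by (simp add: power2_norm_eq_inner mult.assoc)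
    then show "dist (u x) (u y) \<le> M * dist x y"
      by (cases "u x = u y") (auto simp: dist_norm power2_eq_square M0)
  qed (rule M0)
qed

section \<open>The Yukawa kernel as a Gaussian mixture\<close>

lemma integrable_exp_abs:
  fixes b :: real
  assumes "0 < b" shows "integrable lborel (\<lambda>s::real. exp (- b * \<bar>s\<bar>))"
proof -
  let ?h = "\<lambda>s. indicator {0<..} s *\<^sub>R exp (- (s * b))"
  have i: "integrable lborel ?h"
    using integrable_I0i_exp_mscale[OF assms] by (simp add: set_integrable_def)
  from lborel_integrable_real_affine[OF this, of "-1" 0]
  have "integrable lborel (\<lambda>s. ?h s + ?h (- s))"
    using i by (intro Bochner_Integration.integrable_add) simp_all
  then show ?thesis
  proof (rule integrable_cong_AE_imp)
    show "AE s in lborel. ?h s + ?h (- s) = exp (- b * \<bar>s\<bar>)"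
      using AE_lborel_singleton[of 0]
      by eventually_elim (auto simp: indicator_def abs_if mult.commute)
  qed simp
qed

text \<open>Integrand of the heat-semigroup formula for the resolvent of the Laplacian, with heat
  time \<open>exp s\<close> and \<open>w = |x|^2\<close>:
  \<open>exp (- \<kappa>\<^sup>2 * exp s)\<close> is the damping and
  \<open>exp (- w / 4 * exp (- s))\<close> the Gaussian. The kernel itself has
  \<open>a = d / 2 - 1\<close>, where the Jacobian of the substitution has taken one unit off
  \<open>d / 2\<close>; each derivative in \<open>w\<close> raises \<open>a\<close> by one.\<close>

definition mix :: "real \<Rightarrow> real \<Rightarrow> real \<Rightarrow> real \<Rightarrow> real" where
  "mix \<kappa> a w s = exp (- a * s - \<kappa>\<^sup>2 * exp s - w / 4 * exp (- s))"

definition mix_int :: "real \<Rightarrow> real \<Rightarrow> real \<Rightarrow> real" where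
  "mix_int \<kappa> a w = (LINT s|lborel. mix \<kappa> a w s)"

lemma mix_pos: "0 < mix \<kappa> a w s"
  by (simp add: mix_def)

lemma mix_measurable [measurable]: "(\<lambda>(w, s). mix \<kappa> a w s) \<in> borel_measurable (borel \<Otimes>\<^sub>M borel)"
  unfolding mix_def by measurable

lemma exp_ge_half_square: "0 \<le> s \<Longrightarrow> (s::real)\<^sup>2 / 2 \<le> exp s"
  using power_le_fact_exp[of s 2] by simp

text \<open>Completing the square: a quadratic exponent absorbs any linear growth and leaves
  exponential decay at a prescribed rate \<open>b\<close>.\<close>

lemma exp_exponent_le:
  fixes a b m s :: real
  assumes "0 < m"
  shows "a * \<bar>s\<bar> - m * (s\<^sup>2 / 2) \<le> (a + b)\<^sup>2 / (2 * m) - b * \<bar>s\<bar>"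
proof -
  have "0 \<le> (m * \<bar>s\<bar> - (a + b))\<^sup>2" by simp
  then have "2 * m * ((a + b) * \<bar>s\<bar> - m * (s\<^sup>2 / 2)) \<le> (a + b)\<^sup>2"
    by (simp add: power2_eq_square algebra_simps abs_mult_self_eq)
  then have "(a + b) * \<bar>s\<bar> - m * (s\<^sup>2 / 2) \<le> (a + b)\<^sup>2 / (2 * m)"
    using assms by (simp add: pos_le_divide_eq mult.commute)
  then show ?thesis by (simp add: algebra_simps)
qed

lemma mix_integrable:
  assumes "0 < \<kappa>" "0 < w"
  shows "integrable lborel (mix \<kappa> a w)"
proof -
  \<comment> \<open>A common lower bound for the coefficients of \<open>exp s\<close> and
    \<open>exp (- s)\<close>, so that one multiple of \<open>s\<^sup>2\<close> serves at both ends
    of the line.\<close>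
  define m where "m = min (\<kappa>\<^sup>2) (w / 4)"
  have m: "0 < m" "m \<le> \<kappa>\<^sup>2" "m \<le> w / 4" using assms by (auto simp: m_def)
  define C where "C = (\<bar>a\<bar> + 1)\<^sup>2 / (2 * m)"
  have bound: "mix \<kappa> a w s \<le> exp C * exp (- 1 * \<bar>s\<bar>)" for s
  proof -
    have "s\<^sup>2 / 2 \<le> exp s + exp (- s)"
      using exp_ge_half_square[of s] exp_ge_half_square[of "-s"]
      by (cases "0 \<le> s") (auto intro: order_trans add_increasing add_increasing2)
    then have "m * (s\<^sup>2 / 2) \<le> m * (exp s + exp (- s))" using m by (intro mult_left_mono) auto
    also have "\<dots> \<le> \<kappa>\<^sup>2 * exp s + w / 4 * exp (- s)"
      using m by (auto simp: distrib_left intro!: add_mono mult_right_mono)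
    finally have "- a * s - \<kappa>\<^sup>2 * exp s - w / 4 * exp (- s) \<le> \<bar>a\<bar> * \<bar>s\<bar> - m * (s\<^sup>2 / 2)"
      using abs_ge_minus_self[of "a * s"] by (simp add: abs_mult)
    also have "\<dots> \<le> C - 1 * \<bar>s\<bar>" unfolding C_def by (rule exp_exponent_le[OF m(1)])
    finally show ?thesis unfolding mix_def by (simp add: exp_add[symmetric])
  qed
  have "integrable lborel (\<lambda>s. exp C * exp (- 1 * \<bar>s\<bar>))"
    by (intro integrable_mult_right integrable_exp_abs) simp
  then show ?thesis
    by (rule Bochner_Integration.integrable_bound)
      (use bound mix_pos[of \<kappa> a w] in \<open>auto simp: mix_def[abs_def] abs_of_pos intro!: borel_measurable_exp\<close>)
qed

lemma mix_int_pos: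
  assumes "0 < \<kappa>" "0 < w" shows "0 < mix_int \<kappa> a w"
proof -
  have "mix_int \<kappa> a w \<noteq> 0"
  proof
    assume "mix_int \<kappa> a w = 0"
    then have "AE s in lborel. mix \<kappa> a w s = 0"
      using integral_nonneg_eq_0_iff_AE[OF mix_integrable[OF assms, of a]] mix_pos[of \<kappa> a w]
      by (auto simp: mix_int_def intro: less_imp_le)
    then have "AE s in (lborel::real measure). False"
      by eventually_elim (use mix_pos[of \<kappa> a w] in \<open>metis less_irrefl\<close>)
    then show False by (simp add: eventually_const_iff ae_filter_eq_bot_iff)
  qed
  moreover have "0 \<le> mix_int \<kappa> a w"
    unfolding mix_int_def by (intro Bochner_Integration.integral_nonneg less_imp_le mix_pos)
  ultimately show ?thesis by simp
qed

text \<open>Each integrand depends on \<open>w\<close> through the exponential of a linear function,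
  so \<open>exp x \<ge> 1 + x\<close> integrates to a tangent inequality. Monotonicity, Lipschitz
  bounds, continuity and the derivative of the kernel profile are all derived from it, with no
  differentiation under the integral.\<close>

lemma mix_int_convex:
  assumes "0 < \<kappa>" "0 < w1" "0 < w2"
  shows "mix_int \<kappa> a w1 - (w2 - w1) * (mix_int \<kappa> (a + 1) w1 / 4) \<le> mix_int \<kappa> a w2"
proof -
  note i = mix_integrable[OF assms(1)]
  have "mix_int \<kappa> a w1 - (w2 - w1) * (mix_int \<kappa> (a + 1) w1 / 4)
      = (LINT s|lborel. mix \<kappa> a w1 s - (w2 - w1) / 4 * mix \<kappa> (a + 1) w1 s)"
    unfolding mix_int_def using i[OF assms(2), of a] i[OF assms(2), of "a + 1"] by simp
  also have "\<dots> \<le> mix_int \<kappa> a w2"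
    unfolding mix_int_def
  proof (rule integral_mono)
    fix s :: real
    let ?x = "- (w2 - w1) / 4 * exp (- s)"
    have "mix \<kappa> a w2 s = mix \<kappa> a w1 s * exp ?x"
      unfolding mix_def exp_add[symmetric] by (simp add: algebra_simps add_divide_distrib diff_divide_distrib)
    moreover have "mix \<kappa> (a + 1) w1 s = mix \<kappa> a w1 s * exp (- s)"
      unfolding mix_def exp_add[symmetric] by (simp add: algebra_simps)
    moreover have "mix \<kappa> a w1 s * (1 + ?x) \<le> mix \<kappa> a w1 s * exp ?x"
      by (intro mult_left_mono exp_ge_add_one_self less_imp_le mix_pos)
    moreover have "mix \<kappa> a w1 s - (w2 - w1) / 4 * (mix \<kappa> a w1 s * exp (- s)) = mix \<kappa> a w1 s * (1 + ?x)"
      by (simp add: field_simps)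
    ultimately show "mix \<kappa> a w1 s - (w2 - w1) / 4 * mix \<kappa> (a + 1) w1 s \<le> mix \<kappa> a w2 s"
      by metis
  qed (use i assms in auto)
  finally show ?thesis .
qed

text \<open>For \<open>- M \<le> s \<le> 0\<close> and \<open>w = 4 * exp (- M)\<close> every term
  of the exponent is bounded below, and the interval has length \<open>M\<close>. The growth is thus
  at least logarithmic in \<open>1 / w\<close>, which is the true order for \<open>a = 0\<close>,
  the planar case, and is enough in every dimension to exclude collisions.\<close>

lemma mix_int_lower:
  assumes "0 < \<kappa>" "0 \<le> a" "0 \<le> M"
  shows "M * exp (- \<kappa>\<^sup>2 - 1) \<le> mix_int \<kappa> a (4 * exp (- M))"
proof -
  have "(LINT s|lborel. exp (- \<kappa>\<^sup>2 - 1) * indicator {-M..0} s) \<le> mix_int \<kappa> a (4 * exp (- M))"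
    unfolding mix_int_def
  proof (rule integral_mono)
    fix s :: real
    show "exp (- \<kappa>\<^sup>2 - 1) * indicator {-M..0} s \<le> mix \<kappa> a (4 * exp (- M)) s"
    proof (cases "s \<in> {-M..0}")
      case True
      have 1: "exp (- M) * exp (- s) \<le> 1"
        using True by (simp add: exp_add[symmetric])
      have 2: "\<kappa>\<^sup>2 * exp s \<le> \<kappa>\<^sup>2"
        using True by (simp add: mult_left_le)
      have 3: "a * s \<le> 0" using True assms by (simp add: mult_nonneg_nonpos)
      have "- \<kappa>\<^sup>2 - 1 \<le> - a * s - \<kappa>\<^sup>2 * exp s - 4 * exp (- M) / 4 * exp (- s)"
        using 1 2 3 by simp
      then show ?thesis using True by (simp add: mix_def)
    qed (use mix_pos[of \<kappa> a "4 * exp (- M)" s] in \<open>auto simp: less_imp_le\<close>)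
  qed (use assms mix_integrable in \<open>auto intro!: integrable_mult_right integrable_real_indicator\<close>)
  then show ?thesis using assms by (simp add: mult.commute)
qed

lemma Bessel_K_eq_full_line:
  assumes "0 < z"
  shows "2 * Bessel_K \<nu> z = (LINT s|lborel. exp (- z * cosh s - \<nu> * s))"
proof -
  let ?\<phi> = "\<lambda>s::real. exp (- z * cosh s - \<nu> * s)"
  have i: "integrable lborel ?\<phi>"
  proof -
    have "integrable lborel (mix (sqrt (z / 2)) \<nu> (2 * z))"
      by (rule mix_integrable) (use assms in auto)
    moreover have "mix (sqrt (z / 2)) \<nu> (2 * z) = ?\<phi>"
      using assms by (auto simp: mix_def fun_eq_iff cosh_def field_simps)
    ultimately show ?thesis by simp
  qed
  let ?pos = "\<lambda>s. indicator {0..} s * ?\<phi> s" and ?neg = "\<lambda>s. indicator {0..} s * ?\<phi> (- s)"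
  have ipos: "integrable lborel ?pos"
    using integrable_mult_indicator[OF _ i, of "{0..}"] by simp
  have i': "integrable lborel (\<lambda>s. ?\<phi> (- s))"
    using lborel_integrable_real_affine[OF i, of "-1" 0] by simp
  have ineg: "integrable lborel ?neg"
    using integrable_mult_indicator[OF _ i', of "{0..}"] by simp
  have "Bessel_K \<nu> z = (LINT s|lborel. (?pos s + ?neg s) / 2)"
    unfolding Bessel_K_def set_lebesgue_integral_def
  proof (rule Bochner_Integration.integral_cong)
    fix s :: real
    have "exp (- z * cosh s) * cosh (\<nu> * s) = (?\<phi> s + ?\<phi> (- s)) / 2"
      unfolding cosh_field_def[of "\<nu> * s"] cosh_minus diff_conv_add_uminus exp_add by (simp add: algebra_simps)
    then show "indicator {0..} s *\<^sub>R (exp (- z * cosh s) * cosh (\<nu> * s)) = (?pos s + ?neg s) / 2"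
      by (auto simp: indicator_def)
  qed simp
  then have "2 * Bessel_K \<nu> z = (LINT s|lborel. ?pos s) + (LINT s|lborel. ?neg s)"
    using ipos ineg by simp
  also have "(LINT s|lborel. ?neg s) = (LINT s|lborel. ?neg (- s))"
    using lborel_integral_real_affine[of "-1" ?neg 0] by simp
  also have "(LINT s|lborel. ?pos s) + (LINT s|lborel. ?neg (- s)) = (LINT s|lborel. ?pos s + ?neg (- s))"
    using ipos lborel_integrable_real_affine[OF ineg, of "-1" 0] by simp
  also have "\<dots> = (LINT s|lborel. ?\<phi> s)"
  proof (rule integral_cong_AE)
    show "AE s in lborel. ?pos s + ?neg (- s) = ?\<phi> s"
      \<comment> \<open>Both half-lines contain the origin, where the value is counted
        twice.\<close>
      using AE_lborel_singleton[of 0] by eventually_elim (auto simp: indicator_def)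
  qed (use i ipos lborel_integrable_real_affine[OF ineg, of "-1" 0] in auto)
  finally show ?thesis .
qed

lemma Bessel_K_eq_mix_int:
  assumes "0 < \<kappa>" "0 < r"
  shows "(\<kappa> / r) powr a * Bessel_K a (\<kappa> * r) = 2 powr (- a - 1) * mix_int \<kappa> a (r\<^sup>2)"
proof -
  \<comment> \<open>The translation that balances the two exponentials:
    \<open>\<kappa>\<^sup>2 * exp s\<close> and \<open>r\<^sup>2 / 4 * exp (- s)\<close> both
    acquire the coefficient \<open>\<kappa> * r / 2\<close> and combine to a hyperbolic
    cosine.\<close>
  define t where "t = ln (r / (2 * \<kappa>))"
  have et: "exp t = r / (2 * \<kappa>)" using assms by (simp add: t_def)
  have emt: "exp (- t) = 2 * \<kappa> / r" using et assms by (simp add: exp_minus)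
  have "mix_int \<kappa> a (r\<^sup>2) = (LINT s|lborel. mix \<kappa> a (r\<^sup>2) (t + 1 * s))"
    unfolding mix_int_def using lborel_integral_real_affine[of 1 "mix \<kappa> a (r\<^sup>2)" t] by simp
  also have "\<dots> = (LINT s|lborel. (2 * \<kappa> / r) powr a * exp (- (\<kappa> * r) * cosh s - a * s))"
  proof (rule Bochner_Integration.integral_cong)
    fix s
    have e1: "\<kappa>\<^sup>2 * exp (t + s) = \<kappa> * r / 2 * exp s"
      unfolding exp_add et using assms by (simp add: power2_eq_square)
    have e2: "r\<^sup>2 / 4 * exp (- (t + s)) = \<kappa> * r / 2 * exp (- s)"
      unfolding minus_add_distrib exp_add emt using assms by (simp add: power2_eq_square)
    have eq: "- a * (t + s) - \<kappa>\<^sup>2 * exp (t + s) - r\<^sup>2 / 4 * exp (- (t + s))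
        = a * (- t) + (- (\<kappa> * r) * cosh s - a * s)"
      unfolding e1 e2 cosh_def by (simp add: algebra_simps)
    have eq': "exp (a * (- t)) = (2 * \<kappa> / r) powr a"
      using assms by (simp add: powr_def t_def ln_div ln_mult algebra_simps)
    show "mix \<kappa> a (r\<^sup>2) (t + 1 * s) = (2 * \<kappa> / r) powr a * exp (- (\<kappa> * r) * cosh s - a * s)"
      by (simp only: mix_def mult_1 eq exp_add[of "a * - t"] eq')
  qed simp
  also have "\<dots> = (2 * \<kappa> / r) powr a * (2 * Bessel_K a (\<kappa> * r))"
    using Bessel_K_eq_full_line[of "\<kappa> * r" a] assms by simp
  also have "(2 * \<kappa> / r) powr a = 2 powr a * (\<kappa> / r) powr a"
    using powr_mult[of 2 "\<kappa> / r" a] assms by simp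
  finally have "mix_int \<kappa> a (r\<^sup>2) = 2 powr (a + 1) * ((\<kappa> / r) powr a * Bessel_K a (\<kappa> * r))"
    by (simp add: powr_add mult_ac)
  then have "2 powr (- a - 1) * mix_int \<kappa> a (r\<^sup>2)
      = (2 powr (- a - 1) * 2 powr (a + 1)) * ((\<kappa> / r) powr a * Bessel_K a (\<kappa> * r))"
    by simp
  also have "2 powr (- a - 1) * 2 powr (a + 1) = (1::real)"
    by (simp add: powr_add[symmetric])
  finally show ?thesis by simp
qed

lemma nn_integral_gaussian:
  fixes s :: real
  assumes "0 < s"
  shows "(\<integral>\<^sup>+x. ennreal (exp (- s * x\<^sup>2)) \<partial>lborel) = ennreal (sqrt (pi / s))"
proof -
  define \<sigma> where "\<sigma> = sqrt (1 / (2 * s))"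
  have \<sigma>: "0 < \<sigma>" "\<sigma>\<^sup>2 = 1 / (2 * s)" using assms by (auto simp: \<sigma>_def)
  have eq: "exp (- s * x\<^sup>2) = sqrt (pi / s) * normal_density 0 \<sigma> x" for x
    using assms by (simp add: normal_density_def \<sigma> real_sqrt_divide field_simps)
  have "(\<integral>\<^sup>+x. ennreal (exp (- s * x\<^sup>2)) \<partial>lborel) =
      ennreal (LINT x|lborel. sqrt (pi / s) * normal_density 0 \<sigma> x)"
    unfolding eq using assms \<sigma>
    by (intro nn_integral_eq_integral) auto
  then show ?thesis using \<sigma> by simp
qed

lemma nn_integral_gaussian_euclidean:
  assumes "0 < s"
  shows "(\<integral>\<^sup>+x. ennreal (exp (- s * (norm (x::'a::euclidean_space))\<^sup>2)) \<partial>lborel) = ennreal (sqrt (pi / s) ^ DIM('a))"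
proof -
  have "(norm x)\<^sup>2 = (\<Sum>b\<in>Basis. (x \<bullet> b)\<^sup>2)" for x :: 'a
    unfolding power2_norm_eq_inner by (subst euclidean_inner) (simp add: power2_eq_square)
  then have "ennreal (exp (- s * (norm x)\<^sup>2)) = (\<Prod>b\<in>Basis. ennreal (exp (- s * (x \<bullet> b)\<^sup>2)))" for x :: 'a
    by (simp add: prod_ennreal exp_sum[symmetric] sum_distrib_left sum_negf)
  then have "(\<integral>\<^sup>+x. ennreal (exp (- s * (norm (x::'a))\<^sup>2)) \<partial>lborel)
      = (\<integral>\<^sup>+x. (\<Prod>b\<in>Basis. ennreal (exp (- s * ((x::'a) \<bullet> b)\<^sup>2))) \<partial>lborel)"
    by (simp only:)
  also have "\<dots> = (\<Prod>b\<in>(Basis::'a set). (\<integral>\<^sup>+x. ennreal (exp (- s * x\<^sup>2)) \<partial>lborel))"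
    by (rule nn_integral_lborel_prod) auto
  also have "\<dots> = ennreal (sqrt (pi / s)) ^ DIM('a)"
    by (simp only: nn_integral_gaussian[OF assms] prod_constant)
  finally show ?thesis
    using assms by (simp add: ennreal_power)
qed

text \<open>Integrating the Gaussian over \<open>x\<close> first produces
  \<open>exp (d / 2 * s)\<close>. The remaining exponent \<open>b = d / 2 - a\<close> is positive,
  which gives decay as \<open>s\<close> tends to minus infinity, and
  \<open>\<kappa>\<^sup>2 * exp s\<close> takes care of the other end. The width \<open>m\<close> is
  free: 4 serves the potential, 8 its gradient.\<close>

lemma gaussian_mixture_finite:
  assumes \<kappa>: "0 < \<kappa>" and m: "0 < m" and a: "a < real DIM('a) / 2"
  shows "(\<integral>\<^sup>+x. (\<integral>\<^sup>+s. ennreal (exp (- a * s - \<kappa>\<^sup>2 * exp s - (norm (x::'a::euclidean_space))\<^sup>2 / m * exp (- s))) \<partial>lborel) \<partial>lborel) < \<infinity>"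
proof -
  define b where "b = real DIM('a) / 2 - a"
  have b: "0 < b" using a by (simp add: b_def)
  let ?f = "\<lambda>x::'a. \<lambda>s. exp (- a * s - \<kappa>\<^sup>2 * exp s - (norm x)\<^sup>2 / m * exp (- s))"
  have "(\<integral>\<^sup>+x. (\<integral>\<^sup>+s. ennreal (?f x s) \<partial>lborel) \<partial>lborel) = (\<integral>\<^sup>+s. (\<integral>\<^sup>+x. ennreal (?f x s) \<partial>lborel) \<partial>lborel)"
    by (rule lborel_pair.Fubini'[symmetric]) measurable
  also have "\<dots> = (\<integral>\<^sup>+s. ennreal (sqrt (pi * m) ^ DIM('a) * exp (b * s - \<kappa>\<^sup>2 * exp s)) \<partial>lborel)"
  proof (rule nn_integral_cong)
    fix s :: real
    have "(\<integral>\<^sup>+x. ennreal (?f x s) \<partial>lborel) =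
        (\<integral>\<^sup>+x. ennreal (exp (- a * s - \<kappa>\<^sup>2 * exp s)) * ennreal (exp (- (exp (- s) / m) * (norm (x::'a))\<^sup>2)) \<partial>lborel)"
      by (rule nn_integral_cong) (simp add: ennreal_mult'[symmetric] exp_add[symmetric] mult.commute)
    also have "\<dots> = ennreal (exp (- a * s - \<kappa>\<^sup>2 * exp s)) * ennreal (sqrt (pi / (exp (- s) / m)) ^ DIM('a))"
      by (subst nn_integral_cmult, measurable, subst nn_integral_gaussian_euclidean) (use m in simp_all)
    also have "sqrt (pi / (exp (- s) / m)) = sqrt (pi * m) * exp (s / 2)"
    proof -
      have "pi / (exp (- s) / m) = (pi * m) * exp s" by (simp add: exp_minus field_simps)
      moreover have "sqrt (exp s) = exp (s / 2)"
        by (rule real_sqrt_unique) (simp_all add: exp_double[symmetric])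
      ultimately show ?thesis by (simp add: real_sqrt_mult)
    qed
    also have "(sqrt (pi * m) * exp (s / 2)) ^ DIM('a) = sqrt (pi * m) ^ DIM('a) * exp (real DIM('a) / 2 * s)"
      by (simp add: power_mult_distrib exp_of_nat_mult[symmetric])
    also have "ennreal (exp (- a * s - \<kappa>\<^sup>2 * exp s)) * ennreal (sqrt (pi * m) ^ DIM('a) * exp (real DIM('a) / 2 * s))
        = ennreal (sqrt (pi * m) ^ DIM('a) * exp (b * s - \<kappa>\<^sup>2 * exp s))"
      by (simp add: ennreal_mult'[symmetric] b_def exp_add[symmetric] algebra_simps)
    finally show "(\<integral>\<^sup>+x. ennreal (?f x s) \<partial>lborel) = ennreal (sqrt (pi * m) ^ DIM('a) * exp (b * s - \<kappa>\<^sup>2 * exp s))" .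
  qed
  also have "\<dots> < \<infinity>"
  proof -
    define C where "C = (b + b)\<^sup>2 / (2 * \<kappa>\<^sup>2)"
    have C0: "0 \<le> C" by (simp add: C_def)
    have bound: "exp (b * s - \<kappa>\<^sup>2 * exp s) \<le> exp C * exp (- b * \<bar>s\<bar>)" for s
    proof (cases "0 \<le> s")
      case True
      have "\<kappa>\<^sup>2 * (s\<^sup>2 / 2) \<le> \<kappa>\<^sup>2 * exp s"
        using exp_ge_half_square[OF True] by (intro mult_left_mono) auto
      moreover have "b * \<bar>s\<bar> - \<kappa>\<^sup>2 * (s\<^sup>2 / 2) \<le> C - b * \<bar>s\<bar>"
        unfolding C_def by (rule exp_exponent_le) (use \<kappa> in simp)
      ultimately show ?thesis using True by (simp add: exp_add[symmetric])
    next
      case False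
      have "0 \<le> \<kappa>\<^sup>2 * exp s" by simp
      then have "b * s - \<kappa>\<^sup>2 * exp s \<le> C + - b * \<bar>s\<bar>"
      proof -
        have "- b * \<bar>s\<bar> = b * s" using False by simp
        with \<open>0 \<le> \<kappa>\<^sup>2 * exp s\<close> C0 show ?thesis by linarith
      qed
      then show ?thesis unfolding exp_add[symmetric] exp_le_cancel_iff .
    qed
    have "integrable lborel (\<lambda>s. sqrt (pi * m) ^ DIM('a) * (exp C * exp (- b * \<bar>s\<bar>)))"
      by (intro integrable_mult_right integrable_exp_abs b)
    then have "(\<integral>\<^sup>+s. ennreal (sqrt (pi * m) ^ DIM('a) * (exp C * exp (- b * \<bar>s\<bar>))) \<partial>lborel) < \<infinity>"
      using m by (subst nn_integral_eq_integral) auto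
    then show ?thesis
      by (rule le_less_trans[rotated]) (use m bound in \<open>auto intro!: nn_integral_mono ennreal_leI mult_left_mono\<close>)
  qed
  finally show ?thesis .
qed


section \<open>The kernel profile as a function of the squared distance\<close>

text \<open>Up to the sign \<open>(-1) ^ j\<close>, the \<open>j\<close>-th derivative of the
  potential with respect to \<open>w = |x|^2\<close>; every differentiation brings down a factor
  \<open>1 / 4\<close> and raises the exponent by one.\<close>

definition prof :: "real \<Rightarrow> nat \<Rightarrow> nat \<Rightarrow> real \<Rightarrow> real" where
  "prof \<kappa> d j w = (4 * pi) powr (- real d / 2) * (1 / 4) ^ j * mix_int \<kappa> (real d / 2 - 1 + real j) w"

lemma prof_pos: "0 < \<kappa> \<Longrightarrow> 0 < w \<Longrightarrow> 0 < prof \<kappa> d j w"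
  by (simp add: prof_def mix_int_pos)

lemma prof_convex:
  assumes "0 < \<kappa>" "0 < w1" "0 < w2"
  shows "prof \<kappa> d j w1 - (w2 - w1) * prof \<kappa> d (Suc j) w1 \<le> prof \<kappa> d j w2"
proof -
  let ?c = "(4 * pi) powr (- real d / 2) * (1 / 4) ^ j :: real"
  let ?a = "real d / 2 - 1 + real j"
  have "?c * (mix_int \<kappa> ?a w1 - (w2 - w1) * (mix_int \<kappa> (?a + 1) w1 / 4)) \<le> ?c * mix_int \<kappa> ?a w2"
    by (intro mult_left_mono mix_int_convex assms) simp
  moreover have "?a + 1 = real d / 2 - 1 + real (Suc j)" by simp
  ultimately show ?thesis unfolding prof_def by (simp add: algebra_simps)
qed

lemma prof_antimono:
  assumes "0 < \<kappa>" "0 < w1" "w1 \<le> w2"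
  shows "prof \<kappa> d j w2 \<le> prof \<kappa> d j w1"
proof -
  have "0 \<le> (w2 - w1) * prof \<kappa> d (Suc j) w2"
    using prof_pos[OF assms(1), of w2 d "Suc j"] assms by simp
  then show ?thesis
    using prof_convex[of \<kappa> w2 w1 d j] assms by (simp add: algebra_simps)
qed

text \<open>The tangent at \<open>w\<close>, evaluated at \<open>w / 2\<close>, lies below the
  profile there. It trades a factor \<open>w\<close> for one derivative, at the price of halving the
  argument.\<close>

lemma prof_mult_le:
  assumes "0 < \<kappa>" "0 < w"
  shows "w * prof \<kappa> d (Suc j) w \<le> 2 * prof \<kappa> d j (w / 2)"
  using prof_convex[of \<kappa> w "w / 2" d j] prof_pos[OF assms, of d j] assms by (simp add: algebra_simps)

lemma prof_lipschitz:
  assumes "0 < \<kappa>" "0 < \<delta>" "\<delta> \<le> w1" "\<delta> \<le> w2"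
  shows "\<bar>prof \<kappa> d j w1 - prof \<kappa> d j w2\<bar> \<le> prof \<kappa> d (Suc j) \<delta> * \<bar>w1 - w2\<bar>"
proof -
  have *: "prof \<kappa> d j u - prof \<kappa> d j v \<le> prof \<kappa> d (Suc j) \<delta> * (v - u)" if "\<delta> \<le> u" "u \<le> v" for u v
  proof -
    have "(v - u) * prof \<kappa> d (Suc j) u \<le> (v - u) * prof \<kappa> d (Suc j) \<delta>"
      using that assms by (intro mult_left_mono prof_antimono) auto
    then show ?thesis
      using prof_convex[of \<kappa> u v d j] that assms by (simp add: mult.commute)
  qed
  show ?thesis
    using *[of w1 w2] *[of w2 w1] prof_antimono[of \<kappa> w1 w2 d j] prof_antimono[of \<kappa> w2 w1 d j] assms
    by (cases "w1 \<le> w2") (auto simp: abs_if)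
qed

text \<open>The tangent inequality from \<open>w\<close> to \<open>v\<close> and the one from
  \<open>v\<close> to \<open>w\<close> enclose the increment between \<open>- k w * (v - w)\<close>
  and \<open>- k v * (v - w)\<close>; continuity of the slope closes the gap.\<close>

lemma convex_has_real_derivative:
  fixes f k :: "real \<Rightarrow> real"
  assumes S: "open S" "w \<in> S"
    and conv: "\<And>u v. u \<in> S \<Longrightarrow> v \<in> S \<Longrightarrow> f u - (v - u) * k u \<le> f v"
    and cont: "isCont k w"
  shows "(f has_real_derivative - k w) (at w)"
  unfolding has_field_derivative_def has_derivative_at_alt
proof (intro conjI allI impI)
  fix e :: real assume e: "0 < e"
  obtain d1 where d1: "0 < d1" "\<And>v. dist v w < d1 \<Longrightarrow> \<bar>k v - k w\<bar> < e"
    using cont e unfolding continuous_at_eps_delta dist_real_def by blast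
  obtain d2 where d2: "0 < d2" "\<And>v. dist v w < d2 \<Longrightarrow> v \<in> S"
    using S unfolding open_dist by blast
  show "\<exists>d>0. \<forall>v. norm (v - w) < d \<longrightarrow> norm (f v - f w - - k w * (v - w)) \<le> e * norm (v - w)"
  proof (intro exI[of _ "min d1 d2"] conjI allI impI)
    fix v assume v: "norm (v - w) < min d1 d2"
    have 1: "0 \<le> f v - f w - - k w * (v - w)"
      using conv[of w v] S d2(2)[of v] v by (simp add: dist_real_def algebra_simps)
    have 2: "f v - f w - - k w * (v - w) \<le> (k w - k v) * (v - w)"
      using conv[of v w] S d2(2)[of v] v by (simp add: dist_real_def algebra_simps)
    have "(k w - k v) * (v - w) \<le> \<bar>k w - k v\<bar> * \<bar>v - w\<bar>"
      by (metis abs_ge_self abs_mult)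
    also have "\<dots> \<le> e * \<bar>v - w\<bar>"
      using d1(2)[of v] v by (intro mult_right_mono) (auto simp: dist_real_def abs_minus_commute less_imp_le)
    finally show "norm (f v - f w - - k w * (v - w)) \<le> e * norm (v - w)"
      using 1 2 by simp
  qed (use d1 d2 in auto)
qed (rule bounded_linear_mult_right)

lemma prof_isCont:
  assumes "0 < \<kappa>" "0 < w" shows "isCont (prof \<kappa> d j) w"
proof -
  have "(prof \<kappa> d (Suc j) (w / 2))-lipschitz_on {w / 2..} (prof \<kappa> d j)"
    by (rule lipschitz_onI)
      (use prof_lipschitz[OF assms(1), of "w / 2"] prof_pos[OF assms(1), of "w / 2" d "Suc j"] assms(2) in
        \<open>auto simp: dist_real_def\<close>)
  then have "continuous_on {w / 2..} (prof \<kappa> d j)" by (rule lipschitz_on_continuous_on)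
  then have "continuous_on {w / 2<..} (prof \<kappa> d j)" by (rule continuous_on_subset) auto
  then show ?thesis
    using assms by (simp add: continuous_on_eq_continuous_at)
qed

lemma prof_has_real_derivative:
  assumes "0 < \<kappa>" "0 < w"
  shows "(prof \<kappa> d j has_real_derivative - prof \<kappa> d (Suc j) w) (at w)"
  by (rule convex_has_real_derivative[where S="{0<..}"])
    (use assms prof_convex[OF assms(1)] prof_isCont[OF assms] in auto)

text \<open>Dimension at least two makes the exponent \<open>d / 2 - 1\<close> nonnegative, as the
  logarithmic lower bound requires. This blow-up is the barrier against collisions.\<close>

lemma prof_unbounded:
  assumes "0 < \<kappa>" "2 \<le> d"
  shows "\<exists>\<delta>>0. \<forall>w. 0 < w \<longrightarrow> w \<le> \<delta> \<longrightarrow> M \<le> prof \<kappa> d 0 w"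
proof -
  define c :: real where "c = (4 * pi) powr (- real d / 2)"
  have c: "0 < c" by (simp add: c_def)
  define K where "K = \<bar>M\<bar> / (c * exp (- \<kappa>\<^sup>2 - 1))"
  have K: "0 \<le> K" using c by (simp add: K_def)
  have "M \<le> c * (K * exp (- \<kappa>\<^sup>2 - 1))"
    using c by (simp add: K_def)
  also have "\<dots> \<le> c * mix_int \<kappa> (real d / 2 - 1) (4 * exp (- K))"
    using mix_int_lower[OF assms(1) _ K, of "real d / 2 - 1"] assms c by (intro mult_left_mono) auto
  finally have M: "M \<le> prof \<kappa> d 0 (4 * exp (- K))"
    by (simp add: prof_def c_def)
  show ?thesis
    by (intro exI[of _ "4 * exp (- K)"] conjI allI impI order_trans[OF M] prof_antimono assms) auto
qed

lemma prof_measurable [measurable]: "prof \<kappa> d j \<in> borel_measurable borel"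
  unfolding prof_def mix_int_def mix_def by measurable

section \<open>Potential and gradient in space, and their integrability\<close>

definition ypot :: "real \<Rightarrow> real^'n \<Rightarrow> real" where
  "ypot \<kappa> x = prof \<kappa> CARD('n) 0 ((norm x)\<^sup>2)"

text \<open>The factor \<open>x\<close> gives the value 0 at the origin, where
  \<open>grad (yukawa \<kappa>)\<close> is unspecified; sums over particles may therefore include
  the diagonal term.\<close>

definition ygrad :: "real \<Rightarrow> real^'n \<Rightarrow> real^'n" where
  "ygrad \<kappa> x = (- 2 * prof \<kappa> CARD('n) 1 ((norm x)\<^sup>2)) *\<^sub>R x"

lemma ypot_measurable [measurable]: "ypot \<kappa> \<in> borel_measurable borel"
  unfolding ypot_def by measurable

lemma ygrad_measurable [measurable]: "ygrad \<kappa> \<in> borel_measurable borel"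
  unfolding ygrad_def by measurable

lemma ygrad_zero [simp]: "ygrad \<kappa> 0 = 0"
  by (simp add: ygrad_def)

lemma ygrad_minus: "ygrad \<kappa> (- x) = - ygrad \<kappa> x"
  by (simp add: ygrad_def)

lemma ypot_minus: "ypot \<kappa> (- x) = ypot \<kappa> x"
  by (simp add: ypot_def)

lemma norm_ygrad: "0 < \<kappa> \<Longrightarrow> norm (ygrad \<kappa> x) = 2 * prof \<kappa> CARD('n) 1 ((norm x)\<^sup>2) * norm (x::real^'n)"
  using prof_pos[of \<kappa> "(norm x)\<^sup>2" "CARD('n)" 1] by (cases "x = 0") (auto simp: ygrad_def)

lemma yukawa_eq_ypot:
  fixes x :: "real^'n"
  assumes "0 < \<kappa>" "x \<noteq> 0"
  shows "yukawa \<kappa> x = ypot \<kappa> x"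
proof -
  define d where "d = real CARD('n)"
  have "yukawa \<kappa> x = (2 * pi) powr (- d / 2) * (2 powr (- (d / 2 - 1) - 1) * mix_int \<kappa> (d / 2 - 1) ((norm x)\<^sup>2))"
    unfolding yukawa_def Let_def d_def[symmetric]
    by (subst Bessel_K_eq_mix_int[symmetric]) (use assms in auto)
  also have "\<dots> = ((2 * pi) powr (- d / 2) * 2 powr (- d / 2)) * mix_int \<kappa> (d / 2 - 1) ((norm x)\<^sup>2)"
    by simp
  also have "(2 * pi) powr (- d / 2) * 2 powr (- d / 2) = (4 * pi) powr (- d / 2)"
    by (subst powr_mult[symmetric]) auto
  finally show ?thesis by (simp add: ypot_def prof_def d_def)
qed

lemma has_derivative_norm_square:
  "((\<lambda>x::'a::real_inner. (norm x)\<^sup>2) has_derivative (\<lambda>v. 2 * (x \<bullet> v))) (at x within S)"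
  unfolding power2_norm_eq_inner by (auto intro!: derivative_eq_intros simp: inner_commute)

lemma ypot_has_derivative:
  fixes x :: "real^'n"
  assumes "0 < \<kappa>" "x \<noteq> 0"
  shows "(ypot \<kappa> has_derivative (\<lambda>v. ygrad \<kappa> x \<bullet> v)) (at x)"
proof -
  have "(prof \<kappa> CARD('n) 0 has_derivative (*) (- prof \<kappa> CARD('n) 1 ((norm x)\<^sup>2))) (at ((norm x)\<^sup>2))"
    using prof_has_real_derivative[of \<kappa> "(norm x)\<^sup>2" "CARD('n)" 0] assms by (simp add: has_field_derivative_def)
  from has_derivative_compose[OF has_derivative_norm_square this]
  show ?thesis by (simp add: ypot_def[abs_def] ygrad_def algebra_simps)
qed

lemma yukawa_has_derivative:
  fixes x :: "real^'n"
  assumes "0 < \<kappa>" "x \<noteq> 0"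
  shows "(yukawa \<kappa> has_derivative (\<lambda>v. ygrad \<kappa> x \<bullet> v)) (at x)"
  by (rule has_derivative_transform_within_open[OF ypot_has_derivative[OF assms], of "- {0}"])
    (use assms in \<open>auto simp: yukawa_eq_ypot\<close>)

lemma grad_yukawa:
  fixes x :: "real^'n"
  assumes "0 < \<kappa>" "x \<noteq> 0"
  shows "grad (yukawa \<kappa>) x = ygrad \<kappa> x"
  unfolding grad_def
proof (rule the_equality)
  show "GDERIV (yukawa \<kappa>) x :> ygrad \<kappa> x"
    using yukawa_has_derivative[OF assms] by (simp add: gderiv_def inner_commute)
  fix D assume "GDERIV (yukawa \<kappa>) x :> D"
  then have "(yukawa \<kappa> has_derivative (\<lambda>v. v \<bullet> D)) (at x)" by (simp add: gderiv_def)
  from has_derivative_unique[OF this yukawa_has_derivative[OF assms]]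
  have "v \<bullet> D = v \<bullet> ygrad \<kappa> x" for v
    unfolding inner_commute[of v "ygrad \<kappa> x"] by (rule fun_cong)
  from this[of "D - ygrad \<kappa> x"] have "(D - ygrad \<kappa> x) \<bullet> (D - ygrad \<kappa> x) = 0"
    by (simp add: inner_diff_right)
  then show "D = ygrad \<kappa> x" by simp
qed

lemma ypot_integrable:
  assumes "0 < \<kappa>"
  shows "integrable lborel (ypot \<kappa> :: real^'n \<Rightarrow> real)"
proof (rule integrableI_bounded)
  define c :: real where "c = (4 * pi) powr (- real CARD('n) / 2)"
  have c: "0 \<le> c" by (simp add: c_def)
  let ?a = "real CARD('n) / 2 - 1"
  let ?f = "\<lambda>x::real^'n. \<lambda>s. exp (- ?a * s - \<kappa>\<^sup>2 * exp s - (norm x)\<^sup>2 / 4 * exp (- s))"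
  have "(\<integral>\<^sup>+x. ennreal (norm (ypot \<kappa> (x::real^'n))) \<partial>lborel) = (\<integral>\<^sup>+x. ennreal c * (\<integral>\<^sup>+s. ennreal (?f x s) \<partial>lborel) \<partial>lborel)"
  proof (rule nn_integral_cong_AE)
    show "AE x in lborel. ennreal (norm (ypot \<kappa> (x::real^'n))) = ennreal c * (\<integral>\<^sup>+s. ennreal (?f x s) \<partial>lborel)"
      using AE_lborel_singleton[of 0]
    proof eventually_elim
      case (elim x)
      have w: "0 < (norm x)\<^sup>2" using elim by simp
      have "ennreal (mix_int \<kappa> ?a ((norm x)\<^sup>2)) = (\<integral>\<^sup>+s. ennreal (mix \<kappa> ?a ((norm x)\<^sup>2) s) \<partial>lborel)"
        using nn_integral_eq_integral[OF mix_integrable[OF assms w, of ?a]] mix_pos[of \<kappa> ?a "(norm x)\<^sup>2"]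
        by (simp add: mix_int_def less_imp_le)
      also have "\<dots> = (\<integral>\<^sup>+s. ennreal (?f x s) \<partial>lborel)"
        unfolding mix_def ..
      finally have "(\<integral>\<^sup>+s. ennreal (?f x s) \<partial>lborel) = ennreal (mix_int \<kappa> ?a ((norm x)\<^sup>2))" ..
      moreover have "norm (ypot \<kappa> x) = c * mix_int \<kappa> ?a ((norm x)\<^sup>2)"
        using prof_pos[OF assms w, of "CARD('n)" 0] by (simp add: ypot_def prof_def c_def)
      ultimately show ?case using c by (simp add: ennreal_mult')
    qed
  qed
  also have "\<dots> = ennreal c * (\<integral>\<^sup>+x. (\<integral>\<^sup>+s. ennreal (?f x s) \<partial>lborel) \<partial>lborel)"
    by (rule nn_integral_cmult) measurable
  also have "\<dots> < \<infinity>"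
    using gaussian_mixture_finite[OF assms, of 4 ?a, where 'a="real^'n"] by (simp add: ennreal_mult_less_top)
  finally show "(\<integral>\<^sup>+x. ennreal (norm (ypot \<kappa> (x::real^'n))) \<partial>lborel) < \<infinity>" .
qed measurable

lemma le_exp_eighth_square: "y \<le> 2 * exp (y\<^sup>2 / 8)" for y :: real
proof -
  have "0 \<le> (y - 2)\<^sup>2 / 8" by simp
  then have "y / 2 \<le> 1 + y\<^sup>2 / 8" by (simp add: power2_diff field_simps)
  also have "\<dots> \<le> exp (y\<^sup>2 / 8)" by (rule exp_ge_add_one_self)
  finally show ?thesis by simp
qed

text \<open>The extra factor \<open>norm x\<close> is absorbed by half of the Gaussian, through
  \<open>y \<le> 2 * exp (y\<^sup>2 / 8)\<close> with \<open>y = norm x * exp (- s / 2)\<close>.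
  This lowers the exponent from \<open>d / 2\<close> to \<open>d / 2 - 1 / 2\<close>, below the
  critical value of the mixture bound.\<close>

lemma ygrad_integrable:
  assumes "0 < \<kappa>"
  shows "integrable lborel (ygrad \<kappa> :: real^'n \<Rightarrow> real^'n)"
proof (rule integrableI_bounded)
  define c :: real where "c = (4 * pi) powr (- real CARD('n) / 2)"
  have c: "0 \<le> c" by (simp add: c_def)
  let ?a = "real CARD('n) / 2"
  let ?f = "\<lambda>x::real^'n. \<lambda>s. exp (- (?a - 1 / 2) * s - \<kappa>\<^sup>2 * exp s - (norm x)\<^sup>2 / 8 * exp (- s))"
  have "(\<integral>\<^sup>+x. ennreal (norm (ygrad \<kappa> (x::real^'n))) \<partial>lborel) \<le> (\<integral>\<^sup>+x. ennreal c * (\<integral>\<^sup>+s. ennreal (?f x s) \<partial>lborel) \<partial>lborel)"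
  proof (rule nn_integral_mono_AE)
    show "AE x in lborel. ennreal (norm (ygrad \<kappa> (x::real^'n))) \<le> ennreal c * (\<integral>\<^sup>+s. ennreal (?f x s) \<partial>lborel)"
      using AE_lborel_singleton[of 0]
    proof eventually_elim
      case (elim x)
      have w: "0 < (norm x)\<^sup>2" using elim by simp
      have "norm (ygrad \<kappa> x) = c * (norm x / 2 * mix_int \<kappa> ?a ((norm x)\<^sup>2))"
        by (simp add: norm_ygrad[OF assms] prof_def c_def)
      then have eq: "ennreal (norm (ygrad \<kappa> x)) = ennreal c * (ennreal (norm x / 2) * ennreal (mix_int \<kappa> ?a ((norm x)\<^sup>2)))"
        by (simp only: ennreal_mult'[OF c] ennreal_mult'[of "norm x / 2", OF divide_nonneg_pos[OF norm_ge_zero zero_less_numeral]])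
      have "ennreal (mix_int \<kappa> ?a ((norm x)\<^sup>2)) = (\<integral>\<^sup>+s. ennreal (mix \<kappa> ?a ((norm x)\<^sup>2) s) \<partial>lborel)"
        using nn_integral_eq_integral[OF mix_integrable[OF assms w, of ?a]] mix_pos[of \<kappa> ?a "(norm x)\<^sup>2"]
        by (simp add: mix_int_def less_imp_le)
      then have "ennreal (norm x / 2) * ennreal (mix_int \<kappa> ?a ((norm x)\<^sup>2)) = ennreal (norm x / 2) * (\<integral>\<^sup>+s. ennreal (mix \<kappa> ?a ((norm x)\<^sup>2) s) \<partial>lborel)"
        by (simp only:)
      also have "\<dots> = (\<integral>\<^sup>+s. ennreal (norm x / 2) * ennreal (mix \<kappa> ?a ((norm x)\<^sup>2) s) \<partial>lborel)"
        by (rule nn_integral_cmult[symmetric]) (simp add: mix_def)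
      also have "\<dots> \<le> (\<integral>\<^sup>+s. ennreal (?f x s) \<partial>lborel)"
      proof (rule nn_integral_mono)
        fix s :: real
        let ?y = "norm x * exp (- s / 2)"
        have y2: "?y\<^sup>2 = (norm x)\<^sup>2 * exp (- s)"
          by (simp add: power_mult_distrib exp_of_nat_mult[symmetric])
        have "norm x / 2 = (?y / 2) * exp (s / 2)"
          by (simp add: exp_minus field_simps)
        also have "\<dots> \<le> exp (?y\<^sup>2 / 8) * exp (s / 2)"
          using le_exp_eighth_square[of ?y] by (intro mult_right_mono) auto
        finally have "norm x / 2 * mix \<kappa> ?a ((norm x)\<^sup>2) s \<le> (exp (?y\<^sup>2 / 8) * exp (s / 2)) * mix \<kappa> ?a ((norm x)\<^sup>2) s"
          by (rule mult_right_mono) (simp add: mix_def)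
        also have "\<dots> = ?f x s"
          unfolding mix_def y2 exp_add[symmetric] by (simp add: algebra_simps)
        finally show "ennreal (norm x / 2) * ennreal (mix \<kappa> ?a ((norm x)\<^sup>2) s) \<le> ennreal (?f x s)"
          by (simp add: ennreal_mult'[symmetric] ennreal_leI)
      qed
      finally show ?case unfolding eq by (rule mult_left_mono) simp
    qed
  qed
  also have "\<dots> = ennreal c * (\<integral>\<^sup>+x. (\<integral>\<^sup>+s. ennreal (?f x s) \<partial>lborel) \<partial>lborel)"
    by (rule nn_integral_cmult) measurable
  also have "\<dots> < \<infinity>"
    using gaussian_mixture_finite[OF assms, of 8 "?a - 1 / 2", where 'a="real^'n"] by (simp add: ennreal_mult_less_top)
  finally show "(\<integral>\<^sup>+x. ennreal (norm (ygrad \<kappa> (x::real^'n))) \<partial>lborel) < \<infinity>" .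
qed measurable

section \<open>The truncated kernel\<close>

definition tprof :: "real \<Rightarrow> nat \<Rightarrow> real \<Rightarrow> real \<Rightarrow> real" where
  "tprof \<kappa> d \<delta> w = (if \<delta> \<le> w then prof \<kappa> d 0 w else prof \<kappa> d 0 \<delta> + (\<delta> - w) * prof \<kappa> d 1 \<delta>)"

definition tpot :: "real \<Rightarrow> real \<Rightarrow> real^'n \<Rightarrow> real" where
  "tpot \<kappa> \<delta> x = tprof \<kappa> CARD('n) \<delta> ((norm x)\<^sup>2)"

definition tgrad :: "real \<Rightarrow> real \<Rightarrow> real^'n \<Rightarrow> real^'n" where
  "tgrad \<kappa> \<delta> x = (- 2 * prof \<kappa> CARD('n) 1 (max \<delta> ((norm x)\<^sup>2))) *\<^sub>R x"

lemma tprof_convex: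
  assumes "0 < \<kappa>" "0 < \<delta>"
  shows "tprof \<kappa> d \<delta> u - (v - u) * prof \<kappa> d 1 (max \<delta> u) \<le> tprof \<kappa> d \<delta> v"
proof -
  note conv = prof_convex[OF assms(1), of _ _ d 0, folded One_nat_def]
  consider "\<delta> \<le> u" "\<delta> \<le> v" | "u < \<delta>" "v < \<delta>" | "\<delta> \<le> u" "v < \<delta>" | "u < \<delta>" "\<delta> \<le> v" by linarith
  then show ?thesis
  proof cases
    case 1 then show ?thesis using conv[of u v] assms by (simp add: tprof_def max_def)
  next
    case 2 then show ?thesis by (simp add: tprof_def algebra_simps)
  next
    case 3
    have "0 \<le> (\<delta> - v) * (prof \<kappa> d 1 \<delta> - prof \<kappa> d 1 u)"
      using 3 prof_antimono[OF assms(1), of \<delta> u d 1] assms by simp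
    then show ?thesis using 3 conv[of u \<delta>] assms by (simp add: tprof_def max_def algebra_simps)
  next
    case 4 then show ?thesis using conv[of \<delta> v] assms by (simp add: tprof_def max_def algebra_simps)
  qed
qed

lemma tprof_has_real_derivative:
  assumes "0 < \<kappa>" "0 < \<delta>"
  shows "(tprof \<kappa> d \<delta> has_real_derivative - prof \<kappa> d 1 (max \<delta> w)) (at w)"
proof (rule convex_has_real_derivative[where S=UNIV])
  have "isCont (prof \<kappa> d 1) (max \<delta> w)"
    using assms by (intro prof_isCont) auto
  then show "isCont (\<lambda>w. prof \<kappa> d 1 (max \<delta> w)) w"
    by (intro isCont_o2[where g="prof \<kappa> d 1" and f="max \<delta>"] continuous_intros)
qed (use tprof_convex[OF assms] in auto)

lemma tpot_has_derivative:
  fixes x :: "real^'n"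
  assumes "0 < \<kappa>" "0 < \<delta>"
  shows "(tpot \<kappa> \<delta> has_derivative (\<lambda>v. tgrad \<kappa> \<delta> x \<bullet> v)) (at x)"
proof -
  have "(tprof \<kappa> CARD('n) \<delta> has_derivative (*) (- prof \<kappa> CARD('n) 1 (max \<delta> ((norm x)\<^sup>2)))) (at ((norm x)\<^sup>2))"
    using tprof_has_real_derivative[OF assms] by (simp add: has_field_derivative_def)
  from has_derivative_compose[OF has_derivative_norm_square this]
  show ?thesis by (simp add: tpot_def[abs_def] tgrad_def algebra_simps)
qed

lemma tpot_nonneg:
  assumes "0 < \<kappa>" "0 < \<delta>" shows "0 \<le> tpot \<kappa> \<delta> x"
  unfolding tpot_def tprof_def
  using assms(2) by (auto intro!: add_nonneg_nonneg mult_nonneg_nonneg less_imp_le[OF prof_pos[OF assms(1)]])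

lemma tpot_le_ypot:
  fixes x :: "real^'n"
  assumes "0 < \<kappa>" "0 < \<delta>" "x \<noteq> 0" shows "tpot \<kappa> \<delta> x \<le> ypot \<kappa> x"
  using prof_convex[OF assms(1,2), of "(norm x)\<^sup>2" "CARD('n)" 0] assms(3)
  by (simp add: tpot_def tprof_def ypot_def algebra_simps)

lemma tgrad_minus: "tgrad \<kappa> \<delta> (- x) = - tgrad \<kappa> \<delta> x"
  by (simp add: tgrad_def)

lemma norm_tgrad:
  fixes x :: "real^'n"
  assumes "0 < \<kappa>" "0 < \<delta>"
  shows "norm (tgrad \<kappa> \<delta> x) = 2 * prof \<kappa> CARD('n) 1 (max \<delta> ((norm x)\<^sup>2)) * norm x"
proof -
  have "0 < prof \<kappa> CARD('n) 1 (max \<delta> ((norm x)\<^sup>2))"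
    using assms by (intro prof_pos) auto
  then show ?thesis by (simp add: tgrad_def)
qed

lemma norm_tgrad_le:
  fixes x :: "real^'n"
  assumes "0 < \<kappa>" "0 < \<delta>" shows "norm (tgrad \<kappa> \<delta> x) \<le> norm (ygrad \<kappa> x)"
  using prof_antimono[OF assms(1), of "(norm x)\<^sup>2" "max \<delta> ((norm x)\<^sup>2)" "CARD('n)" 1]
  by (cases "x = 0") (auto simp: norm_tgrad[OF assms] norm_ygrad[OF assms(1)] intro!: mult_right_mono)

lemma tgrad_eq_ygrad: "\<delta> \<le> (norm x)\<^sup>2 \<Longrightarrow> tgrad \<kappa> \<delta> x = ygrad \<kappa> x"
  by (simp add: tgrad_def ygrad_def max_def)

lemma tpot_eq_ypot: "\<delta> \<le> (norm x)\<^sup>2 \<Longrightarrow> tpot \<kappa> \<delta> x = ypot \<kappa> x"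
  by (simp add: tpot_def tprof_def ypot_def)

lemma tpot_ge:
  fixes x :: "real^'n"
  assumes "0 < \<kappa>" "0 < \<delta>" "(norm x)\<^sup>2 \<le> \<delta>" shows "prof \<kappa> CARD('n) 0 \<delta> \<le> tpot \<kappa> \<delta> x"
  using prof_pos[OF assms(1,2), of "CARD('n)" 1] assms(3)
  by (auto simp: tpot_def tprof_def intro!: mult_nonneg_nonneg)

text \<open>With \<open>m = max \<delta> ((norm x)\<^sup>2)\<close> one has
  \<open>norm x * sqrt \<delta> \<le> m\<close>, and \<open>m\<close> times the first derivative of
  the profile is bounded by the profile at \<open>m / 2\<close>. This covers small and large
  \<open>x\<close> at once.\<close>

lemma tgrad_bounded:
  assumes "0 < \<kappa>" "0 < \<delta>"
  shows "\<exists>M\<ge>0. \<forall>x::real^'n. norm (tgrad \<kappa> \<delta> x) \<le> M"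
proof (intro exI conjI allI)
  let ?d = "CARD('n)"
  show "0 \<le> 4 * prof \<kappa> ?d 0 (\<delta> / 2) / sqrt \<delta>"
    using prof_pos[OF assms(1), of "\<delta> / 2" ?d 0] assms by simp
  fix x :: "real^'n"
  define m where "m = max \<delta> ((norm x)\<^sup>2)"
  have m: "\<delta> \<le> m" "(norm x)\<^sup>2 \<le> m" "0 < m" using assms by (auto simp: m_def)
  have pp: "0 < prof \<kappa> ?d 1 m" by (rule prof_pos[OF assms(1) m(3)])
  have "norm x * sqrt \<delta> \<le> sqrt m * sqrt m"
    by (rule mult_mono) (use m assms in \<open>auto simp: real_le_rsqrt\<close>)
  then have "norm x * sqrt \<delta> * prof \<kappa> ?d 1 m \<le> m * prof \<kappa> ?d 1 m"
    using pp m by (intro mult_right_mono) auto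
  also have "\<dots> \<le> 2 * prof \<kappa> ?d 0 (m / 2)"
    using prof_mult_le[OF assms(1) m(3), of ?d 0] by simp
  also have "\<dots> \<le> 2 * prof \<kappa> ?d 0 (\<delta> / 2)"
    using prof_antimono[OF assms(1), of "\<delta> / 2" "m / 2" ?d 0] m assms by simp
  finally show "norm (tgrad \<kappa> \<delta> x) \<le> 4 * prof \<kappa> ?d 0 (\<delta> / 2) / sqrt \<delta>"
    using assms by (simp add: norm_tgrad[OF assms] m_def[symmetric] pos_le_divide_eq mult_ac)
qed

text \<open>For \<open>norm y \<le> norm x\<close> the difference splits into
  \<open>p x * (x - y)\<close> and \<open>(p x - p y) * y\<close>. If
  \<open>norm x \<le> 2 * norm y\<close>, the second part is a second derivative of the profile
  times \<open>(norm y)\<^sup>2\<close>, which the first derivative at half the argument controls;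
  otherwise \<open>norm y \<le> norm (x - y)\<close>, and boundedness of \<open>p\<close>
  suffices.\<close>

lemma tgrad_lipschitz:
  assumes "0 < \<kappa>" "0 < \<delta>"
  shows "\<exists>L\<ge>0. \<forall>x y::real^'n. norm (tgrad \<kappa> \<delta> x - tgrad \<kappa> \<delta> y) \<le> L * norm (x - y)"
proof -
  let ?d = "CARD('n)"
  let ?A = "prof \<kappa> ?d 1 \<delta>" and ?B = "prof \<kappa> ?d 1 (\<delta> / 2)"
  have A: "0 < ?A" "0 < ?B" using prof_pos[OF assms(1)] assms by auto
  define L where "L = 2 * (?A + (?A + 6 * ?B))"
  let ?p = "\<lambda>x::real^'n. prof \<kappa> ?d 1 (max \<delta> ((norm x)\<^sup>2))"
  have ordered: "norm (tgrad \<kappa> \<delta> x - tgrad \<kappa> \<delta> y) \<le> L * norm (x - y)" if le: "norm y \<le> norm x" for x y :: "real^'n"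
  proof -
    have p0: "0 < ?p z" "?p z \<le> ?A" for z
      using prof_pos[OF assms(1), of "max \<delta> ((norm z)\<^sup>2)"] prof_antimono[OF assms, of "max \<delta> ((norm z)\<^sup>2)"] assms by auto
    have tri: "norm x - norm y \<le> norm (x - y)" by (rule norm_triangle_ineq2)
    have "(?p y - ?p x) * norm y \<le> (?A + 6 * ?B) * norm (x - y)"
    proof (cases "norm x \<le> 2 * norm y")
      case True
      let ?mx = "max \<delta> ((norm x)\<^sup>2)" and ?my = "max \<delta> ((norm y)\<^sup>2)"
      have sq: "(norm y)\<^sup>2 \<le> (norm x)\<^sup>2" using le by (intro power_mono) auto
      have "max \<delta> a - max \<delta> b \<le> a - b" if "b \<le> a" for a b
        using that by (simp add: max_def)
      from this[OF sq] have "?mx - ?my \<le> (norm x)\<^sup>2 - (norm y)\<^sup>2" .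
      also have "\<dots> = (norm x - norm y) * (norm x + norm y)" by (simp add: power2_eq_square algebra_simps)
      also have "\<dots> \<le> norm (x - y) * (3 * norm y)"
        using tri le True by (intro mult_mono) auto
      finally have mm: "?mx - ?my \<le> norm (x - y) * (3 * norm y)" .
      have my: "0 < ?my" using assms by auto
      have p2: "0 < prof \<kappa> ?d 2 ?my" by (rule prof_pos[OF assms(1) my])
      have "?p y - ?p x \<le> (?mx - ?my) * prof \<kappa> ?d 2 ?my"
        using prof_convex[OF assms(1) my less_max_iff_disj[THEN iffD2, OF disjI1, OF assms(2)], of ?d 1 "(norm x)\<^sup>2"]
        by (simp add: numeral_2_eq_2 algebra_simps)
      also have "\<dots> \<le> (norm (x - y) * (3 * norm y)) * prof \<kappa> ?d 2 ?my"
        using mm p2 by (intro mult_right_mono) auto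
      finally have "(?p y - ?p x) * norm y \<le> (norm (x - y) * (3 * norm y)) * prof \<kappa> ?d 2 ?my * norm y"
        by (rule mult_right_mono) simp
      also have "\<dots> = 3 * norm (x - y) * ((norm y)\<^sup>2 * prof \<kappa> ?d 2 ?my)"
        by (simp add: power2_eq_square)
      also have "\<dots> \<le> 3 * norm (x - y) * (?my * prof \<kappa> ?d 2 ?my)"
        using p2 by (intro mult_left_mono mult_right_mono) auto
      also have "\<dots> \<le> 3 * norm (x - y) * (2 * ?B)"
      proof (rule mult_left_mono)
        have "?my * prof \<kappa> ?d 2 ?my \<le> 2 * prof \<kappa> ?d 1 (?my / 2)"
          using prof_mult_le[OF assms(1) my, of ?d 1] by (simp add: numeral_2_eq_2)
        also have "\<dots> \<le> 2 * ?B"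
          using prof_antimono[OF assms(1), of "\<delta> / 2" "?my / 2" ?d 1] assms by simp
        finally show "?my * prof \<kappa> ?d 2 ?my \<le> 2 * ?B" .
      qed simp
      also have "\<dots> \<le> (?A + 6 * ?B) * norm (x - y)"
        using A by (simp add: algebra_simps)
      finally show ?thesis .
    next
      case False
      then have "norm y \<le> norm (x - y)" using tri by linarith
      then have "(?p y - ?p x) * norm y \<le> ?A * norm (x - y)"
        using p0[of y] p0[of x] by (intro mult_mono) auto
      also have "\<dots> \<le> (?A + 6 * ?B) * norm (x - y)"
        using A by (intro mult_right_mono) auto
      finally show ?thesis .
    qed
    moreover have "?p x \<le> ?p y"
      using assms by (intro prof_antimono max.mono power_mono[OF le norm_ge_zero]) auto
    ultimately have *: "\<bar>?p x - ?p y\<bar> * norm y \<le> (?A + 6 * ?B) * norm (x - y)"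
      by simp
    have "tgrad \<kappa> \<delta> x - tgrad \<kappa> \<delta> y = - 2 *\<^sub>R (?p x *\<^sub>R (x - y) + (?p x - ?p y) *\<^sub>R y)"
      by (simp add: tgrad_def algebra_simps)
    then have "norm (tgrad \<kappa> \<delta> x - tgrad \<kappa> \<delta> y) = 2 * norm (?p x *\<^sub>R (x - y) + (?p x - ?p y) *\<^sub>R y)"
      by simp
    also have "norm (?p x *\<^sub>R (x - y) + (?p x - ?p y) *\<^sub>R y) \<le> ?p x * norm (x - y) + \<bar>?p x - ?p y\<bar> * norm y"
      using norm_triangle_ineq[of "?p x *\<^sub>R (x - y)" "(?p x - ?p y) *\<^sub>R y"] p0(1)[of x] by simp
    also have "\<dots> \<le> ?A * norm (x - y) + (?A + 6 * ?B) * norm (x - y)"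
      by (intro add_mono mult_right_mono p0 *) simp
    finally show ?thesis by (simp add: L_def algebra_simps)
  qed
  show ?thesis
  proof (intro exI[of _ L] conjI allI)
    show "0 \<le> L" using A by (simp add: L_def)
    show "norm (tgrad \<kappa> \<delta> x - tgrad \<kappa> \<delta> y) \<le> L * norm (x - y)" for x y :: "real^'n"
      using ordered[of x y] ordered[of y x] by (cases "norm y \<le> norm x") (auto simp: norm_minus_commute)
  qed
qed

lemma tgrad_continuous_on:
  assumes "0 < \<kappa>" "0 < \<delta>" shows "continuous_on S (tgrad \<kappa> \<delta> :: real^'n \<Rightarrow> real^'n)"
proof -
  from tgrad_lipschitz[OF assms, where 'n='n]
  obtain L where "0 \<le> L" "\<forall>x y::real^'n. norm (tgrad \<kappa> \<delta> x - tgrad \<kappa> \<delta> y) \<le> L * norm (x - y)" by blast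
  then have "L-lipschitz_on UNIV (tgrad \<kappa> \<delta> :: real^'n \<Rightarrow> real^'n)"
    by (auto intro!: lipschitz_onI simp: dist_norm)
  then show ?thesis
    by (meson lipschitz_on_continuous_on continuous_on_subset subset_UNIV)
qed

lemma eventually_inverse_Suc_le:
  assumes "0 < (a::real)" shows "\<forall>\<^sub>F n in sequentially. 1 / real (Suc n) \<le> a"
proof -
  from LIMSEQ_inverse_real_of_nat have "\<forall>\<^sub>F n in sequentially. inverse (real (Suc n)) < a"
    by (rule order_tendstoD) (rule assms)
  then show ?thesis by eventually_elim (simp add: inverse_eq_divide)
qed

lemma tpot_tendsto_ypot:
  "x \<noteq> 0 \<Longrightarrow> (\<lambda>n. tpot \<kappa> (1 / real (Suc n)) x) \<longlonglongrightarrow> ypot \<kappa> x"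
  by (rule tendsto_eventually, rule eventually_mono[OF eventually_inverse_Suc_le[of "(norm x)\<^sup>2"]])
    (auto intro: tpot_eq_ypot)

lemma tgrad_tendsto_ygrad:
  "(\<lambda>n. tgrad \<kappa> (1 / real (Suc n)) x) \<longlonglongrightarrow> ygrad \<kappa> x"
proof (cases "x = 0")
  case False
  then show ?thesis
    by (intro tendsto_eventually eventually_mono[OF eventually_inverse_Suc_le[of "(norm x)\<^sup>2"]])
      (auto intro: tgrad_eq_ygrad)
qed (simp add: tgrad_def)

lemma tgrad_measurable [measurable]: "tgrad \<kappa> \<delta> \<in> borel_measurable borel"
  unfolding tgrad_def by measurable

lemma tpot_measurable [measurable]: "tpot \<kappa> \<delta> \<in> borel_measurable borel"
  unfolding tpot_def tprof_def by measurable

lemma tgrad_integrable: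
  assumes "0 < \<kappa>" "0 < \<delta>"
  shows "integrable lborel (tgrad \<kappa> \<delta> :: real^'n \<Rightarrow> real^'n)"
  by (rule Bochner_Integration.integrable_bound[OF ygrad_integrable[OF assms(1)]])
    (auto simp: norm_tgrad_le[OF assms])

text \<open>Convergence in L1 is the useful mode here: against densities bounded by \<Lambda> it
  makes the truncated velocities converge uniformly.\<close>

lemma tgrad_L1_tendsto:
  assumes "0 < \<kappa>"
  shows "(\<lambda>n. LINT x|lborel. norm (ygrad \<kappa> (x::real^'n) - tgrad \<kappa> (1 / real (Suc n)) x)) \<longlonglongrightarrow> 0"
proof -
  have "(\<lambda>n. LINT x|lborel. norm (ygrad \<kappa> (x::real^'n) - tgrad \<kappa> (1 / real (Suc n)) x)) \<longlonglongrightarrow> (LINT x|(lborel :: (real^'n) measure). (0::real))"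
  proof (rule integral_dominated_convergence[where w="\<lambda>x::real^'n. 2 * norm (ygrad \<kappa> x)"])
    show "AE x in lborel. (\<lambda>n. norm (ygrad \<kappa> (x::real^'n) - tgrad \<kappa> (1 / real (Suc n)) x)) \<longlonglongrightarrow> 0"
    proof (intro always_eventually allI)
      show "(\<lambda>n. norm (ygrad \<kappa> (x::real^'n) - tgrad \<kappa> (1 / real (Suc n)) x)) \<longlonglongrightarrow> 0" for x
        using tendsto_norm[OF tendsto_diff[OF tendsto_const[of "ygrad \<kappa> x"] tgrad_tendsto_ygrad[of \<kappa> x]]] by simp
    qed
    show "AE x in lborel. norm (norm (ygrad \<kappa> (x::real^'n) - tgrad \<kappa> (1 / real (Suc n)) x)) \<le> 2 * norm (ygrad \<kappa> x)" for n
    proof (intro always_eventually allI)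
      fix x :: "real^'n"
      have "0 < 1 / real (Suc n)" by simp
      from norm_tgrad_le[OF assms this, of x] norm_triangle_ineq4[of "ygrad \<kappa> x" "tgrad \<kappa> (1 / real (Suc n)) x"]
      show "norm (norm (ygrad \<kappa> x - tgrad \<kappa> (1 / real (Suc n)) x)) \<le> 2 * norm (ygrad \<kappa> x)" by simp
    qed
  qed (use ygrad_integrable[OF assms] in auto)
  then show ?thesis by simp
qed


section \<open>Ordinary differential equations with a Lipschitz right-hand side\<close>

lemma integral_has_vector_derivative_halfline:
  fixes g :: "real \<Rightarrow> 'a::banach"
  assumes "continuous_on {0..} g" "0 \<le> t"
  shows "((\<lambda>u. integral {0..u} g) has_vector_derivative g t) (at t within {0..})"
proof -
  have "((\<lambda>u. integral {0..u} g) has_vector_derivative g t) (at t within {0..t + 1})"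
    by (rule integral_has_vector_derivative)
      (use assms continuous_on_subset in \<open>auto intro: continuous_on_subset\<close>)
  moreover have "at t within {0..t + 1} = at t within {0..}"
    by (rule at_within_nhd[where S="{..<t + 1}"]) (use assms in auto)
  ultimately show ?thesis by simp
qed

lemma continuous_on_integral_halfline:
  fixes g :: "real \<Rightarrow> 'a::banach"
  assumes "continuous_on {0..} g"
  shows "continuous_on {0..} (\<lambda>u. integral {0..u} g)"
  by (rule continuous_on_vector_derivative, rule integral_has_vector_derivative_halfline[OF assms]) simp

lemma has_integral_exp_scaled:
  assumes "0 < (l::real)" "0 \<le> t"
  shows "((\<lambda>s. exp (l * s)) has_integral (exp (l * t) - 1) / l) {0..t}"
proof -
  have "((\<lambda>s. exp (l * s)) has_integral exp (l * t) / l - exp (l * 0) / l) {0..t}"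
    by (rule fundamental_theorem_of_calculus)
      (use assms in \<open>auto intro!: derivative_eq_intros simp: has_real_derivative_iff_has_vector_derivative[symmetric]\<close>)
  then show ?thesis by (simp add: diff_divide_distrib)
qed

text \<open>Picard's fixed point argument in the supremum norm weighted by an exponential, which makes it
  work on the whole half-line at once.\<close>

lemma ode_exists:
  fixes f :: "real \<Rightarrow> 'a::banach \<Rightarrow> 'a"
  assumes cont: "continuous_on UNIV (\<lambda>p. f (fst p) (snd p))"
    and bnd: "\<And>t x. norm (f t x) \<le> M"
    and lip: "\<And>t x y. norm (f t x - f t y) \<le> L * norm (x - y)" and L: "0 \<le> L"
  shows "\<exists>z. z 0 = x0 \<and> (\<forall>t\<ge>0. (z has_vector_derivative f t (z t)) (at t within {0..}))"
proof -
  \<comment> \<open>A weight strictly above \<open>L\<close>, positive even for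
    \<open>L = 0\<close>, so that the contraction factor \<open>L / l\<close> is below 1.\<close>
  define l where "l = L + 1"
  have l: "0 < l" "L < l" using L by (auto simp: l_def)
  have M: "0 \<le> M" using bnd[of 0 0] norm_ge_zero order_trans by blast
  \<comment> \<open>The unknown \<open>y\<close> is the rescaled displacement
    \<open>exp (- l * s) *\<^sub>R (z s - x0)\<close>, which is bounded because \<open>f\<close> is;
    the solution itself may grow linearly and would not be a bounded function.\<close>
  define g where "g y s = f s (x0 + exp (l * s) *\<^sub>R apply_bcontfun y s)" for y :: "real \<Rightarrow>\<^sub>C 'a" and s
  \<comment> \<open>Bounded continuous functions live on the whole line, so negative times are
    frozen at 0.\<close>
  define P where "P y t = exp (- l * max 0 t) *\<^sub>R integral {0..max 0 t} (g y)" for y t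
  have gcont: "continuous_on S (g y)" for y S
    unfolding g_def
    by (rule continuous_on_compose2[OF cont, of S "\<lambda>s. (s, x0 + exp (l * s) *\<^sub>R apply_bcontfun y s)", simplified])
      (intro continuous_intros continuous_on_apply_bcontfun)
  have gint: "g y integrable_on {0..t}" for y t
    by (rule integrable_continuous_real[OF gcont])
  have le_exp: "l * u \<le> exp (l * u)" for u
    using exp_ge_add_one_self[of "l * u"] by linarith
  have Pb: "P y \<in> bcontfun" for y
  proof (rule bcontfun_normI)
    show "continuous_on UNIV (P y)"
      unfolding P_def
      by (intro continuous_intros continuous_on_compose2[OF continuous_on_integral_halfline[OF gcont]]) auto
    fix t :: real
    let ?u = "max 0 t"
    have "norm (integral {0..?u} (g y)) \<le> M * (?u - 0)"
      by (rule integral_bound[OF _ gcont]) (use bnd in \<open>auto simp: g_def\<close>)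
    then have "norm (P y t) \<le> exp (- l * ?u) * (M * ?u)"
      unfolding P_def by (simp add: mult_left_mono)
    also have "\<dots> = (M / l) * (exp (- l * ?u) * (l * ?u))" using l by simp
    also have "\<dots> \<le> (M / l) * (exp (- l * ?u) * exp (l * ?u))"
      using M l by (intro mult_left_mono le_exp) auto
    also have "\<dots> = M / l" by (simp add: exp_add[symmetric])
    finally show "norm (P y t) \<le> M / l" .
  qed
  have contr: "dist (Bcontfun (P y)) (Bcontfun (P y')) \<le> (L / l) * dist y y'" for y y'
  proof (rule dist_bound)
    fix t :: real
    let ?u = "max 0 t"
    have "integral {0..?u} (g y) - integral {0..?u} (g y') = integral {0..?u} (\<lambda>s. g y s - g y' s)"
      by (rule integral_diff[symmetric]) (rule gint)+
    also have "norm \<dots> \<le> integral {0..?u} (\<lambda>s. (L * dist y y') * exp (l * s))"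
    proof (rule integral_norm_bound_integral)
      show "(\<lambda>s. g y s - g y' s) integrable_on {0..?u}" by (intro integrable_diff gint)
      show "(\<lambda>s. (L * dist y y') * exp (l * s)) integrable_on {0..?u}"
        by (intro integrable_continuous_real continuous_intros)
      fix s
      have "norm (g y s - g y' s) \<le> L * norm (exp (l * s) *\<^sub>R (apply_bcontfun y s - apply_bcontfun y' s))"
        unfolding g_def using lip[of s "x0 + exp (l * s) *\<^sub>R apply_bcontfun y s" "x0 + exp (l * s) *\<^sub>R apply_bcontfun y' s"]
        by (simp add: scaleR_diff_right)
      also have "\<dots> \<le> L * (exp (l * s) * dist y y')"
        using L dist_bounded[of y s y'] by (auto simp: dist_norm intro!: mult_left_mono)
      finally show "norm (g y s - g y' s) \<le> (L * dist y y') * exp (l * s)" by (simp add: mult_ac)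
    qed
    also have "\<dots> = (L * dist y y') * ((exp (l * ?u) - 1) / l)"
      using integral_unique[OF has_integral_exp_scaled[OF l(1), of ?u]] by simp
    finally have "exp (- l * ?u) * norm (integral {0..?u} (g y) - integral {0..?u} (g y')) \<le> exp (- l * ?u) * ((L * dist y y') * ((exp (l * ?u) - 1) / l))"
      by (rule mult_left_mono) simp
    then have "norm (P y t - P y' t) \<le> exp (- l * ?u) * ((L * dist y y') * ((exp (l * ?u) - 1) / l))"
      unfolding P_def scaleR_diff_right[symmetric] by simp
    also have "\<dots> = (L / l * dist y y') * (exp (- l * ?u) * (exp (l * ?u) - 1))" by simp
    also have "\<dots> \<le> (L / l * dist y y') * 1"
      using L l by (intro mult_left_mono) (auto simp: right_diff_distrib exp_add[symmetric])
    finally show "dist (apply_bcontfun (Bcontfun (P y)) t) (apply_bcontfun (Bcontfun (P y')) t) \<le> L / l * dist y y'"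
      by (simp add: Bcontfun_inverse[OF Pb] dist_norm)
  qed
  have "\<exists>!y. Bcontfun (P y) = y"
    by (rule banach_fix_type[where c="L / l"]) (use l L contr in auto)
  then obtain y where "Bcontfun (P y) = y" by blast
  then have y: "apply_bcontfun y = P y" by (metis Bcontfun_inverse[OF Pb])
  define z where "z t = x0 + integral {0..t} (g y)" for t
  have zt: "x0 + exp (l * t) *\<^sub>R apply_bcontfun y t = z t" if "0 \<le> t" for t
    using that by (simp add: y P_def z_def max_def exp_add[symmetric])
  have "(z has_vector_derivative f t (z t)) (at t within {0..})" if t: "0 \<le> t" for t
  proof -
    have "(z has_vector_derivative g y t) (at t within {0..})"
      unfolding z_def
      by (auto intro!: derivative_eq_intros integral_has_vector_derivative_halfline[OF gcont t])
    then show ?thesis unfolding g_def zt[OF t] .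
  qed
  moreover have "z 0 = x0" by (simp add: z_def)
  ultimately show ?thesis by blast
qed

text \<open>The integrating factor is applied to the right-hand side
  \<open>c + K * integral {0..t} w\<close>, which is differentiable although \<open>w\<close> is
  only continuous.\<close>

lemma gronwall_integral:
  fixes w :: "real \<Rightarrow> real"
  assumes w: "continuous_on {0..T} w" and K: "0 \<le> K" and t: "t \<in> {0..T}"
    and le: "\<And>t. t \<in> {0..T} \<Longrightarrow> w t \<le> c + K * integral {0..t} w"
  shows "w t \<le> c * exp (K * t)"
proof -
  let ?I = "\<lambda>t. integral {0..t} w"
  define \<phi> where "\<phi> t = exp (- K * t) * (c + K * ?I t)" for t
  have D: "(?I has_real_derivative w s) (at s within {0..T})" if "s \<in> {0..T}" for s
    using integral_has_vector_derivative[OF w that]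
    by (simp add: has_real_derivative_iff_has_vector_derivative)
  have "\<phi> t \<le> \<phi> 0"
  proof (rule DERIV_nonpos_imp_decreasing_open[where f=\<phi>])
    show "continuous_on {0..t} \<phi>"
      unfolding \<phi>_def using t
      by (intro continuous_intros continuous_on_subset[OF DERIV_continuous_on[OF D]]) auto
    fix s assume s: "0 < s" "s < t"
    have "(?I has_real_derivative w s) (at s)"
      using D[of s] s t at_within_interior[of s "{0..T}"] by (auto simp: interior_atLeastAtMost_real)
    then have "(\<phi> has_real_derivative exp (- K * s) * (K * (w s - (c + K * ?I s)))) (at s)"
      unfolding \<phi>_def by (auto intro!: derivative_eq_intros simp: algebra_simps)
    moreover have "exp (- K * s) * (K * (w s - (c + K * ?I s))) \<le> 0"
      using le[of s] s t K by (auto intro!: mult_nonneg_nonpos)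
    ultimately show "\<exists>y. (\<phi> has_real_derivative y) (at s) \<and> y \<le> 0" by blast
  qed (use t in auto)
  then have "exp (K * t) * (exp (- K * t) * (c + K * ?I t)) \<le> exp (K * t) * c"
    by (intro mult_left_mono) (auto simp: \<phi>_def)
  then have "c + K * ?I t \<le> c * exp (K * t)"
    by (simp add: mult.assoc[symmetric] exp_add[symmetric] mult.commute)
  with le[OF t] show ?thesis by linarith
qed

lemma norm_gronwall:
  fixes z :: "real \<Rightarrow> 'a::banach"
  assumes z: "\<And>s. 0 \<le> s \<Longrightarrow> (z has_vector_derivative d s) (at s within {0..})"
    and d: "\<And>s. 0 \<le> s \<Longrightarrow> s \<le> t \<Longrightarrow> norm (d s) \<le> L * norm (z s)" and L: "0 \<le> L" and t: "0 \<le> t"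
  shows "norm (z t) \<le> norm (z 0) * exp (L * t)"
proof (rule gronwall_integral[of t "\<lambda>s. norm (z s)"])
  have zc: "continuous_on {0..t} z"
    by (rule continuous_on_subset[OF continuous_on_vector_derivative[of "{0..}", OF z]]) auto
  show nc: "continuous_on {0..t} (\<lambda>s. norm (z s))"
    by (intro continuous_intros zc)
  fix u assume u: "u \<in> {0..t}"
  have I: "(d has_integral z u - z 0) {0..u}"
    by (rule fundamental_theorem_of_calculus)
      (use u in \<open>auto intro!: has_vector_derivative_within_subset[OF z]\<close>)
  have "norm (z u - z 0) = norm (integral {0..u} d)" by (simp add: integral_unique[OF I])
  also have "\<dots> \<le> integral {0..u} (\<lambda>s. L * norm (z s))"
  proof (rule integral_norm_bound_integral)
    show "d integrable_on {0..u}" using I by blast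
    show "(\<lambda>s. L * norm (z s)) integrable_on {0..u}"
      by (intro integrable_continuous_real continuous_intros continuous_on_subset[OF zc]) (use u in auto)
  qed (use u d in auto)
  also have "\<dots> = L * integral {0..u} (\<lambda>s. norm (z s))" by simp
  finally show "norm (z u) \<le> norm (z 0) + L * integral {0..u} (\<lambda>s. norm (z s))"
    using norm_triangle_ineq2[of "z u" "z 0"] by linarith
qed (use L t in auto)

lemma nonincreasing_halfline:
  fixes \<phi> :: "real \<Rightarrow> real"
  assumes D: "\<And>s. 0 \<le> s \<Longrightarrow> (\<phi> has_real_derivative \<phi>' s) (at s within {0..})"
    and le: "\<And>s. 0 \<le> s \<Longrightarrow> \<phi>' s \<le> 0" and ab: "0 \<le> a" "a \<le> b"
  shows "\<phi> b \<le> \<phi> a"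
proof (rule DERIV_nonpos_imp_decreasing_open[where f=\<phi>])
  show "continuous_on {a..b} \<phi>"
    by (rule continuous_on_subset[OF DERIV_continuous_on[of "{0..}", OF D]]) (use ab in auto)
  fix s assume s: "a < s" "s < b"
  have "(\<phi> has_real_derivative \<phi>' s) (at s)"
    using D[of s] s ab at_within_interior[of s "{0..}"] by (auto simp: interior_real_atLeast)
  then show "\<exists>y. (\<phi> has_real_derivative y) (at s) \<and> y \<le> 0" using le[of s] s ab by auto
qed (use ab in auto)

section \<open>Velocity fields of bounded densities\<close>

lemma prob_density_prob_space:
  assumes "prob_density f" shows "prob_space (density_law f)"
  using assms by (intro prob_spaceI) (simp add: prob_density_def emeasure_density)

lemma AE_density_law_neq:
  fixes f :: "real^'n \<Rightarrow> real"
  assumes "prob_density f"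
  shows "AE y in density_law f. y \<noteq> x"
  using assms AE_lborel_singleton[of x] by (subst AE_density) (auto simp: prob_density_def elim: eventually_mono)

lemma density_law_integrable:
  fixes f :: "real^'n \<Rightarrow> real" and k :: "real^'n \<Rightarrow> 'b::{banach, second_countable_topology}"
  assumes f: "prob_density f" and L: "AE x in lborel. f x \<le> L" and k: "integrable lborel k"
  shows "integrable (density_law f) (\<lambda>y. k (x - y))"
    and "(LINT y|density_law f. norm (k (x - y))) \<le> L * (LINT y|lborel. norm (k y))"
proof -
  have [measurable]: "f \<in> borel_measurable borel" using f by (simp add: prob_density_def)
  have [measurable]: "k \<in> borel_measurable borel" using borel_measurable_integrable[OF k] by simp
  have f0: "0 \<le> f x" for x using f by (simp add: prob_density_def)
  have ik: "integrable lborel (\<lambda>y. L * norm (k (x - y)))"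
    using integrable_norm[OF lborel_integrable_reflect[OF k]] by simp
  have bound: "AE y in lborel. f y * norm (k (x - y)) \<le> L * norm (k (x - y))"
    using L by eventually_elim (rule mult_right_mono, simp_all)
  have i: "integrable lborel (\<lambda>y. f y *\<^sub>R k (x - y))"
    by (rule Bochner_Integration.integrable_bound[OF ik])
      (use bound f0 in \<open>auto elim!: eventually_mono intro: order_trans[OF _ abs_ge_self]\<close>)
  then show "integrable (density_law f) (\<lambda>y. k (x - y))"
    by (subst integrable_density) (auto simp: f0)
  have "(LINT y|density_law f. norm (k (x - y))) = (LINT y|lborel. f y * norm (k (x - y)))"
    by (subst integral_density) (auto simp: f0)
  also have "\<dots> \<le> (LINT y|lborel. L * norm (k (x - y)))"
    using integrable_norm[OF i] ik bound by (intro integral_mono_AE) (auto simp: f0)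
  also have "\<dots> = L * (LINT y|lborel. norm (k y))"
    using lborel_integral_reflect[of "\<lambda>y. norm (k y)" x] by simp
  finally show "(LINT y|density_law f. norm (k (x - y))) \<le> L * (LINT y|lborel. norm (k y))" .
qed

lemma grad_yukawa_conv_eq:
  fixes f :: "real^'n \<Rightarrow> real"
  assumes \<kappa>: "0 < \<kappa>" and f: "prob_density f"
  shows "grad_yukawa_conv \<kappa> (density_law f) x = (LINT y|density_law f. ygrad \<kappa> (x - y))"
proof -
  have ae: "AE y in density_law f. ygrad \<kappa> (x - y) = grad (yukawa \<kappa>) (x - y)"
    using AE_density_law_neq[OF f, of x] by eventually_elim (simp add: grad_yukawa[OF \<kappa>])
  \<comment> \<open>The unspecified gradient at the origin changes the function at the single point
    \<open>y = x\<close>, which harms neither measurability nor the integral.\<close>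
  have eq: "(\<lambda>y. grad (yukawa \<kappa>) (x - y)) = (\<lambda>y. if y = x then grad (yukawa \<kappa>) 0 else ygrad \<kappa> (x - y))"
    by (auto simp: grad_yukawa[OF \<kappa>] fun_eq_iff)
  have "(\<lambda>y. grad (yukawa \<kappa>) (x - y)) \<in> borel_measurable borel"
    unfolding eq by measurable
  then show ?thesis
    unfolding grad_yukawa_conv_def using ae by (intro integral_cong_AE) (auto elim: eventually_mono)
qed

lemma Linf_norm_AE:
  fixes f :: "real^'n \<Rightarrow> real"
  assumes "Linf_norm f \<le> ennreal L" "0 \<le> L"
  shows "AE x in lborel. f x \<le> L"
proof -
  have "AE x in lborel. ennreal (norm (f x)) \<le> esssup lborel (\<lambda>x. ennreal (norm (f x)))"
    by (rule esssup_AE)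
  then show ?thesis
  proof eventually_elim
    case (elim x)
    then have "ennreal (norm (f x)) \<le> ennreal L" using assms(1) by (auto simp: Linf_norm_def)
    then show ?case using assms(2) by (simp add: ennreal_le_iff)
  qed
qed

section \<open>Couplings and the quadratic Wasserstein distance\<close>

lemma coupling_exists_lt:
  assumes "(W2 \<delta> \<mu> \<nu>)\<^sup>2 < c"
  shows "\<exists>\<pi>\<in>couplings \<mu> \<nu>. (\<integral>\<^sup>+ p. ennreal ((\<delta> (fst p) (snd p))\<^sup>2) \<partial>\<pi>) < c"
  using assms unfolding W2_power2 INF_less_iff .

lemma coupling_integral_fst:
  fixes \<phi> :: "'a \<Rightarrow> 'c::{banach, second_countable_topology}"
  assumes "\<pi> \<in> couplings \<mu> \<nu>" "\<phi> \<in> borel_measurable \<mu>"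
  shows "(LINT x|\<mu>. \<phi> x) = (LINT p|\<pi>. \<phi> (fst p))"
proof -
  have m: "fst \<in> measurable \<pi> \<mu>" and d: "distr \<pi> \<mu> fst = \<mu>"
    using assms(1) by (auto simp: couplings_def cong: measurable_cong_sets)
  show ?thesis using integral_distr[OF m assms(2)] d by simp
qed

lemma coupling_integral_snd:
  fixes \<phi> :: "'b \<Rightarrow> 'c::{banach, second_countable_topology}"
  assumes "\<pi> \<in> couplings \<mu> \<nu>" "\<phi> \<in> borel_measurable \<nu>"
  shows "(LINT x|\<nu>. \<phi> x) = (LINT p|\<pi>. \<phi> (snd p))"
proof -
  have m: "snd \<in> measurable \<pi> \<nu>" and d: "distr \<pi> \<nu> snd = \<nu>"
    using assms(1) by (auto simp: couplings_def cong: measurable_cong_sets)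
  show ?thesis using integral_distr[OF m assms(2)] d by simp
qed

lemma coupling_prob_space:
  assumes "\<pi> \<in> couplings \<mu> \<nu>" "prob_space \<mu>" shows "prob_space \<pi>"
proof -
  have m: "fst \<in> measurable \<pi> \<mu>" and d: "distr \<pi> \<mu> fst = \<mu>"
    using assms(1) by (auto simp: couplings_def cong: measurable_cong_sets)
  interpret prob_space \<mu> by fact
  have "emeasure \<pi> (space \<pi>) = emeasure (distr \<pi> \<mu> fst) (space \<mu>)"
    using m by (subst emeasure_distr) (auto simp: measurable_def intro!: arg_cong[where f="emeasure \<pi>"])
  then show ?thesis unfolding d emeasure_space_1 by (intro prob_spaceI)
qed

text \<open>The shape \<open>e + C * (dist x y)\<^sup>2\<close> of the modulus is adapted to the
  quadratic cost: close pairs contribute \<open>e\<close>, while for distant pairs a trivial bound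
  is charged to the transport cost.\<close>

lemma coupling_integral_diff_bound:
  fixes \<phi> \<psi> :: "'a::euclidean_space \<Rightarrow> 'b::{banach, second_countable_topology}"
  assumes \<pi>: "\<pi> \<in> couplings \<mu> \<nu>" and \<mu>: "prob_space \<mu>"
    and cost: "(\<integral>\<^sup>+ p. ennreal ((dist (fst p) (snd p))\<^sup>2) \<partial>\<pi>) \<le> ennreal c" "0 \<le> c"
    and sets: "sets \<mu> = sets borel" "sets \<nu> = sets borel"
    and m: "\<phi> \<in> borel_measurable borel" "\<psi> \<in> borel_measurable borel"
    and bnd: "\<And>x. norm (\<phi> x) \<le> M" "\<And>x. norm (\<psi> x) \<le> M"
    and close: "\<And>x y. norm (\<phi> x - \<psi> y) \<le> e + C * (dist x y)\<^sup>2" and C: "0 \<le> C"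
    and e: "0 \<le> e"
  shows "norm ((LINT x|\<mu>. \<phi> x) - (LINT x|\<nu>. \<psi> x)) \<le> e + C * c"
proof -
  interpret \<pi>: prob_space \<pi> by (rule coupling_prob_space[OF \<pi> \<mu>])
  have m': "\<phi> \<in> borel_measurable \<mu>" "\<psi> \<in> borel_measurable \<nu>"
    using m sets by (auto cong: measurable_cong_sets)
  have sp: "sets \<pi> = sets (\<mu> \<Otimes>\<^sub>M \<nu>)" using \<pi> by (simp add: couplings_def)
  have proj: "fst \<in> measurable \<pi> \<mu>" "snd \<in> measurable \<pi> \<nu>"
    by (auto simp: measurable_cong_sets[OF sp refl])
  have mp: "(\<lambda>p. \<phi> (fst p)) \<in> borel_measurable \<pi>" "(\<lambda>p. \<psi> (snd p)) \<in> borel_measurable \<pi>"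
    by (rule measurable_compose[OF proj(1) m'(1)] measurable_compose[OF proj(2) m'(2)])+
  have i: "integrable \<pi> (\<lambda>p. \<phi> (fst p))" "integrable \<pi> (\<lambda>p. \<psi> (snd p))"
    using mp bnd by (auto intro!: \<pi>.integrable_const_bound[where B=M])
  have "norm ((LINT x|\<mu>. \<phi> x) - (LINT x|\<nu>. \<psi> x)) = norm (LINT p|\<pi>. \<phi> (fst p) - \<psi> (snd p))"
    unfolding coupling_integral_fst[OF \<pi> m'(1)] coupling_integral_snd[OF \<pi> m'(2)]
    using i by simp
  also have "ennreal \<dots> \<le> (\<integral>\<^sup>+ p. ennreal (norm (\<phi> (fst p) - \<psi> (snd p))) \<partial>\<pi>)"
    using i by (intro integral_norm_bound_ennreal) auto
  also have "\<dots> \<le> (\<integral>\<^sup>+ p. ennreal e + ennreal C * ennreal ((dist (fst p) (snd p))\<^sup>2) \<partial>\<pi>)"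
    using close C e by (intro nn_integral_mono) (auto simp: ennreal_mult'[symmetric] ennreal_plus[symmetric] simp del: ennreal_plus intro!: ennreal_leI)
  also have "\<dots> \<le> ennreal e + ennreal C * ennreal c"
  proof -
    have "(\<lambda>p::'a \<times> 'a. ennreal ((dist (fst p) (snd p))\<^sup>2)) \<in> borel_measurable (borel \<Otimes>\<^sub>M borel)"
      by measurable
    moreover have "sets \<pi> = sets (borel \<Otimes>\<^sub>M borel)"
      using sp sets_pair_measure_cong[OF sets] by simp
    ultimately have "(\<lambda>p. ennreal ((dist (fst p) (snd p))\<^sup>2)) \<in> borel_measurable \<pi>"
      by (simp cong: measurable_cong_sets)
    then show ?thesis
      using cost by (simp add: nn_integral_add nn_integral_cmult \<pi>.emeasure_space_1 mult_left_mono add_left_mono)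
  qed
  also have "\<dots> = ennreal (e + C * c)"
    using e C cost by (simp add: ennreal_mult' ennreal_plus)
  finally show ?thesis
    using e C cost ennreal_le_iff[of "e + C * c"] by (simp del: ennreal_plus)
qed

lemma diagonal_coupling:
  assumes "prob_space \<mu>"
  shows "distr \<mu> (\<mu> \<Otimes>\<^sub>M \<mu>) (\<lambda>x. (x, x)) \<in> couplings \<mu> \<mu>"
  by (auto simp: couplings_def distr_distr comp_def distr_id)

lemma W2_self:
  fixes \<mu> :: "'a::euclidean_space measure"
  assumes "prob_space \<mu>" "sets \<mu> = sets borel"
  shows "W2 dist \<mu> \<mu> = 0"
proof -
  let ?\<pi> = "distr \<mu> (\<mu> \<Otimes>\<^sub>M \<mu>) (\<lambda>x. (x, x))"
  have "(\<lambda>p::'a \<times> 'a. ennreal ((dist (fst p) (snd p))\<^sup>2)) \<in> borel_measurable (borel \<Otimes>\<^sub>M borel)"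
    by measurable
  then have "(\<lambda>p. ennreal ((dist (fst p) (snd p))\<^sup>2)) \<in> borel_measurable (\<mu> \<Otimes>\<^sub>M \<mu>)"
    using sets_pair_measure_cong[OF assms(2) assms(2)] by (simp cong: measurable_cong_sets)
  then have "(\<integral>\<^sup>+ p. ennreal ((dist (fst p) (snd p))\<^sup>2) \<partial>?\<pi>) = 0"
    by (subst nn_integral_distr) simp_all
  then have "(W2 dist \<mu> \<mu>)\<^sup>2 \<le> 0"
    unfolding W2_power2 by (intro INF_lower2[OF diagonal_coupling[OF assms(1)]]) (rule eq_refl)
  then show ?thesis by simp
qed

section \<open>Regularity of the mean-field velocity\<close>

locale mean_field =
  fixes \<kappa> T \<Lambda> :: real and \<rho> :: "real \<Rightarrow> real^'n \<Rightarrow> real"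
  assumes kappa: "0 < \<kappa>" and T: "0 < T" and dim: "2 \<le> CARD('n)"
    and sol: "solution \<kappa> T \<rho>" and Lam: "Lambda_bound \<kappa> T \<rho> = ennreal \<Lambda>"
begin

text \<open>Freezing time outside \<open>{0..T}\<close> extends the velocity to all times, so that
  flows can be built on a half-line without a boundary at \<open>T\<close>.\<close>

definition clampT :: "real \<Rightarrow> real" where "clampT t = max 0 (min T t)"

abbreviation \<mu> :: "real \<Rightarrow> (real^'n) measure" where "\<mu> t \<equiv> density_law (\<rho> t)"

definition U :: "real \<Rightarrow> real^'n \<Rightarrow> real^'n" where "U t = velocity \<kappa> (\<rho> (clampT t))"

lemma clampT_in: "clampT t \<in> {0..T}"
  using T by (auto simp: clampT_def)

lemma clampT_eq: "t \<in> {0..T} \<Longrightarrow> clampT t = t"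
  by (auto simp: clampT_def)

lemma continuous_clampT: "continuous_on S clampT"
  unfolding clampT_def by (intro continuous_intros)

lemma density: "t \<in> {0..T} \<Longrightarrow> prob_density (\<rho> t)"
  using sol by (auto simp: solution_def)

lemma prob_mu: "t \<in> {0..T} \<Longrightarrow> prob_space (\<mu> t)"
  by (rule prob_density_prob_space[OF density])

lemma Lambda_ge_1: "1 \<le> \<Lambda>"
proof -
  have "1 \<le> ennreal \<Lambda>" unfolding Lam[symmetric] Lambda_bound_def by simp
  then show ?thesis by (metis ennreal_1 ennreal_le_iff2 not_one_le_zero)
qed

lemma Lambda_parts:
  assumes "t \<in> {0..T}"
  shows "1 + (Linf_norm (\<rho> t) + (Linf_norm (velocity \<kappa> (\<rho> t)) + grad_Linf_norm (velocity \<kappa> (\<rho> t)))) \<le> ennreal \<Lambda>"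
  unfolding Lam[symmetric] Lambda_bound_def W1inf_norm_def[symmetric]
  by (intro add_left_mono SUP_upper assms)

lemma Linf_le:
  assumes "t \<in> {0..T}" shows "Linf_norm (\<rho> t) \<le> ennreal \<Lambda>"
proof -
  have "a \<le> 1 + (a + X)" for a X :: ennreal
    unfolding add.left_commute[of 1 a] by (simp add: add_increasing2)
  then show ?thesis by (rule order_trans[OF _ Lambda_parts[OF assms]])
qed

lemma AE_le: "t \<in> {0..T} \<Longrightarrow> AE x in lborel. \<rho> t x \<le> \<Lambda>"
  using Linf_norm_AE[OF Linf_le] Lambda_ge_1 by auto

text \<open>Strictness comes from the summand 1 in \<open>Lambda_bound\<close>; with it the infimum
  defining the norm yields a weak gradient below \<Lambda>.\<close>

lemma grad_Linf_less:
  assumes "t \<in> {0..T}" shows "grad_Linf_norm (velocity \<kappa> (\<rho> t)) < ennreal \<Lambda>"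
proof -
  let ?a = "grad_Linf_norm (velocity \<kappa> (\<rho> t))"
  have "1 + ?a \<le> ennreal \<Lambda>"
    by (rule order_trans[OF _ Lambda_parts[OF assms]]) (intro add_left_mono, simp add: add_increasing)
  then show ?thesis
  proof (cases ?a)
    case (real r)
    then have "ennreal (1 + r) \<le> ennreal \<Lambda>"
      using \<open>1 + ?a \<le> ennreal \<Lambda>\<close> by (simp add: ennreal_plus)
    then have "1 + r \<le> \<Lambda>" using Lambda_ge_1 ennreal_le_iff[of \<Lambda> "1 + r"] by (simp del: ennreal_plus)
    then show ?thesis using real by (simp add: ennreal_less_iff)
  next
    case top
    then show ?thesis using \<open>1 + ?a \<le> ennreal \<Lambda>\<close> by (simp add: top.extremum_unique)
  qed
qed

lemma mu_integrable:
  fixes k :: "real^'n \<Rightarrow> 'b::{banach, second_countable_topology}"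
  assumes "t \<in> {0..T}" "integrable lborel k"
  shows "integrable (\<mu> t) (\<lambda>y. k (x - y))"
    and "(LINT y|\<mu> t. norm (k (x - y))) \<le> \<Lambda> * (LINT y|lborel. norm (k y))"
  by (rule density_law_integrable[OF density[OF assms(1)] AE_le[OF assms(1)] assms(2)])+

lemma U_eq: "U t x = - (LINT y|\<mu> (clampT t). ygrad \<kappa> (x - y))"
  unfolding U_def velocity_def grad_yukawa_conv_eq[OF kappa density[OF clampT_in]] ..

definition Umax :: real where "Umax = \<Lambda> * (LINT y|lborel. norm (ygrad \<kappa> (y::real^'n)))"

lemma U_bounded: "norm (U t x) \<le> Umax"
proof -
  have "norm (U t x) \<le> (LINT y|\<mu> (clampT t). norm (ygrad \<kappa> (x - y)))"
    unfolding U_eq norm_minus_cancel by (rule integral_norm_bound)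
  then show ?thesis
    using mu_integrable(2)[OF clampT_in ygrad_integrable[OF kappa], of t x] by (simp add: Umax_def)
qed

lemma Umax_nonneg: "0 \<le> Umax"
  using U_bounded[of 0 0] norm_ge_zero order_trans by blast

text \<open>Law and integrand vary together. Pairs closer than \<open>r\<close> are handled by the
  local modulus of the integrand; for the others the trivial bound \<open>2 * M\<close> is at most
  \<open>(2 * M / r\<^sup>2) * (dist x y)\<^sup>2\<close> and is paid for by the transport cost
  between the two laws, which is small by continuity in \<open>W2\<close>.\<close>

lemma param_integral_continuous:
  fixes \<Phi> :: "'p::metric_space \<Rightarrow> real^'n \<Rightarrow> 'b::{banach, second_countable_topology}"
  assumes \<tau>: "continuous_on UNIV \<tau>" "\<And>p. \<tau> p \<in> {0..T}"
    and bnd: "\<And>p y. norm (\<Phi> p y) \<le> M"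
    and meas: "\<And>p. \<Phi> p \<in> borel_measurable borel"
    and uc: "\<And>p e. 0 < e \<Longrightarrow> \<exists>r>0. \<forall>q x y. dist q p < r \<longrightarrow> dist x y < r \<longrightarrow> norm (\<Phi> q x - \<Phi> p y) \<le> e"
  shows "continuous_on UNIV (\<lambda>p. LINT y|\<mu> (\<tau> p). \<Phi> p y)"
  unfolding continuous_on_iff
proof (intro ballI allI impI)
  fix p :: 'p and e :: real assume e: "0 < e"
  obtain r where r: "0 < r" "\<And>q x y. dist q p < r \<Longrightarrow> dist x y < r \<Longrightarrow> norm (\<Phi> q x - \<Phi> p y) \<le> e / 3"
    using uc[of "e / 3" p] e by auto
  have M: "0 \<le> M" using bnd[of p 0] norm_ge_zero order_trans by blast
  define C where "C = 2 * M / r\<^sup>2"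
  have C: "0 \<le> C" using M by (simp add: C_def)
  \<comment> \<open>Capped at 1, so that the square of a distance below \<open>c\<close> is below
    \<open>c\<close> too.\<close>
  define c where "c = min 1 (e / (3 * (C + 1)))"
  have c: "0 < c" "c \<le> 1" "C * c \<le> e / 3"
  proof -
    show "0 < c" "c \<le> 1" using e C by (auto simp: c_def)
    have "C * c \<le> (C + 1) * (e / (3 * (C + 1)))"
      using C e by (intro mult_mono) (auto simp: c_def)
    also have "\<dots> = e / 3" using C by (simp add: field_simps)
    finally show "C * c \<le> e / 3" .
  qed
  have lim: "((\<lambda>t. W2 dist (\<mu> t) (\<mu> (\<tau> p))) \<longlongrightarrow> 0) (at (\<tau> p) within {0..T})"
    using sol \<tau>(2)[of p] by (auto simp: solution_def)
  have "eventually (\<lambda>t. W2 dist (\<mu> t) (\<mu> (\<tau> p)) < ennreal c) (at (\<tau> p) within {0..T})"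
    using order_tendstoD(2)[OF lim, of "ennreal c"] c by simp
  then obtain s where s: "0 < s"
    "\<And>t. t \<in> {0..T} \<Longrightarrow> t \<noteq> \<tau> p \<Longrightarrow> dist t (\<tau> p) < s \<Longrightarrow> W2 dist (\<mu> t) (\<mu> (\<tau> p)) < ennreal c"
    unfolding eventually_at by blast
  have W: "W2 dist (\<mu> t) (\<mu> (\<tau> p)) < ennreal c" if "t \<in> {0..T}" "dist t (\<tau> p) < s" for t
  proof (cases "t = \<tau> p")
    case True then show ?thesis using W2_self[OF prob_mu[OF that(1)]] c by simp
  qed (use s that in auto)
  obtain r' where r': "0 < r'" "\<And>q. dist q p < r' \<Longrightarrow> dist (\<tau> q) (\<tau> p) < s"
    using \<tau>(1) s(1) unfolding continuous_on_iff by (metis UNIV_I)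
  show "\<exists>d>0. \<forall>q\<in>UNIV. dist q p < d \<longrightarrow> dist (LINT y|\<mu> (\<tau> q). \<Phi> q y) (LINT y|\<mu> (\<tau> p). \<Phi> p y) < e"
  proof (intro exI[of _ "min r r'"] conjI ballI impI)
    fix q assume q: "dist q p < min r r'"
    have W1: "W2 dist (\<mu> (\<tau> q)) (\<mu> (\<tau> p)) < ennreal c" using W[OF \<tau>(2)] r' q by simp
    have "W2 dist (\<mu> (\<tau> q)) (\<mu> (\<tau> p)) \<le> 1"
      by (rule order_trans[OF less_imp_le[OF W1]]) (use c in simp)
    then have "(W2 dist (\<mu> (\<tau> q)) (\<mu> (\<tau> p)))\<^sup>2 \<le> 1 * W2 dist (\<mu> (\<tau> q)) (\<mu> (\<tau> p))"
      unfolding power2_eq_square by (rule mult_right_mono) simp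
    then have "(W2 dist (\<mu> (\<tau> q)) (\<mu> (\<tau> p)))\<^sup>2 < ennreal c"
      using W1 by simp
    from coupling_exists_lt[OF this] obtain \<pi> where \<pi>: "\<pi> \<in> couplings (\<mu> (\<tau> q)) (\<mu> (\<tau> p))"
      "(\<integral>\<^sup>+ p. ennreal ((dist (fst p) (snd p))\<^sup>2) \<partial>\<pi>) < ennreal c" by blast
    have "norm ((LINT y|\<mu> (\<tau> q). \<Phi> q y) - (LINT y|\<mu> (\<tau> p). \<Phi> p y)) \<le> e / 3 + C * c"
    proof (rule coupling_integral_diff_bound[OF \<pi>(1) prob_mu[OF \<tau>(2)] less_imp_le[OF \<pi>(2)], where M=M])
      fix x y :: "real^'n"
      show "norm (\<Phi> q x - \<Phi> p y) \<le> e / 3 + C * (dist x y)\<^sup>2"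
      proof (cases "dist x y < r")
        case True
        then show ?thesis using r(2)[of q x y] q C by (simp add: add_increasing2)
      next
        case False
        have "norm (\<Phi> q x - \<Phi> p y) \<le> 2 * M * 1"
          using norm_triangle_ineq4[of "\<Phi> q x" "\<Phi> p y"] bnd[of q x] bnd[of p y] by simp
        also have "\<dots> \<le> 2 * M * ((dist x y)\<^sup>2 / r\<^sup>2)"
          using M False r(1) by (intro mult_left_mono) (auto simp: power_mono)
        finally show ?thesis using e by (simp add: C_def)
      qed
    qed (use c C e meas bnd in auto)
    then show "dist (LINT y|\<mu> (\<tau> q). \<Phi> q y) (LINT y|\<mu> (\<tau> p). \<Phi> p y) < e"
      using c e by (simp add: dist_norm)
  qed (use r r' in auto)
qed

text \<open>A truncated kernel is bounded and Lipschitz, so its averages are jointly continuous.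
  They converge to the velocity uniformly in time and space, the error being at most \<Lambda> times
  the L1 distance of the kernels.\<close>

lemma U_continuous: "continuous_on UNIV (\<lambda>p. U (fst p) (snd p))"
proof -
  let ?u = "\<lambda>n p. - (LINT y|\<mu> (clampT (fst p)). tgrad \<kappa> (1 / real (Suc n)) (snd p - y))"
  have cont: "continuous_on UNIV (?u n)" for n
  proof -
    let ?k = "tgrad \<kappa> (1 / real (Suc n)) :: real^'n \<Rightarrow> real^'n"
    have d: "0 < 1 / real (Suc n)" by simp
    from tgrad_bounded[OF kappa d, where 'n='n] obtain M where M: "\<And>x. norm (?k x) \<le> M" by blast
    from tgrad_lipschitz[OF kappa d, where 'n='n] obtain L where
      L: "0 \<le> L" "\<And>x y. norm (?k x - ?k y) \<le> L * norm (x - y)" by blast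
    show ?thesis
  proof (rule continuous_on_minus, rule param_integral_continuous[where \<tau>="\<lambda>p. clampT (fst p)"
        and \<Phi>="\<lambda>p y. tgrad \<kappa> (1 / real (Suc n)) (snd p - y)"])
    show "continuous_on UNIV (\<lambda>p::real \<times> (real^'n). clampT (fst p))"
      by (rule continuous_on_compose2[OF continuous_clampT[of UNIV]]) (simp_all add: continuous_on_fst)
    show "norm (?k (snd p - y)) \<le> M" for p :: "real \<times> (real^'n)" and y by (rule M)
    fix p :: "real \<times> (real^'n)" and e :: real assume e: "0 < e"
    define r where "r = e / (2 * (L + 1))"
    have "norm (?k (snd q - x) - ?k (snd p - y)) \<le> e" if "dist q p < r" "dist x y < r" for q x y
    proof -
      have "norm (snd q - snd p) < r"
        using that(1) dist_snd_le[of q p] by (simp add: dist_norm)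
      then have "norm ((snd q - x) - (snd p - y)) \<le> r + r"
        using norm_triangle_ineq4[of "snd q - snd p" "x - y"] that(2) by (simp add: dist_norm algebra_simps)
      then have "L * norm ((snd q - x) - (snd p - y)) \<le> (L + 1) * (r + r)"
        using L(1) by (intro mult_mono) auto
      also have "\<dots> = (2 * (L + 1)) * r" by (simp add: algebra_simps)
      also have "\<dots> = e" using L(1) by (simp add: r_def)
      finally show ?thesis using L(2) order_trans by blast
    qed
    moreover have "0 < r" using e L by (simp add: r_def)
    ultimately show "\<exists>r>0. \<forall>q x y. dist q p < r \<longrightarrow> dist x y < r \<longrightarrow> norm (?k (snd q - x) - ?k (snd p - y)) \<le> e"
      by blast
  qed (use clampT_in in auto)
  qed
  have "uniform_limit UNIV ?u (\<lambda>p. U (fst p) (snd p)) sequentially"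
  proof (rule uniform_limitI)
    fix e :: real assume e: "0 < e"
    let ?I = "\<lambda>n. LINT x|lborel. norm (ygrad \<kappa> (x::real^'n) - tgrad \<kappa> (1 / real (Suc n)) x)"
    have "(\<lambda>n. \<Lambda> * ?I n) \<longlonglongrightarrow> \<Lambda> * 0"
      by (intro tendsto_intros tgrad_L1_tendsto[OF kappa])
    then have "\<forall>\<^sub>F n in sequentially. \<Lambda> * ?I n < e"
      using e by (intro order_tendstoD(2)) auto
    then show "\<forall>\<^sub>F n in sequentially. \<forall>p\<in>UNIV. dist (?u n p) (U (fst p) (snd p)) < e"
    proof eventually_elim
      case (elim n)
      have d: "0 < 1 / real (Suc n)" by simp
      show ?case
      proof
        fix p :: "real \<times> (real^'n)"
        let ?t = "clampT (fst p)" and ?x = "snd p"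
        note iy = ygrad_integrable[OF kappa, where 'n='n] and it = tgrad_integrable[OF kappa d, where 'n='n]
        have "?u n p - U (fst p) ?x = (LINT y|\<mu> ?t. ygrad \<kappa> (?x - y) - tgrad \<kappa> (1 / real (Suc n)) (?x - y))"
          unfolding U_eq using mu_integrable(1)[OF clampT_in iy] mu_integrable(1)[OF clampT_in it] by simp
        also have "norm \<dots> \<le> (LINT y|\<mu> ?t. norm (ygrad \<kappa> (?x - y) - tgrad \<kappa> (1 / real (Suc n)) (?x - y)))"
          by (rule integral_norm_bound)
        also have "\<dots> \<le> \<Lambda> * ?I n"
          using mu_integrable(2)[OF clampT_in Bochner_Integration.integrable_diff[OF iy it]] .
        finally show "dist (?u n p) (U (fst p) ?x) < e" using elim by (simp add: dist_norm)
      qed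
    qed
  qed
  then show ?thesis
    by (rule uniform_limit_theorem[rotated]) (use cont in auto)
qed

lemma U_continuous_compose:
  assumes "continuous_on S f" "continuous_on S g"
  shows "continuous_on S (\<lambda>s. U (f s) (g s))"
  using continuous_on_compose2[OF U_continuous continuous_on_Pair[OF assms]] by simp

lemma U_measurable [measurable]:
  assumes [measurable]: "f \<in> borel_measurable M" "g \<in> borel_measurable M"
  shows "(\<lambda>s. U (f s) (g s)) \<in> borel_measurable M"
proof -
  have "(\<lambda>s. (f s, g s)) \<in> borel_measurable M"
    by (rule borel_measurable_Pair) fact+
  from measurable_compose[OF this borel_measurable_continuous_onI[OF U_continuous]] show ?thesis
    by simp
qed

lemma U_lipschitz: "norm (U t x - U t y) \<le> \<Lambda> * norm (x - y)"
proof -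
  have "continuous_on UNIV (U t)"
    by (rule U_continuous_compose) (auto intro: continuous_intros)
  then have "\<Lambda>-lipschitz_on UNIV (U t)"
    using grad_Linf_less[OF clampT_in] U_bounded by (intro grad_Linf_norm_lipschitz) (auto simp: U_def)
  then show ?thesis by (auto dest!: lipschitz_onD simp: dist_norm)
qed

end

section \<open>Auxiliary facts on test functions in space-time\<close>

lemma smooth_fst: "smooth (\<lambda>p::real \<times> 'a::real_normed_vector. fst p)"
proof -
  have "ndiff n (\<lambda>p::real \<times> 'a. fst p)" for n
  proof (cases n)
    case (Suc m)
    show ?thesis unfolding Suc
      by (rule ndiff_SucI[where f'="\<lambda>_ v. fst v"]) (auto intro!: derivative_eq_intros ndiff_const)
  qed simp
  then show ?thesis by (simp add: smooth_iff_ndiff)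
qed

lemma smooth_compose_fst:
  fixes h :: "real \<Rightarrow> real"
  assumes "smooth h" shows "smooth (\<lambda>p::real \<times> 'a::real_normed_vector. h (fst p))"
  using assms smooth_fst[where 'a='a] ndiff_compose[of _ h "\<lambda>p::real \<times> 'a. fst p"] by (simp add: smooth_iff_ndiff)

lemma continuous_bounded_support_uniform:
  fixes f :: "'a::euclidean_space \<Rightarrow> real"
  assumes cont: "continuous_on UNIV f" and supp: "\<And>x. f x \<noteq> 0 \<Longrightarrow> norm x \<le> R" and e: "0 < e"
  shows "\<exists>r>0. \<forall>x y. dist x y < r \<longrightarrow> \<bar>f x - f y\<bar> \<le> e"
proof -
  have "uniformly_continuous_on (cball 0 (R + 1)) f"
    by (rule compact_uniformly_continuous[OF continuous_on_subset[OF cont]]) auto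
  then obtain d where d: "0 < d"
    "\<And>x y. x \<in> cball 0 (R + 1) \<Longrightarrow> y \<in> cball 0 (R + 1) \<Longrightarrow> dist y x < d \<Longrightarrow> dist (f y) (f x) < e"
    unfolding uniformly_continuous_on_def using e by meson
  show ?thesis
  proof (intro exI[of _ "min d 1"] conjI allI impI)
    fix x y :: 'a assume xy: "dist x y < min d 1"
    have n: "norm x \<le> norm y + dist x y" "norm y \<le> norm x + dist x y"
      using norm_triangle_ineq2[of x y] norm_triangle_ineq2[of y x] by (auto simp: dist_norm norm_minus_commute)
    show "\<bar>f x - f y\<bar> \<le> e"
    proof (cases "norm x \<le> R \<or> norm y \<le> R")
      case True
      then have "x \<in> cball 0 (R + 1)" "y \<in> cball 0 (R + 1)" using n xy by auto
      from d(2)[OF this(2,1)] xy show ?thesis by (simp add: dist_real_def)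
    next
      case False
      then have "f x = 0" "f y = 0" using supp by blast+
      then show ?thesis using e by simp
    qed
  qed (use d in auto)
qed

lemma frechet_derivative_continuous:
  fixes \<phi> :: "'a::euclidean_space \<Rightarrow> real"
  assumes \<phi>: "smooth \<phi>" and v: "continuous_on S v"
  shows "continuous_on S (\<lambda>p. frechet_derivative \<phi> (at p) (v p))"
proof -
  have "frechet_derivative \<phi> (at p) (v p) = (\<Sum>b\<in>Basis. (v p \<bullet> b) * frechet_derivative \<phi> (at p) b)" for p
  proof -
    have l: "linear (frechet_derivative \<phi> (at p))"
      by (rule has_derivative_linear[OF smooth_has_derivative[OF \<phi>]])
    have "frechet_derivative \<phi> (at p) (v p) = frechet_derivative \<phi> (at p) (\<Sum>b\<in>Basis. (v p \<bullet> b) *\<^sub>R b)"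
      by (rule arg_cong[OF euclidean_representation[symmetric]])
    also have "\<dots> = (\<Sum>b\<in>Basis. (v p \<bullet> b) * frechet_derivative \<phi> (at p) b)"
      by (simp only: linear_sum[OF l] linear_scale[OF l] real_scaleR_def)
    finally show ?thesis .
  qed
  then show ?thesis
    by (simp only:) (intro continuous_intros v smooth_continuous_on smooth_frechet_derivative \<phi>)
qed

lemma vector_derivative_lipschitz:
  fixes z :: "real \<Rightarrow> 'a::real_normed_vector"
  assumes z: "\<And>s. 0 \<le> s \<Longrightarrow> (z has_vector_derivative d s) (at s within {0..})"
    and le: "\<And>s. 0 \<le> s \<Longrightarrow> s \<le> b \<Longrightarrow> norm (d s) \<le> C" and st: "0 \<le> s" "0 \<le> t" "s \<le> b" "t \<le> b"
  shows "norm (z s - z t) \<le> C * \<bar>s - t\<bar>"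
proof -
  have "norm (z s - z t) \<le> C * norm (s - t)"
  proof (rule differentiable_bound[where S="{0..b}" and f'="\<lambda>s h. h *\<^sub>R d s"])
    show "(z has_derivative (\<lambda>h. h *\<^sub>R d r)) (at r within {0..b})" if "r \<in> {0..b}" for r
      using has_derivative_subset[OF z[of r, unfolded has_vector_derivative_def]] that by auto
    show "onorm (\<lambda>h. h *\<^sub>R d r) \<le> C" if "r \<in> {0..b}" for r
    proof (rule onorm_le)
      show "norm (h *\<^sub>R d r) \<le> C * norm h" for h
        using mult_right_mono[OF le[of r], of "\<bar>h\<bar>"] that by (simp add: mult.commute)
    qed
  qed (use st in auto)
  then show ?thesis by simp
qed

context mean_field
begin

section \<open>The characteristic flow and uniqueness for the continuity equation\<close>

text \<open>The last argument is the elapsed time, not the final time, so every characteristic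
  starts at 0 on the half-line whatever its initial time \<open>s\<close>.\<close>

definition psi :: "real \<Rightarrow> real^'n \<Rightarrow> real \<Rightarrow> real^'n" where
  "psi s x = (SOME z. z 0 = x \<and> (\<forall>\<tau>\<ge>0. (z has_vector_derivative U (s + \<tau>) (z \<tau>)) (at \<tau> within {0..})))"

lemma Lambda_nonneg: "0 \<le> \<Lambda>"
  using Lambda_ge_1 by simp

lemma psi_solution: "psi s x 0 = x \<and> (\<forall>\<tau>\<ge>0. (psi s x has_vector_derivative U (s + \<tau>) (psi s x \<tau>)) (at \<tau> within {0..}))"
proof -
  have "\<exists>z. z 0 = x \<and> (\<forall>\<tau>\<ge>0. (z has_vector_derivative U (s + \<tau>) (z \<tau>)) (at \<tau> within {0..}))"
  proof (rule ode_exists)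
    show "continuous_on UNIV (\<lambda>p. U (s + fst p) (snd p))"
      by (intro U_continuous_compose continuous_intros)
  qed (rule U_bounded U_lipschitz Lambda_nonneg)+
  then show ?thesis unfolding psi_def by (rule someI_ex)
qed

lemma psi_0 [simp]: "psi s x 0 = x"
  using psi_solution by blast

lemma psi_deriv: "0 \<le> \<tau> \<Longrightarrow> (psi s x has_vector_derivative U (s + \<tau>) (psi s x \<tau>)) (at \<tau> within {0..})"
  using psi_solution by blast

lemma psi_stable:
  assumes z: "\<And>\<tau>. 0 \<le> \<tau> \<Longrightarrow> (z has_vector_derivative U (s + \<tau>) (z \<tau>)) (at \<tau> within {0..})" and \<tau>: "0 \<le> \<tau>"
  shows "norm (psi s x \<tau> - z \<tau>) \<le> norm (x - z 0) * exp (\<Lambda> * \<tau>)"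
  using norm_gronwall[where z="\<lambda>\<tau>. psi s x \<tau> - z \<tau>" and d="\<lambda>\<tau>. U (s + \<tau>) (psi s x \<tau>) - U (s + \<tau>) (z \<tau>)" and L=\<Lambda> and t=\<tau>,
      OF has_vector_derivative_diff[OF psi_deriv z] U_lipschitz Lambda_nonneg \<tau>]
  by simp

lemma psi_unique:
  assumes "\<And>\<tau>. 0 \<le> \<tau> \<Longrightarrow> (z has_vector_derivative U (s + \<tau>) (z \<tau>)) (at \<tau> within {0..})" and "0 \<le> \<tau>"
  shows "z \<tau> = psi s (z 0) \<tau>"
  using psi_stable[of z s, OF assms, of "z 0"] by simp

lemma psi_lipschitz: "0 \<le> \<tau> \<Longrightarrow> norm (psi s x \<tau> - psi s y \<tau>) \<le> norm (x - y) * exp (\<Lambda> * \<tau>)"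
  using psi_stable[of "psi s y" s, OF psi_deriv, of \<tau> x] by simp

text \<open>The distance of two characteristics shrinks at rate at most \<Lambda>, so
  \<open>exp (2 * \<Lambda> * r)\<close> times its square is nondecreasing. This yields injectivity
  of the flow without constructing a backward flow.\<close>

lemma psi_separation:
  assumes "0 \<le> \<tau>"
  shows "norm (x - y) \<le> exp (\<Lambda> * \<tau>) * norm (psi s x \<tau> - psi s y \<tau>)"
proof -
  let ?z = "\<lambda>r. psi s x r - psi s y r" and ?d = "\<lambda>r. U (s + r) (psi s x r) - U (s + r) (psi s y r)"
  define \<phi> where "\<phi> r = - (exp (2 * \<Lambda> * r) * (?z r \<bullet> ?z r))" for r
  have "\<phi> \<tau> \<le> \<phi> 0"
  proof (rule nonincreasing_halfline[where \<phi>=\<phi>])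
    fix r :: real assume r: "0 \<le> r"
    have D: "(?z has_derivative (\<lambda>h. h *\<^sub>R ?d r)) (at r within {0..})"
      using has_vector_derivative_diff[OF psi_deriv[OF r] psi_deriv[OF r]] by (simp add: has_vector_derivative_def)
    have "((\<lambda>r. ?z r \<bullet> ?z r) has_derivative (\<lambda>h. ?z r \<bullet> (h *\<^sub>R ?d r) + (h *\<^sub>R ?d r) \<bullet> ?z r)) (at r within {0..})"
      by (rule has_derivative_inner[OF D D])
    then have Dq: "((\<lambda>r. ?z r \<bullet> ?z r) has_real_derivative 2 * (?z r \<bullet> ?d r)) (at r within {0..})"
      unfolding has_field_derivative_def
      by (rule has_derivative_eq_rhs)
        (simp only: inner_scaleR_left inner_scaleR_right inner_commute[of "?d r" "?z r"], simp add: fun_eq_iff mult.commute)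
    have De: "((\<lambda>r. exp (2 * \<Lambda> * r)) has_real_derivative exp (2 * \<Lambda> * r) * (2 * \<Lambda>)) (at r within {0..})"
      by (auto intro!: derivative_eq_intros)
    from DERIV_minus[OF DERIV_mult[OF De Dq]]
    show "(\<phi> has_real_derivative - (exp (2 * \<Lambda> * r) * (2 * \<Lambda> * (?z r \<bullet> ?z r) + 2 * (?z r \<bullet> ?d r)))) (at r within {0..})"
      unfolding \<phi>_def by (rule DERIV_cong) algebra
    have "- (?z r \<bullet> ?d r) \<le> norm (?z r) * norm (?d r)"
      using Cauchy_Schwarz_ineq2[of "?z r" "?d r"] by linarith
    also have "\<dots> \<le> norm (?z r) * (\<Lambda> * norm (?z r))"
      by (intro mult_left_mono U_lipschitz) simp
    also have "\<dots> = \<Lambda> * (?z r \<bullet> ?z r)" by (simp add: power2_norm_eq_inner[symmetric] power2_eq_square)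
    finally have "0 \<le> 2 * \<Lambda> * (?z r \<bullet> ?z r) + 2 * (?z r \<bullet> ?d r)" by simp
    then show "- (exp (2 * \<Lambda> * r) * (2 * \<Lambda> * (?z r \<bullet> ?z r) + 2 * (?z r \<bullet> ?d r))) \<le> 0"
      by (simp only: neg_le_0_iff_le) (rule mult_nonneg_nonneg, simp_all)
  qed (use assms in auto)
  then have "(norm (x - y))\<^sup>2 \<le> (exp (\<Lambda> * \<tau>) * norm (?z \<tau>))\<^sup>2"
    by (simp add: \<phi>_def power_mult_distrib power2_norm_eq_inner exp_of_nat_mult[symmetric] algebra_simps)
  then show ?thesis
    by (rule power2_le_imp_le) simp
qed

lemma psi_time_lipschitz:
  assumes "0 \<le> \<sigma>" "0 \<le> \<tau>"
  shows "norm (psi s x \<sigma> - psi s x \<tau>) \<le> Umax * \<bar>\<sigma> - \<tau>\<bar>"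
  by (rule vector_derivative_lipschitz[OF psi_deriv U_bounded, where b="max \<sigma> \<tau>"]) (use assms in auto)

lemma psi_semigroup:
  assumes "0 \<le> h" "0 \<le> \<tau>"
  shows "psi s x (h + \<tau>) = psi (s + h) (psi s x h) \<tau>"
proof -
  let ?z = "\<lambda>\<tau>. psi s x (h + \<tau>)"
  have "(?z has_vector_derivative U (s + h + r) (?z r)) (at r within {0..})" if "0 \<le> r" for r
  proof -
    have "(psi s x has_vector_derivative U (s + (h + r)) (psi s x (h + r))) (at (h + r) within (\<lambda>r. h + r) ` {0..})"
      by (rule has_vector_derivative_within_subset[OF psi_deriv]) (use assms that in auto)
    moreover have "((\<lambda>r. h + r) has_vector_derivative 1) (at r within {0..})"
      by (auto intro!: derivative_eq_intros)
    ultimately have "(psi s x \<circ> (\<lambda>r. h + r) has_vector_derivative 1 *\<^sub>R U (s + (h + r)) (psi s x (h + r))) (at r within {0..})"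
      by (rule vector_diff_chain_within[rotated])
    then show ?thesis by (simp add: comp_def add.assoc)
  qed
  from psi_unique[of ?z "s + h", OF this assms(2)] show ?thesis by simp
qed

text \<open>The observable \<open>\<phi>\<close> transported back along characteristics from time \<open>t\<^sub>1\<close>.\<close>

definition pullback :: "(real^'n \<Rightarrow> real) \<Rightarrow> real \<Rightarrow> real \<times> (real^'n) \<Rightarrow> real" where
  "pullback \<phi> t1 p = (let c = max 0 (min t1 (fst p)) in \<phi> (psi c (snd p) (t1 - c)))"

end

text \<open>Fixes an observable and a final time. Bounded Lipschitz observables of bounded support
  determine a probability measure, and this class is stable under transport by a flow that is merely
  Lipschitz.\<close>

locale transported = mean_field \<kappa> T \<Lambda> \<rho>
  for \<kappa> T \<Lambda> :: real and \<rho> :: "real \<Rightarrow> real^'n \<Rightarrow> real" +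
  fixes \<phi> :: "real^'n \<Rightarrow> real" and L M R t1 :: real
  assumes phi_lip: "\<And>x y. \<bar>\<phi> x - \<phi> y\<bar> \<le> L * norm (x - y)" and L0: "0 \<le> L"
    and phi_bnd: "\<And>x. \<bar>\<phi> x\<bar> \<le> M" and phi_supp: "\<And>x. \<phi> x \<noteq> 0 \<Longrightarrow> norm x \<le> R"
    and t1: "0 < t1" "t1 \<le> T"
begin

lemma pullback_bounded: "\<bar>pullback \<phi> t1 p\<bar> \<le> M"
  by (simp add: pullback_def Let_def phi_bnd)

lemma pullback_support:
  assumes "pullback \<phi> t1 p \<noteq> 0" shows "norm (snd p) \<le> R + Umax * T"
proof -
  let ?c = "max 0 (min t1 (fst p))"
  have c: "0 \<le> t1 - ?c" "t1 - ?c \<le> T" using t1 by auto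
  have "norm (psi ?c (snd p) (t1 - ?c)) \<le> R"
    using assms by (intro phi_supp) (simp add: pullback_def Let_def)
  moreover have "norm (psi ?c (snd p) (t1 - ?c) - snd p) \<le> Umax * T"
    using psi_time_lipschitz[OF c(1) order_refl, of ?c "snd p"] mult_left_mono[OF c(2) Umax_nonneg] c(1) by simp
  ultimately show ?thesis
    using norm_triangle_ineq2[of "snd p" "psi ?c (snd p) (t1 - ?c)"] by (simp add: norm_minus_commute)
qed

text \<open>Lipschitz constant of the pullback in space-time: the exponential is the stretching by
  the flow, and \<open>Umax\<close> enters because a time shift by \<open>h\<close> can be traded
  for a displacement of at most \<open>Umax * h\<close>.\<close>

definition LW :: real where "LW = L * exp (\<Lambda> * T) * (1 + Umax)"

lemma LW_nonneg: "0 \<le> LW"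
  using L0 Umax_nonneg by (simp add: LW_def)

lemma pullback_space_lipschitz: "\<bar>pullback \<phi> t1 (t, x) - pullback \<phi> t1 (t, y)\<bar> \<le> L * exp (\<Lambda> * T) * norm (x - y)"
proof -
  let ?c = "max 0 (min t1 t)"
  have c: "0 \<le> t1 - ?c" "t1 - ?c \<le> T" using t1 by auto
  have "\<bar>pullback \<phi> t1 (t, x) - pullback \<phi> t1 (t, y)\<bar> \<le> L * norm (psi ?c x (t1 - ?c) - psi ?c y (t1 - ?c))"
    by (simp add: pullback_def Let_def phi_lip)
  also have "\<dots> \<le> L * (norm (x - y) * exp (\<Lambda> * (t1 - ?c)))"
    by (intro mult_left_mono psi_lipschitz c L0)
  also have "\<dots> \<le> L * (norm (x - y) * exp (\<Lambda> * T))"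
    using c Lambda_nonneg L0 by (intro mult_left_mono) (auto simp: mult_left_mono)
  finally show ?thesis by (simp add: mult_ac)
qed

lemma pullback_flow:
  assumes "0 \<le> t" "0 \<le> h" "t + h \<le> t1"
  shows "pullback \<phi> t1 (t + h, psi t x h) = pullback \<phi> t1 (t, x)"
proof -
  have "psi t x (h + (t1 - (t + h))) = psi (t + h) (psi t x h) (t1 - (t + h))"
    by (rule psi_semigroup) (use assms in auto)
  then show ?thesis using assms t1 by (simp add: pullback_def Let_def algebra_simps)
qed

lemma pullback_clamp: "pullback \<phi> t1 (t, x) = pullback \<phi> t1 (max 0 (min t1 t), x)"
  using t1 by (simp add: pullback_def Let_def)

lemma pullback_lipschitz: "\<bar>pullback \<phi> t1 p - pullback \<phi> t1 q\<bar> \<le> LW * (\<bar>fst p - fst q\<bar> + norm (snd p - snd q))"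
proof -
  let ?K = "L * exp (\<Lambda> * T)"
  have K: "0 \<le> ?K" using L0 by simp
  have ordered: "\<bar>pullback \<phi> t1 (t, x) - pullback \<phi> t1 (t', x)\<bar> \<le> ?K * (Umax * (t' - t))" if "0 \<le> t" "t \<le> t'" "t' \<le> t1" for t t' x
  proof -
    have "\<bar>pullback \<phi> t1 (t, x) - pullback \<phi> t1 (t', x)\<bar> = \<bar>pullback \<phi> t1 (t', psi t x (t' - t)) - pullback \<phi> t1 (t', x)\<bar>"
      using pullback_flow[of t "t' - t" x] that by simp
    also have "\<dots> \<le> ?K * norm (psi t x (t' - t) - x)" by (rule pullback_space_lipschitz)
    also have "\<dots> \<le> ?K * (Umax * (t' - t))"
      using psi_time_lipschitz[of "t' - t" 0 t x] that K by (intro mult_left_mono) auto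
    finally show ?thesis .
  qed
  have time: "\<bar>pullback \<phi> t1 (t, x) - pullback \<phi> t1 (t', x)\<bar> \<le> ?K * (Umax * \<bar>t - t'\<bar>)" for t t' x
  proof -
    let ?c = "max 0 (min t1 t)" and ?c' = "max 0 (min t1 t')"
    have "\<bar>pullback \<phi> t1 (?c, x) - pullback \<phi> t1 (?c', x)\<bar> \<le> ?K * (Umax * \<bar>?c - ?c'\<bar>)"
    proof (cases "?c \<le> ?c'")
      case True
      have "\<bar>?c - ?c'\<bar> = ?c' - ?c" using True by (simp only: abs_of_nonpos diff_le_0_iff_le minus_diff_eq)
      moreover have "0 \<le> ?c" "?c' \<le> t1" using t1 by simp_all
      ultimately show ?thesis using ordered[OF _ True] by (simp only:)
    next
      case False
      then have le: "?c' \<le> ?c" by linarith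
      have "\<bar>?c - ?c'\<bar> = ?c - ?c'" using le by (simp only: abs_of_nonneg diff_ge_0_iff_ge)
      moreover have "0 \<le> ?c'" "?c \<le> t1" using t1 by simp_all
      ultimately show ?thesis using ordered[OF _ le] by (simp only: abs_minus_commute[of "pullback \<phi> t1 (?c, x)"])
    qed
    also have "\<dots> \<le> ?K * (Umax * \<bar>t - t'\<bar>)"
      using K Umax_nonneg by (intro mult_left_mono) auto
    finally show ?thesis using pullback_clamp[of t x] pullback_clamp[of t' x] by simp
  qed
  have "\<bar>pullback \<phi> t1 p - pullback \<phi> t1 q\<bar> \<le> ?K * (Umax * \<bar>fst p - fst q\<bar>) + ?K * norm (snd p - snd q)"
    using time[of "fst p" "snd p" "fst q"] pullback_space_lipschitz[of "fst q" "snd p" "snd q"] by simp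
  also have "\<dots> = ?K * (Umax * \<bar>fst p - fst q\<bar> + norm (snd p - snd q))" by (simp add: distrib_left)
  also have "\<dots> \<le> ?K * ((1 + Umax) * (\<bar>fst p - fst q\<bar> + norm (snd p - snd q)))"
    using K Umax_nonneg by (intro mult_left_mono) (auto simp: algebra_simps)
  finally show ?thesis by (simp add: LW_def mult_ac)
qed

lemma pullback_continuous: "continuous_on UNIV (pullback \<phi> t1)"
proof -
  have "(2 * LW)-lipschitz_on UNIV (pullback \<phi> t1)"
  proof (rule lipschitz_onI)
    fix p q :: "real \<times> (real^'n)"
    have "\<bar>fst p - fst q\<bar> + norm (snd p - snd q) \<le> 2 * dist p q"
      using dist_fst_le[of p q] dist_snd_le[of p q] by (simp add: dist_norm)
    then have "LW * (\<bar>fst p - fst q\<bar> + norm (snd p - snd q)) \<le> LW * (2 * dist p q)"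
      by (intro mult_left_mono LW_nonneg)
    then show "dist (pullback \<phi> t1 p) (pullback \<phi> t1 q) \<le> 2 * LW * dist p q"
      using pullback_lipschitz[of p q] by (simp add: dist_real_def)
  qed (use LW_nonneg in simp)
  then show ?thesis by (rule lipschitz_on_continuous_on)
qed

lemma pullback_measurable: "pullback \<phi> t1 \<in> borel_measurable borel"
  by (rule borel_measurable_continuous_onI[OF pullback_continuous])

abbreviation Wm :: "real \<Rightarrow> real \<times> (real^'n) \<Rightarrow> real" where
  "Wm r \<equiv> convolve (pullback \<phi> t1) (mollifier r)"

text \<open>Since the pullback is constant along characteristics, its regularisation almost is.\<close>

lemma mollified_transport:
  assumes \<eta>: "0 < \<eta>" and ab: "0 < a" "b < t1"
  shows "\<exists>r0>0. \<forall>r t x. 0 < r \<longrightarrow> r \<le> r0 \<longrightarrow> a \<le> t \<longrightarrow> t \<le> b \<longrightarrow>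
     \<bar>frechet_derivative (Wm r) (at (t, x)) (1, U t x)\<bar> \<le> \<eta>"
proof -
  define R0 where "R0 = max 0 (R + Umax * T)"
  let ?K = "cball 0 (T + R0 + 5) :: (real \<times> (real^'n)) set"
  \<comment> \<open>A position error of \<open>\<eta>' * h\<close> changes the pullback by at most
    \<open>LW * \<eta>' * h\<close>, hence by at most \<open>\<eta> * h\<close>.\<close>
  define \<eta>' where "\<eta>' = \<eta> / (LW + 1)"
  have \<eta>': "0 < \<eta>'" "LW * \<eta>' \<le> \<eta>"
    using \<eta> LW_nonneg by (auto simp: \<eta>'_def field_simps)
  have "uniformly_continuous_on ?K (\<lambda>p. U (fst p) (snd p))"
    by (rule compact_uniformly_continuous[OF continuous_on_subset[OF U_continuous]]) auto
  then obtain d where d: "0 < d"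
    "\<And>p q. p \<in> ?K \<Longrightarrow> q \<in> ?K \<Longrightarrow> dist q p < d \<Longrightarrow> dist (U (fst q) (snd q)) (U (fst p) (snd p)) < \<eta>'"
    unfolding uniformly_continuous_on_def using \<eta>'(1) by meson
  \<comment> \<open>Radius and step are so small that all times stay in \<open>{0..t1}\<close> and
    every point met stays within \<open>d\<close> of \<open>(t, x)\<close>: the budget
    \<open>2 * r + h * (1 + Umax)\<close> is at most \<open>3 * d / 8\<close>.\<close>
  define r0 where "r0 = min (min (a / 2) ((t1 - b) / 2)) (min (d / 8) 1)"
  define h0 where "h0 = min ((t1 - b) / 2) (min (d / 8) 1 / (1 + Umax))"
  have "r0 \<le> min (a / 2) ((t1 - b) / 2)" "r0 \<le> min (d / 8) 1"
    unfolding r0_def by (rule min.cobounded1 min.cobounded2)+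
  then have r0: "0 < r0" "r0 \<le> a / 2" "r0 \<le> (t1 - b) / 2" "r0 \<le> d / 8" "r0 \<le> 1"
    using ab d(1) by (auto simp: r0_def)
  have h0: "0 < h0" "h0 \<le> (t1 - b) / 2" "h0 * (1 + Umax) \<le> d / 8" "h0 * (1 + Umax) \<le> 1"
  proof -
    have "h0 \<le> min (d / 8) 1 / (1 + Umax)" by (simp add: h0_def)
    then have "h0 * (1 + Umax) \<le> min (d / 8) 1"
      using Umax_nonneg by (simp add: pos_le_divide_eq)
    then show "h0 * (1 + Umax) \<le> d / 8" "h0 * (1 + Umax) \<le> 1" by auto
    show "0 < h0" using ab d(1) Umax_nonneg by (simp add: h0_def)
    show "h0 \<le> (t1 - b) / 2" unfolding h0_def by (rule min.cobounded1)
  qed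
  show ?thesis
  proof (intro exI[of _ r0] conjI allI impI r0(1))
    fix r t :: real and x :: "real^'n"
    assume r: "0 < r" "r \<le> r0" and t: "a \<le> t" "t \<le> b"
    show "\<bar>frechet_derivative (Wm r) (at (t, x)) (1, U t x)\<bar> \<le> \<eta>"
    proof (rule convolve_mollifier_directional_bound[OF r(1) pullback_measurable pullback_bounded h0(1)])
      fix y :: "real \<times> (real^'n)" and h :: real
      assume y: "norm (y - (t, x)) \<le> r" and h: "0 < h" "h < h0"
      obtain t' x' where y_eq: "y = (t', x')" by (cases y)
      have tt: "\<bar>t' - t\<bar> \<le> r" and xx: "norm (x' - x) \<le> r"
        using y norm_fst_le[of "t' - t" "x' - x"] norm_snd_le[of "x' - x" "t' - t"] by (simp_all add: y_eq)
      have "h * (1 + Umax) \<le> h0 * (1 + Umax)"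
        by (rule mult_right_mono) (use h Umax_nonneg in auto)
      with h0 have hU: "h * (1 + Umax) \<le> d / 8" "h * (1 + Umax) \<le> 1" by linarith+
      have hUm: "h * Umax \<le> 1" "h \<le> 1" "0 \<le> h * Umax"
      proof -
        show "0 \<le> h * Umax" using h Umax_nonneg by simp
        then show "h * Umax \<le> 1" "h \<le> 1" using hU(2) h unfolding distrib_left by linarith+
      qed
      have t': "0 \<le> t'" "t' + h \<le> t1" "t' + h \<le> T" 
      proof -
        have "t' \<le> t + r" "t - r \<le> t'" using tt by auto
        moreover have "h \<le> (t1 - b) / 2" "r \<le> (t1 - b) / 2" "r \<le> a / 2"
          using h(2) h0(2) r(2) r0(2,3) by linarith+
        moreover have "0 < a" "0 < h" by fact+
        ultimately show "0 \<le> t'" "t' + h \<le> t1" using t by (simp_all add: field_simps)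
        then show "t' + h \<le> T" using t1(2) by linarith
      qed
      have hUx: "norm (h *\<^sub>R U t x) \<le> h * Umax"
        using U_bounded[of t x] h by (simp add: mult_left_mono)
      have "\<bar>pullback \<phi> t1 (t' + h, x' + h *\<^sub>R U t x) - pullback \<phi> t1 (t', x')\<bar> \<le> h * \<eta>"
      proof (cases "norm x' \<le> R0 + 1")
        case True
        \<comment> \<open>The straight step in direction \<open>U t x\<close>, taken from a nearby
          point, is compared with the characteristic through that point; uniform continuity of the
          field makes them differ by \<open>\<eta>' * h\<close>.\<close>
        have "norm (psi t' x' h - h *\<^sub>R U t x - (psi t' x' 0 - 0 *\<^sub>R U t x)) \<le> \<eta>' * \<bar>h - 0\<bar>"
        proof (rule vector_derivative_lipschitz[where b=h and d="\<lambda>s. U (t' + s) (psi t' x' s) - U t x"])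
          show "((\<lambda>s. psi t' x' s - s *\<^sub>R U t x) has_vector_derivative U (t' + s) (psi t' x' s) - U t x) (at s within {0..})"
            if "0 \<le> s" for s
            using psi_deriv[OF that] by (auto intro!: derivative_eq_intros)
          fix s assume s: "0 \<le> s" "s \<le> h"
          have ps: "norm (psi t' x' s - x') \<le> h * Umax"
            using psi_time_lipschitz[OF s(1) order_refl, of t' x'] mult_left_mono[OF s(2) Umax_nonneg] s by (simp add: mult.commute)
          have n1: "norm (psi t' x' s) \<le> R0 + 2"
            using True ps hUm norm_triangle_ineq2[of "psi t' x' s" x'] by linarith
          have "(t' + s, psi t' x' s) \<in> ?K"
            using n1 t' s T norm_Pair_le[of "t' + s" "psi t' x' s"] by simp
          moreover have "(t, x) \<in> ?K"
            using True xx r r0 t ab t1 norm_triangle_ineq2[of x x'] norm_Pair_le[of t x]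
            by (simp add: norm_minus_commute)
          moreover have "dist (t' + s, psi t' x' s) (t, x) < d"
          proof -
            have "dist (t' + s, psi t' x' s) (t, x) \<le> norm (t' + s - t) + norm (psi t' x' s - x)"
              using norm_Pair_le[of "t' + s - t" "psi t' x' s - x"] by (simp add: dist_norm)
            also have "\<dots> \<le> (r + h) + (h * Umax + r)"
              using tt s ps xx norm_triangle_ineq[of "psi t' x' s - x'" "x' - x"] by (intro add_mono) auto
            also have "\<dots> = 2 * r + h * (1 + Umax)" by (simp add: algebra_simps)
            also have "\<dots> < d" using r r0 hU d by linarith
            finally show ?thesis .
          qed
          ultimately have "dist (U (t' + s) (psi t' x' s)) (U t x) < \<eta>'"
            using d(2)[of "(t, x)" "(t' + s, psi t' x' s)"] by simp
          then show "norm (U (t' + s) (psi t' x' s) - U t x) \<le> \<eta>'" by (simp add: dist_norm)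
        qed (use h in auto)
        then have n: "norm (x' + h *\<^sub>R U t x - psi t' x' h) \<le> \<eta>' * h"
          using h norm_minus_commute[of "x' + h *\<^sub>R U t x" "psi t' x' h"] by (simp add: algebra_simps)
        have "\<bar>pullback \<phi> t1 (t' + h, x' + h *\<^sub>R U t x) - pullback \<phi> t1 (t', x')\<bar>
            = \<bar>pullback \<phi> t1 (t' + h, x' + h *\<^sub>R U t x) - pullback \<phi> t1 (t' + h, psi t' x' h)\<bar>"
          using pullback_flow[of t' h x'] t' h by simp
        also have "\<dots> \<le> LW * norm (x' + h *\<^sub>R U t x - psi t' x' h)"
          using pullback_lipschitz[of "(t' + h, x' + h *\<^sub>R U t x)" "(t' + h, psi t' x' h)"] by simp
        also have "\<dots> \<le> LW * (\<eta>' * h)" by (intro mult_left_mono n LW_nonneg)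
        also have "\<dots> \<le> h * \<eta>" using \<eta>'(2) h mult_right_mono[OF \<eta>'(2), of h] by (simp add: mult_ac)
        finally show ?thesis .
      next
        case False
        then have "R0 < norm (x' + h *\<^sub>R U t x)" "R0 < norm x'"
          using hUx hUm norm_triangle_ineq2[of x' "- (h *\<^sub>R U t x)"] by auto
        then have "pullback \<phi> t1 (t' + h, x' + h *\<^sub>R U t x) = 0" "pullback \<phi> t1 (t', x') = 0"
          using pullback_support[of "(t' + h, x' + h *\<^sub>R U t x)"] pullback_support[of "(t', x')"] by (auto simp: R0_def)
        then show ?thesis using h \<eta> by simp
      qed
      then show "\<bar>pullback \<phi> t1 (y + h *\<^sub>R (1, U t x)) - pullback \<phi> t1 y\<bar> \<le> h * \<eta>"
        by (simp add: y_eq)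
    qed
  qed
qed

end

section \<open>Time cut-offs, and measures determined by Lipschitz observables\<close>

lemma mollifier_minus: "mollifier r (- z) = mollifier r z"
  by (simp add: mollifier_def bump_def)

text \<open>This smooth cut-off has as its derivative the difference of two mollifiers, so testing
  with it compares mollified values at the two end points.\<close>

lemma convolve_indicator_derivative:
  fixes r a b t :: real
  assumes r: "0 < r" and ab: "a \<le> b"
  shows "frechet_derivative (convolve (indicator {a..b}) (mollifier r)) (at t) 1 = mollifier r (t - a) - mollifier r (t - b)"
proof -
  let ?m = "mollifier r :: real \<Rightarrow> real"
  let ?D = "\<lambda>s. frechet_derivative ?m (at s) 1"
  have "(\<lambda>y. - ?m (t - y)) = (\<lambda>y. (-1) * ?m ((-1) *\<^sub>R y + t))" by (simp add: fun_eq_iff)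
  have D: "((\<lambda>y. - ?m (t - y)) has_vector_derivative ?D (t - y)) (at y within {a..b})" for y :: real
  proof -
    have "(?m has_derivative frechet_derivative ?m (at (t - y))) (at (t - y))"
      by (rule smooth_has_derivative[OF smooth_mollifier])
    moreover have "frechet_derivative ?m (at (t - y)) = (\<lambda>h. ?D (t - y) * h)"
    proof
      fix h :: real
      show "frechet_derivative ?m (at (t - y)) h = ?D (t - y) * h"
        using linear_cmul[OF has_derivative_linear[OF smooth_has_derivative[OF smooth_mollifier]], of r "t - y" h "1::real"] by simp
    qed
    ultimately have "(?m has_real_derivative ?D (t - y)) (at (t - y))"
      by (simp add: has_field_derivative_def)
    then have "((\<lambda>y. ?m (t - y)) has_real_derivative ?D (t - y) * (- 1)) (at y)"
      by (rule DERIV_chain2) (auto intro!: derivative_eq_intros)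
    from DERIV_minus[OF this] show ?thesis
      by (simp add: has_real_derivative_iff_has_vector_derivative has_vector_derivative_at_within)
  qed
  have cont: "continuous_on S (\<lambda>y. ?D (t - y))" for S
    by (rule continuous_on_compose2[OF smooth_continuous_on[where S=UNIV, OF smooth_frechet_derivative[OF smooth_mollifier]]])
      (auto intro: continuous_intros)
  have "frechet_derivative (convolve (indicator {a..b}) ?m) (at t) 1 = convolve (indicator {a..b}) ?D t"
    by (rule frechet_derivative_convolve[OF _ _ test_function_mollifier[OF r], where M=1]) (auto simp: indicator_def)
  also have "\<dots> = - ?m (t - b) - - ?m (t - a)"
    unfolding convolve_def using integral_FTC_atLeastAtMost[OF ab D cont] by simp
  finally show ?thesis by simp
qed

text \<open>Open boxes are a generator stable under intersections, and the indicator of a box is the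
  limit of \<open>n\<close> times the distance to its complement, capped at 1.\<close>

lemma measure_eqI_lipschitz:
  fixes \<mu> \<nu> :: "'a::euclidean_space measure"
  assumes \<mu>: "prob_space \<mu>" "sets \<mu> = sets borel" and \<nu>: "prob_space \<nu>" "sets \<nu> = sets borel"
    and eq: "\<And>\<phi> L M R. (\<And>x y. \<bar>\<phi> x - \<phi> y\<bar> \<le> L * norm (x - y)) \<Longrightarrow> 0 \<le> L \<Longrightarrow> (\<And>x. \<bar>\<phi> x\<bar> \<le> M) \<Longrightarrow>
      (\<And>x. \<phi> x \<noteq> 0 \<Longrightarrow> norm x \<le> R) \<Longrightarrow> (LINT x|\<mu>. \<phi> x) = (LINT x|\<nu>. \<phi> x)"
  shows "\<mu> = \<nu>"
proof (rule measure_eqI_generator_eq)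
  let ?E = "range (\<lambda>(a, b). box a b::'a set)"
  show "Int_stable ?E" by (auto simp: Int_stable_def box_Int_box)
  show "?E \<subseteq> Pow UNIV" "sets \<mu> = sigma_sets UNIV ?E" "sets \<nu> = sigma_sets UNIV ?E"
    by (simp_all add: borel_eq_box \<mu> \<nu>)
  let ?A = "\<lambda>n::nat. box (- (real n *\<^sub>R One)) (real n *\<^sub>R One) :: 'a set"
  show "range ?A \<subseteq> ?E" "(\<Union>i. ?A i) = UNIV"
    unfolding UN_box_eq_UNIV by auto
  interpret \<mu>: prob_space \<mu> by fact
  interpret \<nu>: prob_space \<nu> by fact
  show "emeasure \<mu> (?A i) \<noteq> \<infinity>" for i by simp
  fix X assume "X \<in> ?E"
  then obtain a b where X: "X = box a b" by auto
  let ?g = "\<lambda>n x. min 1 (real n * infdist x (- X))"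
  have g0: "0 \<le> ?g n x" "\<bar>?g n x\<bar> \<le> 1" for n x by (auto simp: infdist_nonneg)
  have cl: "closed (- X)" by (simp add: X closed_def open_box)
  \<comment> \<open>The distance to the empty set is 0 by convention, which would spoil the
    approximation.\<close>
  have ne: "- X \<noteq> {}"
  proof
    assume "- X = {}"
    then have "X = UNIV" by blast
    then show False using not_bounded_UNIV[where 'a='a] bounded_box[of a b] unfolding X by simp
  qed
  have lip: "\<bar>?g n x - ?g n y\<bar> \<le> real n * norm (x - y)" for n x y
  proof -
    have "\<bar>?g n x - ?g n y\<bar> \<le> \<bar>real n * infdist x (- X) - real n * infdist y (- X)\<bar>" by linarith
    also have "\<dots> = real n * \<bar>infdist x (- X) - infdist y (- X)\<bar>"
      by (simp add: right_diff_distrib[symmetric] abs_mult)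
    also have "\<dots> \<le> real n * norm (x - y)"
      using infdist_triangle_abs[of x "- X" y] by (intro mult_left_mono) (auto simp: dist_norm)
    finally show ?thesis .
  qed
  obtain R where R: "\<And>x. x \<in> X \<Longrightarrow> norm x \<le> R"
    using bounded_box[of a b] unfolding X bounded_iff by blast
  have supp: "norm x \<le> R" if "?g n x \<noteq> 0" for n x
  proof (rule R)
    show "x \<in> X" using that infdist_zero[of x "- X"] by (cases "x \<in> X") auto
  qed
  have eqn: "(LINT x|\<mu>. ?g n x) = (LINT x|\<nu>. ?g n x)" for n
    by (rule eq[OF lip _ g0(2) supp]) simp_all
  have lim: "(\<lambda>n. ?g n x) \<longlonglongrightarrow> indicator X x" for x
  proof (cases "x \<in> X")
    case True
    then have pos: "0 < infdist x (- X)"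
      using in_closed_iff_infdist_zero[OF cl ne, of x] infdist_nonneg[of x "- X"] by auto
    have "\<forall>\<^sub>F n in sequentially. ?g n x = 1"
    proof (rule eventually_mono[OF eventually_ge_at_top[of "nat \<lceil>1 / infdist x (- X)\<rceil>"]])
      fix n assume "nat \<lceil>1 / infdist x (- X)\<rceil> \<le> n"
      then have "1 / infdist x (- X) \<le> real n" by linarith
      then show "?g n x = 1" using pos by (simp add: divide_le_eq)
    qed
    then show ?thesis using True by (simp add: tendsto_eventually)
  next
    case False
    then have "infdist x (- X) = 0" by simp
    then show ?thesis using False by simp
  qed
  have meas: "?g n \<in> borel_measurable borel" for n
    by (intro borel_measurable_continuous_onI continuous_intros)
  have lim_int: "(\<lambda>n. LINT x|\<alpha>. ?g n x) \<longlonglongrightarrow> measure \<alpha> X" if \<alpha>: "prob_space \<alpha>" "sets \<alpha> = sets borel" for \<alpha>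
  proof -
    interpret \<alpha>: prob_space \<alpha> by fact
    have "(\<lambda>n. LINT x|\<alpha>. ?g n x) \<longlonglongrightarrow> (LINT x|\<alpha>. indicator X x)"
    proof (rule integral_dominated_convergence[where w="\<lambda>_. 1"])
      show "?g n \<in> borel_measurable \<alpha>" for n using meas measurable_cong_sets[OF \<alpha>(2) refl] by auto
      show "(\<lambda>x. indicator X x :: real) \<in> borel_measurable \<alpha>" using \<alpha>(2) by (auto simp: X)
    qed (use lim g0 in auto)
    then show ?thesis using \<alpha>(2) by (simp add: X)
  qed
  have "measure \<mu> X = measure \<nu> X"
    using LIMSEQ_unique[OF lim_int[OF \<mu>]] lim_int[OF \<nu>] eqn by simp
  then show "emeasure \<mu> X = emeasure \<nu> X"
    by (simp add: \<mu>.emeasure_eq_measure \<nu>.emeasure_eq_measure)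
qed

lemma set_integral_abs_le_const:
  fixes f :: "real \<Rightarrow> real"
  assumes "continuous_on UNIV f" "\<And>t. t \<in> {0..T} \<Longrightarrow> \<bar>f t\<bar> \<le> e" "0 \<le> T"
  shows "\<bar>LINT t:{0..T}|lborel. f t\<bar> \<le> T * e"
proof -
  have i: "set_integrable lborel {0..T} f"
    by (rule borel_integrable_atLeastAtMost') (use assms continuous_on_subset in blast)
  have "\<bar>LINT t:{0..T}|lborel. f t\<bar> \<le> (LINT t:{0..T}|lborel. \<bar>f t\<bar>)"
    using set_integral_norm_bound[OF i] by simp
  also have "\<dots> \<le> (LINT t:{0..T}|lborel. e)"
    by (intro set_integral_mono set_integrable_abs[OF i] borel_integrable_atLeastAtMost') (auto intro: assms)
  also have "\<dots> = T * e" using assms by (simp add: set_lebesgue_integral_def)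
  finally show ?thesis .
qed

section \<open>Constancy in time of the transported mean\<close>

context transported
begin

text \<open>At \<open>t1\<close> this is the mean of the observable itself, at 0 its mean after
  transport by the flow; the claim to be proved is that it is constant.\<close>

definition mW :: "real \<Rightarrow> real" where
  "mW t = (LINT x|\<mu> (clampT t). pullback \<phi> t1 (t, x))"

lemma pullback_param_continuous:
  assumes "0 < e"
  shows "\<exists>r>0. \<forall>q x y. dist q t < r \<longrightarrow> dist x y < r \<longrightarrow> \<bar>pullback \<phi> t1 (q, x) - pullback \<phi> t1 (t, y)\<bar> \<le> e"
proof (intro exI[of _ "e / (2 * LW + 1)"] conjI allI impI)
  show "0 < e / (2 * LW + 1)" using assms LW_nonneg by simp
  fix q :: real and x y :: "real^'n"
  assume d: "dist q t < e / (2 * LW + 1)" "dist x y < e / (2 * LW + 1)"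
  have "\<bar>pullback \<phi> t1 (q, x) - pullback \<phi> t1 (t, y)\<bar> \<le> LW * (\<bar>q - t\<bar> + norm (x - y))"
    using pullback_lipschitz[of "(q, x)" "(t, y)"] by simp
  also have "\<dots> \<le> LW * (2 * (e / (2 * LW + 1)))"
    using d LW_nonneg by (intro mult_left_mono) (auto simp: dist_norm)
  also have "\<dots> \<le> (2 * LW + 1) * (e / (2 * LW + 1))"
    using assms LW_nonneg by (simp add: field_simps)
  also have "\<dots> = e" using LW_nonneg by simp
  finally show "\<bar>pullback \<phi> t1 (q, x) - pullback \<phi> t1 (t, y)\<bar> \<le> e" .
qed

lemma pullback_slice_measurable: "(\<lambda>x. pullback \<phi> t1 (t, x)) \<in> borel_measurable borel"
  by (intro borel_measurable_continuous_onI continuous_on_compose2[OF pullback_continuous])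
    (auto intro: continuous_intros)

lemma mW_continuous: "continuous_on UNIV mW"
  unfolding mW_def
  by (rule param_integral_continuous[where \<tau>=clampT and M=M])
    (use continuous_clampT clampT_in pullback_bounded pullback_slice_measurable pullback_param_continuous in auto)

lemma mW_bounded: "\<bar>mW t\<bar> \<le> M"
proof -
  interpret prob_space "\<mu> (clampT t)" by (rule prob_mu[OF clampT_in])
  have i: "integrable (\<mu> (clampT t)) (\<lambda>x. pullback \<phi> t1 (t, x))"
    by (rule integrable_const_bound[where B=M]) (use pullback_bounded pullback_slice_measurable in auto)
  have "\<bar>mW t\<bar> \<le> (LINT x|\<mu> (clampT t). \<bar>pullback \<phi> t1 (t, x)\<bar>)"
    unfolding mW_def using integral_norm_bound[of "\<mu> (clampT t)" "\<lambda>x. pullback \<phi> t1 (t, x)"] by simp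
  also have "\<dots> \<le> (LINT x|\<mu> (clampT t). M)"
    using i by (intro integral_mono) (auto simp: pullback_bounded)
  also have "\<dots> = M" using prob_space by simp
  finally show ?thesis .
qed

text \<open>The continuity equation is tested with \<open>\<theta>\<close> times the mollified
  pullback. Its transport derivative is the derivative of \<open>\<theta>\<close> times the
  pullback, up to one error from mollification and one from the approximate transport equation.
  Keeping the support of \<open>\<theta>\<close> inside the open interval leaves room to mollify in
  time.\<close>

lemma transport_weak:
  fixes \<theta> :: "real \<Rightarrow> real"
  assumes \<theta>: "smooth \<theta>" and supp: "\<And>t. \<theta> t \<noteq> 0 \<Longrightarrow> a \<le> t \<and> t \<le> b" and ab: "0 < a" "b < t1"
  shows "(LINT t:{0..T}|lborel. frechet_derivative \<theta> (at t) 1 * mW t) = 0"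
proof -
  let ?\<theta>' = "\<lambda>t. frechet_derivative \<theta> (at t) 1"
  have tf: "test_function UNIV \<theta>"
    by (rule test_functionI[OF \<theta>, where R="\<bar>a\<bar> + \<bar>b\<bar>" and S'=UNIV]) (use supp in force)+
  from test_function_abs_bounded[OF tf] obtain B where B: "\<And>t. \<bar>\<theta> t\<bar> \<le> B" by blast
  from test_function_abs_bounded[OF test_function_frechet_derivative[OF tf]]
  obtain B' where B': "\<And>t. \<bar>?\<theta>' t\<bar> \<le> B'" by blast
  have B0: "0 \<le> B" "0 \<le> B'" using B[of 0] B'[of 0] by linarith+
  have \<theta>'c: "continuous_on S ?\<theta>'" for S
    by (intro smooth_continuous_on smooth_frechet_derivative \<theta>)
  have \<theta>'lin: "frechet_derivative \<theta> (at t) h = ?\<theta>' t * h" for t h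
    using linear_cmul[OF has_derivative_linear[OF smooth_has_derivative[OF \<theta>]], of t h 1] by simp
  have small: "\<bar>LINT t:{0..T}|lborel. ?\<theta>' t * mW t\<bar> \<le> T * e" if e: "0 < e" for e
  proof -
    define \<eta> where "\<eta> = e / (2 * (B + 1))"
    have \<eta>: "0 < \<eta>" "B * \<eta> \<le> e / 2"
    proof -
      show "0 < \<eta>" using e B0 by (simp add: \<eta>_def)
      then have "B * \<eta> \<le> (B + 1) * \<eta>" by (simp add: mult_right_mono)
      also have "\<dots> = e / 2" using B0 by (simp add: \<eta>_def field_simps)
      finally show "B * \<eta> \<le> e / 2" .
    qed
    from mollified_transport[OF \<eta>(1) ab] obtain r0 where r0': "0 < r0"
      and r0'': "\<forall>r t x. 0 < r \<longrightarrow> r \<le> r0 \<longrightarrow> a \<le> t \<longrightarrow> t \<le> b \<longrightarrow>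
        \<bar>frechet_derivative (Wm r) (at (t, x)) (1, U t x)\<bar> \<le> \<eta>"
      by (elim exE conjE)
    note r0 = r0' r0''[rule_format]
    \<comment> \<open>The mollified pullback is within \<open>2 * LW * r\<close> of the pullback;
      multiplied by the bound \<open>B'\<close> on the derivative of \<open>\<theta>\<close> this is
      at most \<open>e / 2\<close>, the other half being \<open>B * \<eta>\<close>.\<close>
    define r where "r = min r0 (e / (2 * (B' + 1) * (2 * LW + 1)))"
    have r: "0 < r" "r \<le> r0" using r0 e B0 LW_nonneg by (auto simp: r_def)
    have Br: "B' * (2 * LW * r) \<le> e / 2"
    proof -
      have "B' * (2 * LW * r) \<le> (B' + 1) * ((2 * LW + 1) * r)"
        using B0 LW_nonneg r by (intro mult_mono mult_right_mono) auto
      also have "\<dots> \<le> (B' + 1) * ((2 * LW + 1) * (e / (2 * (B' + 1) * (2 * LW + 1))))"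
        using B0 LW_nonneg by (intro mult_left_mono) (auto simp: r_def)
      also have "\<dots> = e / 2"
      proof -
        have "B' + 1 \<noteq> 0" "2 * LW + 1 \<noteq> 0" using B0 LW_nonneg by linarith+
        then show ?thesis by (simp add: divide_simps)
      qed
      finally show ?thesis .
    qed
    note sW = smooth_convolve[OF pullback_measurable pullback_bounded test_function_mollifier[OF r(1)]]
    define \<Theta> where "\<Theta> p = \<theta> (fst p) * Wm r p" for p
    have s\<Theta>: "smooth \<Theta>"
      unfolding \<Theta>_def by (intro smooth_mult smooth_compose_fst \<theta> sW)
    have supp\<Theta>: "a \<le> fst p \<and> fst p \<le> b \<and> norm (snd p) \<le> R + Umax * T + r" if "\<Theta> p \<noteq> 0" for p
    proof -
      have "\<theta> (fst p) \<noteq> 0" "Wm r p \<noteq> 0" using that by (auto simp: \<Theta>_def)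
      from convolve_nonzeroD[OF this(2)] obtain q where q: "pullback \<phi> t1 q \<noteq> 0" "mollifier r (p - q) \<noteq> 0" by blast
      have "norm (snd p - snd q) \<le> r"
        using mollifier_support[OF r(1) q(2)] norm_snd_le[of "snd p - snd q" "fst p - fst q"] by (simp add: minus_prod_def)
      then have "norm (snd p) \<le> R + Umax * T + r"
        using pullback_support[OF q(1)] norm_triangle_ineq2[of "snd p" "snd q"] by linarith
      then show ?thesis using supp[of "fst p"] \<open>\<theta> (fst p) \<noteq> 0\<close> by blast
    qed
    define R1 where "R1 = T + (R + Umax * T + r)"
    have supp1: "norm p \<le> R1" if "\<Theta> p \<noteq> 0" for p
      using supp\<Theta>[OF that] norm_Pair_le[of "fst p" "snd p"] ab t1 by (simp add: R1_def)
    have t\<Theta>: "test_function ({0<..<T} \<times> UNIV) \<Theta>"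
    proof (rule test_functionI[OF s\<Theta> supp1, where S'="{a..b} \<times> UNIV"])
      show "{a..b} \<times> UNIV \<subseteq> {0<..<T} \<times> (UNIV :: (real^'n) set)" using ab t1 by auto
      show "p \<in> {a..b} \<times> UNIV" if "\<Theta> p \<noteq> 0" for p
        using supp\<Theta>[OF that] by (simp add: mem_Times_iff)
    qed (auto intro: closed_Times)
    define G where "G p = frechet_derivative \<Theta> (at p) (1, U (fst p) (snd p))" for p
    have Gc: "continuous_on UNIV G"
      unfolding G_def by (intro frechet_derivative_continuous s\<Theta> continuous_intros U_continuous)
    have Gsupp: "norm p \<le> R1" if "G p \<noteq> 0" for p
    proof (rule ccontr)
      assume "\<not> norm p \<le> R1"
      then have p: "p \<in> - cball 0 R1" by simp
      have "(\<Theta> has_derivative (\<lambda>_. 0)) (at p)"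
      proof (rule has_derivative_transform_within_open[OF has_derivative_const, of "- cball 0 R1"])
        show "\<And>q. q \<in> - cball 0 R1 \<Longrightarrow> 0 = \<Theta> q" using supp1 by force
      qed (use p in auto)
      then have "(\<lambda>_. 0) = frechet_derivative \<Theta> (at p)" by (rule frechet_derivative_at)
      from fun_cong[OF this, of "(1, U (fst p) (snd p))"] show False using that by (simp add: G_def)
    qed
    have Gb: "\<exists>K. \<forall>p. \<bar>G p\<bar> \<le> K"
    proof -
      have "bounded (G ` cball 0 R1)"
        by (intro compact_imp_bounded compact_continuous_image continuous_on_subset[OF Gc]) auto
      then obtain K where "0 < K" "\<forall>y\<in>G ` cball 0 R1. norm y \<le> K" unfolding bounded_pos by blast
      then have "\<bar>G p\<bar> \<le> K" for p using Gsupp[of p] by (cases "G p = 0") auto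
      then show ?thesis by blast
    qed
    then obtain K where K: "\<And>p. \<bar>G p\<bar> \<le> K" by blast
    have GWm: "G (t, x) = ?\<theta>' t * Wm r (t, x) + \<theta> t * frechet_derivative (Wm r) (at (t, x)) (1, U t x)" for t x
    proof -
      have d1: "((\<lambda>p::real \<times> (real^'n). \<theta> (fst p)) has_derivative (\<lambda>v. ?\<theta>' t * fst v)) (at (t, x))"
      proof -
        have "(fst has_derivative fst) (at (t, x :: real^'n))"
          by (rule bounded_linear_imp_has_derivative[OF bounded_linear_fst])
        moreover have "(\<theta> has_derivative (\<lambda>h. ?\<theta>' t * h)) (at (fst (t, x)))"
          unfolding fst_conv
          by (rule has_derivative_eq_rhs[OF smooth_has_derivative[OF \<theta>]]) (rule ext, rule \<theta>'lin)
        ultimately show ?thesis by (rule has_derivative_compose)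
      qed
      have "((\<lambda>p. \<theta> (fst p) * Wm r p) has_derivative
          (\<lambda>v. \<theta> (fst (t, x)) * frechet_derivative (Wm r) (at (t, x)) v + ?\<theta>' t * fst v * Wm r (t, x))) (at (t, x))"
        by (rule has_derivative_mult[OF d1 smooth_has_derivative[OF sW]])
      moreover have "(\<lambda>p. \<theta> (fst p) * Wm r p) = \<Theta>" by (rule ext) (simp only: \<Theta>_def)
      ultimately have "(\<Theta> has_derivative
          (\<lambda>v. \<theta> (fst (t, x)) * frechet_derivative (Wm r) (at (t, x)) v + ?\<theta>' t * fst v * Wm r (t, x))) (at (t, x))"
        by (simp only:)
      note e = fun_cong[OF frechet_derivative_at[OF this], of "(1, U t x)"]
      have "G (t, x) = frechet_derivative \<Theta> (at (t, x)) (1, U t x)" by (simp only: G_def fst_conv snd_conv)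
      then show ?thesis unfolding e[symmetric] fst_conv mult_1_right by (simp only: add.commute)
    qed
    have close: "\<bar>G (t, x) - ?\<theta>' t * pullback \<phi> t1 (t, x)\<bar> \<le> e" for t x
    proof -
      have "\<bar>Wm r (t, x) - pullback \<phi> t1 (t, x)\<bar> \<le> 2 * LW * r"
      proof (rule convolve_mollifier_close[OF r(1) pullback_measurable pullback_bounded])
        fix q assume q: "norm (q - (t, x)) \<le> r"
        have "\<bar>fst q - t\<bar> \<le> r" "norm (snd q - x) \<le> r"
          using q norm_fst_le[of "fst q - t" "snd q - x"] norm_snd_le[of "snd q - x" "fst q - t"] by (simp_all add: minus_prod_def)
        then have "LW * (\<bar>fst q - t\<bar> + norm (snd q - x)) \<le> LW * (2 * r)"
          using LW_nonneg by (intro mult_left_mono) auto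
        then show "\<bar>pullback \<phi> t1 q - pullback \<phi> t1 (t, x)\<bar> \<le> 2 * LW * r"
          using pullback_lipschitz[of q "(t, x)"] by simp
      qed
      then have "\<bar>?\<theta>' t\<bar> * \<bar>Wm r (t, x) - pullback \<phi> t1 (t, x)\<bar> \<le> B' * (2 * LW * r)"
        using B' B0 by (intro mult_mono) auto
      moreover have "\<bar>\<theta> t\<bar> * \<bar>frechet_derivative (Wm r) (at (t, x)) (1, U t x)\<bar> \<le> B * \<eta>"
      proof (cases "\<theta> t = 0")
        case False
        then show ?thesis
          using supp[OF False] r0(2)[OF r] B B0 by (intro mult_mono) auto
      qed (use B0 \<eta> in simp)
      moreover have "G (t, x) - ?\<theta>' t * pullback \<phi> t1 (t, x) =
          ?\<theta>' t * (Wm r (t, x) - pullback \<phi> t1 (t, x)) + \<theta> t * frechet_derivative (Wm r) (at (t, x)) (1, U t x)"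
        unfolding GWm by (simp add: algebra_simps)
      ultimately show ?thesis
        using abs_triangle_ineq[of "?\<theta>' t * (Wm r (t, x) - pullback \<phi> t1 (t, x))" "\<theta> t * frechet_derivative (Wm r) (at (t, x)) (1, U t x)"]
          \<eta>(2) Br unfolding abs_mult by linarith
    qed
    have Gm: "(\<lambda>x. G (t, x)) \<in> borel_measurable borel" for t
      by (intro borel_measurable_continuous_onI continuous_on_compose2[OF Gc]) (auto intro: continuous_intros)
    define I where "I t = (LINT x|\<mu> (clampT t). G (t, x))" for t
    have Ic: "continuous_on UNIV I"
      unfolding I_def
    proof (rule param_integral_continuous[where \<tau>=clampT and M=K])
      fix t e' :: real assume "0 < e'"
      from continuous_bounded_support_uniform[OF Gc Gsupp this] obtain r' where
        r': "0 < r'" "\<And>p q. dist p q < r' \<Longrightarrow> \<bar>G p - G q\<bar> \<le> e'" by blast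
      show "\<exists>r>0. \<forall>q x y. dist q t < r \<longrightarrow> dist x y < r \<longrightarrow> norm (G (q, x) - G (t, y)) \<le> e'"
      proof (intro exI[of _ "r' / 2"] conjI allI impI)
        fix q :: real and x y :: "real^'n" assume "dist q t < r' / 2" "dist x y < r' / 2"
        then have "dist (q, x) (t, y) < r'"
          using norm_Pair_le[of "q - t" "x - y"] by (simp add: dist_norm)
        then show "norm (G (q, x) - G (t, y)) \<le> e'" using r'(2) by simp
      qed (use r' in simp)
    qed (use continuous_clampT clampT_in K Gm in auto)
    have IJ: "\<bar>I t - ?\<theta>' t * mW t\<bar> \<le> e" for t
    proof -
      interpret prob_space "\<mu> (clampT t)" by (rule prob_mu[OF clampT_in])
      have i1: "integrable (\<mu> (clampT t)) (\<lambda>x. G (t, x))"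
        by (rule integrable_const_bound[where B=K]) (use K Gm in auto)
      have i2: "integrable (\<mu> (clampT t)) (\<lambda>x. ?\<theta>' t * pullback \<phi> t1 (t, x))"
        by (intro integrable_mult_right integrable_const_bound[where B=M])
          (use pullback_bounded pullback_slice_measurable in auto)
      have eq: "I t - ?\<theta>' t * mW t = (LINT x|\<mu> (clampT t). G (t, x) - ?\<theta>' t * pullback \<phi> t1 (t, x))"
        unfolding I_def mW_def using i1 i2 by simp
      have "\<bar>I t - ?\<theta>' t * mW t\<bar> \<le> (LINT x|\<mu> (clampT t). \<bar>G (t, x) - ?\<theta>' t * pullback \<phi> t1 (t, x)\<bar>)"
        unfolding eq using integral_norm_bound[of "\<mu> (clampT t)" "\<lambda>x. G (t, x) - ?\<theta>' t * pullback \<phi> t1 (t, x)"]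
        by (simp only: real_norm_def)
      also have "\<dots> \<le> (LINT x|\<mu> (clampT t). e)"
        by (rule integral_mono[OF integrable_abs[OF Bochner_Integration.integrable_diff[OF i1 i2]] _ close]) simp
      also have "\<dots> = e" using prob_space by simp
      finally show ?thesis .
    qed
    have "(LINT t:{0..T}|lborel. I t) = (LINT t:{0..T}|lborel. (LINT x|\<mu> t. frechet_derivative \<Theta> (at (t, x)) (1, velocity \<kappa> (\<rho> t) x)))"
      by (rule set_lebesgue_integral_cong) (auto simp: I_def G_def U_def clampT_eq)
    also have "\<dots> = 0"
    proof -
      have "continuity_equation \<kappa> T \<rho>" using sol by (simp add: solution_def)
      from this[unfolded continuity_equation_def, rule_format, OF t\<Theta>] show ?thesis .
    qed
    finally have I0: "(LINT t:{0..T}|lborel. I t) = 0" .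
    have Jc: "continuous_on UNIV (\<lambda>t. ?\<theta>' t * mW t)"
      by (intro continuous_intros \<theta>'c mW_continuous)
    have si: "set_integrable lborel {0..T} f" if "continuous_on UNIV f" for f :: "real \<Rightarrow> real"
      by (rule borel_integrable_atLeastAtMost') (use that continuous_on_subset in blast)
    have "(LINT t:{0..T}|lborel. I t - ?\<theta>' t * mW t) = - (LINT t:{0..T}|lborel. ?\<theta>' t * mW t)"
      using set_integral_diff(2)[OF si[OF Ic] si[OF Jc]] I0 by simp
    moreover have "\<bar>LINT t:{0..T}|lborel. I t - ?\<theta>' t * mW t\<bar> \<le> T * e"
      by (rule set_integral_abs_le_const) (use IJ T in \<open>auto intro!: continuous_intros Ic Jc\<close>)
    ultimately show ?thesis by simp
  qed
  have "\<bar>LINT t:{0..T}|lborel. ?\<theta>' t * mW t\<bar> \<le> 0"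
  proof (rule field_le_epsilon)
    fix e :: real assume "0 < e"
    then show "\<bar>LINT t:{0..T}|lborel. ?\<theta>' t * mW t\<bar> \<le> 0 + e" using small[of "e / T"] T by simp
  qed
  then show ?thesis by simp
qed

text \<open>Testing with the mollified indicator of \<open>{a..b}\<close> turns the vanishing weak
  derivative into equality of the mollified means at \<open>a\<close> and \<open>b\<close>; the
  mollification is removed by continuity of \<open>mW\<close>.\<close>

lemma mW_eq:
  assumes "0 < a" "a < b" "b < t1"
  shows "mW a = mW b"
proof -
  note mb = borel_measurable_continuous_onI[OF mW_continuous]
  have conv_eq: "convolve mW (mollifier h) a = convolve mW (mollifier h) b" if h: "0 < h" "h \<le> a / 2" "h \<le> (t1 - b) / 2" for h
  proof -
    let ?m = "mollifier h :: real \<Rightarrow> real"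
    let ?\<theta> = "convolve (indicator {a..b}) ?m"
    note tm = test_function_mollifier[OF h(1), where 'a=real]
    have "(LINT t:{0..T}|lborel. frechet_derivative ?\<theta> (at t) 1 * mW t) = 0"
    proof (rule transport_weak[where a="a / 2" and b="(b + t1) / 2"])
      show "smooth ?\<theta>" by (rule smooth_convolve[OF _ _ tm, where M=1]) (auto simp: indicator_def)
      fix t assume "?\<theta> t \<noteq> 0"
      from convolve_nonzeroD[OF this] obtain y where "y \<in> {a..b}" "?m (t - y) \<noteq> 0"
        by (auto simp: indicator_def split: if_splits)
      then show "a / 2 \<le> t \<and> t \<le> (b + t1) / 2"
        using mollifier_support[OF h(1), of "t - y"] h by (auto simp: field_simps)
    qed (use assms in auto)
    moreover have "(LINT t:{0..T}|lborel. frechet_derivative ?\<theta> (at t) 1 * mW t) = (LINT t|lborel. mW t * ?m (a - t) - mW t * ?m (b - t))"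
      unfolding set_lebesgue_integral_def
    proof (rule Bochner_Integration.integral_cong)
      fix t
      have sy: "?m (t - a) = ?m (a - t)" "?m (t - b) = ?m (b - t)"
        using mollifier_minus[of h "a - t"] mollifier_minus[of h "b - t"] by simp_all
      have z: "?m (a - t) = 0 \<and> ?m (b - t) = 0" if "t \<notin> {0..T}"
      proof -
        have "\<not> norm (a - t) \<le> h" "\<not> norm (b - t) \<le> h" using that h assms t1 by (auto simp: abs_if field_simps)
        then show ?thesis using mollifier_support[OF h(1)] by blast
      qed
      have fd: "frechet_derivative ?\<theta> (at t) 1 = ?m (a - t) - ?m (b - t)"
        using convolve_indicator_derivative[OF h(1) less_imp_le[OF assms(2)], of t] sy by simp
      show "indicator {0..T} t *\<^sub>R (frechet_derivative ?\<theta> (at t) 1 * mW t) = mW t * ?m (a - t) - mW t * ?m (b - t)"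
        unfolding fd using z by (cases "t \<in> {0..T}") (auto simp: algebra_simps)
    qed simp
    moreover have "(LINT t|lborel. mW t * ?m (a - t) - mW t * ?m (b - t)) = convolve mW ?m a - convolve mW ?m b"
      unfolding convolve_def
      by (rule Bochner_Integration.integral_diff) (rule convolve_integrable[OF mb mW_bounded tm])+
    ultimately show ?thesis by simp
  qed
  have "\<bar>mW a - mW b\<bar> \<le> 0"
  proof (rule field_le_epsilon)
    fix e :: real assume e: "0 < e"
    have "\<exists>d>0. \<forall>y. dist y s < d \<longrightarrow> dist (mW y) (mW s) < e / 2" for s
      using mW_continuous e unfolding continuous_on_iff by (meson UNIV_I half_gt_zero)
    then obtain d1 d2 where d: "0 < d1" "0 < d2" "\<And>y. dist y a < d1 \<Longrightarrow> dist (mW y) (mW a) < e / 2"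
      "\<And>y. dist y b < d2 \<Longrightarrow> dist (mW y) (mW b) < e / 2" by meson
    define h where "h = min (min (a / 2) ((t1 - b) / 2)) (min (d1 / 2) (d2 / 2))"
    have "h \<le> min (a / 2) ((t1 - b) / 2)" "h \<le> min (d1 / 2) (d2 / 2)"
      unfolding h_def by (rule min.cobounded1 min.cobounded2)+
    then have h: "0 < h" "h \<le> a / 2" "h \<le> (t1 - b) / 2" "h < d1" "h < d2"
      using assms d(1,2) by (auto simp: h_def)
    have "\<bar>convolve mW (mollifier h) a - mW a\<bar> \<le> e / 2"
      by (rule convolve_mollifier_close[OF h(1) mb mW_bounded])
        (use d(3) h in \<open>force simp: dist_real_def intro: less_imp_le\<close>)
    moreover have "\<bar>convolve mW (mollifier h) b - mW b\<bar> \<le> e / 2"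
      by (rule convolve_mollifier_close[OF h(1) mb mW_bounded])
        (use d(4) h in \<open>force simp: dist_real_def intro: less_imp_le\<close>)
    ultimately show "\<bar>mW a - mW b\<bar> \<le> 0 + e"
      using conv_eq[OF h(1-3)] by linarith
  qed
  then show ?thesis by simp
qed

lemma transport_identity: "(LINT x|\<mu> t1. \<phi> x) = (LINT x|\<mu> 0. \<phi> (psi 0 x t1))"
proof -
  have const: "mW s = mW (t1 / 2)" if "s \<in> {0<..<t1}" for s
  proof (cases s "t1 / 2" rule: linorder_cases)
    case less
    then show ?thesis using that t1 by (intro mW_eq) auto
  next
    case greater
    then show ?thesis using that t1 by (intro mW_eq[symmetric]) auto
  next
    case equal
    then show ?thesis by (simp only:)
  qed
  \<comment> \<open>Test functions see only the open interval; continuity carries the constancy to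
    both end points.\<close>
  have cl: "closure {0<..<t1} = {0..t1}" using t1 by simp
  have "mW s = mW (t1 / 2)" if "s \<in> {0..t1}" for s
    by (rule continuous_constant_on_closure[OF continuous_on_subset[OF mW_continuous subset_UNIV] const])
      (assumption, subst cl, rule that)
  from this[of 0] this[of t1] have "mW t1 = mW 0" using t1 by simp
  then show ?thesis
    using t1 T by (simp add: mW_def pullback_def clampT_eq)
qed

end

section \<open>The density as image of its initial value under the flow\<close>

context mean_field
begin

lemma psi_joint_lipschitz:
  assumes "0 \<le> \<sigma>" "\<sigma> \<le> T" "0 \<le> \<tau>" "\<tau> \<le> T"
  shows "norm (psi 0 x \<sigma> - psi 0 y \<tau>) \<le> norm (x - y) * exp (\<Lambda> * T) + Umax * \<bar>\<sigma> - \<tau>\<bar>"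
proof -
  have "norm (psi 0 x \<sigma> - psi 0 y \<sigma>) \<le> norm (x - y) * exp (\<Lambda> * \<sigma>)"
    by (rule psi_lipschitz[OF assms(1)])
  also have "\<dots> \<le> norm (x - y) * exp (\<Lambda> * T)"
    using assms Lambda_nonneg by (intro mult_left_mono) (auto simp: mult_left_mono)
  finally show ?thesis
    using psi_time_lipschitz[OF assms(1,3), of 0 y] norm_triangle_ineq[of "psi 0 x \<sigma> - psi 0 y \<sigma>" "psi 0 y \<sigma> - psi 0 y \<tau>"]
    by simp
qed

definition Y :: "real \<Rightarrow> real^'n \<Rightarrow> real^'n" where "Y t y = psi 0 y (clampT t)"

lemma Y_continuous: "continuous_on UNIV (\<lambda>p. Y (fst p) (snd p))"
proof -
  have "(exp (\<Lambda> * T) + Umax)-lipschitz_on UNIV (\<lambda>p. Y (fst p) (snd p))"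
  proof (rule lipschitz_onI)
    fix p q :: "real \<times> (real^'n)"
    have "norm (Y (fst p) (snd p) - Y (fst q) (snd q)) \<le> norm (snd p - snd q) * exp (\<Lambda> * T) + Umax * \<bar>clampT (fst p) - clampT (fst q)\<bar>"
      unfolding Y_def by (rule psi_joint_lipschitz) (use clampT_in in auto)
    also have "\<dots> \<le> dist p q * exp (\<Lambda> * T) + Umax * dist p q"
    proof (intro add_mono mult_right_mono mult_left_mono Umax_nonneg)
      show "norm (snd p - snd q) \<le> dist p q" using dist_snd_le[of p q] by (simp add: dist_norm)
      have "\<bar>clampT (fst p) - clampT (fst q)\<bar> \<le> \<bar>fst p - fst q\<bar>" by (auto simp: clampT_def)
      then show "\<bar>clampT (fst p) - clampT (fst q)\<bar> \<le> dist p q" using dist_fst_le[of p q] by (simp add: dist_norm)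
    qed simp
    finally show "dist (Y (fst p) (snd p)) (Y (fst q) (snd q)) \<le> (exp (\<Lambda> * T) + Umax) * dist p q"
      by (simp add: dist_norm algebra_simps)
  qed (use Umax_nonneg in simp)
  then show ?thesis by (rule lipschitz_on_continuous_on)
qed

lemma Y_measurable [measurable]:
  assumes [measurable]: "f \<in> borel_measurable M" "g \<in> borel_measurable M"
  shows "(\<lambda>s. Y (f s) (g s)) \<in> borel_measurable M"
proof -
  have "(\<lambda>s. (f s, g s)) \<in> borel_measurable M"
    by (rule borel_measurable_Pair) fact+
  from measurable_compose[OF this borel_measurable_continuous_onI[OF Y_continuous]] show ?thesis
    by simp
qed

lemma Y_0: "Y 0 y = y"
  using T by (simp add: Y_def clampT_def)

text \<open>Both measures give the same mean to every Lipschitz observable of bounded support. Time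
  0 is separate because a transported observable needs a positive final time.\<close>

lemma distr_Y:
  assumes t: "t \<in> {0..T}"
  shows "distr (\<mu> 0) borel (Y t) = \<mu> t"
proof (cases "t = 0")
  case True
  then show ?thesis using distr_id2[of borel "\<mu> 0"] by (simp add: Y_0[abs_def] Y_0)
next
  case False
  interpret p0: prob_space "\<mu> 0" by (rule prob_mu) (use T in auto)
  show ?thesis
  proof (rule measure_eqI_lipschitz)
    show "prob_space (distr (\<mu> 0) borel (Y t))"
      by (rule p0.prob_space_distr) measurable
    fix \<phi> :: "real^'n \<Rightarrow> real" and L M R
    assume a: "\<And>x y. \<bar>\<phi> x - \<phi> y\<bar> \<le> L * norm (x - y)" "0 \<le> L" "\<And>x. \<bar>\<phi> x\<bar> \<le> M" "\<And>x. \<phi> x \<noteq> 0 \<Longrightarrow> norm x \<le> R"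
    interpret transported \<kappa> T \<Lambda> \<rho> \<phi> L M R t
      by unfold_locales (use a t False in auto)
    have "L-lipschitz_on UNIV \<phi>" using a by (auto intro!: lipschitz_onI simp: dist_norm)
    then have [measurable]: "\<phi> \<in> borel_measurable borel"
      by (intro borel_measurable_continuous_onI lipschitz_on_continuous_on)
    have "(LINT x|distr (\<mu> 0) borel (Y t). \<phi> x) = (LINT x|\<mu> 0. \<phi> (psi 0 x t))"
      by (subst integral_distr) (use clampT_eq[OF t] in \<open>auto simp: Y_def\<close>)
    then show "(LINT x|distr (\<mu> 0) borel (Y t). \<phi> x) = (LINT x|\<mu> t. \<phi> x)"
      using transport_identity by simp
  qed (use prob_mu[OF t] in auto)
qed

end

section \<open>The particle flow\<close>

text \<open>The number of particles is a variable and not a type. Bounded functions on a discrete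
  index type form a Banach space that holds configurations of any size, so the general existence
  theorem applies.\<close>

instance bcontfun :: (metric_space, banach) banach ..

lemma bounded_linear_apply_bcontfun:
  "bounded_linear (\<lambda>x::'a::topological_space \<Rightarrow>\<^sub>C 'b::real_normed_vector. apply_bcontfun x i)"
proof (rule bounded_linear_intro)
  show "norm (apply_bcontfun x i) \<le> norm x * 1" for x :: "'a \<Rightarrow>\<^sub>C 'b"
    using norm_bounded[of x i] by simp
qed (auto simp: plus_bcontfun.rep_eq scaleR_bcontfun.rep_eq)

text \<open>The diagonal term is kept, as both the gradient and its truncation vanish at 0; this
  makes the double sums symmetric.\<close>

definition force :: "nat \<Rightarrow> (real^'n \<Rightarrow> real^'n) \<Rightarrow> (nat \<Rightarrow> real^'n) \<Rightarrow> nat \<Rightarrow> real^'n" where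
  "force N K X i = - (1 / real N) *\<^sub>R (\<Sum>j<N. K (X i - X j))"

definition solves :: "nat \<Rightarrow> (real^'n \<Rightarrow> real^'n) \<Rightarrow> (real \<Rightarrow> nat \<Rightarrow> real^'n) \<Rightarrow> bool" where
  "solves N K x \<longleftrightarrow> (\<forall>t\<ge>0. \<forall>i<N. ((\<lambda>s. x s i) has_vector_derivative force N K (x t) i) (at t within {0..}))"

lemma solvesD: "solves N K x \<Longrightarrow> 0 \<le> t \<Longrightarrow> i < N \<Longrightarrow>
    ((\<lambda>s. x s i) has_vector_derivative force N K (x t) i) (at t within {0..})"
  by (simp add: solves_def)

lemma norm_force_le:
  assumes "0 < N" "\<And>x. norm (K x) \<le> M"
  shows "norm (force N K X i) \<le> M"
proof -
  have "norm (\<Sum>j<N. K (X i - X j)) \<le> (\<Sum>j<N. M)"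
    by (intro order_trans[OF norm_sum] sum_mono assms(2))
  then show ?thesis using assms(1) by (simp add: force_def field_simps)
qed

lemma norm_force_diff_le:
  assumes N: "0 < N" and K: "\<And>x y. norm (K x - K y) \<le> L * norm (x - y)" and L: "0 \<le> L"
  shows "norm (force N K X i - force N K Y i) \<le> L / real N * (\<Sum>j<N. norm (X i - Y i) + norm (X j - Y j))"
proof -
  have "force N K X i - force N K Y i = - (1 / real N) *\<^sub>R (\<Sum>j<N. K (X i - X j) - K (Y i - Y j))"
    by (simp add: force_def sum_subtractf scaleR_diff_right)
  also have "norm \<dots> \<le> 1 / real N * (\<Sum>j<N. L * (norm (X i - Y i) + norm (X j - Y j)))"
  proof -
    have "norm (K (X i - X j) - K (Y i - Y j)) \<le> L * (norm (X i - Y i) + norm (X j - Y j))" for j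
    proof -
      have "norm (X i - X j - (Y i - Y j)) \<le> norm (X i - Y i) + norm (X j - Y j)"
        using norm_triangle_ineq4[of "X i - Y i" "X j - Y j"] by (simp add: algebra_simps)
      then show ?thesis using K[of "X i - X j" "Y i - Y j"] L by (meson mult_left_mono order_trans)
    qed
    then have "norm (\<Sum>j<N. K (X i - X j) - K (Y i - Y j)) \<le> (\<Sum>j<N. L * (norm (X i - Y i) + norm (X j - Y j)))"
      by (intro order_trans[OF norm_sum] sum_mono)
    then show ?thesis by (simp add: divide_right_mono)
  qed
  finally show ?thesis by (simp add: sum_distrib_left[symmetric])
qed

lemma solution_exists_lipschitz:
  fixes K :: "real^'n \<Rightarrow> real^'n"
  assumes N: "0 < N" and K: "\<And>x y. norm (K x - K y) \<le> L * norm (x - y)" and L: "0 \<le> L"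
    and M: "\<And>x. norm (K x) \<le> M"
  shows "\<exists>x. (\<forall>i<N. x 0 i = X i) \<and> solves N K x"
proof -
  \<comment> \<open>A configuration is extended by 0 beyond \<open>N\<close>. Every function on a
    discrete space is continuous, so only boundedness needs an argument.\<close>
  define ext :: "(nat \<Rightarrow> real^'n) \<Rightarrow> nat discrete \<Rightarrow>\<^sub>C (real^'n)" where "ext h = Bcontfun (\<lambda>k. if of_discrete k < N then h (of_discrete k) else 0)" for h
  have ext: "apply_bcontfun (ext h) k = (if of_discrete k < N then h (of_discrete k) else 0)" for h k
  proof -
    have "(\<lambda>k. if of_discrete k < N then h (of_discrete k) else 0) \<in> bcontfun"
    proof (rule bcontfun_normI)
      show "norm (if of_discrete k < N then h (of_discrete k) else 0) \<le> (\<Sum>j<N. norm (h j))" for k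
        by (auto intro!: member_le_sum sum_nonneg)
      show "continuous_on UNIV (\<lambda>k. if of_discrete k < N then h (of_discrete k) else 0)"
        unfolding continuous_on_open_vimage[OF open_UNIV] by (intro allI impI Discrete_Topology.open_discrete)
    qed
    then show ?thesis by (simp add: ext_def Bcontfun_inverse)
  qed
  define ev :: "(nat discrete \<Rightarrow>\<^sub>C (real^'n)) \<Rightarrow> nat \<Rightarrow> real^'n" where "ev x i = apply_bcontfun x (discrete i)" for x i
  have ev_ext: "i < N \<Longrightarrow> ev (ext h) i = h i" for h i by (simp add: ev_def ext discrete_inverse)
  let ?f = "\<lambda>x. ext (force N K (ev x))"
  have lip: "norm (?f x - ?f y) \<le> (2 * L) * norm (x - y)" for x y
  proof -
    have "dist (?f x) (?f y) \<le> 2 * L * norm (x - y)"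
    proof (rule dist_bound)
      fix k :: "nat discrete"
      let ?i = "of_discrete k"
      have d: "norm (ev x j - ev y j) \<le> norm (x - y)" for j
        using dist_bounded[of x "discrete j" y] by (simp add: dist_norm ev_def)
      have "L / real N * (\<Sum>j<N. norm (ev x ?i - ev y ?i) + norm (ev x j - ev y j))
          \<le> L / real N * (\<Sum>j<N. norm (x - y) + norm (x - y))"
        using L by (intro mult_left_mono sum_mono add_mono d) auto
      also have "\<dots> = 2 * L * norm (x - y)" using N by simp
      finally show "dist (apply_bcontfun (?f x) k) (apply_bcontfun (?f y) k) \<le> 2 * L * norm (x - y)"
        using norm_force_diff_le[OF N K L, of "ev x" ?i "ev y"] L by (simp add: ext dist_norm)
    qed
    then show ?thesis by (simp add: dist_norm)
  qed
  have bnd: "norm (?f x) \<le> M" for x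
  proof -
    have "0 \<le> M" using M[of 0] norm_ge_zero order_trans by blast
    then have "dist (?f x) 0 \<le> M"
      using norm_force_le[OF N M] by (intro dist_bound) (simp add: ext dist_norm)
    then show ?thesis by (simp add: dist_norm)
  qed
  have cont: "continuous_on UNIV (\<lambda>p::real \<times> (nat discrete \<Rightarrow>\<^sub>C (real^'n)). ?f (snd p))"
  proof (rule continuous_on_compose2[where f=snd and t=UNIV])
    have "(2 * L)-lipschitz_on UNIV ?f"
      by (rule lipschitz_onI) (use lip L in \<open>auto simp: dist_norm\<close>)
    then show "continuous_on UNIV ?f" by (rule lipschitz_on_continuous_on)
  qed (auto intro: continuous_intros)
  have L2: "0 \<le> 2 * L" using L by simp
  from ode_exists[of "\<lambda>_. ?f", OF cont bnd lip L2, of "ext X"] obtain z where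
    z: "z 0 = ext X" "\<And>t. 0 \<le> t \<Longrightarrow> (z has_vector_derivative ?f (z t)) (at t within {0..})" by blast
  show ?thesis
  proof (intro exI[of _ "\<lambda>t. ev (z t)"] conjI)
    show "\<forall>i<N. ev (z 0) i = X i" by (simp add: z ev_ext)
    show "solves N K (\<lambda>t. ev (z t))"
      unfolding solves_def
    proof (intro allI impI)
      fix t :: real and i assume "0 \<le> t" "i < N"
      then show "((\<lambda>s. ev (z s) i) has_vector_derivative force N K (ev (z t)) i) (at t within {0..})"
        using bounded_linear.has_vector_derivative[OF bounded_linear_apply_bcontfun z(2), of t "discrete i"]
        unfolding ev_def[symmetric] by (simp add: ev_ext)
    qed
  qed
qed

lemma has_real_derivative_inner_self:
  fixes z :: "real \<Rightarrow> 'a::real_inner"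
  assumes "(z has_vector_derivative d) (at t within S)"
  shows "((\<lambda>s. z s \<bullet> z s) has_real_derivative 2 * (z t \<bullet> d)) (at t within S)"
proof -
  have D: "(z has_derivative (\<lambda>h. h *\<^sub>R d)) (at t within S)"
    using assms by (simp add: has_vector_derivative_def)
  show ?thesis
    unfolding has_field_derivative_def
    by (rule has_derivative_eq_rhs[OF has_derivative_inner[OF D D]])
      (simp add: fun_eq_iff inner_commute[of d])
qed

text \<open>Gronwall for the sum of squares:
  \<open>2 * a * (a + b) \<le> 3 * a\<^sup>2 + b\<^sup>2\<close> turns the coupled errors into sums
  of squares, and averaging over the partners gives the rate \<open>4 * L\<close>, free of
  \<open>N\<close>.\<close>

lemma solution_stable:
  fixes K :: "real^'n \<Rightarrow> real^'n"
  assumes N: "0 < N" and K: "\<And>x y. norm (K x - K y) \<le> L * norm (x - y)" and L: "0 \<le> L"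
    and x: "solves N K x" and y: "solves N K y" and t: "0 \<le> t"
  shows "(\<Sum>i<N. (norm (x t i - y t i))\<^sup>2) \<le> exp (4 * L * t) * (\<Sum>i<N. (norm (x 0 i - y 0 i))\<^sup>2)"
proof -
  let ?e = "\<lambda>t i. x t i - y t i" and ?d = "\<lambda>t i. force N K (x t) i - force N K (y t) i"
  define q where "q t = (\<Sum>i<N. ?e t i \<bullet> ?e t i)" for t
  have Dq: "(q has_real_derivative (\<Sum>i<N. 2 * (?e t i \<bullet> ?d t i))) (at t within {0..})" if "0 \<le> t" for t
    unfolding q_def
    by (intro DERIV_sum has_real_derivative_inner_self has_vector_derivative_diff solvesD x y that) auto
  have le: "(\<Sum>i<N. 2 * (?e t i \<bullet> ?d t i)) \<le> 4 * L * q t" for t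
  proof -
    let ?n = "\<lambda>i. norm (?e t i)"
    have "2 * (?e t i \<bullet> ?d t i) \<le> L / real N * (\<Sum>j<N. 3 * (?n i)\<^sup>2 + (?n j)\<^sup>2)" for i
    proof -
      have "?e t i \<bullet> ?d t i \<le> ?n i * norm (?d t i)" by (rule norm_cauchy_schwarz)
      also have "\<dots> \<le> ?n i * (L / real N * (\<Sum>j<N. ?n i + ?n j))"
        by (intro mult_left_mono norm_force_diff_le[OF N K L]) simp
      finally have "2 * (?e t i \<bullet> ?d t i) \<le> 2 * (?n i * (L / real N * (\<Sum>j<N. ?n i + ?n j)))"
        by simp
      also have "\<dots> = L / real N * (\<Sum>j<N. 2 * (?n i * (?n i + ?n j)))"
        by (simp add: sum_distrib_left mult_ac)
      also have "\<dots> \<le> L / real N * (\<Sum>j<N. 3 * (?n i)\<^sup>2 + (?n j)\<^sup>2)"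
      proof (intro mult_left_mono sum_mono)
        show "2 * (?n i * (?n i + ?n j)) \<le> 3 * (?n i)\<^sup>2 + (?n j)\<^sup>2" for j
          using zero_le_power2[of "?n i - ?n j"] by (simp add: power2_eq_square algebra_simps)
      qed (use L in simp)
      finally show ?thesis .
    qed
    then have "(\<Sum>i<N. 2 * (?e t i \<bullet> ?d t i)) \<le> (\<Sum>i<N. L / real N * (\<Sum>j<N. 3 * (?n i)\<^sup>2 + (?n j)\<^sup>2))"
      by (intro sum_mono)
    also have "\<dots> = L / real N * (\<Sum>i<N. \<Sum>j<N. 3 * (?n i)\<^sup>2 + (?n j)\<^sup>2)"
      by (rule sum_distrib_left[symmetric])
    also have "(\<Sum>i<N. \<Sum>j<N. 3 * (?n i)\<^sup>2 + (?n j)\<^sup>2) = 4 * real N * (\<Sum>i<N. (?n i)\<^sup>2)"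
      by (simp add: sum.distrib sum_distrib_left[symmetric])
    also have "L / real N * (4 * real N * (\<Sum>i<N. (?n i)\<^sup>2)) = 4 * L * q t"
      using N by (simp add: q_def power2_norm_eq_inner)
    finally show ?thesis .
  qed
  define \<phi> where "\<phi> t = exp (- (4 * L) * t) * q t" for t
  have "\<phi> t \<le> \<phi> 0"
  proof (rule nonincreasing_halfline[where \<phi>=\<phi>])
    fix s :: real assume s: "0 \<le> s"
    let ?q' = "\<Sum>i<N. 2 * (?e s i \<bullet> ?d s i)"
    have De: "((\<lambda>s. exp (- (4 * L) * s)) has_real_derivative exp (- (4 * L) * s) * (- (4 * L))) (at s within {0..})"
      by (auto intro!: derivative_eq_intros)
    from DERIV_mult[OF De Dq[OF s]]
    show "(\<phi> has_real_derivative exp (- (4 * L) * s) * (?q' - 4 * L * q s)) (at s within {0..})"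
      unfolding \<phi>_def by (rule DERIV_cong) algebra
    show "exp (- (4 * L) * s) * (?q' - 4 * L * q s) \<le> 0"
      using le[of s] by (intro mult_nonneg_nonpos) auto
  qed (use t in auto)
  then have "exp (4 * L * t) * (exp (- (4 * L) * t) * q t) \<le> exp (4 * L * t) * q 0"
    by (intro mult_left_mono) (auto simp: \<phi>_def)
  then have "q t \<le> exp (4 * L * t) * q 0"
    by (simp add: mult.assoc[symmetric] exp_add[symmetric])
  then show ?thesis by (simp add: q_def power2_norm_eq_inner)
qed

lemma has_real_derivative_compose_vector:
  fixes G :: "'a::real_normed_vector \<Rightarrow> real"
  assumes "(z has_vector_derivative d) (at t within S)" "(G has_derivative G') (at (z t))"
  shows "((\<lambda>s. G (z s)) has_real_derivative G' d) (at t within S)"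
proof -
  have "((\<lambda>s. G (z s)) has_derivative (\<lambda>h. G' (h *\<^sub>R d))) (at t within S)"
    by (rule has_derivative_compose[OF assms(1)[unfolded has_vector_derivative_def] assms(2)])
  then show ?thesis
    unfolding has_field_derivative_def
    by (rule has_derivative_eq_rhs) (simp add: fun_eq_iff linear_simps(5)[OF has_derivative_bounded_linear[OF assms(2)]])
qed

text \<open>Since the kernel is odd, swapping the indices shows that both velocity terms contribute
  equally; each sum of kernels is a multiple of the force, so the total is minus a sum of squares.
  The dynamics is a gradient flow.\<close>

lemma interaction_power:
  assumes odd: "\<And>z. K (- z) = - K z" and N: "0 < N"
  shows "(\<Sum>i<N. \<Sum>j<N. K (X i - X j) \<bullet> (force N K X i - force N K X j)) = - 2 * real N * (\<Sum>i<N. (norm (force N K X i))\<^sup>2)"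
proof -
  let ?v = "force N K X"
  have S: "(\<Sum>j<N. K (X i - X j)) = - real N *\<^sub>R ?v i" for i
    using N by (simp add: force_def)
  have 1: "(\<Sum>i<N. \<Sum>j<N. K (X i - X j) \<bullet> ?v i) = - real N * (\<Sum>i<N. (norm (?v i))\<^sup>2)"
    unfolding inner_sum_left[symmetric] S by (simp add: power2_norm_eq_inner sum_negf sum_distrib_left)
  have "(\<Sum>i<N. \<Sum>j<N. K (X i - X j) \<bullet> ?v j) = (\<Sum>j<N. \<Sum>i<N. - (K (X j - X i) \<bullet> ?v j))"
  proof (subst sum.swap, intro sum.cong refl)
    show "K (X i - X j) \<bullet> ?v j = - (K (X j - X i) \<bullet> ?v j)" for i j
      using odd[of "X j - X i"] by simp
  qed
  also have "\<dots> = real N * (\<Sum>i<N. (norm (?v i))\<^sup>2)"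
    unfolding sum_negf inner_sum_left[symmetric] S by (simp add: power2_norm_eq_inner sum_negf sum_distrib_left)
  finally show ?thesis
    using 1 by (simp add: inner_diff_right sum_subtractf)
qed

lemma interaction_energy_deriv:
  assumes x: "solves N K x" and t: "0 \<le> t" and odd: "\<And>z. K (- z) = - K z" and N: "0 < N"
    and G: "\<And>i j. i < N \<Longrightarrow> j < N \<Longrightarrow> i \<noteq> j \<Longrightarrow> (G has_derivative (\<lambda>v. K (x t i - x t j) \<bullet> v)) (at (x t i - x t j))"
  shows "((\<lambda>s. \<Sum>i<N. \<Sum>j<N. G (x s i - x s j)) has_real_derivative
    - 2 * real N * (\<Sum>i<N. (norm (force N K (x t) i))\<^sup>2)) (at t within {0..})"
proof -
  have "((\<lambda>s. G (x s i - x s j)) has_real_derivative K (x t i - x t j) \<bullet> (force N K (x t) i - force N K (x t) j)) (at t within {0..})"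
    if ij: "i < N" "j < N" for i j
  proof (cases "i = j")
    case False
    have "(G has_derivative (\<lambda>v. K (x t i - x t j) \<bullet> v)) (at (x t i - x t j))"
      using G[OF ij False] .
    from has_real_derivative_compose_vector[OF has_vector_derivative_diff[OF solvesD[OF x t ij(1)] solvesD[OF x t ij(2)]] this]
    show ?thesis .
  qed simp
  then show ?thesis
    unfolding interaction_power[of K N "x t", OF odd N, symmetric] by (intro DERIV_sum) auto
qed


definition pair_energy :: "nat \<Rightarrow> (real^'n \<Rightarrow> real) \<Rightarrow> (nat \<Rightarrow> real^'n) \<Rightarrow> real" where
  "pair_energy N G X = (\<Sum>i<N. \<Sum>j\<in>{..<N} - {i}. G (X i - X j))"

lemma pair_energy_full: "(\<Sum>i<N. \<Sum>j<N. G (X i - X j)) = pair_energy N G X + real N * G 0"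
  by (simp add: pair_energy_def sum.remove[of "{..<N}"] sum.distrib)

text \<open>The full double sum differs only by the constant \<open>real N * G 0\<close>, whatever
  value \<open>G\<close> has at the origin.\<close>

lemma pair_energy_deriv:
  assumes "solves N K x" "0 \<le> t" "\<And>z. K (- z) = - K z" "0 < N"
    "\<And>i j. i < N \<Longrightarrow> j < N \<Longrightarrow> i \<noteq> j \<Longrightarrow> (G has_derivative (\<lambda>v. K (x t i - x t j) \<bullet> v)) (at (x t i - x t j))"
  shows "((\<lambda>s. pair_energy N G (x s)) has_real_derivative
    - 2 * real N * (\<Sum>i<N. (norm (force N K (x t) i))\<^sup>2)) (at t within {0..})"
proof -
  have "pair_energy N G X = (\<Sum>i<N. \<Sum>j<N. G (X i - X j)) - real N * G 0" for X
    by (simp add: pair_energy_full)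
  then show ?thesis
    using DERIV_diff[OF interaction_energy_deriv[OF assms] DERIV_const] by simp
qed

lemma pair_energy_decreasing:
  assumes x: "solves N K x" and t: "0 \<le> t" and odd: "\<And>z. K (- z) = - K z" and N: "0 < N"
    and G: "\<And>s i j. 0 \<le> s \<Longrightarrow> i < N \<Longrightarrow> j < N \<Longrightarrow> i \<noteq> j \<Longrightarrow> (G has_derivative (\<lambda>v. K (x s i - x s j) \<bullet> v)) (at (x s i - x s j))"
  shows "pair_energy N G (x t) \<le> pair_energy N G (x 0)"
  by (rule nonincreasing_halfline[OF pair_energy_deriv[OF x _ odd N G]])
    (use t in \<open>auto intro!: mult_nonneg_nonneg sum_nonneg\<close>)

lemma pair_energy_ge_term:
  assumes "\<And>z. 0 \<le> G z" "i < N" "j < N" "i \<noteq> j"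
  shows "G (X i - X j) \<le> pair_energy N G X"
proof -
  have "G (X i - X j) \<le> (\<Sum>j\<in>{..<N} - {i}. G (X i - X j))"
    using assms by (intro member_le_sum[of j]) auto
  also have "\<dots> \<le> pair_energy N G X"
    unfolding pair_energy_def using assms by (intro member_le_sum[of i]) (auto intro: sum_nonneg)
  finally show ?thesis .
qed

section \<open>Existence and uniqueness for the singular particle system\<close>

locale particles = mean_field \<kappa> T \<Lambda> \<rho>
  for \<kappa> T \<Lambda> :: real and \<rho> :: "real \<Rightarrow> real^'n \<Rightarrow> real" +
  fixes N :: nat
  assumes N2: "2 \<le> N"
begin

lemma N0: "0 < N" using N2 by simp

abbreviation vel :: "(nat \<Rightarrow> real^'n) \<Rightarrow> nat \<Rightarrow> real^'n" where
  "vel X i \<equiv> force N (ygrad \<kappa>) X i"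

lemma vel_eq:
  assumes "X \<notin> collisions N" "i < N"
  shows "- (1 / real N) *\<^sub>R (\<Sum>j\<in>{..<N} - {i}. grad (yukawa \<kappa>) (X i - X j)) = vel X i"
proof -
  have "(\<Sum>j\<in>{..<N} - {i}. grad (yukawa \<kappa>) (X i - X j)) = (\<Sum>j\<in>{..<N} - {i}. ygrad \<kappa> (X i - X j))"
    using assms by (intro sum.cong refl grad_yukawa[OF kappa]) (auto simp: collisions_def)
  also have "\<dots> = (\<Sum>j<N. ygrad \<kappa> (X i - X j))"
    using assms by (simp add: sum.remove[of "{..<N}" i])
  finally show ?thesis by (simp add: force_def)
qed

lemma trajectory_iff:
  fixes X :: "nat \<Rightarrow> real^'n"
  shows "trajectory \<kappa> N X x \<longleftrightarrow> x 0 = X \<and> (\<forall>t\<ge>0. x t \<in> space (config_space N) \<and> x t \<notin> collisions N) \<and> solves N (ygrad \<kappa>) x"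
proof -
  have "(\<forall>i<N. ((\<lambda>s. x s i) has_vector_derivative
      - (1 / real N) *\<^sub>R (\<Sum>j\<in>{..<N} - {i}. grad (yukawa \<kappa>) (x t i - x t j))) (at t within {0..})) \<longleftrightarrow>
    (\<forall>i<N. ((\<lambda>s. x s i) has_vector_derivative vel (x t) i) (at t within {0..}))" if "x t \<notin> collisions N" for t
    using vel_eq[OF that] by (metis (no_types, lifting))
  then show ?thesis unfolding trajectory_def solves_def by meson
qed

text \<open>Below the level \<open>prof \<kappa> d 0 \<delta>\<close> of the energy no two particles come closer than
  \<open>sqrt \<delta>\<close>, and the truncation of the kernel at this distance is never felt.\<close>

definition safe :: "real \<Rightarrow> (nat \<Rightarrow> real^'n) \<Rightarrow> bool" where
  "safe \<delta> X \<longleftrightarrow> 0 < \<delta> \<and> (\<forall>i<N. \<forall>j<N. i \<noteq> j \<longrightarrow> \<delta> \<le> (norm (X i - X j))\<^sup>2) \<and>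
     pair_energy N (ypot \<kappa>) X < prof \<kappa> CARD('n) 0 \<delta>"

lemma ypot_nonneg_nonzero: "z \<noteq> 0 \<Longrightarrow> 0 \<le> ypot \<kappa> (z :: real^'n)"
  unfolding ypot_def by (intro less_imp_le prof_pos kappa) simp

lemma pair_energy_cong:
  assumes "\<And>i j. i < N \<Longrightarrow> j < N \<Longrightarrow> i \<noteq> j \<Longrightarrow> G (X i - X j) = H (X i - X j)"
  shows "pair_energy N G X = pair_energy N H X"
  unfolding pair_energy_def by (intro sum.cong refl) (use assms in auto)

text \<open>The truncated energy decreases, and initially it equals the true energy because the
  configuration is separated. A single pair at squared distance at most \<open>\<delta>\<close>
  would already cost the profile at \<open>\<delta>\<close>, which exceeds that initial
  energy.\<close>

lemma truncated_solution_safe: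
  assumes X: "safe \<delta> X" and x: "solves N (tgrad \<kappa> \<delta>) x" and x0: "\<And>i. i < N \<Longrightarrow> x 0 i = X i" and t: "0 \<le> t"
    and ij: "i < N" "j < N" "i \<noteq> j"
  shows "\<delta> < (norm (x t i - x t j))\<^sup>2"
proof (rule ccontr)
  have \<delta>: "0 < \<delta>" using X by (simp add: safe_def)
  assume "\<not> ?thesis"
  then have "prof \<kappa> CARD('n) 0 \<delta> \<le> tpot \<kappa> \<delta> (x t i - x t j)"
    by (intro tpot_ge kappa \<delta>) simp
  also have "\<dots> \<le> pair_energy N (tpot \<kappa> \<delta>) (x t)"
    by (rule pair_energy_ge_term[OF tpot_nonneg[OF kappa \<delta>] ij])
  also have "\<dots> \<le> pair_energy N (tpot \<kappa> \<delta>) (x 0)"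
    by (rule pair_energy_decreasing[OF x t tgrad_minus N0 tpot_has_derivative[OF kappa \<delta>]])
  also have "\<dots> = pair_energy N (tpot \<kappa> \<delta>) X"
    by (simp add: pair_energy_def x0)
  also have "\<dots> = pair_energy N (ypot \<kappa>) X"
    using X by (intro pair_energy_cong tpot_eq_ypot) (auto simp: safe_def)
  finally show False using X by (simp add: safe_def)
qed

lemma trajectory_safe:
  assumes X: "safe \<delta> X" and x: "trajectory \<kappa> N X x" and t: "0 \<le> t" and ij: "i < N" "j < N" "i \<noteq> j"
  shows "\<delta> < (norm (x t i - x t j))\<^sup>2"
proof (rule ccontr)
  have \<delta>: "0 < \<delta>" using X by (simp add: safe_def)
  have nc: "x s i \<noteq> x s j" if "0 \<le> s" "i < N" "j < N" "i \<noteq> j" for s i j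
    using x that unfolding trajectory_iff collisions_def by blast
  \<comment> \<open>Positivity of the potential is known only off the origin; changing it there
    makes it nonnegative everywhere, as the bound by one pair requires, and does not affect
    collision-free configurations.\<close>
  define G where "G z = (if z = 0 then 0 else ypot \<kappa> z)" for z :: "real^'n"
  have G0: "0 \<le> G z" for z by (simp add: G_def ypot_nonneg_nonzero)
  have eq: "pair_energy N G (x s) = pair_energy N (ypot \<kappa>) (x s)" if "0 \<le> s" for s
    by (rule pair_energy_cong) (use nc[OF that] in \<open>auto simp: G_def\<close>)
  assume "\<not> ?thesis"
  then have "prof \<kappa> CARD('n) 0 \<delta> \<le> ypot \<kappa> (x t i - x t j)"
    unfolding ypot_def using nc[OF t ij] by (intro prof_antimono kappa) auto
  also have "\<dots> = G (x t i - x t j)" using nc[OF t ij] by (simp add: G_def)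
  also have "\<dots> \<le> pair_energy N G (x t)"
    by (rule pair_energy_ge_term[OF G0 ij])
  also have "\<dots> = pair_energy N (ypot \<kappa>) (x t)" by (rule eq[OF t])
  also have "\<dots> \<le> pair_energy N (ypot \<kappa>) (x 0)"
  proof (rule pair_energy_decreasing[where K="ygrad \<kappa>", OF _ t _ N0])
    show "ygrad \<kappa> (- z) = - ygrad \<kappa> z" for z :: "real^'n" by (rule ygrad_minus)
    show "solves N (ygrad \<kappa>) x" using x by (simp add: trajectory_iff)
    show "(ypot \<kappa> has_derivative (\<lambda>v. ygrad \<kappa> (x s i - x s j) \<bullet> v)) (at (x s i - x s j))"
      if "0 \<le> s" "i < N" "j < N" "i \<noteq> j" for s i j
      using nc[OF that] by (intro ypot_has_derivative kappa) simp
  qed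
  also have "x 0 = X" using x by (simp add: trajectory_iff)
  finally show False using X by (simp add: safe_def)
qed

lemma force_truncated_eq:
  assumes "\<And>i j. i < N \<Longrightarrow> j < N \<Longrightarrow> i \<noteq> j \<Longrightarrow> \<delta> < (norm (X i - X j))\<^sup>2" "i < N"
  shows "force N (tgrad \<kappa> \<delta>) X i = vel X i"
proof -
  have "tgrad \<kappa> \<delta> (X i - X j) = ygrad \<kappa> (X i - X j)" if "j < N" for j
    using assms(1)[OF assms(2) that] tgrad_eq_ygrad[of \<delta> "X i - X j"]
    by (cases "i = j") (auto simp: tgrad_def)
  then show ?thesis by (simp add: force_def)
qed

lemma solves_restrict:
  assumes "solves N K x" shows "solves N K (\<lambda>t. restrict (x t) {..<N})"
  unfolding solves_def
proof (intro allI impI)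
  fix t :: real and i assume ti: "0 \<le> t" "i < N"
  have "force N K (restrict (x t) {..<N}) i = force N K (x t) i"
    using ti by (simp add: force_def)
  moreover have "(\<lambda>s. restrict (x s) {..<N} i) = (\<lambda>s. x s i)" using ti by simp
  ultimately show "((\<lambda>s. restrict (x s) {..<N} i) has_vector_derivative force N K (restrict (x t) {..<N}) i) (at t within {0..})"
    using solvesD[OF assms ti] by simp
qed

definition tsol :: "real \<Rightarrow> (nat \<Rightarrow> real^'n) \<Rightarrow> real \<Rightarrow> nat \<Rightarrow> real^'n" where
  "tsol \<delta> X = (SOME x. (\<forall>i<N. x 0 i = X i) \<and> solves N (tgrad \<kappa> \<delta>) x)"

lemma tsol:
  assumes "0 < \<delta>"
  shows "i < N \<Longrightarrow> tsol \<delta> X 0 i = X i" and "solves N (tgrad \<kappa> \<delta>) (tsol \<delta> X)"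
proof -
  from tgrad_lipschitz[OF kappa assms, where 'n='n] obtain L where
    L: "0 \<le> L" "\<forall>x y::real^'n. norm (tgrad \<kappa> \<delta> x - tgrad \<kappa> \<delta> y) \<le> L * norm (x - y)" by blast
  from tgrad_bounded[OF kappa assms, where 'n='n] obtain M where
    M: "\<forall>x::real^'n. norm (tgrad \<kappa> \<delta> x) \<le> M" by blast
  have "\<exists>x. (\<forall>i<N. x 0 i = X i) \<and> solves N (tgrad \<kappa> \<delta>) x"
    by (rule solution_exists_lipschitz[OF N0 L(2)[rule_format] L(1) M[rule_format]])
  then have "(\<forall>i<N. tsol \<delta> X 0 i = X i) \<and> solves N (tgrad \<kappa> \<delta>) (tsol \<delta> X)"
    unfolding tsol_def by (rule someI_ex)
  then show "i < N \<Longrightarrow> tsol \<delta> X 0 i = X i" "solves N (tgrad \<kappa> \<delta>) (tsol \<delta> X)" by blast+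
qed

lemma space_config: "X \<in> space (config_space N :: (nat \<Rightarrow> real^'n) measure) \<longleftrightarrow> X \<in> extensional {..<N}"
  by (simp add: space_PiM PiE_def)

lemma trajectory_tsol:
  assumes X: "safe \<delta> X" "X \<in> space (config_space N)"
  shows "trajectory \<kappa> N X (\<lambda>t. restrict (tsol \<delta> X t) {..<N})"
  unfolding trajectory_iff
proof (intro conjI allI impI)
  have \<delta>: "0 < \<delta>" using X by (simp add: safe_def)
  note ts = tsol(1)[OF \<delta>, of _ X] tsol(2)[OF \<delta>, of X]
  have sep: "\<delta> < (norm (tsol \<delta> X t i - tsol \<delta> X t j))\<^sup>2" if "0 \<le> t" "i < N" "j < N" "i \<noteq> j" for t i j
    by (rule truncated_solution_safe[OF X(1) ts(2) ts(1) that])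
  show "restrict (tsol \<delta> X 0) {..<N} = X"
    using X(2) ts(1) unfolding space_config by (auto simp: fun_eq_iff restrict_def extensional_def)
  fix t :: real assume t: "0 \<le> t"
  show "restrict (tsol \<delta> X t) {..<N} \<in> space (config_space N)" by (simp add: space_config)
  show "restrict (tsol \<delta> X t) {..<N} \<notin> collisions N"
    using sep[OF t] \<delta> by (force simp: collisions_def)
next
  have \<delta>: "0 < \<delta>" using X by (simp add: safe_def)
  note ts = tsol(1)[OF \<delta>, of _ X] tsol(2)[OF \<delta>, of X]
  have "solves N (ygrad \<kappa>) (tsol \<delta> X)"
    unfolding solves_def
  proof (intro allI impI)
    fix t :: real and i assume ti: "0 \<le> t" "i < N"
    show "((\<lambda>s. tsol \<delta> X s i) has_vector_derivative vel (tsol \<delta> X t) i) (at t within {0..})"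
      using solvesD[OF ts(2) ti] force_truncated_eq[OF truncated_solution_safe[OF X(1) ts(2) ts(1) ti(1)] ti(2)] by simp
  qed
  then show "solves N (ygrad \<kappa>) (\<lambda>t. restrict (tsol \<delta> X t) {..<N})" by (rule solves_restrict)
qed

lemma trajectory_solves_truncated:
  assumes X: "safe \<delta> X" and x: "trajectory \<kappa> N X x"
  shows "solves N (tgrad \<kappa> \<delta>) x"
  unfolding solves_def
proof (intro allI impI)
  fix t :: real and i assume ti: "0 \<le> t" "i < N"
  have "solves N (ygrad \<kappa>) x" using x by (simp add: trajectory_iff)
  then show "((\<lambda>s. x s i) has_vector_derivative force N (tgrad \<kappa> \<delta>) (x t) i) (at t within {0..})"
    using solvesD[OF _ ti] force_truncated_eq[OF trajectory_safe[OF X x ti(1)] ti(2)] by simp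
qed

text \<open>The singular force has no Lipschitz constant, but a trajectory from a safe configuration
  also solves the truncated system, where stability applies.\<close>

lemma trajectory_unique:
  assumes X: "safe \<delta> X" and x: "trajectory \<kappa> N X x" and t: "0 \<le> t"
  shows "x t = restrict (tsol \<delta> X t) {..<N}"
proof
  fix i
  have \<delta>: "0 < \<delta>" using X by (simp add: safe_def)
  from tgrad_lipschitz[OF kappa \<delta>, where 'n='n] obtain L where
    L: "0 \<le> L" "\<forall>x y::real^'n. norm (tgrad \<kappa> \<delta> x - tgrad \<kappa> \<delta> y) \<le> L * norm (x - y)" by blast
  have "x 0 = X" using x by (simp add: trajectory_iff)
  then have z: "(\<Sum>i<N. (norm (x 0 i - tsol \<delta> X 0 i))\<^sup>2) = 0" by (simp add: tsol(1)[OF \<delta>])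
  have "(\<Sum>i<N. (norm (x t i - tsol \<delta> X t i))\<^sup>2) \<le> 0"
    using solution_stable[OF N0 L(2)[rule_format] L(1) trajectory_solves_truncated[OF X x] tsol(2)[OF \<delta>] t, of X] z by simp
  then have "\<forall>i\<in>{..<N}. (norm (x t i - tsol \<delta> X t i))\<^sup>2 = 0"
    by (subst sum_nonneg_eq_0_iff[symmetric]) (auto intro!: antisym sum_nonneg)
  moreover have "x t \<in> extensional {..<N}" using x t by (simp add: trajectory_iff space_config)
  ultimately show "x t i = restrict (tsol \<delta> X t) {..<N} i"
    by (cases "i < N") (auto simp: extensional_def)
qed

text \<open>The energy of a collision-free configuration is finite and the profile is unbounded near
  0. All small \<open>\<delta>\<close> are included so that the sequence \<open>1 / (n + 1)\<close>
  is eventually safe, which later exhibits the flow as a limit of truncated flows.\<close>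

lemma safe_exists:
  assumes "X \<notin> collisions N"
  shows "\<exists>\<delta>0>0. \<forall>\<delta>. 0 < \<delta> \<longrightarrow> \<delta> \<le> \<delta>0 \<longrightarrow> safe \<delta> X"
proof -
  from prof_unbounded[OF kappa dim, of "pair_energy N (ypot \<kappa>) X + 1"] obtain \<delta>1 where
    \<delta>1: "0 < \<delta>1" "\<forall>w. 0 < w \<longrightarrow> w \<le> \<delta>1 \<longrightarrow> pair_energy N (ypot \<kappa>) X + 1 \<le> prof \<kappa> CARD('n) 0 w" by blast
  let ?S = "(\<lambda>(i, j). (norm (X i - X j))\<^sup>2) ` {(i, j). i < N \<and> j < N \<and> i \<noteq> j}"
  have fin: "finite ?S"
    by (rule finite_imageI, rule finite_subset[of _ "{..<N} \<times> {..<N}"]) auto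
  define \<delta>2 where "\<delta>2 = Min (insert 1 ?S)"
  have pos: "0 < \<delta>2"
    using assms fin unfolding \<delta>2_def by (subst Min_gr_iff) (auto simp: collisions_def)
  have le: "\<delta>2 \<le> (norm (X i - X j))\<^sup>2" if "i < N" "j < N" "i \<noteq> j" for i j
    unfolding \<delta>2_def using fin that by (intro Min_le) auto
  show ?thesis
  proof (intro exI[of _ "min \<delta>1 \<delta>2"] conjI allI impI)
    fix \<delta> assume \<delta>: "0 < \<delta>" "\<delta> \<le> min \<delta>1 \<delta>2"
    then have "pair_energy N (ypot \<kappa>) X + 1 \<le> prof \<kappa> CARD('n) 0 \<delta>" using \<delta>1(2) by simp
    moreover have "\<delta> \<le> (norm (X i - X j))\<^sup>2" if "i < N" "j < N" "i \<noteq> j" for i j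
      using le[OF that] \<delta> by simp
    ultimately show "safe \<delta> X" using \<delta> by (simp add: safe_def)
  qed (use \<delta>1 pos in simp)
qed

lemma flow_eq_tsol:
  fixes X :: "nat \<Rightarrow> real^'n"
  assumes X: "safe \<delta> X" "X \<in> space (config_space N)" "X \<notin> collisions N" and t: "0 \<le> t"
  shows "flow \<kappa> N t X = restrict (tsol \<delta> X t) {..<N}"
proof -
  have "(THE Y. \<exists>x. trajectory \<kappa> N X x \<and> Y = x t) = restrict (tsol \<delta> X t) {..<N}"
  proof (rule the_equality)
    show "\<exists>x. trajectory \<kappa> N X x \<and> restrict (tsol \<delta> X t) {..<N} = x t"
      using trajectory_tsol[OF X(1,2)] by blast
    show "\<And>Y. \<exists>x. trajectory \<kappa> N X x \<and> Y = x t \<Longrightarrow> Y = restrict (tsol \<delta> X t) {..<N}"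
      using trajectory_unique[OF X(1) _ t] by blast
  qed
  then show ?thesis using X(3) by (simp add: flow_def)
qed

lemma solves_cong:
  assumes "solves M K x" "\<And>t. 0 \<le> t \<Longrightarrow> y t = x t"
  shows "solves M K y"
  unfolding solves_def
proof (intro allI impI)
  fix t :: real and i assume ti: "0 \<le> t" "i < M"
  show "((\<lambda>s. y s i) has_vector_derivative force M K (y t) i) (at t within {0..})"
    unfolding assms(2)[OF ti(1)]
    by (rule has_vector_derivative_transform[OF _ _ solvesD[OF assms(1) ti]]) (use assms(2) ti in auto)
qed

lemma trajectory_flow:
  fixes X :: "nat \<Rightarrow> real^'n"
  assumes X: "X \<in> space (config_space N)" "X \<notin> collisions N"
  shows "trajectory \<kappa> N X (\<lambda>t. flow \<kappa> N t X)"
proof -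
  from safe_exists[OF X(2)] obtain \<delta> where s: "safe \<delta> X" by blast
  note eq = flow_eq_tsol[OF s X]
  show ?thesis
    using trajectory_tsol[OF s X(1)] solves_cong[of N "ygrad \<kappa>" _ "\<lambda>t. flow \<kappa> N t X", OF _ eq]
    unfolding trajectory_iff by (simp add: eq)
qed

lemma flow_unique:
  fixes X :: "nat \<Rightarrow> real^'n"
  assumes X: "X \<in> space (config_space N)" "X \<notin> collisions N" and x: "trajectory \<kappa> N X x" and t: "0 \<le> t"
  shows "flow \<kappa> N t X = x t"
proof -
  from safe_exists[OF X(2)] obtain \<delta> where s: "safe \<delta> X" by blast
  show ?thesis by (rule trans[OF flow_eq_tsol[OF s X t] trajectory_unique[OF s x t, symmetric]])
qed

lemma flow_collisions: "X \<in> collisions N \<Longrightarrow> flow \<kappa> N t X = X"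
  by (simp add: flow_def)

lemma flow_0: "(X :: nat \<Rightarrow> real^'n) \<in> space (config_space N) \<Longrightarrow> flow \<kappa> N 0 X = X"
  using trajectory_flow[of X] flow_collisions[of X 0] by (cases "X \<in> collisions N") (auto simp: trajectory_iff)

lemma flow_in_space:
  fixes X :: "nat \<Rightarrow> real^'n"
  assumes "X \<in> space (config_space N)" "0 \<le> t"
  shows "flow \<kappa> N t X \<in> space (config_space N)"
proof (cases "X \<in> collisions N")
  case False
  then show ?thesis using trajectory_flow[OF assms(1)] assms(2) unfolding trajectory_iff by blast
qed (simp add: flow_collisions assms)

lemma flow_not_collisions:
  fixes X :: "nat \<Rightarrow> real^'n"
  assumes "X \<in> space (config_space N)" "X \<notin> collisions N" "0 \<le> t"
  shows "flow \<kappa> N t X \<notin> collisions N"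
  using trajectory_flow[OF assms(1,2)] assms(3) unfolding trajectory_iff by blast

lemma solves_flow:
  fixes X :: "nat \<Rightarrow> real^'n"
  assumes X: "X \<in> space (config_space N)" "X \<notin> collisions N"
  shows "solves N (ygrad \<kappa>) (\<lambda>t. flow \<kappa> N t X)"
  using trajectory_flow[OF X] unfolding trajectory_iff by blast

text \<open>A relabelled trajectory is a trajectory of the relabelled configuration, and
  trajectories are unique.\<close>

lemma flow_permute:
  fixes X :: "nat \<Rightarrow> real^'n"
  assumes X: "X \<in> space (config_space N)" "X \<notin> collisions N" and \<sigma>: "\<sigma> permutes {..<N}" and t: "0 \<le> t"
  shows "flow \<kappa> N t (X \<circ> \<sigma>) = flow \<kappa> N t X \<circ> \<sigma>"
proof -
  define x where "x t = flow \<kappa> N t X" for t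
  have x: "trajectory \<kappa> N X x"
    using trajectory_flow[OF X] by (simp add: x_def[abs_def])
  have inj: "\<sigma> i = \<sigma> j \<longleftrightarrow> i = j" for i j using permutes_inj[OF \<sigma>] by (simp add: inj_eq)
  have lt: "\<sigma> i < N \<longleftrightarrow> i < N" for i using permutes_in_image[OF \<sigma>, of i] by simp
  have ext: "Z \<circ> \<sigma> \<in> space (config_space N)" if "Z \<in> space (config_space N)" for Z :: "nat \<Rightarrow> real^'n"
    using that permutes_not_in[OF \<sigma>] unfolding space_config by (auto simp: extensional_def)
  have coll: "Z \<circ> \<sigma> \<notin> collisions N" if "Z \<notin> collisions N" for Z :: "nat \<Rightarrow> real^'n"
  proof
    assume "Z \<circ> \<sigma> \<in> collisions N"
    then obtain i j where "i < N" "j < N" "i \<noteq> j" "Z (\<sigma> i) = Z (\<sigma> j)" by (auto simp: collisions_def)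
    then have "Z \<in> collisions N"
      unfolding collisions_def using inj lt by blast
    then show False using that by blast
  qed
  have tr: "trajectory \<kappa> N (X \<circ> \<sigma>) (\<lambda>t. x t \<circ> \<sigma>)"
    unfolding trajectory_iff
  proof (intro conjI allI impI)
    show "x 0 \<circ> \<sigma> = X \<circ> \<sigma>" using x by (simp add: trajectory_iff)
    fix t :: real assume "0 \<le> t"
    then have "x t \<in> space (config_space N)" "x t \<notin> collisions N" using x by (simp_all add: trajectory_iff)
    then show "x t \<circ> \<sigma> \<in> space (config_space N)" "x t \<circ> \<sigma> \<notin> collisions N"
      using ext coll by blast+
  next
    show "solves N (ygrad \<kappa>) (\<lambda>t. x t \<circ> \<sigma>)"
      unfolding solves_def
    proof (intro allI impI)
      fix t :: real and i assume ti: "0 \<le> t" "i < N"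
      have "(\<Sum>j<N. ygrad \<kappa> (x t (\<sigma> i) - x t (\<sigma> j))) = (\<Sum>j<N. ygrad \<kappa> (x t (\<sigma> i) - x t j))"
        using sum.permute[OF \<sigma>, of "\<lambda>j. ygrad \<kappa> (x t (\<sigma> i) - x t j)"] by (simp add: comp_def)
      then have "vel (x t \<circ> \<sigma>) i = vel (x t) (\<sigma> i)" by (simp add: force_def)
      moreover have "solves N (ygrad \<kappa>) x" using x by (simp add: trajectory_iff)
      ultimately show "((\<lambda>s. (x s \<circ> \<sigma>) i) has_vector_derivative vel (x t \<circ> \<sigma>) i) (at t within {0..})"
        using solvesD[of N "ygrad \<kappa>" x t "\<sigma> i"] ti lt by simp
    qed
  qed
  show ?thesis
    using flow_unique[OF ext[OF X(1)] coll[OF X(2)] tr t] by (simp only: x_def)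
qed

end

section \<open>Evolution of the modulated energy\<close>

lemma integral_empirical:
  fixes h :: "real^'n \<Rightarrow> real"
  assumes "0 < N" "h \<in> borel_measurable borel"
  shows "integrable (empirical N X) h" "(LINT x|empirical N X. h x) = 1 / real N * (\<Sum>i<N. h (X i))"
proof -
  have m: "X \<in> measurable (uniform_count_measure {..<N}) borel"
    by (simp add: measurable_def sets_uniform_count_measure space_uniform_count_measure)
  show "integrable (empirical N X) h"
    unfolding empirical_def by (subst integrable_distr_eq[OF m assms(2)])
      (simp add: uniform_count_measure_def integrable_point_measure_finite)
  show "(LINT x|empirical N X. h x) = 1 / real N * (\<Sum>i<N. h (X i))"
    unfolding empirical_def by (subst integral_distr[OF m assms(2)])
      (simp add: integral_uniform_count_measure)
qed

lemma prob_space_empirical: "0 < N \<Longrightarrow> prob_space (empirical N X)"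
  unfolding empirical_def
  by (intro prob_space.prob_space_distr prob_space_uniform_count_measure)
    (auto simp: measurable_def sets_uniform_count_measure space_uniform_count_measure)

lemma sets_empirical [measurable_cong, simp]: "sets (empirical N X) = sets borel"
  by (simp add: empirical_def)

text \<open>The integrand \<open>h\<close> may be arbitrary on the diagonal, hence the well-behaved
  version \<open>h0\<close> that agrees with it elsewhere. As \<open>\<nu>\<close> has no atoms, the
  removed diagonal is visible only in the term with two empirical measures. Integrability is checked
  for each product measure, since a divergent Bochner integral would silently count as 0.\<close>

lemma offdiag_integral_expand:
  fixes X :: "nat \<Rightarrow> real^'n" and \<nu> :: "(real^'n) measure" and h h0 :: "real^'n \<Rightarrow> real^'n \<Rightarrow> real"
  assumes N: "0 < N" and X: "X \<notin> collisions N"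
    and \<nu>: "prob_space \<nu>" "sets \<nu> = sets borel" "\<And>x. AE y in \<nu>. y \<noteq> x"
    and h: "\<And>x y. x \<noteq> y \<Longrightarrow> h x y = h0 x y"
    and m: "(\<lambda>p. h0 (fst p) (snd p)) \<in> borel_measurable (borel \<Otimes>\<^sub>M borel)"
    and i1: "\<And>x. integrable \<nu> (\<lambda>y. h0 x y)" and i2: "\<And>y. integrable \<nu> (\<lambda>x. h0 x y)"
    and i3: "integrable (\<nu> \<Otimes>\<^sub>M \<nu>) (\<lambda>p. h0 (fst p) (snd p))"
  shows "offdiag_integral (empirical N X) \<nu> h =
    1 / (real N)\<^sup>2 * (\<Sum>i<N. \<Sum>j\<in>{..<N} - {i}. h0 (X i) (X j))
    - 1 / real N * (\<Sum>i<N. (LINT y|\<nu>. h0 (X i) y)) - 1 / real N * (\<Sum>i<N. (LINT x|\<nu>. h0 x (X i)))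
    + (LINT p|(\<nu> \<Otimes>\<^sub>M \<nu>). h0 (fst p) (snd p))"
proof -
  interpret \<nu>: prob_space \<nu> by fact
  interpret e: prob_space "empirical N X" by (rule prob_space_empirical[OF N])
  interpret ee: pair_sigma_finite "empirical N X" "empirical N X" ..
  interpret en: pair_sigma_finite "empirical N X" \<nu> ..
  interpret ne: pair_sigma_finite \<nu> "empirical N X" ..
  interpret nn: pair_sigma_finite \<nu> \<nu> ..
  note \<nu>(2)[measurable_cong]
  define k where "k x y = (if x = y then 0 else h0 x y)" for x y
  have mk [measurable]: "(\<lambda>p. k (fst p) (snd p)) \<in> borel_measurable (borel \<Otimes>\<^sub>M borel)"
    unfolding k_def using m by measurable
  have mk': "(\<lambda>p. k (fst p) (snd p)) \<in> borel_measurable (\<alpha> \<Otimes>\<^sub>M \<beta>)"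
    if "sets \<alpha> = sets borel" "sets \<beta> = sets borel" for \<alpha> \<beta> :: "(real^'n) measure"
    using mk measurable_cong_sets[OF sets_pair_measure_cong[OF that] refl] by blast
  have mk1: "(\<lambda>y. k x y) \<in> borel_measurable borel" "(\<lambda>y. k y x) \<in> borel_measurable borel" for x
    using measurable_compose[OF measurable_Pair1' mk, of x] measurable_compose[OF measurable_Pair2' mk, of x] by simp_all
  have I: "(LINT p:{p. fst p \<noteq> snd p}|(\<alpha> \<Otimes>\<^sub>M \<beta>). h (fst p) (snd p)) = (LINT p|(\<alpha> \<Otimes>\<^sub>M \<beta>). k (fst p) (snd p))" for \<alpha> \<beta> :: "(real^'n) measure"
    unfolding set_lebesgue_integral_def by (intro Bochner_Integration.integral_cong) (auto simp: k_def h)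
  have kx: "AE y in \<nu>. k x y = h0 x y" "AE y in \<nu>. k y x = h0 y x" for x
    using \<nu>(3)[of x] by (eventually_elim, simp add: k_def)+
  have mh: "(\<lambda>y. h0 x y) \<in> borel_measurable \<nu>" "(\<lambda>y. h0 y x) \<in> borel_measurable \<nu>" for x
    using i1 i2 by (blast intro: borel_measurable_integrable)+
  have mkn: "(\<lambda>y. k x y) \<in> borel_measurable \<nu>" "(\<lambda>y. k y x) \<in> borel_measurable \<nu>" for x
    using mk1 measurable_cong_sets[OF \<nu>(2) refl] by blast+
  have ki: "integrable \<nu> (\<lambda>y. k x y)" "integrable \<nu> (\<lambda>y. k y x)" for x
    using integrable_cong_AE[OF mkn(1) mh(1) kx(1)] integrable_cong_AE[OF mkn(2) mh(2) kx(2)] i1 i2 by blast+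
  have kI: "(LINT y|\<nu>. k x y) = (LINT y|\<nu>. h0 x y)" "(LINT y|\<nu>. k y x) = (LINT y|\<nu>. h0 y x)" for x
    using integral_cong_AE[OF mkn(1) mh(1) kx(1)] integral_cong_AE[OF mkn(2) mh(2) kx(2)] by blast+
  note se = sets_empirical[of N X]
  have 1: "(LINT p|(empirical N X \<Otimes>\<^sub>M empirical N X). k (fst p) (snd p)) = 1 / (real N)\<^sup>2 * (\<Sum>i<N. \<Sum>j\<in>{..<N} - {i}. h0 (X i) (X j))"
  proof -
    have int: "integrable (empirical N X \<Otimes>\<^sub>M empirical N X) (\<lambda>p. k (fst p) (snd p))"
    proof (rule ee.Fubini_integrable[OF mk'[OF se se]])
      have "(\<lambda>x. LINT y|empirical N X. norm (k (fst (x, y)) (snd (x, y)))) \<in> borel_measurable borel"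
        using mk by measurable
      then show "integrable (empirical N X) (\<lambda>x. LINT y|empirical N X. norm (k (fst (x, y)) (snd (x, y))))"
        by (rule integral_empirical(1)[OF N])
    qed (simp add: integral_empirical(1)[OF N mk1(1)])
    have "(LINT p|(empirical N X \<Otimes>\<^sub>M empirical N X). k (fst p) (snd p)) = (LINT x|empirical N X. LINT y|empirical N X. k x y)"
      using ee.integral_fst'[OF int] by simp
    also have "\<dots> = (LINT x|empirical N X. 1 / real N * (\<Sum>j<N. k x (X j)))"
      by (simp add: integral_empirical(2)[OF N mk1(1)])
    also have "\<dots> = 1 / real N * (\<Sum>i<N. 1 / real N * (\<Sum>j<N. k (X i) (X j)))"
      by (subst integral_empirical(2)[OF N]) (use mk1 in auto)
    also have "\<dots> = 1 / (real N)\<^sup>2 * (\<Sum>i<N. \<Sum>j<N. k (X i) (X j))"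
      by (simp add: sum_distrib_left[symmetric] sum_divide_distrib[symmetric] power2_eq_square)
    also have "(\<Sum>i<N. \<Sum>j<N. k (X i) (X j)) = (\<Sum>i<N. \<Sum>j\<in>{..<N} - {i}. h0 (X i) (X j))"
    proof (rule sum.cong[OF refl])
      fix i assume i: "i \<in> {..<N}"
      have "(\<Sum>j<N. k (X i) (X j)) = (\<Sum>j\<in>{..<N} - {i}. k (X i) (X j))"
        using i by (simp add: sum.remove[of "{..<N}" i] k_def)
      also have "\<dots> = (\<Sum>j\<in>{..<N} - {i}. h0 (X i) (X j))"
        using X i by (intro sum.cong refl) (auto simp: k_def collisions_def)
      finally show "(\<Sum>j<N. k (X i) (X j)) = (\<Sum>j\<in>{..<N} - {i}. h0 (X i) (X j))" .
    qed
    finally show ?thesis .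
  qed
  have 2: "(LINT p|(empirical N X \<Otimes>\<^sub>M \<nu>). k (fst p) (snd p)) = 1 / real N * (\<Sum>i<N. (LINT y|\<nu>. h0 (X i) y))"
  proof -
    have mm: "(\<lambda>x. LINT y|\<nu>. g (k x y)) \<in> borel_measurable borel" if [measurable]: "g \<in> borel_measurable borel" for g :: "real \<Rightarrow> real"
    proof -
      have [measurable]: "(\<lambda>p. k (fst p) (snd p)) \<in> borel_measurable (borel \<Otimes>\<^sub>M \<nu>)" by (rule mk'[OF refl \<nu>(2)])
      have "(\<lambda>x. LINT y|\<nu>. g (k (fst (x, y)) (snd (x, y)))) \<in> borel_measurable borel" by measurable
      then show ?thesis by simp
    qed
    have int: "integrable (empirical N X \<Otimes>\<^sub>M \<nu>) (\<lambda>p. k (fst p) (snd p))"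
    proof (rule en.Fubini_integrable[OF mk'[OF se \<nu>(2)]])
      show "integrable (empirical N X) (\<lambda>x. LINT y|\<nu>. norm (k (fst (x, y)) (snd (x, y))))"
        using integral_empirical(1)[OF N mm[of norm]] by simp
    qed (simp add: ki)
    have "(LINT p|(empirical N X \<Otimes>\<^sub>M \<nu>). k (fst p) (snd p)) = (LINT x|empirical N X. LINT y|\<nu>. k x y)"
      using en.integral_fst'[OF int] by simp
    also have "\<dots> = 1 / real N * (\<Sum>i<N. (LINT y|\<nu>. h0 (X i) y))"
      by (subst integral_empirical(2)[OF N]) (use mm[of "\<lambda>x. x"] in \<open>simp_all add: kI\<close>)
    finally show ?thesis .
  qed
  have 3: "(LINT p|(\<nu> \<Otimes>\<^sub>M empirical N X). k (fst p) (snd p)) = 1 / real N * (\<Sum>i<N. (LINT x|\<nu>. h0 x (X i)))"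
  proof -
    have nk: "(\<lambda>y. norm (k x y)) \<in> borel_measurable borel" for x using mk1(1)[of x] by measurable
    have int: "integrable (\<nu> \<Otimes>\<^sub>M empirical N X) (\<lambda>p. k (fst p) (snd p))"
    proof (rule ne.Fubini_integrable[OF mk'[OF \<nu>(2) se]])
      show "integrable \<nu> (\<lambda>x. LINT y|empirical N X. norm (k (fst (x, y)) (snd (x, y))))"
        using integral_empirical(2)[OF N nk] ki(2) by simp
    qed (simp add: integral_empirical(1)[OF N mk1(1)])
    have "(LINT p|(\<nu> \<Otimes>\<^sub>M empirical N X). k (fst p) (snd p)) = (LINT x|\<nu>. LINT y|empirical N X. k x y)"
      using ne.integral_fst'[OF int] by simp
    also have "\<dots> = (LINT x|\<nu>. 1 / real N * (\<Sum>j<N. k x (X j)))"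
      by (simp add: integral_empirical(2)[OF N mk1(1)])
    also have "\<dots> = 1 / real N * (\<Sum>i<N. (LINT x|\<nu>. h0 x (X i)))"
      using ki(2) by (simp add: kI)
    finally show ?thesis .
  qed
  have 4: "(LINT p|(\<nu> \<Otimes>\<^sub>M \<nu>). k (fst p) (snd p)) = (LINT p|(\<nu> \<Otimes>\<^sub>M \<nu>). h0 (fst p) (snd p))"
  proof (rule integral_cong_AE)
    have [measurable]: "{p \<in> space (\<nu> \<Otimes>\<^sub>M \<nu>). snd p \<noteq> fst p} \<in> sets (\<nu> \<Otimes>\<^sub>M \<nu>)"
      by measurable
    have "AE p in \<nu> \<Otimes>\<^sub>M \<nu>. snd p \<noteq> fst p"
      using \<nu>(3) by (intro nn.AE_pair_measure) auto
    then show "AE p in \<nu> \<Otimes>\<^sub>M \<nu>. k (fst p) (snd p) = h0 (fst p) (snd p)"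
      by eventually_elim (simp add: k_def)
  qed (use mk'[OF \<nu>(2) \<nu>(2)] i3 in auto)
  show ?thesis
    unfolding offdiag_integral_def Let_def I 1 2 3 4 ..
qed


text \<open>The chain rule is clear for the truncated kernel; the truncation is removed by dominated
  convergence.\<close>

lemma averaged_potential_chain_rule:
  fixes z w :: "real \<Rightarrow> 'm \<Rightarrow> real^'n"
  assumes \<kappa>: "0 < \<kappa>" and M: "prob_space M" and t: "0 \<le> t"
    and D: "\<And>s \<omega>. s \<in> {0..t} \<Longrightarrow> ((\<lambda>s. z s \<omega>) has_vector_derivative w s \<omega>) (at s within {0..t})"
    and wc: "\<And>\<omega>. continuous_on {0..t} (\<lambda>s. w s \<omega>)" and W: "\<And>s \<omega>. norm (w s \<omega>) \<le> W"
    and zm: "(\<lambda>p. z (fst p) (snd p)) \<in> borel_measurable (borel \<Otimes>\<^sub>M M)"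
    and wm: "(\<lambda>p. w (fst p) (snd p)) \<in> borel_measurable (borel \<Otimes>\<^sub>M M)"
    and Ki: "\<And>s. s \<in> {0..t} \<Longrightarrow> integrable M (\<lambda>\<omega>. ygrad \<kappa> (z s \<omega>))"
    and K: "\<And>s. s \<in> {0..t} \<Longrightarrow> (LINT \<omega>|M. norm (ygrad \<kappa> (z s \<omega>))) \<le> K"
    and P: "\<And>s. s \<in> {0..t} \<Longrightarrow> integrable M (\<lambda>\<omega>. ypot \<kappa> (z s \<omega>))"
    and nz: "\<And>s. s \<in> {0..t} \<Longrightarrow> AE \<omega> in M. z s \<omega> \<noteq> 0"
  shows "set_integrable lborel {0..t} (\<lambda>s. LINT \<omega>|M. ygrad \<kappa> (z s \<omega>) \<bullet> w s \<omega>)"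
    and "(LINT \<omega>|M. ypot \<kappa> (z t \<omega>)) - (LINT \<omega>|M. ypot \<kappa> (z 0 \<omega>)) =
      (LINT s:{0..t}|lborel. (LINT \<omega>|M. ygrad \<kappa> (z s \<omega>) \<bullet> w s \<omega>))"
proof -
  interpret M: prob_space M by fact
  interpret LM: pair_sigma_finite lborel M ..
  note zm[measurable] wm[measurable]
  have zm' [measurable]: "(\<lambda>p. z (fst p) (snd p)) \<in> borel_measurable (lborel \<Otimes>\<^sub>M M)"
    and wm' [measurable]: "(\<lambda>p. w (fst p) (snd p)) \<in> borel_measurable (lborel \<Otimes>\<^sub>M M)"
    using zm wm by (simp_all cong: measurable_cong_sets sets_pair_measure_cong)
  have zs [measurable]: "z s \<in> borel_measurable M" and ws [measurable]: "w s \<in> borel_measurable M" for s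
    using measurable_compose[OF measurable_Pair1' zm, of s] measurable_compose[OF measurable_Pair1' wm, of s] by simp_all
  have W0: "0 \<le> W" using W[of 0 undefined] norm_ge_zero order_trans by blast
  let ?d = "\<lambda>n. 1 / real (Suc n)"
  have d: "0 < ?d n" for n by simp
  let ?f = "\<lambda>n s \<omega>. tgrad \<kappa> (?d n) (z s \<omega>) \<bullet> w s \<omega>"
  let ?g = "\<lambda>s \<omega>. ygrad \<kappa> (z s \<omega>) \<bullet> w s \<omega>"
  have gi: "integrable M (\<lambda>\<omega>. norm (ygrad \<kappa> (z s \<omega>)) * W)" if "s \<in> {0..t}" for s
    using Ki[OF that] by simp
  have fb: "\<bar>?f n s \<omega>\<bar> \<le> norm (ygrad \<kappa> (z s \<omega>)) * W" for n s \<omega>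
    using Cauchy_Schwarz_ineq2[of "tgrad \<kappa> (?d n) (z s \<omega>)" "w s \<omega>"]
      mult_mono[OF norm_tgrad_le[OF \<kappa> d, of n "z s \<omega>"] W[of s \<omega>]] by simp
  have gb: "\<bar>?g s \<omega>\<bar> \<le> norm (ygrad \<kappa> (z s \<omega>)) * W" for s \<omega>
    using Cauchy_Schwarz_ineq2[of "ygrad \<kappa> (z s \<omega>)" "w s \<omega>"]
      mult_left_mono[OF W[of s \<omega>] norm_ge_zero, of "ygrad \<kappa> (z s \<omega>)"] by linarith
  have inner_lim: "(\<lambda>n. LINT \<omega>|M. ?f n s \<omega>) \<longlonglongrightarrow> (LINT \<omega>|M. ?g s \<omega>)" if s: "s \<in> {0..t}" for s
  proof (rule integral_dominated_convergence[where w="\<lambda>\<omega>. norm (ygrad \<kappa> (z s \<omega>)) * W"])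
    show "AE \<omega> in M. (\<lambda>n. ?f n s \<omega>) \<longlonglongrightarrow> ?g s \<omega>"
      by (intro always_eventually allI tendsto_inner tgrad_tendsto_ygrad tendsto_const)
    show "AE \<omega> in M. norm (?f n s \<omega>) \<le> norm (ygrad \<kappa> (z s \<omega>)) * W" for n
      using fb by simp
  qed (use gi[OF s] in measurable)
  have inner_bound: "\<bar>LINT \<omega>|M. ?f n s \<omega>\<bar> \<le> K * W" if s: "s \<in> {0..t}" for n s
  proof -
    have "\<bar>LINT \<omega>|M. ?f n s \<omega>\<bar> \<le> (LINT \<omega>|M. norm (?f n s \<omega>))"
      using integral_norm_bound[of M "?f n s"] by simp
    also have "\<dots> \<le> (LINT \<omega>|M. norm (ygrad \<kappa> (z s \<omega>)) * W)"
    proof (rule integral_mono)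
      show "integrable M (\<lambda>\<omega>. norm (?f n s \<omega>))"
        by (rule Bochner_Integration.integrable_bound[OF gi[OF s]]) (use order_trans[OF fb abs_ge_self] in auto)
    qed (use gi[OF s] fb in auto)
    also have "\<dots> \<le> K * W" using mult_right_mono[OF K[OF s] W0] by simp
    finally show ?thesis .
  qed
  have fm: "(\<lambda>s. indicator {0..t} s *\<^sub>R (LINT \<omega>|M. ?f n s \<omega>)) \<in> borel_measurable lborel" for n
  proof -
    have "(\<lambda>s. LINT \<omega>|M. tgrad \<kappa> (?d n) (z (fst (s, \<omega>)) (snd (s, \<omega>))) \<bullet> w (fst (s, \<omega>)) (snd (s, \<omega>))) \<in> borel_measurable lborel"
      by measurable
    then show ?thesis by simp
  qed
  have gm: "(\<lambda>s. indicator {0..t} s *\<^sub>R (LINT \<omega>|M. ?g s \<omega>)) \<in> borel_measurable lborel"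
  proof -
    have "(\<lambda>s. LINT \<omega>|M. ygrad \<kappa> (z (fst (s, \<omega>)) (snd (s, \<omega>))) \<bullet> w (fst (s, \<omega>)) (snd (s, \<omega>))) \<in> borel_measurable lborel"
      by measurable
    then show ?thesis by simp
  qed
  have dom: "integrable lborel (\<lambda>s. indicator {0..t} s * (K * W))"
    using t by (intro integrable_mult_left integrable_real_indicator) auto
  have outer_bound: "norm (indicator {0..t} s *\<^sub>R (LINT \<omega>|M. ?f n s \<omega>)) \<le> indicator {0..t} s * (K * W)" for n s
    using inner_bound[of s n] by (simp add: indicator_def)
  have outer_lim: "(\<lambda>n. indicator {0..t} s *\<^sub>R (LINT \<omega>|M. ?f n s \<omega>)) \<longlonglongrightarrow> indicator {0..t} s *\<^sub>R (LINT \<omega>|M. ?g s \<omega>)" for s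
    using inner_lim[of s] by (cases "s \<in> {0..t}") (auto simp: indicator_def)
  show "set_integrable lborel {0..t} (\<lambda>s. LINT \<omega>|M. ?g s \<omega>)"
    unfolding set_integrable_def
    by (rule integrable_dominated_convergence[where s="\<lambda>n s. indicator {0..t} s *\<^sub>R (LINT \<omega>|M. ?f n s \<omega>)", OF gm fm dom])
      (use outer_lim outer_bound in auto)
  have rhs: "(\<lambda>n. LINT s:{0..t}|lborel. (LINT \<omega>|M. ?f n s \<omega>)) \<longlonglongrightarrow> (LINT s:{0..t}|lborel. (LINT \<omega>|M. ?g s \<omega>))"
    unfolding set_lebesgue_integral_def
    by (rule integral_dominated_convergence[where s="\<lambda>n s. indicator {0..t} s *\<^sub>R (LINT \<omega>|M. ?f n s \<omega>)", OF gm fm dom])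
      (use outer_lim outer_bound in auto)
  \<comment> \<open>The tangent continuation lies below the convex profile, so the singular
    potential dominates all its truncations.\<close>
  have pot_lim: "(\<lambda>n. LINT \<omega>|M. tpot \<kappa> (?d n) (z s \<omega>)) \<longlonglongrightarrow> (LINT \<omega>|M. ypot \<kappa> (z s \<omega>))" if s: "s \<in> {0..t}" for s
  proof (rule integral_dominated_convergence[where w="\<lambda>\<omega>. ypot \<kappa> (z s \<omega>)"])
    show "AE \<omega> in M. (\<lambda>n. tpot \<kappa> (?d n) (z s \<omega>)) \<longlonglongrightarrow> ypot \<kappa> (z s \<omega>)"
      using nz[OF s] by eventually_elim (rule tpot_tendsto_ypot)
    show "AE \<omega> in M. norm (tpot \<kappa> (?d n) (z s \<omega>)) \<le> ypot \<kappa> (z s \<omega>)" for n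
      using nz[OF s]
    proof eventually_elim
      case (elim \<omega>)
      then show ?case using tpot_le_ypot[OF \<kappa> d elim, of n] tpot_nonneg[OF \<kappa> d, of n "z s \<omega>"] by simp
    qed
  qed (use P[OF s] in measurable)
  \<comment> \<open>For a truncated kernel this is the fundamental theorem along each path followed
    by Fubini; the bound \<open>K * W\<close> is uniform in time and makes the product
    integrable.\<close>
  have trunc: "(LINT \<omega>|M. tpot \<kappa> (?d n) (z t \<omega>)) - (LINT \<omega>|M. tpot \<kappa> (?d n) (z 0 \<omega>)) = (LINT s:{0..t}|lborel. (LINT \<omega>|M. ?f n s \<omega>))" for n
  proof -
    have ftc: "(LINT s|lborel. indicator {0..t} s *\<^sub>R ?f n s \<omega>) = tpot \<kappa> (?d n) (z t \<omega>) - tpot \<kappa> (?d n) (z 0 \<omega>)" for \<omega>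
    proof (rule integral_FTC_atLeastAtMost[OF t])
      fix s assume "0 \<le> s" "s \<le> t"
      then have "s \<in> {0..t}" by simp
      from has_real_derivative_compose_vector[OF D[OF this] tpot_has_derivative[OF \<kappa> d]]
      show "((\<lambda>s. tpot \<kappa> (?d n) (z s \<omega>)) has_vector_derivative ?f n s \<omega>) (at s within {0..t})"
        by (simp add: has_real_derivative_iff_has_vector_derivative)
    next
      have "continuous_on {0..t} (\<lambda>s. z s \<omega>)"
        by (rule continuous_on_vector_derivative[OF D])
      then show "continuous_on {0..t} (\<lambda>s. ?f n s \<omega>)"
        by (intro continuous_on_inner wc continuous_on_compose2[OF tgrad_continuous_on[OF \<kappa> d]]) auto
    qed
    have Pn: "integrable M (\<lambda>\<omega>. tpot \<kappa> (?d n) (z s \<omega>))" if s: "s \<in> {0..t}" for s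
    proof (rule Bochner_Integration.integrable_bound[OF P[OF s]])
      show "AE \<omega> in M. norm (tpot \<kappa> (?d n) (z s \<omega>)) \<le> norm (ypot \<kappa> (z s \<omega>))"
        using nz[OF s]
      proof eventually_elim
        case (elim \<omega>)
        then show ?case using tpot_le_ypot[OF \<kappa> d elim, of n] tpot_nonneg[OF \<kappa> d, of n "z s \<omega>"] by simp
      qed
    qed measurable
    let ?F = "\<lambda>s \<omega>. indicator {0..t} s *\<^sub>R ?f n s \<omega>"
    have Fm: "case_prod ?F \<in> borel_measurable (lborel \<Otimes>\<^sub>M M)"
      unfolding case_prod_beta by measurable
    have Fi: "integrable (lborel \<Otimes>\<^sub>M M) (case_prod ?F)"
    proof (rule LM.Fubini_integrable[OF Fm])
      have e: "(LINT \<omega>|M. norm (?F s \<omega>)) = indicator {0..t} s * (LINT \<omega>|M. norm (?f n s \<omega>))" for s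
        by (simp add: indicator_def)
      have "(LINT \<omega>|M. norm (?f n s \<omega>)) \<le> K * W" if s: "s \<in> {0..t}" for s
      proof -
        have "(LINT \<omega>|M. norm (?f n s \<omega>)) \<le> (LINT \<omega>|M. norm (ygrad \<kappa> (z s \<omega>)) * W)"
        proof (rule integral_mono)
          show "integrable M (\<lambda>\<omega>. norm (?f n s \<omega>))"
            by (rule Bochner_Integration.integrable_bound[OF gi[OF s]]) (use order_trans[OF fb abs_ge_self] in auto)
        qed (use gi[OF s] fb in auto)
        also have "\<dots> \<le> K * W" using mult_right_mono[OF K[OF s] W0] by simp
        finally show ?thesis .
      qed
      then have b: "norm (indicator {0..t} s * (LINT \<omega>|M. norm (?f n s \<omega>))) \<le> norm (indicator {0..t} s * (K * W))" for s
        by (cases "s \<in> {0..t}") (auto intro: order_trans[OF _ abs_ge_self])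
      have "(\<lambda>s. LINT \<omega>|M. norm (tgrad \<kappa> (?d n) (z (fst (s, \<omega>)) (snd (s, \<omega>))) \<bullet> w (fst (s, \<omega>)) (snd (s, \<omega>)))) \<in> borel_measurable lborel"
        by measurable
      then have m: "(\<lambda>s. indicator {0..t} s * (LINT \<omega>|M. norm (?f n s \<omega>))) \<in> borel_measurable lborel" by simp
      have "integrable lborel (\<lambda>s. indicator {0..t} s * (LINT \<omega>|M. norm (?f n s \<omega>)))"
        by (rule Bochner_Integration.integrable_bound[OF dom m]) (use b in simp)
      then show "integrable lborel (\<lambda>s. LINT \<omega>|M. norm (case_prod ?F (s, \<omega>)))"
        unfolding case_prod_conv e .
      have "integrable M (?F s)" for s
      proof (cases "s \<in> {0..t}")
        case True
        have "integrable M (?f n s)"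
          by (rule Bochner_Integration.integrable_bound[OF gi[OF True]]) (use order_trans[OF fb abs_ge_self] in auto)
        then show ?thesis by simp
      qed simp
      then show "AE s in lborel. integrable M (\<lambda>\<omega>. case_prod ?F (s, \<omega>))" by simp
    qed
    have "(LINT \<omega>|M. tpot \<kappa> (?d n) (z t \<omega>)) - (LINT \<omega>|M. tpot \<kappa> (?d n) (z 0 \<omega>)) = (LINT \<omega>|M. LINT s|lborel. ?F s \<omega>)"
      unfolding ftc using Pn t by simp
    also have "\<dots> = (LINT s|lborel. LINT \<omega>|M. ?F s \<omega>)"
      by (rule LM.Fubini_integral[OF Fi])
    also have "\<dots> = (LINT s:{0..t}|lborel. (LINT \<omega>|M. ?f n s \<omega>))"
      by (simp add: set_lebesgue_integral_def)
    finally show ?thesis .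
  qed
  have "(\<lambda>n. LINT s:{0..t}|lborel. (LINT \<omega>|M. ?f n s \<omega>)) \<longlonglongrightarrow> (LINT \<omega>|M. ypot \<kappa> (z t \<omega>)) - (LINT \<omega>|M. ypot \<kappa> (z 0 \<omega>))"
    unfolding trunc[symmetric] using t by (intro tendsto_diff pot_lim) auto
  from LIMSEQ_unique[OF this rhs]
  show "(LINT \<omega>|M. ypot \<kappa> (z t \<omega>)) - (LINT \<omega>|M. ypot \<kappa> (z 0 \<omega>)) = (LINT s:{0..t}|lborel. (LINT \<omega>|M. ?g s \<omega>))" .
qed

section \<open>Joint measurability of the particle flow\<close>

text \<open>Passes from the finite product sigma-algebra to the Borel sets of the product topology
  on all sequences, so that continuity in the initial configuration can be used as
  measurability.\<close>

lemma measurable_config_borel: "(\<lambda>X. X) \<in> measurable (config_space N :: (nat \<Rightarrow> real^'n) measure) borel"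
proof -
  have "(\<lambda>X. X) \<in> measurable (config_space N) (PiM UNIV (\<lambda>_. borel :: (real^'n) measure))"
  proof (rule measurable_PiM_single')
    fix i :: nat
    show "(\<lambda>X. X i) \<in> measurable (config_space N) (borel :: (real^'n) measure)"
    proof (cases "i < N")
      case False
      then have "X i = undefined" if "X \<in> space (config_space N)" for X :: "nat \<Rightarrow> real^'n"
        using that by (auto simp: space_PiM PiE_def extensional_def)
      then show ?thesis by (subst measurable_cong[where g="\<lambda>_. undefined"]) auto
    qed simp
  qed (auto simp: space_PiM)
  then show ?thesis by (simp cong: measurable_cong_sets add: sets_PiM_equal_borel)
qed

lemma collisions_pred_measurable [measurable]:
  "Measurable.pred (config_space N :: (nat \<Rightarrow> real^'n) measure) (\<lambda>X. X \<in> collisions N)"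
proof -
  have e: "X \<in> collisions N \<longleftrightarrow> (\<exists>i\<in>{..<N}. \<exists>j\<in>{..<N}. i \<noteq> j \<and> X i = X j)" for X :: "nat \<Rightarrow> real^'n"
    by (auto simp: collisions_def)
  have "Measurable.pred (config_space N) (\<lambda>X :: nat \<Rightarrow> real^'n. i \<noteq> j \<and> X i = X j)" if "i \<in> {..<N}" "j \<in> {..<N}" for i j
  proof -
    have "(\<lambda>X. X i - X j) \<in> borel_measurable (config_space N :: (nat \<Rightarrow> real^'n) measure)"
      by (rule borel_measurable_diff[OF measurable_component_singleton[OF that(1)] measurable_component_singleton[OF that(2)]])
    from measurable_compose[OF this, of "\<lambda>v. i \<noteq> j \<and> v = 0"] show ?thesis by simp
  qed
  then show ?thesis unfolding e by (intro pred_intros_finite finite_lessThan)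
qed

context particles
begin

text \<open>Stability in the initial data and the speed bound in time combine to a modulus
  \<open>g\<close> that vanishes at \<open>p\<close>. Only the coordinates below \<open>N\<close>
  enter, so \<open>g\<close> is continuous for the product topology.\<close>

lemma tsol_continuous:
  assumes \<delta>: "0 < \<delta>" and i: "i < N"
  shows "continuous_on UNIV (\<lambda>p. tsol \<delta> (snd p) (max 0 (fst p)) i)"
proof -
  from tgrad_lipschitz[OF kappa \<delta>, where 'n='n] obtain L where
    L: "0 \<le> L" "\<And>x y::real^'n. norm (tgrad \<kappa> \<delta> x - tgrad \<kappa> \<delta> y) \<le> L * norm (x - y)" by blast
  from tgrad_bounded[OF kappa \<delta>, where 'n='n] obtain M where
    M: "\<And>x::real^'n. norm (tgrad \<kappa> \<delta> x) \<le> M" by blast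
  let ?f = "\<lambda>p. tsol \<delta> (snd p) (max 0 (fst p)) i"
  have "isCont ?f p" for p :: "real \<times> (nat \<Rightarrow> real^'n)"
  proof -
    define g where "g q = sqrt (exp (4 * L * max 0 (fst q)) * (\<Sum>j<N. (norm (snd q j - snd p j))\<^sup>2))
      + M * \<bar>max 0 (fst q) - max 0 (fst p)\<bar>" for q :: "real \<times> (nat \<Rightarrow> real^'n)"
    have le: "norm (?f q - ?f p) \<le> g q" for q
    proof -
      let ?t = "max 0 (fst q)" and ?s = "max 0 (fst p)"
      let ?x = "tsol \<delta> (snd q)" and ?y = "tsol \<delta> (snd p)"
      have "(norm (?x ?t i - ?y ?t i))\<^sup>2 \<le> (\<Sum>j<N. (norm (?x ?t j - ?y ?t j))\<^sup>2)"
        using i by (intro member_le_sum) auto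
      also have "\<dots> \<le> exp (4 * L * ?t) * (\<Sum>j<N. (norm (?x 0 j - ?y 0 j))\<^sup>2)"
        by (rule solution_stable[OF N0 L(2) L(1) tsol(2)[OF \<delta>] tsol(2)[OF \<delta>]]) simp
      also have "(\<Sum>j<N. (norm (?x 0 j - ?y 0 j))\<^sup>2) = (\<Sum>j<N. (norm (snd q j - snd p j))\<^sup>2)"
        by (intro sum.cong refl) (simp add: tsol(1)[OF \<delta>])
      finally have "norm (?x ?t i - ?y ?t i) \<le> sqrt (exp (4 * L * ?t) * (\<Sum>j<N. (norm (snd q j - snd p j))\<^sup>2))"
        by (rule real_le_rsqrt)
      moreover have "norm (?y ?t i - ?y ?s i) \<le> M * \<bar>?t - ?s\<bar>"
        by (rule vector_derivative_lipschitz[OF solvesD[OF tsol(2)[OF \<delta>] _ i] norm_force_le[OF N0 M], where b="max ?t ?s"]) auto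
      moreover have "norm (?x ?t i - ?y ?s i) \<le> norm (?x ?t i - ?y ?t i) + norm (?y ?t i - ?y ?s i)"
        using norm_triangle_ineq[of "?x ?t i - ?y ?t i" "?y ?t i - ?y ?s i"] by simp
      ultimately show ?thesis unfolding g_def by linarith
    qed
    have "isCont g p"
    proof -
      have c: "continuous_on UNIV (\<lambda>q::real \<times> (nat \<Rightarrow> real^'n). snd q j)" for j
        by (rule continuous_on_compose2[OF continuous_on_product_coordinates continuous_on_snd[OF continuous_on_id]]) auto
      have "continuous_on UNIV g"
        unfolding g_def by (intro continuous_intros c)
      then show ?thesis using continuous_on_eq_continuous_at[OF open_UNIV, of g] by blast
    qed
    then have "(g \<longlongrightarrow> 0) (at p)" by (simp add: isCont_def g_def)
    with always_eventually[OF allI[OF le]] have "((\<lambda>q. ?f q - ?f p) \<longlongrightarrow> 0) (at p)"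
      by (rule Lim_null_comparison)
    then show ?thesis unfolding isCont_def by (rule LIM_zero_cancel)
  qed
  then show ?thesis by (simp add: continuous_on_eq_continuous_at)
qed

text \<open>Off the collision set the truncated solutions with parameter \<open>1 / (n + 1)\<close>
  eventually coincide with the flow, so the flow is a pointwise limit of jointly continuous
  functions; on that set it is the identity.\<close>

lemma flow_component_measurable:
  assumes i: "i < N"
  shows "(\<lambda>p. flow \<kappa> N (max 0 (fst p)) (snd p) i) \<in> borel_measurable (borel \<Otimes>\<^sub>M (config_space N :: (nat \<Rightarrow> real^'n) measure))"
proof -
  let ?d = "\<lambda>n. 1 / real (Suc n)"
  have emb: "(\<lambda>p. p) \<in> measurable (borel \<Otimes>\<^sub>M (config_space N :: (nat \<Rightarrow> real^'n) measure)) (borel :: (real \<times> (nat \<Rightarrow> real^'n)) measure)"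
  proof -
    have "(\<lambda>p. (fst p, snd p)) \<in> measurable ((borel :: real measure) \<Otimes>\<^sub>M (config_space N :: (nat \<Rightarrow> real^'n) measure)) (borel \<Otimes>\<^sub>M borel)"
      by (rule measurable_Pair[OF measurable_fst measurable_compose[OF measurable_snd measurable_config_borel]])
    then show ?thesis by (simp only: borel_prod prod.collapse)
  qed
  have m [measurable]: "(\<lambda>p. tsol (?d n) (snd p) (max 0 (fst p)) i) \<in> borel_measurable (borel \<Otimes>\<^sub>M (config_space N :: (nat \<Rightarrow> real^'n) measure))" for n
    by (rule measurable_compose[OF emb borel_measurable_continuous_onI[OF tsol_continuous[OF _ i]]]) simp
  have comp [measurable]: "(\<lambda>p. snd p i) \<in> borel_measurable ((borel :: real measure) \<Otimes>\<^sub>M (config_space N :: (nat \<Rightarrow> real^'n) measure))"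
    by (rule measurable_compose[OF measurable_snd measurable_component_singleton]) (use i in simp)
  have lim: "flow \<kappa> N (max 0 (fst p)) (snd p) i =
      (if snd p \<in> collisions N then snd p i else lim (\<lambda>n. tsol (?d n) (snd p) (max 0 (fst p)) i))"
    if p: "p \<in> space (borel \<Otimes>\<^sub>M (config_space N :: (nat \<Rightarrow> real^'n) measure))" for p :: "real \<times> (nat \<Rightarrow> real^'n)"
  proof (cases "snd p \<in> collisions N")
    case False
    have X: "snd p \<in> space (config_space N)" using p by (auto simp: space_pair_measure)
    from safe_exists[OF False] obtain \<delta>0 where \<delta>0: "0 < \<delta>0" "\<And>\<delta>. 0 < \<delta> \<Longrightarrow> \<delta> \<le> \<delta>0 \<Longrightarrow> safe \<delta> (snd p)" by blast
    have "\<forall>\<^sub>F n in sequentially. tsol (?d n) (snd p) (max 0 (fst p)) i = flow \<kappa> N (max 0 (fst p)) (snd p) i"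
      using eventually_inverse_Suc_le[OF \<delta>0(1)]
    proof eventually_elim
      case (elim n)
      have "safe (?d n) (snd p)" using elim by (intro \<delta>0(2)) auto
      from flow_eq_tsol[OF this X False, of "max 0 (fst p)"] show ?case using i by simp
    qed
    then have "(\<lambda>n. tsol (?d n) (snd p) (max 0 (fst p)) i) \<longlonglongrightarrow> flow \<kappa> N (max 0 (fst p)) (snd p) i"
      by (rule tendsto_eventually)
    then show ?thesis using False by (simp add: limI)
  qed (simp add: flow_collisions)
  have [measurable]: "Measurable.pred ((borel :: real measure) \<Otimes>\<^sub>M (config_space N :: (nat \<Rightarrow> real^'n) measure)) (\<lambda>p. snd p \<in> collisions N)"
    by (rule measurable_compose[OF measurable_snd collisions_pred_measurable])
  have [measurable]: "(\<lambda>p. lim (\<lambda>n. tsol (?d n) (snd p) (max 0 (fst p)) i)) \<in> borel_measurable (borel \<Otimes>\<^sub>M (config_space N :: (nat \<Rightarrow> real^'n) measure))"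
    by (rule borel_measurable_lim_metric[OF m])
  have "(\<lambda>p. if snd p \<in> collisions N then snd p i else lim (\<lambda>n. tsol (?d n) (snd p) (max 0 (fst p)) i))
      \<in> borel_measurable (borel \<Otimes>\<^sub>M (config_space N :: (nat \<Rightarrow> real^'n) measure))"
    by measurable
  then show ?thesis by (rule measurable_cong[THEN iffD2, rotated]) (rule lim)
qed

lemma flow_joint_measurable:
  "(\<lambda>p. flow \<kappa> N (max 0 (fst p)) (snd p)) \<in> measurable (borel \<Otimes>\<^sub>M config_space N) (config_space N :: (nat \<Rightarrow> real^'n) measure)"
proof (rule measurable_PiM_single')
  show "(\<lambda>p. flow \<kappa> N (max 0 (fst p)) (snd p)) \<in> space (borel \<Otimes>\<^sub>M (config_space N :: (nat \<Rightarrow> real^'n) measure)) \<rightarrow> (\<Pi>\<^sub>E i\<in>{..<N}. space borel)"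
  proof
    fix p :: "real \<times> (nat \<Rightarrow> real^'n)" assume "p \<in> space (borel \<Otimes>\<^sub>M (config_space N :: (nat \<Rightarrow> real^'n) measure))"
    then have "snd p \<in> space (config_space N)" by (auto simp: space_pair_measure)
    from flow_in_space[OF this, of "max 0 (fst p)"]
    show "flow \<kappa> N (max 0 (fst p)) (snd p) \<in> (\<Pi>\<^sub>E i\<in>{..<N}. space borel)" by (simp add: space_PiM)
  qed
qed (simp add: flow_component_measurable)

lemma flow_measurable:
  assumes "0 \<le> t"
  shows "flow \<kappa> N t \<in> measurable (config_space N) (config_space N :: (nat \<Rightarrow> real^'n) measure)"
  using measurable_compose[OF measurable_Pair1' flow_joint_measurable, of t] assms by simp

end

section \<open>Averages against the transported density\<close>

context mean_field
begin

lemma sets_mu: "sets (\<mu> t) = sets borel" by simp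

lemma integrable_bounded_inner:
  fixes f g :: "'a \<Rightarrow> 'b::euclidean_space"
  assumes f: "f \<in> borel_measurable M" "\<And>y. norm (f y) \<le> C" and g: "integrable M g"
  shows "integrable M (\<lambda>y. f y \<bullet> g y)"
proof (rule Bochner_Integration.integrable_bound[where f="\<lambda>y. C * norm (g y)"])
  show "(\<lambda>y. f y \<bullet> g y) \<in> borel_measurable M"
    using f(1) borel_measurable_integrable[OF g] by measurable
  show "AE y in M. norm (f y \<bullet> g y) \<le> norm (C * norm (g y))"
  proof (intro AE_I2)
    fix y
    have "norm (f y \<bullet> g y) \<le> norm (f y) * norm (g y)" using Cauchy_Schwarz_ineq2 by auto
    also have "\<dots> \<le> C * norm (g y)" by (intro mult_right_mono f) simp
    also have "\<dots> \<le> norm (C * norm (g y))" by simp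
    finally show "norm (f y \<bullet> g y) \<le> norm (C * norm (g y))" .
  qed
qed (use g in simp)

lemma mu_pair_integrable:
  fixes k :: "real^'n \<Rightarrow> 'b::{banach, second_countable_topology}"
  assumes t: "t \<in> {0..T}" and k: "integrable lborel k"
  shows "integrable (\<mu> t \<Otimes>\<^sub>M \<mu> t) (\<lambda>p. k (fst p - snd p))"
    and "(LINT p|(\<mu> t \<Otimes>\<^sub>M \<mu> t). norm (k (fst p - snd p))) \<le> \<Lambda> * (LINT y|lborel. norm (k y))"
proof -
  interpret M: prob_space "\<mu> t" by (rule prob_mu[OF t])
  interpret MM: pair_sigma_finite "\<mu> t" "\<mu> t" ..
  have [measurable]: "k \<in> borel_measurable borel" using k by simp
  have m: "(\<lambda>p. k (fst p - snd p)) \<in> borel_measurable (\<mu> t \<Otimes>\<^sub>M \<mu> t)"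
  proof -
    have "(\<lambda>p. k (fst p - snd p)) \<in> borel_measurable (borel \<Otimes>\<^sub>M borel)" by measurable
    then show ?thesis by (simp cong: measurable_cong_sets sets_pair_measure_cong)
  qed
  have i: "integrable (\<mu> t) (\<lambda>y. norm (k (x - y)))" for x
    using mu_integrable(1)[OF t k] by (rule integrable_norm)
  have b: "(LINT y|\<mu> t. norm (k (x - y))) \<le> \<Lambda> * (LINT y|lborel. norm (k y))" for x
    by (rule mu_integrable(2)[OF t k])
  have o: "integrable (\<mu> t) (\<lambda>x. LINT y|\<mu> t. norm (k (x - y)))"
  proof (rule M.integrable_const_bound)
    show "AE x in \<mu> t. norm (LINT y|\<mu> t. norm (k (x - y))) \<le> \<Lambda> * (LINT y|lborel. norm (k y))"
      using b by simp
    have "(\<lambda>x. LINT y|\<mu> t. norm (k (fst (x, y) - snd (x, y)))) \<in> borel_measurable (\<mu> t)"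
      using m by measurable
    then show "(\<lambda>x. LINT y|\<mu> t. norm (k (x - y))) \<in> borel_measurable (\<mu> t)" by simp
  qed
  show int: "integrable (\<mu> t \<Otimes>\<^sub>M \<mu> t) (\<lambda>p. k (fst p - snd p))"
    by (rule MM.Fubini_integrable[OF m]) (use o mu_integrable(1)[OF t k] in auto)
  have "(LINT p|(\<mu> t \<Otimes>\<^sub>M \<mu> t). norm (k (fst p - snd p))) = (LINT x|\<mu> t. LINT y|\<mu> t. norm (k (x - y)))"
    using MM.integral_fst'[OF integrable_norm[OF int]] by simp
  also have "\<dots> \<le> (LINT x|\<mu> t. \<Lambda> * (LINT y|lborel. norm (k y)))"
    using o b by (intro integral_mono) auto
  finally show "(LINT p|(\<mu> t \<Otimes>\<^sub>M \<mu> t). norm (k (fst p - snd p))) \<le> \<Lambda> * (LINT y|lborel. norm (k y))"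
    using M.prob_space by simp
qed

lemma zero_in_T: "0 \<in> {0..T}" using T by simp

lemma mu_Y:
  fixes f :: "real^'n \<Rightarrow> 'b::{banach, second_countable_topology}"
  assumes t: "t \<in> {0..T}" and [measurable]: "f \<in> borel_measurable borel"
  shows "integrable (\<mu> t) f \<longleftrightarrow> integrable (\<mu> 0) (\<lambda>y. f (Y t y))"
    and "(LINT y|\<mu> t. f y) = (LINT y|\<mu> 0. f (Y t y))"
proof -
  have [measurable]: "Y t \<in> measurable (\<mu> 0) borel" by measurable
  show "integrable (\<mu> t) f \<longleftrightarrow> integrable (\<mu> 0) (\<lambda>y. f (Y t y))"
    unfolding distr_Y[OF t, symmetric] by (rule integrable_distr_eq) measurable
  show "(LINT y|\<mu> t. f y) = (LINT y|\<mu> 0. f (Y t y))"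
    unfolding distr_Y[OF t, symmetric] by (rule integral_distr) measurable
qed

lemma mu_pair_Y:
  fixes f :: "(real^'n) \<times> (real^'n) \<Rightarrow> 'b::{banach, second_countable_topology}"
  assumes t: "t \<in> {0..T}" and f: "f \<in> borel_measurable (borel \<Otimes>\<^sub>M borel)"
  shows "integrable (\<mu> t \<Otimes>\<^sub>M \<mu> t) f \<longleftrightarrow> integrable (\<mu> 0 \<Otimes>\<^sub>M \<mu> 0) (\<lambda>p. f (Y t (fst p), Y t (snd p)))"
    and "(LINT p|(\<mu> t \<Otimes>\<^sub>M \<mu> t). f p) = (LINT p|(\<mu> 0 \<Otimes>\<^sub>M \<mu> 0). f (Y t (fst p), Y t (snd p)))"
proof -
  interpret M: prob_space "\<mu> t" by (rule prob_mu[OF t])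
  have [measurable]: "Y t \<in> measurable (\<mu> 0) borel" by measurable
  have m: "(\<lambda>p. (Y t (fst p), Y t (snd p))) \<in> measurable (\<mu> 0 \<Otimes>\<^sub>M \<mu> 0) (borel \<Otimes>\<^sub>M borel)" by measurable
  have "\<mu> t \<Otimes>\<^sub>M \<mu> t = distr (\<mu> 0) borel (Y t) \<Otimes>\<^sub>M distr (\<mu> 0) borel (Y t)"
    by (simp only: distr_Y[OF t])
  also have "\<dots> = distr (\<mu> 0 \<Otimes>\<^sub>M \<mu> 0) (borel \<Otimes>\<^sub>M borel) (\<lambda>(x, y). (Y t x, Y t y))"
    by (rule pair_measure_distr) (simp_all add: distr_Y[OF t] M.sigma_finite_measure_axioms)
  finally have e: "\<mu> t \<Otimes>\<^sub>M \<mu> t = distr (\<mu> 0 \<Otimes>\<^sub>M \<mu> 0) (borel \<Otimes>\<^sub>M borel) (\<lambda>p. (Y t (fst p), Y t (snd p)))"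
    by (simp add: case_prod_beta')
  show "integrable (\<mu> t \<Otimes>\<^sub>M \<mu> t) f \<longleftrightarrow> integrable (\<mu> 0 \<Otimes>\<^sub>M \<mu> 0) (\<lambda>p. f (Y t (fst p), Y t (snd p)))"
    unfolding e by (rule integrable_distr_eq[OF m f])
  show "(LINT p|(\<mu> t \<Otimes>\<^sub>M \<mu> t). f p) = (LINT p|(\<mu> 0 \<Otimes>\<^sub>M \<mu> 0). f (Y t (fst p), Y t (snd p)))"
    unfolding e by (rule integral_distr[OF m f])
qed

lemma Y_inj:
  assumes "Y t x = Y t y" shows "x = y"
proof -
  have "norm (x - y) \<le> exp (\<Lambda> * clampT t) * norm (Y t x - Y t y)"
    unfolding Y_def using clampT_in[of t] by (intro psi_separation) auto
  with assms show ?thesis by simp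
qed

lemma AE_pair_neq:
  assumes t: "t \<in> {0..T}"
  shows "AE p in \<mu> t \<Otimes>\<^sub>M \<mu> t. fst p \<noteq> snd p"
proof -
  interpret M: prob_space "\<mu> t" by (rule prob_mu[OF t])
  interpret MM: pair_sigma_finite "\<mu> t" "\<mu> t" ..
  have "{p \<in> space (\<mu> t \<Otimes>\<^sub>M \<mu> t). fst p \<noteq> snd p} \<in> sets (\<mu> t \<Otimes>\<^sub>M \<mu> t)" by measurable
  then show ?thesis
    by (rule MM.AE_pair_measure[of "\<lambda>p. fst p \<noteq> snd p"])
      (use AE_density_law_neq[OF density[OF t]] in \<open>auto simp: eq_commute\<close>)
qed

end

section \<open>Algebra of the modulated energy, the commutator and the dissipation\<close>

lemma antisymmetric_double_sum:
  fixes u :: "nat \<Rightarrow> 'a::real_inner" and k :: "nat \<Rightarrow> nat \<Rightarrow> 'a"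
  assumes "\<And>i j. k j i = - k i j"
  shows "(\<Sum>i<N. \<Sum>j<N. (u i - u j) \<bullet> k i j) = 2 * (\<Sum>i<N. u i \<bullet> (\<Sum>j<N. k i j))"
proof -
  have k: "u j \<bullet> k i j = - (u j \<bullet> k j i)" for i j
    by (subst assms) simp
  have "(\<Sum>i<N. \<Sum>j<N. u j \<bullet> k i j) = (\<Sum>j<N. \<Sum>i<N. u j \<bullet> k i j)" by (rule sum.swap)
  also have "\<dots> = (\<Sum>j<N. \<Sum>i<N. - (u j \<bullet> k j i))"
    by (intro sum.cong refl k)
  also have "\<dots> = - (\<Sum>j<N. \<Sum>i<N. u j \<bullet> k j i)" by (simp only: sum_negf)
  finally show ?thesis by (simp add: inner_diff_left sum_subtractf inner_sum_right)
qed

context particles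
begin

lemma mod_energy_expand:
  fixes X :: "nat \<Rightarrow> real^'n"
  assumes t: "t \<in> {0..T}" and X: "X \<notin> collisions N"
  shows "mod_energy \<kappa> N X (\<rho> t) = 1 / (real N)\<^sup>2 * pair_energy N (ypot \<kappa>) X
    - 2 / real N * (\<Sum>i<N. (LINT y|\<mu> t. ypot \<kappa> (X i - y)))
    + (LINT p|(\<mu> t \<Otimes>\<^sub>M \<mu> t). ypot \<kappa> (fst p - snd p))"
proof -
  have i: "integrable (\<mu> t) (\<lambda>y. ypot \<kappa> (x - y))" for x
    by (rule mu_integrable(1)[OF t ypot_integrable[OF kappa]])
  have s: "ypot \<kappa> (x - y) = ypot \<kappa> (y - x)" for x y :: "real^'n"
    using ypot_minus[of \<kappa> "x - y"] by simp
  have "mod_energy \<kappa> N X (\<rho> t) =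
    1 / (real N)\<^sup>2 * (\<Sum>i<N. \<Sum>j\<in>{..<N} - {i}. ypot \<kappa> (X i - X j))
    - 1 / real N * (\<Sum>i<N. (LINT y|\<mu> t. ypot \<kappa> (X i - y))) - 1 / real N * (\<Sum>i<N. (LINT x|\<mu> t. ypot \<kappa> (x - X i)))
    + (LINT p|(\<mu> t \<Otimes>\<^sub>M \<mu> t). ypot \<kappa> (fst p - snd p))"
    unfolding mod_energy_def
  proof (rule offdiag_integral_expand[where ?h0.0="\<lambda>x y. ypot \<kappa> (x - y)", OF N0 X prob_mu[OF t] sets_mu AE_density_law_neq[OF density[OF t]]])
    show "integrable (\<mu> t) (\<lambda>x. ypot \<kappa> (x - y))" for y using i[of y] by (simp add: s[of y])
  qed (use i mu_pair_integrable(1)[OF t ypot_integrable[OF kappa]] in \<open>auto simp: yukawa_eq_ypot kappa\<close>)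
  moreover have "(LINT x|\<mu> t. ypot \<kappa> (x - X i)) = (LINT y|\<mu> t. ypot \<kappa> (X i - y))" for i
    by (simp add: s[of _ "X i"])
  ultimately show ?thesis by (simp add: pair_energy_def)
qed

lemma drift_integrable:
  fixes x :: "real^'n"
  assumes t: "t \<in> {0..T}"
  shows "integrable (\<mu> t) (\<lambda>y. U t y \<bullet> ygrad \<kappa> (x - y))"
  by (rule integrable_bounded_inner[OF _ U_bounded mu_integrable(1)[OF t ygrad_integrable[OF kappa]]]) simp


lemma mu_inner_measurable:
  assumes "f \<in> borel_measurable (borel \<Otimes>\<^sub>M borel)"
  shows "f \<in> borel_measurable (\<mu> t \<Otimes>\<^sub>M \<mu> t)"
  using assms by (simp cong: measurable_cong_sets sets_pair_measure_cong)

lemma commutator_integrable: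
  assumes t: "t \<in> {0..T}"
  shows "integrable (\<mu> t \<Otimes>\<^sub>M \<mu> t) (\<lambda>p. (U t (fst p) - U t (snd p)) \<bullet> ygrad \<kappa> (fst p - snd p))"
proof (rule integrable_bounded_inner[OF _ _ mu_pair_integrable(1)[OF t ygrad_integrable[OF kappa]]])
  show "(\<lambda>p. U t (fst p) - U t (snd p)) \<in> borel_measurable (\<mu> t \<Otimes>\<^sub>M \<mu> t)"
    by (rule mu_inner_measurable) measurable
  show "norm (U t (fst p) - U t (snd p)) \<le> 2 * Umax" for p
    using norm_triangle_ineq4[of "U t (fst p)" "U t (snd p)"] U_bounded[of t "fst p"] U_bounded[of t "snd p"] by linarith
qed

lemma sum_ygrad: "(\<Sum>j<N. ygrad \<kappa> (X i - X j)) = - real N *\<^sub>R vel X i"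
  using N0 by (simp add: force_def)

text \<open>The field tested here is itself minus the averaged gradient, so the mixed terms contain
  \<open>(norm (U t (X i)))\<^sup>2\<close>, and antisymmetry turns the particle term into forces
  tested with the field.\<close>

lemma commutator_expand:
  fixes X :: "nat \<Rightarrow> real^'n"
  assumes t: "t \<in> {0..T}" and X: "X \<notin> collisions N"
  shows "commutator \<kappa> N X (\<rho> t) (U t) = - 2 / real N * (\<Sum>i<N. U t (X i) \<bullet> vel X i)
    + 2 / real N * (\<Sum>i<N. (norm (U t (X i)))\<^sup>2 + (LINT y|\<mu> t. U t y \<bullet> ygrad \<kappa> (X i - y)))
    + (LINT p|(\<mu> t \<Otimes>\<^sub>M \<mu> t). (U t (fst p) - U t (snd p)) \<bullet> ygrad \<kappa> (fst p - snd p))"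
proof -
  let ?h = "\<lambda>x y. (U t x - U t y) \<bullet> ygrad \<kappa> (x - y)"
  have Ut: "U t x = - (LINT y|\<mu> t. ygrad \<kappa> (x - y))" for x
    using U_eq[of t x] clampT_eq[OF t] by simp
  have gi: "integrable (\<mu> t) (\<lambda>y. ygrad \<kappa> (x - y))" for x :: "real^'n"
    by (rule mu_integrable(1)[OF t ygrad_integrable[OF kappa]])
  have i: "integrable (\<mu> t) (?h x)" for x
    unfolding inner_diff_left
    by (rule Bochner_Integration.integrable_diff[OF integrable_inner_right[OF gi] drift_integrable[OF t]])
  have s: "?h x y = ?h y x" for x y
    using ygrad_minus[of \<kappa> "x - y"] by (simp add: inner_diff_left)
  have I: "(LINT y|\<mu> t. ?h x y) = - (norm (U t x))\<^sup>2 - (LINT y|\<mu> t. U t y \<bullet> ygrad \<kappa> (x - y))" for x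
  proof -
    have "(LINT y|\<mu> t. ?h x y) = (LINT y|\<mu> t. U t x \<bullet> ygrad \<kappa> (x - y)) - (LINT y|\<mu> t. U t y \<bullet> ygrad \<kappa> (x - y))"
      unfolding inner_diff_left
      by (rule Bochner_Integration.integral_diff[OF integrable_inner_right[OF gi] drift_integrable[OF t]])
    also have "(LINT y|\<mu> t. U t x \<bullet> ygrad \<kappa> (x - y)) = - (norm (U t x))\<^sup>2"
      using integral_inner_right[OF gi, of "U t x" x] Ut[of x] by (simp add: power2_norm_eq_inner)
    finally show ?thesis .
  qed
  have "commutator \<kappa> N X (\<rho> t) (U t) =
    1 / (real N)\<^sup>2 * (\<Sum>i<N. \<Sum>j\<in>{..<N} - {i}. ?h (X i) (X j))
    - 1 / real N * (\<Sum>i<N. (LINT y|\<mu> t. ?h (X i) y)) - 1 / real N * (\<Sum>i<N. (LINT x|\<mu> t. ?h x (X i)))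
    + (LINT p|(\<mu> t \<Otimes>\<^sub>M \<mu> t). ?h (fst p) (snd p))"
    unfolding commutator_def
  proof (rule offdiag_integral_expand[where ?h0.0="?h", OF N0 X prob_mu[OF t] sets_mu AE_density_law_neq[OF density[OF t]]])
    show "integrable (\<mu> t) (\<lambda>x. ?h x y)" for y using i[of y] by (simp add: s[of y])
  qed (use i commutator_integrable[OF t] in \<open>auto simp: grad_yukawa kappa\<close>)
  moreover have "(LINT x|\<mu> t. ?h x (X i)) = (LINT y|\<mu> t. ?h (X i) y)" for i
    by (simp add: s[of _ "X i"])
  moreover have "(\<Sum>i<N. \<Sum>j\<in>{..<N} - {i}. ?h (X i) (X j)) = - 2 * real N * (\<Sum>i<N. U t (X i) \<bullet> vel X i)"
  proof -
    have "(\<Sum>i<N. \<Sum>j\<in>{..<N} - {i}. ?h (X i) (X j)) = (\<Sum>i<N. \<Sum>j<N. ?h (X i) (X j))"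
    proof (rule sum.cong[OF refl])
      fix i assume "i \<in> {..<N}"
      from sum.remove[OF finite_lessThan this, of "\<lambda>j. ?h (X i) (X j)"]
      show "(\<Sum>j\<in>{..<N} - {i}. ?h (X i) (X j)) = (\<Sum>j<N. ?h (X i) (X j))" by simp
    qed
    also have "\<dots> = 2 * (\<Sum>i<N. U t (X i) \<bullet> (\<Sum>j<N. ygrad \<kappa> (X i - X j)))"
      by (rule antisymmetric_double_sum) (metis minus_diff_eq ygrad_minus)
    also have "\<dots> = - 2 * real N * (\<Sum>i<N. U t (X i) \<bullet> vel X i)"
      by (simp add: sum_ygrad sum_distrib_left sum_negf mult.assoc)
    finally show ?thesis .
  qed
  moreover have "1 / (real N)\<^sup>2 * (- 2 * real N * S) = - 2 / real N * S" for S
    using N0 by (simp add: power2_eq_square field_simps)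
  ultimately have "commutator \<kappa> N X (\<rho> t) (U t) = - 2 / real N * (\<Sum>i<N. U t (X i) \<bullet> vel X i)
    - 2 / real N * (\<Sum>i<N. (LINT y|\<mu> t. ?h (X i) y)) + (LINT p|(\<mu> t \<Otimes>\<^sub>M \<mu> t). ?h (fst p) (snd p))"
    by simp
  also have "(\<Sum>i<N. (LINT y|\<mu> t. ?h (X i) y)) = - (\<Sum>i<N. (norm (U t (X i)))\<^sup>2 + (LINT y|\<mu> t. U t y \<bullet> ygrad \<kappa> (X i - y)))"
    unfolding I by (simp add: sum_negf[symmetric] del: sum_negf)
  finally show ?thesis by simp
qed

definition Dis :: "real \<Rightarrow> (nat \<Rightarrow> real^'n) \<Rightarrow> real" where
  "Dis t X = 1 / real N * (\<Sum>i<N. (norm (vel X i - U t (X i)))\<^sup>2)"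

lemma Dis_nonneg: "0 \<le> Dis t X"
  by (simp add: Dis_def sum_nonneg)

lemma dissipation_eq:
  fixes X :: "nat \<Rightarrow> real^'n"
  assumes t: "t \<in> {0..T}" and X: "X \<notin> collisions N"
  shows "dissipation \<kappa> N X (\<rho> t) = ennreal (Dis t X)"
proof -
  have "norm ((1 / real N) *\<^sub>R (\<Sum>j\<in>{..<N} - {i}. grad (yukawa \<kappa>) (X i - X j)) - grad_yukawa_conv \<kappa> (\<mu> t) (X i))
      = norm (vel X i - U t (X i))" if "i < N" for i
  proof -
    have U: "U t (X i) = - grad_yukawa_conv \<kappa> (\<mu> t) (X i)"
      by (simp add: U_def velocity_def clampT_eq[OF t])
    show ?thesis unfolding vel_eq[OF X that, symmetric] U
      by (simp add: norm_minus_commute)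
  qed
  then show ?thesis using X by (simp add: dissipation_def Dis_def)
qed

text \<open>The right-hand side is what the chain rule produces from the particle, mixed and
  mean-field parts of the modulated energy. Expanding the square in \<open>Dis\<close> supplies the
  terms by which it differs from the commutator; the integrals of \<open>U\<close> against the
  gradient match on both sides and need not be evaluated.\<close>

lemma energy_production:
  fixes X :: "nat \<Rightarrow> real^'n"
  assumes t: "t \<in> {0..T}" and X: "X \<notin> collisions N"
  shows "commutator \<kappa> N X (\<rho> t) (U t) - 2 * Dis t X = - 2 / real N * (\<Sum>i<N. (norm (vel X i))\<^sup>2)
    - 2 / real N * (\<Sum>i<N. (LINT y|\<mu> t. ygrad \<kappa> (X i - y) \<bullet> (vel X i - U t y)))
    + (LINT p|(\<mu> t \<Otimes>\<^sub>M \<mu> t). ygrad \<kappa> (fst p - snd p) \<bullet> (U t (fst p) - U t (snd p)))"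
proof -
  have gi: "integrable (\<mu> t) (\<lambda>y. ygrad \<kappa> (x - y))" for x :: "real^'n"
    by (rule mu_integrable(1)[OF t ygrad_integrable[OF kappa]])
  have Ut: "(LINT y|\<mu> t. ygrad \<kappa> (x - y)) = - U t x" for x
    using U_eq[of t x] clampT_eq[OF t] by simp
  have I: "(LINT y|\<mu> t. ygrad \<kappa> (X i - y) \<bullet> (vel X i - U t y)) = - (U t (X i) \<bullet> vel X i) - (LINT y|\<mu> t. U t y \<bullet> ygrad \<kappa> (X i - y))" for i
  proof -
    have "(LINT y|\<mu> t. ygrad \<kappa> (X i - y) \<bullet> (vel X i - U t y)) = (LINT y|\<mu> t. vel X i \<bullet> ygrad \<kappa> (X i - y) - U t y \<bullet> ygrad \<kappa> (X i - y))"
      by (intro Bochner_Integration.integral_cong) (simp_all add: inner_diff_right inner_commute)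
    also have "\<dots> = (LINT y|\<mu> t. vel X i \<bullet> ygrad \<kappa> (X i - y)) - (LINT y|\<mu> t. U t y \<bullet> ygrad \<kappa> (X i - y))"
      by (rule Bochner_Integration.integral_diff[OF integrable_inner_right[OF gi] drift_integrable[OF t]])
    also have "(LINT y|\<mu> t. vel X i \<bullet> ygrad \<kappa> (X i - y)) = - (U t (X i) \<bullet> vel X i)"
      using integral_inner_right[OF gi, of "vel X i" "X i"] Ut[of "X i"] by (simp add: inner_commute)
    finally show ?thesis .
  qed
  have D: "2 * Dis t X = 2 / real N * (\<Sum>i<N. (norm (vel X i))\<^sup>2 - 2 * (U t (X i) \<bullet> vel X i) + (norm (U t (X i)))\<^sup>2)"
    by (simp add: Dis_def power2_norm_eq_inner inner_diff_left inner_diff_right inner_commute algebra_simps)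
  show ?thesis unfolding commutator_expand[OF t X] D I
    by (simp add: sum.distrib sum_subtractf sum_negf sum_distrib_left[symmetric] inner_commute algebra_simps)
qed

end

section \<open>Integrated evolution laws along the two flows\<close>

lemma set_integral_has_integral:
  fixes f :: "real \<Rightarrow> real"
  assumes "set_integrable lborel S f" "v = (LINT s:S|lborel. f s)"
  shows "(f has_integral v) S"
  using set_borel_integral_eq_integral[OF assms(1)] assms(2) integrable_integral by metis

context mean_field
begin

lemma Y_deriv:
  assumes t: "t \<in> {0..T}" and s: "s \<in> {0..t}"
  shows "((\<lambda>s. Y s y) has_vector_derivative U s (Y s y)) (at s within {0..t})"
proof (rule has_vector_derivative_transform[of s "{0..t}" "\<lambda>s. Y s y" "psi 0 y"])
  show "Y r y = psi 0 y r" if "r \<in> {0..t}" for r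
    using t that by (simp add: Y_def clampT_eq)
  have "Y s y = psi 0 y s" using t s by (simp add: Y_def clampT_eq)
  moreover have "(psi 0 y has_vector_derivative U (0 + s) (psi 0 y s)) (at s within {0..t})"
    by (rule has_vector_derivative_within_subset[OF psi_deriv]) (use s in auto)
  ultimately show "(psi 0 y has_vector_derivative U s (Y s y)) (at s within {0..t})" by simp
qed (use s in simp)

lemma Y_continuous_compose:
  assumes "continuous_on S f" "continuous_on S g"
  shows "continuous_on S (\<lambda>s. Y (f s) (g s))"
  using continuous_on_compose2[OF Y_continuous continuous_on_Pair[OF assms]] by simp

text \<open>Pulled back to time 0, the energy becomes an average over a fixed measure of the
  potential along the difference of two characteristics. Injectivity of the flow keeps this
  difference nonzero almost everywhere.\<close>

lemma mean_field_energy_has_integral: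
  assumes t: "t \<in> {0..T}"
  shows "((\<lambda>s. LINT p|(\<mu> s \<Otimes>\<^sub>M \<mu> s). ygrad \<kappa> (fst p - snd p) \<bullet> (U s (fst p) - U s (snd p))) has_integral
    ((LINT p|(\<mu> t \<Otimes>\<^sub>M \<mu> t). ypot \<kappa> (fst p - snd p)) - (LINT p|(\<mu> 0 \<Otimes>\<^sub>M \<mu> 0). ypot \<kappa> (fst p - snd p)))) {0..t}"
proof -
  interpret M: prob_space "\<mu> 0" by (rule prob_mu[OF zero_in_T])
  interpret MM: pair_prob_space "\<mu> 0" "\<mu> 0" ..
  have sT: "s \<in> {0..T}" if "s \<in> {0..t}" for s using that t by simp
  have t0: "0 \<le> t" using t by simp
  define z where "z s p = Y s (fst p) - Y s (snd p)" for s and p :: "(real^'n) \<times> (real^'n)"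
  define w where "w s p = U s (Y s (fst p)) - U s (Y s (snd p))" for s and p :: "(real^'n) \<times> (real^'n)"
  have mk: "(\<lambda>p. k (fst p - snd p)) \<in> borel_measurable (borel \<Otimes>\<^sub>M borel)"
    if [measurable]: "k \<in> borel_measurable borel" for k :: "real^'n \<Rightarrow> 'b::{second_countable_topology, banach}"
    by measurable
  have push: "integrable (\<mu> s \<Otimes>\<^sub>M \<mu> s) (\<lambda>p. k (fst p - snd p)) \<longleftrightarrow> integrable (\<mu> 0 \<Otimes>\<^sub>M \<mu> 0) (\<lambda>p. k (z s p))"
      "(LINT p|(\<mu> s \<Otimes>\<^sub>M \<mu> s). k (fst p - snd p)) = (LINT p|(\<mu> 0 \<Otimes>\<^sub>M \<mu> 0). k (z s p))"
    if "s \<in> {0..t}" "k \<in> borel_measurable borel" for s and k :: "real^'n \<Rightarrow> 'b::{second_countable_topology, banach}"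
    using mu_pair_Y[OF sT[OF that(1)] mk[OF that(2)]] by (simp_all add: z_def)
  have D: "((\<lambda>s. z s p) has_vector_derivative w s p) (at s within {0..t})" if "s \<in> {0..t}" for s p
    unfolding z_def w_def by (intro has_vector_derivative_diff Y_deriv t that)
  have wc: "continuous_on {0..t} (\<lambda>s. w s p)" for p
    unfolding w_def by (intro continuous_intros U_continuous_compose Y_continuous_compose)
  have W: "norm (w s p) \<le> 2 * Umax" for s p
    unfolding w_def using norm_triangle_ineq4[of "U s (Y s (fst p))" "U s (Y s (snd p))"]
      U_bounded[of s "Y s (fst p)"] U_bounded[of s "Y s (snd p)"] by linarith
  have zm: "(\<lambda>q. z (fst q) (snd q)) \<in> borel_measurable (borel \<Otimes>\<^sub>M (\<mu> 0 \<Otimes>\<^sub>M \<mu> 0))"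
    and wm: "(\<lambda>q. w (fst q) (snd q)) \<in> borel_measurable (borel \<Otimes>\<^sub>M (\<mu> 0 \<Otimes>\<^sub>M \<mu> 0))"
    unfolding z_def w_def by measurable
  have Ki: "integrable (\<mu> 0 \<Otimes>\<^sub>M \<mu> 0) (\<lambda>p. ygrad \<kappa> (z s p))" if "s \<in> {0..t}" for s
    using push(1)[OF that ygrad_measurable] mu_pair_integrable(1)[OF sT[OF that] ygrad_integrable[OF kappa]] by blast
  have K: "(LINT p|(\<mu> 0 \<Otimes>\<^sub>M \<mu> 0). norm (ygrad \<kappa> (z s p))) \<le> \<Lambda> * (LINT y|lborel. norm (ygrad \<kappa> (y::real^'n)))" if "s \<in> {0..t}" for s
    using push(2)[OF that, of "\<lambda>v. norm (ygrad \<kappa> v)"] mu_pair_integrable(2)[OF sT[OF that] ygrad_integrable[OF kappa]] by simp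
  have P: "integrable (\<mu> 0 \<Otimes>\<^sub>M \<mu> 0) (\<lambda>p. ypot \<kappa> (z s p))" if "s \<in> {0..t}" for s
    using push(1)[OF that ypot_measurable] mu_pair_integrable(1)[OF sT[OF that] ypot_integrable[OF kappa]] by blast
  have nz: "AE p in \<mu> 0 \<Otimes>\<^sub>M \<mu> 0. z s p \<noteq> 0" for s
    using AE_pair_neq[OF zero_in_T] by eventually_elim (use Y_inj in \<open>auto simp: z_def\<close>)
  note acr = averaged_potential_chain_rule[OF kappa MM.prob_space_axioms t0 D wc W zm wm Ki K P nz]
  have L: "(LINT p|(\<mu> 0 \<Otimes>\<^sub>M \<mu> 0). ypot \<kappa> (z s p)) = (LINT p|(\<mu> s \<Otimes>\<^sub>M \<mu> s). ypot \<kappa> (fst p - snd p))" if "s \<in> {0..t}" for s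
    using push(2)[OF that ypot_measurable, of \<kappa>] by simp
  have R: "(LINT p|(\<mu> 0 \<Otimes>\<^sub>M \<mu> 0). ygrad \<kappa> (z s p) \<bullet> w s p) =
      (LINT p|(\<mu> s \<Otimes>\<^sub>M \<mu> s). ygrad \<kappa> (fst p - snd p) \<bullet> (U s (fst p) - U s (snd p)))" if "s \<in> {0..t}" for s
  proof -
    have "(\<lambda>p. ygrad \<kappa> (fst p - snd p) \<bullet> (U s (fst p) - U s (snd p))) \<in> borel_measurable (borel \<Otimes>\<^sub>M borel)"
      by measurable
    from mu_pair_Y(2)[OF sT[OF that] this] show ?thesis by (simp add: z_def w_def)
  qed
  have "((\<lambda>s. LINT p|(\<mu> 0 \<Otimes>\<^sub>M \<mu> 0). ygrad \<kappa> (z s p) \<bullet> w s p) has_integral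
    ((LINT p|(\<mu> 0 \<Otimes>\<^sub>M \<mu> 0). ypot \<kappa> (z t p)) - (LINT p|(\<mu> 0 \<Otimes>\<^sub>M \<mu> 0). ypot \<kappa> (z 0 p)))) {0..t}"
    by (rule set_integral_has_integral[OF acr])
  moreover have "t \<in> {0..t}" "0 \<in> {0..t}" using t0 by auto
  ultimately show ?thesis
    by (intro has_integral_eq[OF R]) (simp_all add: L)
qed

end

context particles
begin

context
  fixes X :: "nat \<Rightarrow> real^'n"
  assumes X: "X \<in> space (config_space N)" "X \<notin> collisions N"
begin

lemma flow_deriv:
  assumes "0 \<le> s" "i < N"
  shows "((\<lambda>s. flow \<kappa> N s X i) has_vector_derivative vel (flow \<kappa> N s X) i) (at s within {0..})"
  by (rule solvesD[OF solves_flow[OF X] assms])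

lemma flow_continuous: "i < N \<Longrightarrow> continuous_on {0..} (\<lambda>s. flow \<kappa> N s X i)"
  by (rule continuous_on_vector_derivative[OF flow_deriv]) auto

text \<open>A fixed initial configuration has a separation that persists, so along its path the
  singular force is a truncated one, which is bounded and continuous. The bound depends on the
  configuration and is never integrated over it.\<close>

lemma flow_vel:
  shows "\<exists>M. \<forall>s\<ge>0. \<forall>i<N. norm (vel (flow \<kappa> N s X) i) \<le> M"
    and "i < N \<Longrightarrow> continuous_on {0..} (\<lambda>s. vel (flow \<kappa> N s X) i)"
proof -
  from safe_exists[OF X(2)] obtain \<delta> where s: "safe \<delta> X" by blast
  then have \<delta>: "0 < \<delta>" by (simp add: safe_def)
  have e: "force N (tgrad \<kappa> \<delta>) (flow \<kappa> N s X) i = vel (flow \<kappa> N s X) i" if "0 \<le> s" "i < N" for s i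
    by (rule force_truncated_eq[OF trajectory_safe[OF s trajectory_flow[OF X] that(1)] that(2)])
  from tgrad_bounded[OF kappa \<delta>, where 'n='n] obtain M where
    M: "\<And>x::real^'n. norm (tgrad \<kappa> \<delta> x) \<le> M" by blast
  have "norm (vel (flow \<kappa> N s X) i) \<le> M" if "0 \<le> s" "i < N" for s i
    using norm_force_le[where K="tgrad \<kappa> \<delta>" and X="flow \<kappa> N s X" and i=i, OF N0 M] by (simp add: e that)
  then show "\<exists>M. \<forall>s\<ge>0. \<forall>i<N. norm (vel (flow \<kappa> N s X) i) \<le> M" by blast
  assume i: "i < N"
  have "continuous_on {0..} (\<lambda>s. force N (tgrad \<kappa> \<delta>) (flow \<kappa> N s X) i)"
    unfolding force_def
    by (intro continuous_intros continuous_on_compose2[OF tgrad_continuous_on[OF kappa \<delta>, of UNIV]] flow_continuous i) auto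
  then show "continuous_on {0..} (\<lambda>s. vel (flow \<kappa> N s X) i)"
    by (rule continuous_on_eq) (use e i in auto)
qed

lemma pair_energy_has_integral:
  assumes t: "0 \<le> t"
  shows "((\<lambda>s. - 2 * real N * (\<Sum>i<N. (norm (vel (flow \<kappa> N s X) i))\<^sup>2)) has_integral
    (pair_energy N (ypot \<kappa>) (flow \<kappa> N t X) - pair_energy N (ypot \<kappa>) (flow \<kappa> N 0 X))) {0..t}"
proof (rule fundamental_theorem_of_calculus[OF t])
  fix s assume s: "s \<in> {0..t}"
  have "((\<lambda>s. pair_energy N (ypot \<kappa>) (flow \<kappa> N s X)) has_real_derivative
    - 2 * real N * (\<Sum>i<N. (norm (vel (flow \<kappa> N s X) i))\<^sup>2)) (at s within {0..})"
  proof (rule pair_energy_deriv[OF solves_flow[OF X] _ ygrad_minus N0])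
    show "(ypot \<kappa> has_derivative (\<lambda>v. ygrad \<kappa> (flow \<kappa> N s X i - flow \<kappa> N s X j) \<bullet> v)) (at (flow \<kappa> N s X i - flow \<kappa> N s X j))"
      if "i < N" "j < N" "i \<noteq> j" for i j
      using flow_not_collisions[OF X, of s] s that by (intro ypot_has_derivative kappa) (auto simp: collisions_def)
  qed (use s in simp)
  then show "((\<lambda>s. pair_energy N (ypot \<kappa>) (flow \<kappa> N s X)) has_vector_derivative
    - 2 * real N * (\<Sum>i<N. (norm (vel (flow \<kappa> N s X) i))\<^sup>2)) (at s within {0..t})"
    unfolding has_real_derivative_iff_has_vector_derivative
    by (rule has_vector_derivative_within_subset) auto
qed

text \<open>One end of the difference is now particle \<open>i\<close>, the other a characteristic.
  It is nonzero almost everywhere because the density at each time has no atoms and is the image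
  under the flow.\<close>

lemma interaction_has_integral:
  assumes t: "t \<in> {0..T}" and i: "i < N"
  shows "((\<lambda>s. LINT y|\<mu> s. ygrad \<kappa> (flow \<kappa> N s X i - y) \<bullet> (vel (flow \<kappa> N s X) i - U s y)) has_integral
    ((LINT y|\<mu> t. ypot \<kappa> (flow \<kappa> N t X i - y)) - (LINT y|\<mu> 0. ypot \<kappa> (flow \<kappa> N 0 X i - y)))) {0..t}"
proof -
  have sT: "s \<in> {0..T}" if "s \<in> {0..t}" for s using that t by simp
  have t0: "0 \<le> t" using t by simp
  \<comment> \<open>The chain rule asks for measurability in time on the whole line; clamped times
    make position and velocity continuous there and change nothing on \<open>{0..t}\<close>.\<close>
  define a where "a s = flow \<kappa> N (clampT s) X i" for s
  define v where "v s = vel (flow \<kappa> N (clampT s) X) i" for s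
  define z where "z s y = a s - Y s y" for s y
  define w where "w s y = v s - U s (Y s y)" for s y
  have ac: "continuous_on S a" and vc: "continuous_on S v" for S
    unfolding a_def v_def using clampT_in
    by (auto intro!: continuous_on_compose2[OF flow_continuous[OF i] continuous_clampT] continuous_on_compose2[OF flow_vel(2)[OF i] continuous_clampT])
  have [measurable]: "a \<in> borel_measurable borel" "v \<in> borel_measurable borel"
    using ac vc by (auto intro: borel_measurable_continuous_onI)
  have ae: "a s = flow \<kappa> N s X i" "v s = vel (flow \<kappa> N s X) i" if "s \<in> {0..t}" for s
    using sT[OF that] by (simp_all add: a_def v_def clampT_eq)
  from flow_vel(1) obtain V where V: "\<And>s i. 0 \<le> s \<Longrightarrow> i < N \<Longrightarrow> norm (vel (flow \<kappa> N s X) i) \<le> V" by blast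
  have mk: "(\<lambda>y. k (x - y)) \<in> borel_measurable borel"
    if [measurable]: "k \<in> borel_measurable borel" for k :: "real^'n \<Rightarrow> 'b::{second_countable_topology, banach}" and x
    by measurable
  have push: "integrable (\<mu> s) (\<lambda>y. k (a s - y)) \<longleftrightarrow> integrable (\<mu> 0) (\<lambda>y. k (z s y))"
      "(LINT y|\<mu> s. k (a s - y)) = (LINT y|\<mu> 0. k (z s y))"
    if "s \<in> {0..t}" "k \<in> borel_measurable borel" for s and k :: "real^'n \<Rightarrow> 'b::{second_countable_topology, banach}"
    using mu_Y[OF sT[OF that(1)] mk[OF that(2)]] by (simp_all add: z_def)
  have D: "((\<lambda>s. z s y) has_vector_derivative w s y) (at s within {0..t})" if "s \<in> {0..t}" for s y
  proof -
    have "(a has_vector_derivative v s) (at s within {0..t})"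
    proof (rule has_vector_derivative_transform[OF that ae(1)])
      show "((\<lambda>s. flow \<kappa> N s X i) has_vector_derivative v s) (at s within {0..t})"
        unfolding ae(2)[OF that]
        by (rule has_vector_derivative_within_subset[OF flow_deriv]) (use that i in auto)
    qed
    then show ?thesis
      unfolding z_def w_def by (intro has_vector_derivative_diff Y_deriv t that)
  qed
  have wc: "continuous_on {0..t} (\<lambda>s. w s y)" for y
    unfolding w_def by (intro continuous_intros U_continuous_compose Y_continuous_compose vc)
  have W: "norm (w s y) \<le> V + Umax" for s y
    unfolding w_def v_def using norm_triangle_ineq4[of "v s" "U s (Y s y)"]
      U_bounded[of s "Y s y"] V[of "clampT s" i] clampT_in[of s] i by (auto simp: v_def)
  have zm: "(\<lambda>q. z (fst q) (snd q)) \<in> borel_measurable (borel \<Otimes>\<^sub>M \<mu> 0)"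
    and wm: "(\<lambda>q. w (fst q) (snd q)) \<in> borel_measurable (borel \<Otimes>\<^sub>M \<mu> 0)"
    unfolding z_def w_def by measurable
  have Ki: "integrable (\<mu> 0) (\<lambda>y. ygrad \<kappa> (z s y))" if "s \<in> {0..t}" for s
    using push(1)[OF that ygrad_measurable] mu_integrable(1)[OF sT[OF that] ygrad_integrable[OF kappa]] by blast
  have K: "(LINT y|\<mu> 0. norm (ygrad \<kappa> (z s y))) \<le> \<Lambda> * (LINT y|lborel. norm (ygrad \<kappa> (y::real^'n)))" if "s \<in> {0..t}" for s
    using push(2)[OF that, of "\<lambda>v. norm (ygrad \<kappa> v)"] mu_integrable(2)[OF sT[OF that] ygrad_integrable[OF kappa], of "a s"] by simp
  have P: "integrable (\<mu> 0) (\<lambda>y. ypot \<kappa> (z s y))" if "s \<in> {0..t}" for s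
    using push(1)[OF that ypot_measurable] mu_integrable(1)[OF sT[OF that] ypot_integrable[OF kappa]] by blast
  have nz: "AE y in \<mu> 0. z s y \<noteq> 0" if s: "s \<in> {0..t}" for s
  proof -
    have "AE y in distr (\<mu> 0) borel (Y s). y \<noteq> a s"
      unfolding distr_Y[OF sT[OF s]] by (rule AE_density_law_neq[OF density[OF sT[OF s]]])
    then have "AE y in \<mu> 0. Y s y \<noteq> a s" by (subst (asm) AE_distr_iff) auto
    then show ?thesis by eventually_elim (auto simp: z_def)
  qed
  note acr = averaged_potential_chain_rule[OF kappa prob_mu[OF zero_in_T] t0 D wc W zm wm Ki K P nz]
  have L: "(LINT y|\<mu> 0. ypot \<kappa> (z s y)) = (LINT y|\<mu> s. ypot \<kappa> (flow \<kappa> N s X i - y))" if "s \<in> {0..t}" for s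
    using push(2)[OF that ypot_measurable, of \<kappa>] by (simp add: ae[OF that])
  have R: "(LINT y|\<mu> 0. ygrad \<kappa> (z s y) \<bullet> w s y) =
      (LINT y|\<mu> s. ygrad \<kappa> (flow \<kappa> N s X i - y) \<bullet> (vel (flow \<kappa> N s X) i - U s y))" if "s \<in> {0..t}" for s
  proof -
    have "(\<lambda>y. ygrad \<kappa> (flow \<kappa> N s X i - y) \<bullet> (vel (flow \<kappa> N s X) i - U s y)) \<in> borel_measurable borel"
      by measurable
    from mu_Y(2)[OF sT[OF that] this] show ?thesis by (simp add: z_def w_def ae[OF that])
  qed
  have "((\<lambda>s. LINT y|\<mu> 0. ygrad \<kappa> (z s y) \<bullet> w s y) has_integral
    ((LINT y|\<mu> 0. ypot \<kappa> (z t y)) - (LINT y|\<mu> 0. ypot \<kappa> (z 0 y)))) {0..t}"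
    by (rule set_integral_has_integral[OF acr])
  moreover have "t \<in> {0..t}" "0 \<in> {0..t}" using t0 by auto
  ultimately show ?thesis
    by (intro has_integral_eq[OF R]) (simp_all add: L)
qed

lemma mod_energy_has_integral:
  assumes t: "t \<in> {0..T}"
  shows "((\<lambda>s. commutator \<kappa> N (flow \<kappa> N s X) (\<rho> s) (U s) - 2 * Dis s (flow \<kappa> N s X)) has_integral
    (mod_energy \<kappa> N (flow \<kappa> N t X) (\<rho> t) - mod_energy \<kappa> N (flow \<kappa> N 0 X) (\<rho> 0))) {0..t}"
proof -
  have sT: "s \<in> {0..T}" if "s \<in> {0..t}" for s using that t by simp
  have nc: "flow \<kappa> N s X \<notin> collisions N" if "s \<in> {0..T}" for s
    using flow_not_collisions[OF X, of s] that by simp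
  let ?p = "\<lambda>s. - 2 * real N * (\<Sum>i<N. (norm (vel (flow \<kappa> N s X) i))\<^sup>2)"
  let ?q = "\<lambda>s i. LINT y|\<mu> s. ygrad \<kappa> (flow \<kappa> N s X i - y) \<bullet> (vel (flow \<kappa> N s X) i - U s y)"
  let ?r = "\<lambda>s. LINT p|(\<mu> s \<Otimes>\<^sub>M \<mu> s). ygrad \<kappa> (fst p - snd p) \<bullet> (U s (fst p) - U s (snd p))"
  have q: "((\<lambda>s. \<Sum>i<N. ?q s i) has_integral
    (\<Sum>i<N. (LINT y|\<mu> t. ypot \<kappa> (flow \<kappa> N t X i - y)) - (LINT y|\<mu> 0. ypot \<kappa> (flow \<kappa> N 0 X i - y)))) {0..t}"
    by (intro has_integral_sum interaction_has_integral t) auto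
  have "((\<lambda>s. 1 / (real N)\<^sup>2 * ?p s - 2 / real N * (\<Sum>i<N. ?q s i) + ?r s) has_integral
    (1 / (real N)\<^sup>2 * (pair_energy N (ypot \<kappa>) (flow \<kappa> N t X) - pair_energy N (ypot \<kappa>) (flow \<kappa> N 0 X))
    - 2 / real N * (\<Sum>i<N. (LINT y|\<mu> t. ypot \<kappa> (flow \<kappa> N t X i - y)) - (LINT y|\<mu> 0. ypot \<kappa> (flow \<kappa> N 0 X i - y)))
    + ((LINT p|(\<mu> t \<Otimes>\<^sub>M \<mu> t). ypot \<kappa> (fst p - snd p)) - (LINT p|(\<mu> 0 \<Otimes>\<^sub>M \<mu> 0). ypot \<kappa> (fst p - snd p))))) {0..t}"
    using t by (intro has_integral_add has_integral_diff has_integral_mult_right pair_energy_has_integral q mean_field_energy_has_integral) auto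
  also have "1 / (real N)\<^sup>2 * (pair_energy N (ypot \<kappa>) (flow \<kappa> N t X) - pair_energy N (ypot \<kappa>) (flow \<kappa> N 0 X))
    - 2 / real N * (\<Sum>i<N. (LINT y|\<mu> t. ypot \<kappa> (flow \<kappa> N t X i - y)) - (LINT y|\<mu> 0. ypot \<kappa> (flow \<kappa> N 0 X i - y)))
    + ((LINT p|(\<mu> t \<Otimes>\<^sub>M \<mu> t). ypot \<kappa> (fst p - snd p)) - (LINT p|(\<mu> 0 \<Otimes>\<^sub>M \<mu> 0). ypot \<kappa> (fst p - snd p)))
    = mod_energy \<kappa> N (flow \<kappa> N t X) (\<rho> t) - mod_energy \<kappa> N (flow \<kappa> N 0 X) (\<rho> 0)"
    unfolding mod_energy_expand[OF t nc[OF t]] mod_energy_expand[OF zero_in_T nc[OF zero_in_T]]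
    by (simp add: sum_subtractf right_diff_distrib)
  finally show ?thesis
  proof (rule has_integral_eq[rotated])
    fix s assume s: "s \<in> {0..t}"
    have "1 / (real N)\<^sup>2 * (- 2 * real N * S) = - 2 / real N * S" for S
      using N0 by (simp add: power2_eq_square field_simps)
    then show "1 / (real N)\<^sup>2 * ?p s - 2 / real N * (\<Sum>i<N. ?q s i) + ?r s
      = commutator \<kappa> N (flow \<kappa> N s X) (\<rho> s) (U s) - 2 * Dis s (flow \<kappa> N s X)"
      unfolding energy_production[OF sT[OF s] nc[OF sT[OF s]]] by simp
  qed
qed

end

end

section \<open>Pathwise stability\<close>

locale commutator_bound = particles \<kappa> T \<Lambda> \<rho> N
  for \<kappa> T \<Lambda> :: real and \<rho> :: "real \<Rightarrow> real^'n \<Rightarrow> real" and N +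
  fixes \<kappa>s \<eta> \<eta>0 B C :: real
  assumes constants: "commutator_constants TYPE('n) \<kappa>s \<Lambda> \<eta>0 B C"
    and kappa_le: "\<kappa> \<le> \<kappa>s" and eta: "0 < \<eta>" "\<eta> < \<eta>0"
begin

definition Fs :: "real \<Rightarrow> (nat \<Rightarrow> real^'n) \<Rightarrow> real" where
  "Fs t X = mod_energy \<kappa> N X (\<rho> t) - self_const CARD('n) \<kappa> / real N + B * eps CARD('n) N \<kappa> \<eta>"

lemma mod_energy_sharp_eq:
  assumes "X \<notin> collisions N"
  shows "mod_energy_sharp \<kappa> N X (\<rho> t) + ereal (B * eps CARD('n) N \<kappa> \<eta>) = ereal (Fs t X)"
  using assms by (simp add: mod_energy_sharp_def Fs_def)

lemma C_nonneg: "0 \<le> C"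
  using constants by (simp add: commutator_constants_def)

lemma Fs_bounds:
  fixes X :: "nat \<Rightarrow> real^'n"
  assumes t: "t \<in> {0..T}" and X: "X \<in> space (config_space N)" "X \<notin> collisions N"
  shows "0 \<le> Fs t X" and "\<bar>commutator \<kappa> N X (\<rho> t) (U t)\<bar> \<le> C * \<Lambda> * Fs t X"
proof -
  have "\<Lambda>-lipschitz_on UNIV (U t)"
    using U_lipschitz Lambda_nonneg by (intro lipschitz_onI) (auto simp: dist_norm)
  then have "\<exists>L. L-lipschitz_on UNIV (U t)" by blast
  with constants t X N2 kappa kappa_le eta density[OF t] Linf_le[OF t]
  have *: "mod_energy_sharp \<kappa> N X (\<rho> t) + ereal (B * eps CARD('n) N \<kappa> \<eta>) \<ge> ereal (eps CARD('n) N \<kappa> \<eta>)"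
      "eps CARD('n) N \<kappa> \<eta> \<ge> 0"
      "ennreal \<bar>commutator \<kappa> N X (\<rho> t) (U t)\<bar> \<le> ennreal C * grad_Linf_norm (U t) *
        e2ennreal (mod_energy_sharp \<kappa> N X (\<rho> t) + ereal (B * eps CARD('n) N \<kappa> \<eta>))"
    unfolding commutator_constants_def by blast+
  show F: "0 \<le> Fs t X" using *(1,2) by (simp add: mod_energy_sharp_eq[OF X(2)])
  have "grad_Linf_norm (U t) \<le> ennreal \<Lambda>"
    using grad_Linf_less[OF t] by (simp add: U_def clampT_eq[OF t])
  then have "ennreal C * grad_Linf_norm (U t) * ennreal (Fs t X) \<le> ennreal C * ennreal \<Lambda> * ennreal (Fs t X)"
    by (intro mult_mono) auto
  also have "\<dots> = ennreal (C * \<Lambda> * Fs t X)"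
    using C_nonneg Lambda_nonneg F by (simp add: ennreal_mult)
  finally have "ennreal \<bar>commutator \<kappa> N X (\<rho> t) (U t)\<bar> \<le> ennreal (C * \<Lambda> * Fs t X)"
    using *(3) unfolding mod_energy_sharp_eq[OF X(2)] by (simp add: e2ennreal_ereal)
  then show "\<bar>commutator \<kappa> N X (\<rho> t) (U t)\<bar> \<le> C * \<Lambda> * Fs t X"
    using C_nonneg Lambda_nonneg F by (subst (asm) ennreal_le_iff) auto
qed

text \<open>The arguments refer to different times: \<open>X\<close> is the configuration at time
  \<open>t\<close>, whereas \<open>Z\<close> holds initial positions that \<open>Y\<close> still has
  to move.\<close>

definition pos :: "real \<Rightarrow> (nat \<Rightarrow> real^'n) \<Rightarrow> (nat \<Rightarrow> real^'n) \<Rightarrow> real" where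
  "pos t X Z = 1 / real N * (\<Sum>i<N. (norm (X i - Y t (Z i)))\<^sup>2)"

lemma pos_nonneg: "0 \<le> pos t X Z"
  by (simp add: pos_def sum_nonneg)

text \<open>The summands stem from the Lipschitz constant of the velocity field, from Young's inequality and
  from the commutator estimate.\<close>

definition rate :: real where "rate = 2 * \<Lambda> + 1 + C * \<Lambda>"

lemma rate_nonneg: "0 \<le> rate"
  using C_nonneg Lambda_nonneg by (simp add: rate_def)

text \<open>The field at the particle is inserted between the particle velocity and the field at the
  characteristic. Young's inequality with equal weights charges the first difference one copy of
  \<open>Dis\<close>, half of what the energy dissipates; the second costs \<Lambda> times the
  displacement.\<close>

lemma position_production_le:
  "2 / real N * (\<Sum>i<N. (X i - Y t (Z i)) \<bullet> (vel X i - U t (Y t (Z i)))) \<le> (2 * \<Lambda> + 1) * pos t X Z + Dis t X"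
proof -
  have "2 * (a \<bullet> (v - U t b)) \<le> (2 * \<Lambda> + 1) * (norm a)\<^sup>2 + (norm (v - U t x))\<^sup>2" if "a = x - b" for a v b x
  proof -
    have "2 * (a \<bullet> (v - U t x)) \<le> (norm a)\<^sup>2 + (norm (v - U t x))\<^sup>2"
      using zero_le_power2[of "norm (a - (v - U t x))"]
      by (simp add: power2_norm_eq_inner inner_diff_left inner_diff_right inner_commute)
    moreover have "a \<bullet> (U t x - U t b) \<le> norm a * (\<Lambda> * norm a)"
      using norm_cauchy_schwarz[of a "U t x - U t b"] mult_left_mono[OF U_lipschitz[of t x b] norm_ge_zero[of a]] unfolding that by linarith
    moreover have "a \<bullet> (v - U t b) = a \<bullet> (v - U t x) + a \<bullet> (U t x - U t b)"
      by (simp add: inner_diff_right)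
    ultimately show ?thesis by (simp add: power2_eq_square algebra_simps)
  qed
  then have "(\<Sum>i<N. 2 * ((X i - Y t (Z i)) \<bullet> (vel X i - U t (Y t (Z i)))))
      \<le> (\<Sum>i<N. (2 * \<Lambda> + 1) * (norm (X i - Y t (Z i)))\<^sup>2 + (norm (vel X i - U t (X i)))\<^sup>2)"
    by (intro sum_mono) simp
  then have "1 / real N * (\<Sum>i<N. 2 * ((X i - Y t (Z i)) \<bullet> (vel X i - U t (Y t (Z i)))))
      \<le> 1 / real N * (\<Sum>i<N. (2 * \<Lambda> + 1) * (norm (X i - Y t (Z i)))\<^sup>2 + (norm (vel X i - U t (X i)))\<^sup>2)"
    by (intro mult_left_mono) simp_all
  then show ?thesis
    by (simp add: pos_def Dis_def sum.distrib sum_distrib_left[symmetric] distrib_left mult.left_commute mult.commute add_divide_distrib)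
qed

context
  fixes X Z :: "nat \<Rightarrow> real^'n"
  assumes X: "X \<in> space (config_space N)" "X \<notin> collisions N"
begin

lemma pos_has_integral:
  assumes t: "t \<in> {0..T}"
  shows "((\<lambda>s. 2 / real N * (\<Sum>i<N. (flow \<kappa> N s X i - Y s (Z i)) \<bullet> (vel (flow \<kappa> N s X) i - U s (Y s (Z i))))) has_integral
    (pos t (flow \<kappa> N t X) Z - pos 0 (flow \<kappa> N 0 X) Z)) {0..t}"
proof (rule fundamental_theorem_of_calculus)
  show "0 \<le> t" using t by simp
  fix s assume s: "s \<in> {0..t}"
  have "((\<lambda>s. (norm (flow \<kappa> N s X i - Y s (Z i)))\<^sup>2) has_real_derivative
      2 * ((flow \<kappa> N s X i - Y s (Z i)) \<bullet> (vel (flow \<kappa> N s X) i - U s (Y s (Z i))))) (at s within {0..t})" if i: "i < N" for i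
    unfolding power2_norm_eq_inner
    by (rule has_real_derivative_inner_self[OF has_vector_derivative_diff[OF
          has_vector_derivative_within_subset[OF flow_deriv[OF X _ i]] Y_deriv[OF t s]]]) (use s in auto)
  then have "((\<lambda>s. pos s (flow \<kappa> N s X) Z) has_real_derivative
      1 / real N * (\<Sum>i<N. 2 * ((flow \<kappa> N s X i - Y s (Z i)) \<bullet> (vel (flow \<kappa> N s X) i - U s (Y s (Z i)))))) (at s within {0..t})"
    unfolding pos_def by (intro DERIV_cmult DERIV_sum) auto
  then show "((\<lambda>s. pos s (flow \<kappa> N s X) Z) has_vector_derivative
      2 / real N * (\<Sum>i<N. (flow \<kappa> N s X i - Y s (Z i)) \<bullet> (vel (flow \<kappa> N s X) i - U s (Y s (Z i))))) (at s within {0..t})"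
    by (simp add: has_real_derivative_iff_has_vector_derivative sum_distrib_left[symmetric])
qed

lemma Dis_continuous: "continuous_on {0..} (\<lambda>s. Dis s (flow \<kappa> N s X))"
  unfolding Dis_def
  by (intro continuous_intros U_continuous_compose flow_continuous[OF X] flow_vel(2)[OF X]) auto

text \<open>The accumulated dissipation is made part of the quantity \<open>W\<close> to which
  Gronwall is applied. Its rate uses up the remaining copy of \<open>Dis\<close>, and being
  nonnegative it only enlarges \<open>rate * W\<close>.\<close>

lemma gronwall_path:
  assumes t: "t \<in> {0..T}"
  shows "pos t (flow \<kappa> N t X) Z + Fs t (flow \<kappa> N t X) + integral {0..t} (\<lambda>s. Dis s (flow \<kappa> N s X))
    \<le> (pos 0 X Z + Fs 0 X) * exp (rate * t)"
proof -
  have xs: "flow \<kappa> N s X \<in> space (config_space N)" "flow \<kappa> N s X \<notin> collisions N" if "s \<in> {0..T}" for s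
    using flow_in_space[OF X(1)] flow_not_collisions[OF X] that by auto
  let ?D = "\<lambda>s. Dis s (flow \<kappa> N s X)"
  let ?p = "\<lambda>s. 2 / real N * (\<Sum>i<N. (flow \<kappa> N s X i - Y s (Z i)) \<bullet> (vel (flow \<kappa> N s X) i - U s (Y s (Z i))))"
  let ?g = "\<lambda>s. commutator \<kappa> N (flow \<kappa> N s X) (\<rho> s) (U s) - 2 * ?D s"
  define W where "W s = pos s (flow \<kappa> N s X) Z + Fs s (flow \<kappa> N s X) + integral {0..s} ?D" for s
  have Dc: "continuous_on {0..s} ?D" for s
    by (rule continuous_on_subset[OF Dis_continuous]) auto
  have Di: "(?D has_integral integral {0..s} ?D) {0..s}" for s
    by (rule integrable_integral[OF integrable_continuous_interval[OF Dc]])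
  have g: "(?g has_integral (Fs s (flow \<kappa> N s X) - Fs 0 (flow \<kappa> N 0 X))) {0..s}" if "s \<in> {0..T}" for s
    using mod_energy_has_integral[OF X that] by (simp add: Fs_def)
  have q: "((\<lambda>r. ?p r + ?g r + ?D r) has_integral (W s - W 0)) {0..s}" if s: "s \<in> {0..T}" for s
  proof -
    have "((\<lambda>r. ?p r + ?g r + ?D r) has_integral
      ((pos s (flow \<kappa> N s X) Z - pos 0 (flow \<kappa> N 0 X) Z) + (Fs s (flow \<kappa> N s X) - Fs 0 (flow \<kappa> N 0 X)) + integral {0..s} ?D)) {0..s}"
      by (intro has_integral_add pos_has_integral g Di s)
    then show ?thesis by (simp add: W_def algebra_simps)
  qed
  have le: "?p s + ?g s + ?D s \<le> rate * W s" if s: "s \<in> {0..T}" for s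
  proof -
    have "0 \<le> integral {0..s} ?D" by (rule has_integral_nonneg[OF Di]) (rule Dis_nonneg)
    moreover have "commutator \<kappa> N (flow \<kappa> N s X) (\<rho> s) (U s) \<le> C * \<Lambda> * Fs s (flow \<kappa> N s X)"
      using Fs_bounds(2)[OF s xs[OF s]] by linarith
    moreover have "?p s \<le> (2 * \<Lambda> + 1) * pos s (flow \<kappa> N s X) Z + ?D s"
      by (rule position_production_le)
    moreover have "C * \<Lambda> * Fs s (flow \<kappa> N s X) + (2 * \<Lambda> + 1) * pos s (flow \<kappa> N s X) Z \<le> rate * W s"
    proof -
      have "0 \<le> C * \<Lambda>" using C_nonneg Lambda_nonneg by simp
      have 1: "C * \<Lambda> * Fs s (flow \<kappa> N s X) \<le> rate * Fs s (flow \<kappa> N s X)"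
        using Fs_bounds(1)[OF s xs[OF s]] Lambda_nonneg by (intro mult_right_mono) (simp_all add: rate_def)
      have 2: "(2 * \<Lambda> + 1) * pos s (flow \<kappa> N s X) Z \<le> rate * pos s (flow \<kappa> N s X) Z"
        using pos_nonneg \<open>0 \<le> C * \<Lambda>\<close> by (intro mult_right_mono) (simp_all add: rate_def)
      have 3: "0 \<le> rate * integral {0..s} ?D"
        using rate_nonneg calculation(1) by simp
      have "rate * W s = rate * pos s (flow \<kappa> N s X) Z + rate * Fs s (flow \<kappa> N s X) + rate * integral {0..s} ?D"
        by (simp add: W_def distrib_left)
      then show ?thesis using 1 2 3 by linarith
    qed
    ultimately show ?thesis by linarith
  qed
  have Wc: "continuous_on {0..T} W"
  proof -
    have "(\<lambda>r. ?p r + ?g r + ?D r) integrable_on {0..T}" using q[of T] T by auto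
    then have "continuous_on {0..T} (\<lambda>s. W 0 + integral {0..s} (\<lambda>r. ?p r + ?g r + ?D r))"
      by (intro continuous_intros indefinite_integral_continuous_1)
    then show ?thesis
      by (rule continuous_on_eq) (use integral_unique[OF q] in auto)
  qed
  have "W s \<le> W 0 + rate * integral {0..s} W" if s: "s \<in> {0..T}" for s
  proof -
    have "continuous_on {0..s} W" using s by (intro continuous_on_subset[OF Wc]) auto
    then have "((\<lambda>r. rate * W r) has_integral (rate * integral {0..s} W)) {0..s}"
      by (intro has_integral_mult_right integrable_integral integrable_continuous_interval)
    from has_integral_le[OF q[OF s] this] show ?thesis using le s by auto
  qed
  from gronwall_integral[OF Wc rate_nonneg t this]
  have "W t \<le> W 0 * exp (rate * t)" by simp
  then show ?thesis by (simp add: W_def flow_0[OF X(1)])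
qed

end

end

section \<open>Transport of the initial coupling\<close>

lemma W2_power2_le_cost:
  "\<pi> \<in> couplings \<mu> \<nu> \<Longrightarrow> (W2 \<delta> \<mu> \<nu>)\<^sup>2 \<le> (\<integral>\<^sup>+ p. ennreal ((\<delta> (fst p) (snd p))\<^sup>2) \<partial>\<pi>)"
  unfolding W2_power2 by (rule INF_lower)

lemma coupling_distr:
  assumes \<pi>: "\<pi> \<in> couplings \<mu> \<nu>" and f: "f \<in> measurable \<mu> \<mu>'" and g: "g \<in> measurable \<nu> \<nu>'"
    and f': "distr \<mu> \<mu>' f = \<mu>'" and g': "distr \<nu> \<nu>' g = \<nu>'"
  shows "distr \<pi> (\<mu>' \<Otimes>\<^sub>M \<nu>') (\<lambda>p. (f (fst p), g (snd p))) \<in> couplings \<mu>' \<nu>'"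
proof -
  have s: "sets \<pi> = sets (\<mu> \<Otimes>\<^sub>M \<nu>)" and m: "distr \<pi> \<mu> fst = \<mu>" "distr \<pi> \<nu> snd = \<nu>"
    using \<pi> by (auto simp: couplings_def)
  have [measurable]: "fst \<in> measurable \<pi> \<mu>" "snd \<in> measurable \<pi> \<nu>"
    by (simp_all cong: measurable_cong_sets[OF s refl])
  note f[measurable] g[measurable]
  have h: "(\<lambda>p. (f (fst p), g (snd p))) \<in> measurable \<pi> (\<mu>' \<Otimes>\<^sub>M \<nu>')" by measurable
  have "distr (distr \<pi> (\<mu>' \<Otimes>\<^sub>M \<nu>') (\<lambda>p. (f (fst p), g (snd p)))) \<mu>' fst = distr \<pi> \<mu>' (\<lambda>p. f (fst p))"
    by (subst distr_distr[OF measurable_fst h]) (simp add: comp_def)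
  also have "\<dots> = distr (distr \<pi> \<mu> fst) \<mu>' f"
    by (subst distr_distr[OF f]) (simp_all add: comp_def)
  finally have 1: "distr (distr \<pi> (\<mu>' \<Otimes>\<^sub>M \<nu>') (\<lambda>p. (f (fst p), g (snd p)))) \<mu>' fst = \<mu>'"
    by (simp add: m f')
  have "distr (distr \<pi> (\<mu>' \<Otimes>\<^sub>M \<nu>') (\<lambda>p. (f (fst p), g (snd p)))) \<nu>' snd = distr \<pi> \<nu>' (\<lambda>p. g (snd p))"
    by (subst distr_distr[OF measurable_snd h]) (simp add: comp_def)
  also have "\<dots> = distr (distr \<pi> \<nu> snd) \<nu>' g"
    by (subst distr_distr[OF g]) (simp_all add: comp_def)
  finally have 2: "distr (distr \<pi> (\<mu>' \<Otimes>\<^sub>M \<nu>') (\<lambda>p. (f (fst p), g (snd p)))) \<nu>' snd = \<nu>'"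
    by (simp add: m g')
  from 1 2 show ?thesis by (simp add: couplings_def)
qed

lemma coupling_nn_integral_fst:
  assumes "\<pi> \<in> couplings \<mu> \<nu>" "\<phi> \<in> borel_measurable \<mu>"
  shows "(\<integral>\<^sup>+ p. \<phi> (fst p) \<partial>\<pi>) = (\<integral>\<^sup>+ x. \<phi> x \<partial>\<mu>)"
proof -
  have s: "sets \<pi> = sets (\<mu> \<Otimes>\<^sub>M \<nu>)" and m: "distr \<pi> \<mu> fst = \<mu>"
    using assms by (auto simp: couplings_def)
  have f: "fst \<in> measurable \<pi> \<mu>" by (simp cong: measurable_cong_sets[OF s refl])
  show ?thesis using nn_integral_distr[OF f, of \<phi>] assms(2) by (simp add: m)
qed

lemma config_dist_power2: "(config_dist N X Z)\<^sup>2 = (\<Sum>i<N. (dist (X i) (Z i))\<^sup>2)"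
  by (simp add: config_dist_def L2_set_def sum_nonneg)

lemma config_cost_distr:
  fixes \<pi> :: "('a \<times> 'b) measure" and f :: "'a \<Rightarrow> nat \<Rightarrow> real^'n"
  assumes "\<alpha> = config_space N \<or> sets \<alpha> = sets (config_space N)" "\<beta> = config_space N \<or> sets \<beta> = sets (config_space N)"
    and m: "(\<lambda>p. (f (fst p), g (snd p))) \<in> measurable \<pi> (\<alpha> \<Otimes>\<^sub>M \<beta>)"
  shows "(\<integral>\<^sup>+ p. ennreal ((config_dist N (fst p) (snd p))\<^sup>2) \<partial>distr \<pi> (\<alpha> \<Otimes>\<^sub>M \<beta>) (\<lambda>p. (f (fst p), g (snd p))))
    = (\<integral>\<^sup>+ p. ennreal (\<Sum>i<N. (dist (f (fst p) i) (g (snd p) i))\<^sup>2) \<partial>\<pi>)"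
proof -
  have s: "sets \<alpha> = sets (config_space N)" "sets \<beta> = sets (config_space N)" using assms by auto
  have "(\<lambda>p. \<Sum>i<N. (dist (fst p i) (snd p i))\<^sup>2) \<in> borel_measurable ((config_space N :: (nat \<Rightarrow> real^'n) measure) \<Otimes>\<^sub>M config_space N)"
    by measurable
  then have "(\<lambda>p. ennreal ((config_dist N (fst p) (snd p))\<^sup>2)) \<in> borel_measurable (\<alpha> \<Otimes>\<^sub>M \<beta>)"
    unfolding config_dist_power2 by (simp cong: measurable_cong_sets sets_pair_measure_cong add: s)
  then show ?thesis by (subst nn_integral_distr[OF m]) (simp_all add: config_dist_power2)
qed

context particles
begin

lemma sets_tensor: "sets (tensor_power M (\<rho> t)) = sets (config_space M :: (nat \<Rightarrow> real^'n) measure)"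
  by (intro sets_PiM_cong) simp_all

lemma tensor_distr_Y:
  assumes t: "t \<in> {0..T}"
  shows "distr (tensor_power M (\<rho> 0)) (tensor_power M (\<rho> t)) (compose {..<M} (Y t)) = tensor_power M (\<rho> t)"
proof -
  have "distr (tensor_power M (\<rho> 0)) (tensor_power M (\<rho> t)) (compose {..<M} (Y t))
      = PiM {..<M} (\<lambda>_. distr (\<mu> 0) (\<mu> t) (Y t))"
  proof (rule distr_PiM_finite_prob_space')
    show "Y t \<in> measurable (\<mu> 0) (\<mu> t)" by measurable
  qed (use prob_mu[OF t] prob_mu[OF zero_in_T] in auto)
  also have "distr (\<mu> 0) (\<mu> t) (Y t) = \<mu> t"
    using distr_Y[OF t] distr_cong[of "\<mu> 0" "\<mu> 0" "\<mu> t" borel "Y t" "Y t"] by simp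
  finally show ?thesis .
qed

lemma compose_Y_measurable:
  "compose {..<M} (Y t) \<in> measurable (tensor_power M (\<rho> 0)) (tensor_power M (\<rho> t))"
  unfolding compose_def
proof (rule measurable_restrict)
  fix i assume i: "i \<in> {..<M}"
  have "Y t \<in> measurable (\<mu> 0) (\<mu> t)" by measurable
  then show "(\<lambda>x. Y t (x i)) \<in> measurable (tensor_power M (\<rho> 0)) (\<mu> t)"
    by (rule measurable_compose[OF measurable_component_singleton[OF i]])
qed

lemma vel_measurable:
  assumes i: "i < N"
  shows "(\<lambda>X. vel X i) \<in> borel_measurable (config_space N :: (nat \<Rightarrow> real^'n) measure)"
proof -
  have c: "(\<lambda>X. X j) \<in> borel_measurable (config_space N :: (nat \<Rightarrow> real^'n) measure)" if "j \<in> {..<N}" for j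
    by (rule measurable_component_singleton[OF that])
  show ?thesis unfolding force_def
    by (intro borel_measurable_scaleR borel_measurable_const borel_measurable_sum measurable_compose[OF _ ygrad_measurable]
        borel_measurable_diff c) (use i in auto)
qed

lemma Dis_measurable:
  assumes f: "f \<in> borel_measurable M" and g: "g \<in> measurable M (config_space N)"
  shows "(\<lambda>p. Dis (f p) (g p)) \<in> borel_measurable M"
proof -
  have c: "(\<lambda>p. g p i) \<in> borel_measurable M" if "i < N" for i
    using measurable_compose[OF g measurable_component_singleton, of i] that by simp
  have v: "(\<lambda>p. vel (g p) i) \<in> borel_measurable M" if "i < N" for i
    by (rule measurable_compose[OF g vel_measurable[OF that]])
  have "(\<lambda>p. (norm (vel (g p) i - U (f p) (g p i)))\<^sup>2) \<in> borel_measurable M" if "i \<in> {..<N}" for i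
    using v[of i] U_measurable[OF f c[of i]] that by simp
  then show ?thesis unfolding Dis_def
    by (intro borel_measurable_times borel_measurable_const borel_measurable_sum)
qed

lemma dissipation_measurable:
  assumes t: "t \<in> {0..T}"
  shows "(\<lambda>X. dissipation \<kappa> N X (\<rho> t)) \<in> borel_measurable (config_space N :: (nat \<Rightarrow> real^'n) measure)"
proof -
  have e: "dissipation \<kappa> N X (\<rho> t) = (if X \<in> collisions N then \<infinity> else ennreal (Dis t X))" for X :: "nat \<Rightarrow> real^'n"
    using dissipation_eq[OF t, of X] by (simp add: dissipation_def)
  have [measurable]: "(\<lambda>X. Dis t X) \<in> borel_measurable (config_space N)"
    by (rule Dis_measurable) simp_all
  show ?thesis unfolding e by measurable
qed

text \<open>The expansion is available only off collisions, hence a measurable representative; on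
  the collision set the sharp energy is infinite by definition.\<close>

lemma mod_energy_measurable:
  assumes t: "t \<in> {0..T}"
  shows "\<exists>e \<in> borel_measurable (config_space N :: (nat \<Rightarrow> real^'n) measure). \<forall>X. X \<notin> collisions N \<longrightarrow> mod_energy \<kappa> N X (\<rho> t) = e X"
proof -
  have c: "(\<lambda>X. X j) \<in> borel_measurable (config_space N :: (nat \<Rightarrow> real^'n) measure)" if "j \<in> {..<N}" for j
    by (rule measurable_component_singleton[OF that])
  interpret M: prob_space "\<mu> t" by (rule prob_mu[OF t])
  have p: "(\<lambda>x. LINT y|\<mu> t. ypot \<kappa> (x - y)) \<in> borel_measurable borel"
  proof -
    have "(\<lambda>x. LINT y|\<mu> t. ypot \<kappa> (fst (x, y) - snd (x, y))) \<in> borel_measurable borel" by measurable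
    then show ?thesis by simp
  qed
  have 1: "(\<lambda>X. ypot \<kappa> (X i - X j)) \<in> borel_measurable (config_space N :: (nat \<Rightarrow> real^'n) measure)" if "i < N" "j < N" for i j
    by (rule measurable_compose[OF borel_measurable_diff[OF c c] ypot_measurable]) (use that in auto)
  have 2: "(\<lambda>X. LINT y|\<mu> t. ypot \<kappa> (X i - y)) \<in> borel_measurable (config_space N)" if "i < N" for i
    by (rule measurable_compose[OF c p]) (use that in auto)
  have 3: "pair_energy N (ypot \<kappa>) \<in> borel_measurable (config_space N :: (nat \<Rightarrow> real^'n) measure)"
    unfolding pair_energy_def by (rule borel_measurable_sum, rule borel_measurable_sum) (use 1 in auto)
  have 4: "(\<lambda>X. \<Sum>i<N. LINT y|\<mu> t. ypot \<kappa> (X i - y)) \<in> borel_measurable (config_space N)"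
    by (rule borel_measurable_sum) (use 2 in auto)
  let ?e = "\<lambda>X. 1 / (real N)\<^sup>2 * pair_energy N (ypot \<kappa>) X
    - 2 / real N * (\<Sum>i<N. (LINT y|\<mu> t. ypot \<kappa> (X i - y)))
    + (LINT p|(\<mu> t \<Otimes>\<^sub>M \<mu> t). ypot \<kappa> (fst p - snd p))"
  have "?e \<in> borel_measurable (config_space N)"
    by (rule borel_measurable_add[OF borel_measurable_diff[OF borel_measurable_times[OF borel_measurable_const 3]
          borel_measurable_times[OF borel_measurable_const 4]] borel_measurable_const])
  with mod_energy_expand[OF t] show ?thesis by (intro bexI[where x="?e"] allI impI)
qed

end

section \<open>Averaging the pathwise estimate over a coupling\<close>

context commutator_bound
begin

definition Gs :: "real \<Rightarrow> (nat \<Rightarrow> real^'n) \<Rightarrow> ennreal" where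
  "Gs t X = e2ennreal (mod_energy_sharp \<kappa> N X (\<rho> t) + ereal (B * eps CARD('n) N \<kappa> \<eta>))"

lemma Gs_eq: "Gs t X = (if X \<in> collisions N then \<infinity> else ennreal (Fs t X))"
  by (simp add: Gs_def mod_energy_sharp_eq e2ennreal_ereal) (simp add: mod_energy_sharp_def)

lemma total_error_eq:
  "total_error \<kappa> N B \<eta> P (\<rho> t) = (W2 (config_dist N) P (tensor_power N (\<rho> t)))\<^sup>2 / of_nat N + (\<integral>\<^sup>+ X. Gs t X \<partial>P)"
  by (simp add: total_error_def Gs_def)

lemma Gs_measurable:
  assumes t: "t \<in> {0..T}"
  shows "Gs t \<in> borel_measurable (config_space N)"
proof -
  from mod_energy_measurable[OF t] obtain e where
    [measurable]: "e \<in> borel_measurable (config_space N)" and e: "\<And>X. X \<notin> collisions N \<Longrightarrow> mod_energy \<kappa> N X (\<rho> t) = e X" by blast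
  have "Gs t = (\<lambda>X. if X \<in> collisions N then \<infinity> else ennreal (e X - self_const CARD('n) \<kappa> / real N + B * eps CARD('n) N \<kappa> \<eta>))"
    by (auto simp: fun_eq_iff Gs_eq Fs_def e)
  then show ?thesis by simp
qed

context
  fixes P0 :: "(nat \<Rightarrow> real^'n) measure"
  assumes P0: "prob_space P0" "sets P0 = sets (config_space N)"
    and finite_error: "total_error \<kappa> N B \<eta> P0 (\<rho> 0) < \<infinity>"
begin

lemma space_P0: "space P0 = space (config_space N)"
  by (rule sets_eq_imp_space_eq[OF P0(2)])

text \<open>The bracket is infinite on the collision set, so a finite initial error makes that set
  null.\<close>

lemma AE_P0: "AE X in P0. X \<in> space (config_space N) \<and> X \<notin> collisions N"
proof -
  have "(\<integral>\<^sup>+ X. Gs 0 X \<partial>P0) \<noteq> \<infinity>"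
    using finite_error unfolding total_error_eq by auto
  moreover have "Gs 0 \<in> borel_measurable P0"
    using Gs_measurable[OF zero_in_T] by (simp cong: measurable_cong_sets[OF P0(2) refl])
  ultimately have "AE X in P0. Gs 0 X \<noteq> \<infinity>" by (intro nn_integral_PInf_AE)
  then show ?thesis
    using AE_space by eventually_elim (auto simp: Gs_eq space_P0)
qed

lemma flow_measurable_P0: "0 \<le> t \<Longrightarrow> flow \<kappa> N t \<in> measurable P0 (config_space N)"
  using flow_measurable by (simp cong: measurable_cong_sets[OF P0(2) refl])

lemma nn_integral_law_at:
  assumes "0 \<le> t" "f \<in> borel_measurable (config_space N)"
  shows "(\<integral>\<^sup>+ X. f X \<partial>law_at \<kappa> N P0 t) = (\<integral>\<^sup>+ X. f (flow \<kappa> N t X) \<partial>P0)"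
  unfolding law_at_def using flow_measurable_P0[OF assms(1)] assms(2) by (intro nn_integral_distr) simp_all

context
  fixes \<pi>
  assumes \<pi>: "\<pi> \<in> couplings P0 (tensor_power N (\<rho> 0))"
begin

lemma sets_pi: "sets \<pi> = sets (config_space N \<Otimes>\<^sub>M (config_space N :: (nat \<Rightarrow> real^'n) measure))"
proof -
  have "sets \<pi> = sets (P0 \<Otimes>\<^sub>M tensor_power N (\<rho> 0))" using \<pi> by (simp add: couplings_def)
  also have "\<dots> = sets (config_space N \<Otimes>\<^sub>M (config_space N :: (nat \<Rightarrow> real^'n) measure))"
    by (rule sets_pair_measure_cong[OF P0(2) sets_tensor])
  finally show ?thesis .
qed

lemma AE_pi: "AE p in \<pi>. fst p \<in> space (config_space N) \<and> fst p \<notin> collisions N"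
proof -
  have "fst \<in> measurable \<pi> P0"
    using \<pi> by (simp add: couplings_def cong: measurable_cong_sets)
  moreover have "distr \<pi> P0 fst = P0" using \<pi> by (simp add: couplings_def)
  ultimately show ?thesis
    using AE_distrD[of fst \<pi> P0 "\<lambda>X. X \<in> space (config_space N) \<and> X \<notin> collisions N"] AE_P0 by (simp only: simp_thms)
qed

lemma pos_measurable:
  assumes t: "0 \<le> t"
  shows "(\<lambda>p. pos t (flow \<kappa> N t (fst p)) (snd p)) \<in> borel_measurable \<pi>"
proof -
  have f: "(\<lambda>p. flow \<kappa> N t (fst p)) \<in> measurable ((config_space N :: (nat \<Rightarrow> real^'n) measure) \<Otimes>\<^sub>M (config_space N :: (nat \<Rightarrow> real^'n) measure)) (config_space N)"
    by (rule measurable_compose[OF measurable_fst flow_measurable[OF t]])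
  have "(\<lambda>p. (norm (flow \<kappa> N t (fst p) i - Y t (snd p i)))\<^sup>2) \<in> borel_measurable ((config_space N :: (nat \<Rightarrow> real^'n) measure) \<Otimes>\<^sub>M (config_space N :: (nat \<Rightarrow> real^'n) measure))"
    if i: "i \<in> {..<N}" for i
  proof -
    have [measurable]: "(\<lambda>p. flow \<kappa> N t (fst p) i) \<in> borel_measurable ((config_space N :: (nat \<Rightarrow> real^'n) measure) \<Otimes>\<^sub>M (config_space N :: (nat \<Rightarrow> real^'n) measure))"
      by (rule measurable_compose[OF f measurable_component_singleton[OF i]])
    have "(\<lambda>p. snd p i) \<in> borel_measurable ((config_space N :: (nat \<Rightarrow> real^'n) measure) \<Otimes>\<^sub>M (config_space N :: (nat \<Rightarrow> real^'n) measure))"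
      by (rule measurable_compose[OF measurable_snd measurable_component_singleton[OF i]])
    from Y_measurable[OF measurable_const this, of t]
    have [measurable]: "(\<lambda>p. Y t (snd p i)) \<in> borel_measurable ((config_space N :: (nat \<Rightarrow> real^'n) measure) \<Otimes>\<^sub>M (config_space N :: (nat \<Rightarrow> real^'n) measure))"
      by simp
    show ?thesis by measurable
  qed
  then have "(\<lambda>p. pos t (flow \<kappa> N t (fst p)) (snd p)) \<in> borel_measurable (config_space N \<Otimes>\<^sub>M (config_space N :: (nat \<Rightarrow> real^'n) measure))"
    unfolding pos_def by (intro borel_measurable_times borel_measurable_const borel_measurable_sum)
  then show ?thesis by (simp cong: measurable_cong_sets[OF sets_pi refl])
qed

lemma Gs_flow_measurable:
  assumes t: "t \<in> {0..T}"
  shows "(\<lambda>X. Gs t (flow \<kappa> N t X)) \<in> borel_measurable P0"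
  using t by (intro measurable_compose[OF flow_measurable_P0 Gs_measurable]) auto

lemma Gs_pi_measurable:
  assumes t: "t \<in> {0..T}"
  shows "(\<lambda>p. Gs t (flow \<kappa> N t (fst p))) \<in> borel_measurable \<pi>"
proof (rule measurable_compose[OF _ Gs_flow_measurable[OF t]])
  show "fst \<in> measurable \<pi> P0" using \<pi> by (simp add: couplings_def cong: measurable_cong_sets)
qed

lemma sum_dist_eq_pos:
  "(\<Sum>i<N. (dist (X i) (compose {..<N} (Y t) Z i))\<^sup>2) = real N * pos t X Z"
  using N0 by (simp add: pos_def compose_def dist_norm)

text \<open>The image of the initial coupling under the product of the two flows is admissible at
  time \<open>t\<close>, and its cost is \<open>N\<close> times the averaged
  \<open>pos\<close>.\<close>

lemma W2_law_le:
  assumes t: "t \<in> {0..T}"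
  shows "(W2 (config_dist N) (law_at \<kappa> N P0 t) (tensor_power N (\<rho> t)))\<^sup>2 / of_nat N
    \<le> (\<integral>\<^sup>+ p. ennreal (pos t (flow \<kappa> N t (fst p)) (snd p)) \<partial>\<pi>)"
proof -
  have t0: "0 \<le> t" using t by simp
  let ?h = "\<lambda>p. (flow \<kappa> N t (fst p), compose {..<N} (Y t) (snd p))"
  let ?L = "law_at \<kappa> N P0 t" and ?R = "tensor_power N (\<rho> t)"
  have sL: "sets ?L = sets (config_space N)" by (simp add: law_at_def)
  have f: "flow \<kappa> N t \<in> measurable P0 ?L"
    using flow_measurable_P0[OF t0] by (simp cong: measurable_cong_sets[OF refl sL])
  have fd: "distr P0 ?L (flow \<kappa> N t) = ?L"
  proof -
    have "distr P0 ?L (flow \<kappa> N t) = distr P0 (config_space N) (flow \<kappa> N t)"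
      by (rule distr_cong) (simp_all add: sL)
    then show ?thesis by (simp add: law_at_def)
  qed
  have c: "distr \<pi> (?L \<Otimes>\<^sub>M ?R) ?h \<in> couplings ?L ?R"
    by (rule coupling_distr[OF \<pi> f compose_Y_measurable fd tensor_distr_Y[OF t]])
  have h: "?h \<in> measurable \<pi> (?L \<Otimes>\<^sub>M ?R)"
  proof -
    have "fst \<in> measurable \<pi> P0" "snd \<in> measurable \<pi> (tensor_power N (\<rho> 0))"
      using \<pi> by (simp_all add: couplings_def cong: measurable_cong_sets)
    from measurable_Pair[OF measurable_compose[OF this(1) f] measurable_compose[OF this(2) compose_Y_measurable]]
    show ?thesis .
  qed
  have "(W2 (config_dist N) ?L ?R)\<^sup>2 \<le> (\<integral>\<^sup>+ p. ennreal (\<Sum>i<N. (dist (flow \<kappa> N t (fst p) i) (compose {..<N} (Y t) (snd p) i))\<^sup>2) \<partial>\<pi>)"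
    using W2_power2_le_cost[OF c, of "config_dist N"] config_cost_distr[OF disjI2[OF sL] disjI2[OF sets_tensor] h] by simp
  also have "\<dots> = (\<integral>\<^sup>+ p. of_nat N * ennreal (pos t (flow \<kappa> N t (fst p)) (snd p)) \<partial>\<pi>)"
    unfolding sum_dist_eq_pos by (simp add: ennreal_mult pos_nonneg ennreal_of_nat_eq_real_of_nat)
  also have "\<dots> = of_nat N * (\<integral>\<^sup>+ p. ennreal (pos t (flow \<kappa> N t (fst p)) (snd p)) \<partial>\<pi>)"
    using pos_measurable[OF t0] by (intro nn_integral_cmult) simp
  finally have "(W2 (config_dist N) ?L ?R)\<^sup>2 / of_nat N \<le> of_nat N * (\<integral>\<^sup>+ p. ennreal (pos t (flow \<kappa> N t (fst p)) (snd p)) \<partial>\<pi>) / of_nat N"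
    by (rule divide_right_mono_ennreal)
  also have "\<dots> = (\<integral>\<^sup>+ p. ennreal (pos t (flow \<kappa> N t (fst p)) (snd p)) \<partial>\<pi>)"
    using N0 by (subst mult.commute) (simp add: ennreal_mult_divide_eq ennreal_of_nat_neq_top)
  finally show ?thesis .
qed

definition cost :: ennreal where
  "cost = (\<integral>\<^sup>+ p. ennreal ((config_dist N (fst p) (snd p))\<^sup>2) \<partial>\<pi>) / of_nat N"

lemma initial_measurable:
  "(\<lambda>p. pos 0 (fst p) (snd p)) \<in> borel_measurable \<pi>"
  "(\<lambda>p. Gs 0 (fst p)) \<in> borel_measurable \<pi>"
proof -
  show "(\<lambda>p. pos 0 (fst p) (snd p)) \<in> borel_measurable \<pi>"
  proof -
    have e: "flow \<kappa> N 0 (fst p) = fst p" if "p \<in> space \<pi>" for p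
    proof (rule flow_0)
      have "space \<pi> = space (config_space N :: (nat \<Rightarrow> real^'n) measure) \<times> space (config_space N :: (nat \<Rightarrow> real^'n) measure)"
        unfolding sets_eq_imp_space_eq[OF sets_pi] by (rule space_pair_measure)
      with that show "fst p \<in> space (config_space N)" by (simp only: mem_Times_iff)
    qed
    have "(\<lambda>p. pos 0 (fst p) (snd p)) \<in> borel_measurable \<pi> \<longleftrightarrow> (\<lambda>p. pos 0 (flow \<kappa> N 0 (fst p)) (snd p)) \<in> borel_measurable \<pi>"
      by (rule measurable_cong) (simp only: e)
    then show ?thesis using pos_measurable[OF order_refl] by blast
  qed
  have G: "Gs 0 \<in> borel_measurable P0"
    using Gs_measurable[OF zero_in_T] by (simp cong: measurable_cong_sets[OF P0(2) refl])
  have "fst \<in> measurable \<pi> P0" using \<pi> by (simp add: couplings_def cong: measurable_cong_sets)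
  from measurable_compose[OF this G] show "(\<lambda>p. Gs 0 (fst p)) \<in> borel_measurable \<pi>" .
qed

lemma initial_cost:
  "(\<integral>\<^sup>+ p. ennreal (pos 0 (fst p) (snd p)) + Gs 0 (fst p) \<partial>\<pi>) = cost + (\<integral>\<^sup>+ X. Gs 0 X \<partial>P0)"
proof -
  note m0 = initial_measurable(1) and Gp = initial_measurable(2)
  have G: "Gs 0 \<in> borel_measurable P0"
    using Gs_measurable[OF zero_in_T] by (simp cong: measurable_cong_sets[OF P0(2) refl])
  have "(\<integral>\<^sup>+ p. ennreal (pos 0 (fst p) (snd p)) + Gs 0 (fst p) \<partial>\<pi>) = (\<integral>\<^sup>+ p. ennreal (pos 0 (fst p) (snd p)) \<partial>\<pi>) + (\<integral>\<^sup>+ p. Gs 0 (fst p) \<partial>\<pi>)"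
    using m0 Gp by (intro nn_integral_add) simp_all
  also have "(\<integral>\<^sup>+ p. Gs 0 (fst p) \<partial>\<pi>) = (\<integral>\<^sup>+ X. Gs 0 X \<partial>P0)"
    by (rule coupling_nn_integral_fst[OF \<pi> G])
  also have "(\<integral>\<^sup>+ p. ennreal (pos 0 (fst p) (snd p)) \<partial>\<pi>) = cost"
  proof -
    have "(\<integral>\<^sup>+ p. ennreal ((config_dist N (fst p) (snd p))\<^sup>2) \<partial>\<pi>) = (\<integral>\<^sup>+ p. of_nat N * ennreal (pos 0 (fst p) (snd p)) \<partial>\<pi>)"
      using N0 by (intro nn_integral_cong)
        (simp add: config_dist_power2 pos_def Y_0 dist_norm ennreal_mult[symmetric] ennreal_of_nat_eq_real_of_nat sum_nonneg)
    also have "\<dots> = of_nat N * (\<integral>\<^sup>+ p. ennreal (pos 0 (fst p) (snd p)) \<partial>\<pi>)"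
      using m0 by (intro nn_integral_cmult) simp
    finally show ?thesis
      unfolding cost_def using N0 by (subst (asm) mult.commute) (simp add: ennreal_mult_divide_eq ennreal_of_nat_neq_top)
  qed
  finally show ?thesis .
qed

lemma initial_cost_scaled:
  "(\<integral>\<^sup>+ p. ennreal c * (ennreal (pos 0 (fst p) (snd p)) + Gs 0 (fst p)) \<partial>\<pi>) = ennreal c * (cost + (\<integral>\<^sup>+ X. Gs 0 X \<partial>P0))"
proof -
  have "(\<lambda>p. ennreal (pos 0 (fst p) (snd p)) + Gs 0 (fst p)) \<in> borel_measurable \<pi>"
    using initial_measurable by (intro borel_measurable_add) simp_all
  then show ?thesis by (simp add: nn_integral_cmult initial_cost)
qed

lemma error_le_initial:
  assumes t: "t \<in> {0..T}"
  shows "total_error \<kappa> N B \<eta> (law_at \<kappa> N P0 t) (\<rho> t) \<le> ennreal (exp (rate * T)) * (cost + (\<integral>\<^sup>+ X. Gs 0 X \<partial>P0))"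
proof -
  have t0: "0 \<le> t" using t by simp
  have "total_error \<kappa> N B \<eta> (law_at \<kappa> N P0 t) (\<rho> t)
      \<le> (\<integral>\<^sup>+ p. ennreal (pos t (flow \<kappa> N t (fst p)) (snd p)) \<partial>\<pi>) + (\<integral>\<^sup>+ p. Gs t (flow \<kappa> N t (fst p)) \<partial>\<pi>)"
    unfolding total_error_eq nn_integral_law_at[OF t0 Gs_measurable[OF t]] coupling_nn_integral_fst[OF \<pi> Gs_flow_measurable[OF t]]
    by (intro add_right_mono W2_law_le t)
  also have "\<dots> = (\<integral>\<^sup>+ p. ennreal (pos t (flow \<kappa> N t (fst p)) (snd p)) + Gs t (flow \<kappa> N t (fst p)) \<partial>\<pi>)"
    using pos_measurable[OF t0] Gs_pi_measurable[OF t] by (intro nn_integral_add[symmetric]) simp_all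
  also have "\<dots> \<le> (\<integral>\<^sup>+ p. ennreal (exp (rate * T)) * (ennreal (pos 0 (fst p) (snd p)) + Gs 0 (fst p)) \<partial>\<pi>)"
  proof (rule nn_integral_mono_AE, use AE_pi in eventually_elim)
    case (elim p)
    then have X: "fst p \<in> space (config_space N)" "fst p \<notin> collisions N" by auto
    have nc: "flow \<kappa> N t (fst p) \<notin> collisions N" by (rule flow_not_collisions[OF X t0])
    have F: "0 \<le> Fs t (flow \<kappa> N t (fst p))" "0 \<le> Fs 0 (fst p)"
      using Fs_bounds(1)[OF t flow_in_space[OF X(1) t0] nc] Fs_bounds(1)[OF zero_in_T X] by auto
    have "0 \<le> integral {0..t} (\<lambda>s. Dis s (flow \<kappa> N s (fst p)))"
      by (rule integral_nonneg[OF integrable_continuous_interval[OF continuous_on_subset[OF Dis_continuous[OF X]]]]) (auto simp: Dis_nonneg)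
    then have "pos t (flow \<kappa> N t (fst p)) (snd p) + Fs t (flow \<kappa> N t (fst p)) \<le> (pos 0 (fst p) (snd p) + Fs 0 (fst p)) * exp (rate * t)"
      using gronwall_path[OF X t, of "snd p"] by linarith
    also have "\<dots> \<le> (pos 0 (fst p) (snd p) + Fs 0 (fst p)) * exp (rate * T)"
      using t rate_nonneg F(2) pos_nonneg by (intro mult_left_mono) (auto intro!: mult_left_mono)
    finally show ?case
      using F pos_nonneg X nc
      by (simp add: Gs_eq ennreal_plus[symmetric] ennreal_mult[symmetric] mult.commute ennreal_leI del: ennreal_plus)
  qed
  also have "\<dots> = ennreal (exp (rate * T)) * (cost + (\<integral>\<^sup>+ X. Gs 0 X \<partial>P0))"
    by (rule initial_cost_scaled)
  finally show ?thesis .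
qed

text \<open>Tonelli puts the time integral inside, so the pathwise estimate at the final time
  applies to each configuration; displacement and energy at that time are nonnegative and
  dropped.\<close>

lemma dissipation_le_initial:
  "(\<integral>\<^sup>+ t\<in>{0..T}. (\<integral>\<^sup>+ X. dissipation \<kappa> N X (\<rho> t) \<partial>law_at \<kappa> N P0 t) \<partial>lborel)
    \<le> ennreal (exp (rate * T)) * (cost + (\<integral>\<^sup>+ X. Gs 0 X \<partial>P0))"
proof -
  interpret P: prob_space P0 by (rule P0)
  interpret LP: pair_sigma_finite lborel P0 ..
  \<comment> \<open>Joint measurability of the flow is available with times clamped at 0; the
    indicator makes the clamping invisible.\<close>
  define D where "D t X = ennreal (Dis t (flow \<kappa> N (max 0 t) X)) * indicator {0..T} t" for t X
  have Dm: "case_prod D \<in> borel_measurable (lborel \<Otimes>\<^sub>M P0)"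
  proof -
    have "(\<lambda>p. flow \<kappa> N (max 0 (fst p)) (snd p)) \<in> measurable (lborel \<Otimes>\<^sub>M P0) (config_space N)"
      using flow_joint_measurable
      by (simp add: measurable_cong_sets[OF sets_pair_measure_cong[OF sets_lborel P0(2)] refl])
    moreover have "fst \<in> borel_measurable (lborel \<Otimes>\<^sub>M P0)" by measurable
    ultimately
    have [measurable]: "(\<lambda>p. Dis (fst p) (flow \<kappa> N (max 0 (fst p)) (snd p))) \<in> borel_measurable (lborel \<Otimes>\<^sub>M P0)"
      by (intro Dis_measurable)
    show ?thesis unfolding D_def case_prod_beta by measurable
  qed
  have "(\<integral>\<^sup>+ t\<in>{0..T}. (\<integral>\<^sup>+ X. dissipation \<kappa> N X (\<rho> t) \<partial>law_at \<kappa> N P0 t) \<partial>lborel) = (\<integral>\<^sup>+ t. (\<integral>\<^sup>+ X. D t X \<partial>P0) \<partial>lborel)"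
  proof (intro nn_integral_cong)
    fix t :: real
    show "(\<integral>\<^sup>+ X. dissipation \<kappa> N X (\<rho> t) \<partial>law_at \<kappa> N P0 t) * indicator {0..T} t = (\<integral>\<^sup>+ X. D t X \<partial>P0)"
    proof (cases "t \<in> {0..T}")
      case True
      then have t0: "0 \<le> t" by simp
      have "(\<integral>\<^sup>+ X. dissipation \<kappa> N X (\<rho> t) \<partial>law_at \<kappa> N P0 t) = (\<integral>\<^sup>+ X. dissipation \<kappa> N (flow \<kappa> N t X) (\<rho> t) \<partial>P0)"
        by (rule nn_integral_law_at[OF t0 dissipation_measurable[OF True]])
      also have "\<dots> = (\<integral>\<^sup>+ X. D t X \<partial>P0)"
      proof (rule nn_integral_cong_AE, use AE_P0 in eventually_elim)
        case (elim X)
        then show ?case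
          using dissipation_eq[OF True flow_not_collisions[of X t]] True t0 by (simp add: D_def max_def)
      qed
      finally show ?thesis using True by simp
    qed (simp add: D_def)
  qed
  also have "\<dots> = (\<integral>\<^sup>+ X. (\<integral>\<^sup>+ t. D t X \<partial>lborel) \<partial>P0)"
    by (rule LP.Fubini'[OF Dm, symmetric])
  also have "\<dots> = (\<integral>\<^sup>+ p. (\<integral>\<^sup>+ t. D t (fst p) \<partial>lborel) \<partial>\<pi>)"
  proof (rule coupling_nn_integral_fst[OF \<pi>, symmetric])
    have "case_prod (\<lambda>X t. D t X) \<in> borel_measurable (P0 \<Otimes>\<^sub>M lborel)"
      using measurable_pair_swap[OF Dm] by (simp add: case_prod_beta')
    then show "(\<lambda>X. \<integral>\<^sup>+ t. D t X \<partial>lborel) \<in> borel_measurable P0" by (rule lborel.borel_measurable_nn_integral)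
  qed
  also have "\<dots> \<le> (\<integral>\<^sup>+ p. ennreal (exp (rate * T)) * (ennreal (pos 0 (fst p) (snd p)) + Gs 0 (fst p)) \<partial>\<pi>)"
  proof (rule nn_integral_mono_AE, use AE_pi in eventually_elim)
    case (elim p)
    then have X: "fst p \<in> space (config_space N)" "fst p \<notin> collisions N" by auto
    let ?D = "\<lambda>s. Dis s (flow \<kappa> N s (fst p))"
    have TT: "T \<in> {0..T}" using T by simp
    have T0: "0 \<le> T" using T by simp
    have nc: "flow \<kappa> N T (fst p) \<notin> collisions N" by (rule flow_not_collisions[OF X T0])
    have F: "0 \<le> Fs T (flow \<kappa> N T (fst p))" "0 \<le> Fs 0 (fst p)"
      using Fs_bounds(1)[OF TT flow_in_space[OF X(1) T0] nc] Fs_bounds(1)[OF zero_in_T X] by auto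
    have c: "continuous_on {0..T} ?D"
      by (rule continuous_on_subset[OF Dis_continuous[OF X]]) auto
    have "((\<lambda>t. if t \<in> {0..T} then ?D t else 0) has_integral integral {0..T} ?D) UNIV"
      unfolding has_integral_restrict_UNIV by (rule integrable_integral[OF integrable_continuous_interval[OF c]])
    moreover have "(\<lambda>t. if t \<in> {0..T} then ?D t else 0) \<in> borel_measurable borel"
    proof -
      have "(\<lambda>t. if t \<in> {0..T} then ?D t else 0) = (\<lambda>t. indicator {0..T} t *\<^sub>R ?D t)"
        by (auto simp: fun_eq_iff)
      then show ?thesis using borel_measurable_continuous_on_indicator[OF _ c] by simp
    qed
    ultimately have "(\<integral>\<^sup>+ t. ennreal (if t \<in> {0..T} then ?D t else 0) \<partial>lborel) = ennreal (integral {0..T} ?D)"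
      by (intro nn_integral_has_integral_lborel) (auto simp: Dis_nonneg)
    also have "(\<integral>\<^sup>+ t. ennreal (if t \<in> {0..T} then ?D t else 0) \<partial>lborel) = (\<integral>\<^sup>+ t. D t (fst p) \<partial>lborel)"
      by (intro nn_integral_cong) (auto simp: D_def max_def indicator_def)
    also have "integral {0..T} ?D \<le> (pos 0 (fst p) (snd p) + Fs 0 (fst p)) * exp (rate * T)"
      using gronwall_path[OF X TT, of "snd p"] F pos_nonneg[of T "flow \<kappa> N T (fst p)" "snd p"] by linarith
    finally show ?case
      using F pos_nonneg X
      by (simp add: Gs_eq ennreal_plus[symmetric] ennreal_mult[symmetric] mult.commute ennreal_leI del: ennreal_plus)
  qed
  also have "\<dots> = ennreal (exp (rate * T)) * (cost + (\<integral>\<^sup>+ X. Gs 0 X \<partial>P0))"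
    by (rule initial_cost_scaled)
  finally show ?thesis .
qed

lemma error_plus_dissipation_le:
  "(SUP t\<in>{0..T}. total_error \<kappa> N B \<eta> (law_at \<kappa> N P0 t) (\<rho> t)) +
    (\<integral>\<^sup>+ t\<in>{0..T}. (\<integral>\<^sup>+ X. dissipation \<kappa> N X (\<rho> t) \<partial>law_at \<kappa> N P0 t) \<partial>lborel)
    \<le> ennreal (2 * exp (rate * T)) * (cost + (\<integral>\<^sup>+ X. Gs 0 X \<partial>P0))"
proof -
  have "(SUP t\<in>{0..T}. total_error \<kappa> N B \<eta> (law_at \<kappa> N P0 t) (\<rho> t)) \<le> ennreal (exp (rate * T)) * (cost + (\<integral>\<^sup>+ X. Gs 0 X \<partial>P0))"
    by (intro SUP_least error_le_initial)
  moreover have "ennreal (2 * exp (rate * T)) = ennreal (exp (rate * T)) + ennreal (exp (rate * T))"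
    by (subst ennreal_plus[symmetric]) simp_all
  ultimately show ?thesis
    by (simp only: distrib_right add_mono[OF _ dissipation_le_initial])
qed

end

text \<open>No optimal coupling is invoked: one whose cost exceeds the infimum by \<open>d\<close>
  suffices, and \<open>d\<close> is chosen so that after division by \<open>N\<close> and
  multiplication by the constant the loss is exactly \<open>e\<close>.\<close>

lemma error_bound:
  "(SUP t\<in>{0..T}. total_error \<kappa> N B \<eta> (law_at \<kappa> N P0 t) (\<rho> t)) +
    (\<integral>\<^sup>+ t\<in>{0..T}. (\<integral>\<^sup>+ X. dissipation \<kappa> N X (\<rho> t) \<partial>law_at \<kappa> N P0 t) \<partial>lborel)
    \<le> ennreal (2 * exp (rate * T)) * total_error \<kappa> N B \<eta> P0 (\<rho> 0)" (is "?L \<le> ennreal ?K * _")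
proof (rule ennreal_le_epsilon)
  fix e :: real assume e: "0 < e"
  let ?w = "(W2 (config_dist N) P0 (tensor_power N (\<rho> 0)))\<^sup>2"
  let ?b = "\<integral>\<^sup>+ X. Gs 0 X \<partial>P0"
  define d where "d = e * real N / ?K"
  have K: "0 < ?K" by simp
  have d: "0 < d" using e N0 K unfolding d_def by (intro divide_pos_pos mult_pos_pos) auto
  have "?w < \<infinity>"
  proof (rule ccontr)
    assume "\<not> ?w < \<infinity>"
    then have "?w = \<infinity>" by (simp add: not_less top_unique)
    then have "?w / of_nat N = \<infinity>" by (simp add: ennreal_top_divide ennreal_of_nat_eq_real_of_nat)
    then show False using finite_error by (simp add: total_error_eq)
  qed
  then have "?w < ?w + ennreal d" using d by (cases ?w) (auto simp: ennreal_plus[symmetric] ennreal_less_iff simp del: ennreal_plus)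
  from coupling_exists_lt[OF this] obtain \<pi> where \<pi>: "\<pi> \<in> couplings P0 (tensor_power N (\<rho> 0))"
    and c: "(\<integral>\<^sup>+ p. ennreal ((config_dist N (fst p) (snd p))\<^sup>2) \<partial>\<pi>) < ?w + ennreal d" by blast
  have "cost \<pi> \<le> (?w + ennreal d) / of_nat N"
    unfolding cost_def[OF \<pi>] by (intro divide_right_mono_ennreal less_imp_le c)
  then have "cost \<pi> + ?b \<le> (?w / of_nat N + ennreal d / of_nat N) + ?b"
    by (intro add_right_mono) (simp add: add_divide_distrib_ennreal)
  then have "?L \<le> ennreal ?K * ((?w / of_nat N + ennreal d / of_nat N) + ?b)"
    by (rule order_trans[OF error_plus_dissipation_le[OF \<pi>] mult_left_mono]) simp
  also have "\<dots> = ennreal ?K * total_error \<kappa> N B \<eta> P0 (\<rho> 0) + ennreal ?K * (ennreal d / of_nat N)"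
    by (simp only: total_error_eq distrib_left ac_simps)
  also have "ennreal ?K * (ennreal d / of_nat N) = ennreal (?K * (d / real N))"
  proof -
    have "ennreal d / of_nat N = ennreal (d / real N)"
      using d N0 by (simp add: ennreal_of_nat_eq_real_of_nat divide_ennreal)
    then show ?thesis using d by (simp only: ennreal_mult[OF less_imp_le[OF K] divide_nonneg_nonneg[OF less_imp_le[OF d] of_nat_0_le_iff]])
  qed
  also have "?K * (d / real N) = e"
    using K N0 by (simp add: d_def)
  finally show "?L \<le> ennreal ?K * total_error \<kappa> N B \<eta> P0 (\<rho> 0) + ennreal e" .
qed

end

end

section \<open>Marginals of symmetric laws\<close>

lemma shift_bij_betw:
  assumes "0 < N" shows "bij_betw (\<lambda>r. (j + r) mod N) {..<N} {..<N::nat}"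
proof -
  have *: False if "r < r'" "r' < N" "(j + r) mod N = (j + r') mod N" for r r'
  proof -
    have "N dvd (j + r') - (j + r)"
      using that mod_eq_dvd_iff_nat[of "j + r" "j + r'" N] by simp
    then have "N \<le> r' - r" using that by (intro dvd_imp_le) auto
    then show False using that by simp
  qed
  have inj: "inj_on (\<lambda>r. (j + r) mod N) {..<N}"
  proof (rule inj_onI)
    fix r r' assume "r \<in> {..<N}" "r' \<in> {..<N}" "(j + r) mod N = (j + r') mod N"
    then show "r = r'" using *[of r r'] *[of r' r] by (cases r r' rule: linorder_cases) auto
  qed
  have "(\<lambda>r. (j + r) mod N) ` {..<N} \<subseteq> {..<N}" using assms by auto
  from endo_inj_surj[OF _ this inj] inj show ?thesis by (simp add: bij_betw_def)
qed

lemma permute_measurable: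
  assumes \<sigma>: "\<sigma> permutes {..<N}"
  shows "(\<lambda>X. X \<circ> \<sigma>) \<in> measurable (config_space N) (config_space N :: (nat \<Rightarrow> real^'n) measure)"
proof (rule measurable_PiM_single')
  fix i assume "i \<in> {..<N}"
  then have "\<sigma> i \<in> {..<N}" using permutes_in_image[OF \<sigma>] by simp
  then show "(\<lambda>X. (X \<circ> \<sigma>) i) \<in> borel_measurable (config_space N :: (nat \<Rightarrow> real^'n) measure)"
    unfolding comp_def by (rule measurable_component_singleton)
next
  show "(\<lambda>X. X \<circ> \<sigma>) \<in> space (config_space N :: (nat \<Rightarrow> real^'n) measure) \<rightarrow> (\<Pi>\<^sub>E i\<in>{..<N}. space borel)"
    using permutes_not_in[OF \<sigma>] by (auto simp: space_PiM PiE_def extensional_def)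
qed

text \<open>By symmetry every block of \<open>k\<close> cyclically consecutive coordinates of a coupling couples the
  \<open>k\<close>-marginals; averaging over the \<open>N\<close> blocks, each coordinate is used \<open>k\<close> times.\<close>

lemma marginal_W2_le:
  fixes P :: "(nat \<Rightarrow> real^'n) measure"
  assumes P: "sets P = sets (config_space N)" and sym: "symmetric_law N P"
    and f: "prob_density f" and k: "1 \<le> k" "k \<le> N"
  shows "(W2 (config_dist k) (marginal k P) (tensor_power k f))\<^sup>2
    \<le> of_nat k * ((W2 (config_dist N) P (tensor_power N f))\<^sup>2 / of_nat N)"
proof -
  let ?w = "(W2 (config_dist k) (marginal k P) (tensor_power k f))\<^sup>2"
  have N: "0 < N" using k by simp
  have sm: "sets (marginal k P) = sets (config_space k)" by (simp add: marginal_def)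
  have sT: "sets (tensor_power M f) = sets (config_space M :: (nat \<Rightarrow> real^'n) measure)" for M
    by (intro sets_PiM_cong) simp_all
  have lt: "(j + r) mod N \<in> {..<N}" for j r using N by simp
  define h where "h r = (\<lambda>X :: nat \<Rightarrow> real^'n. \<lambda>j\<in>{..<k}. X ((j + r) mod N))" for r
  have hm: "h r \<in> measurable (config_space N) (config_space k)" for r
    unfolding h_def by (intro measurable_restrict measurable_component_singleton lt)
  have hP: "h r \<in> measurable P (marginal k P)" for r
    using hm by (simp add: measurable_cong_sets[OF P sm])
  have hT: "h r \<in> measurable (tensor_power N f) (tensor_power k f)" for r
    using hm by (simp add: measurable_cong_sets[OF sT sT])
  have dP: "distr P (marginal k P) (h r) = marginal k P" for r
  proof -
    \<comment> \<open>The cyclic shift, continued by the identity because a permutation of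
      \<open>{..<N}\<close> is a function on all indices.\<close>
    define \<sigma> where "\<sigma> i = (if i < N then (i + r) mod N else i)" for i
    have "bij_betw (\<lambda>i. (r + i) mod N) {..<N} {..<N}" by (rule shift_bij_betw[OF N])
    then have "bij_betw \<sigma> {..<N} {..<N}"
      by (rule bij_betw_cong[THEN iffD1, rotated]) (simp add: \<sigma>_def add.commute)
    then have \<sigma>: "\<sigma> permutes {..<N}" by (rule bij_imp_permutes) (simp add: \<sigma>_def)
    have pm: "(\<lambda>X. X \<circ> \<sigma>) \<in> measurable P (config_space N :: (nat \<Rightarrow> real^'n) measure)"
      using permute_measurable[OF \<sigma>] by (simp add: measurable_cong_sets[OF P refl])
    have rm: "(\<lambda>X. restrict X {..<k}) \<in> measurable (config_space N) (config_space k :: (nat \<Rightarrow> real^'n) measure)"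
      using k by (intro measurable_restrict_subset) auto
    have e: "h r = (\<lambda>X. restrict X {..<k}) \<circ> (\<lambda>X. X \<circ> \<sigma>)"
      using k by (auto simp: h_def \<sigma>_def fun_eq_iff restrict_def)
    have "distr P (marginal k P) (h r) = distr P (config_space k) (h r)"
      by (rule distr_cong) (simp_all add: sm)
    also have "\<dots> = distr (distr P (config_space N) (\<lambda>X. X \<circ> \<sigma>)) (config_space k) (\<lambda>X. restrict X {..<k})"
      unfolding e by (rule distr_distr[OF rm pm, symmetric])
    also have "distr P (config_space N) (\<lambda>X. X \<circ> \<sigma>) = P"
      using sym \<sigma> unfolding symmetric_law_def by blast
    finally show ?thesis by (simp only: marginal_def)
  qed
  \<comment> \<open>For a product of equal factors no symmetry argument is needed: distinct indices
    suffice, and \<open>k \<le> N\<close> keeps a block from wrapping onto itself.\<close>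
  have dT: "distr (tensor_power N f) (tensor_power k f) (h r) = tensor_power k f" for r
  proof -
    have "inj_on (\<lambda>j. (j + r) mod N) {..<k}"
      using bij_betw_imp_inj_on[OF shift_bij_betw[OF N, of r]] k
      unfolding add.commute[of r] by (elim inj_on_subset) simp
    from distr_PiM_reindex[of "{..<N}" "\<lambda>_. density_law f", OF prob_density_prob_space[OF f] this]
    show ?thesis using N by (simp add: h_def)
  qed
  have block: "of_nat N * ?w \<le> of_nat k * (\<integral>\<^sup>+ p. ennreal ((config_dist N (fst p) (snd p))\<^sup>2) \<partial>\<pi>)"
    if \<pi>: "\<pi> \<in> couplings P (tensor_power N f)" for \<pi>
  proof -
    have s: "sets \<pi> = sets (config_space N \<Otimes>\<^sub>M (config_space N :: (nat \<Rightarrow> real^'n) measure))"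
    proof -
      have "sets \<pi> = sets (P \<Otimes>\<^sub>M tensor_power N f)" using \<pi> by (simp add: couplings_def)
      also have "\<dots> = sets (config_space N \<Otimes>\<^sub>M (config_space N :: (nat \<Rightarrow> real^'n) measure))"
        by (rule sets_pair_measure_cong[OF P sT])
      finally show ?thesis .
    qed
    define a where "a i = (\<integral>\<^sup>+ p. ennreal ((dist (fst p i) (snd p i))\<^sup>2) \<partial>\<pi>)" for i
    have am: "(\<lambda>p. ennreal ((dist (fst p i) (snd p i))\<^sup>2)) \<in> borel_measurable \<pi>" if i: "i \<in> {..<N}" for i
    proof -
      have [measurable]: "(\<lambda>p. fst p i) \<in> borel_measurable ((config_space N :: (nat \<Rightarrow> real^'n) measure) \<Otimes>\<^sub>M (config_space N :: (nat \<Rightarrow> real^'n) measure))"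
        by (rule measurable_compose[OF measurable_fst measurable_component_singleton[OF i]])
      have [measurable]: "(\<lambda>p. snd p i) \<in> borel_measurable ((config_space N :: (nat \<Rightarrow> real^'n) measure) \<Otimes>\<^sub>M (config_space N :: (nat \<Rightarrow> real^'n) measure))"
        by (rule measurable_compose[OF measurable_snd measurable_component_singleton[OF i]])
      show ?thesis by (simp add: measurable_cong_sets[OF s refl])
    qed
    have w: "?w \<le> (\<Sum>j<k. a ((j + r) mod N))" for r
    proof -
      let ?h = "\<lambda>p. (h r (fst p), h r (snd p))"
      have c: "distr \<pi> (marginal k P \<Otimes>\<^sub>M tensor_power k f) ?h \<in> couplings (marginal k P) (tensor_power k f)"
        by (rule coupling_distr[OF \<pi> hP hT dP dT])
      have m: "?h \<in> measurable \<pi> (marginal k P \<Otimes>\<^sub>M tensor_power k f)"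
      proof -
        have "fst \<in> measurable \<pi> P" "snd \<in> measurable \<pi> (tensor_power N f)"
          using \<pi> by (simp_all add: couplings_def cong: measurable_cong_sets)
        from measurable_Pair[OF measurable_compose[OF this(1) hP] measurable_compose[OF this(2) hT]]
        show ?thesis .
      qed
      have "?w \<le> (\<integral>\<^sup>+ p. ennreal (\<Sum>j<k. (dist (h r (fst p) j) (h r (snd p) j))\<^sup>2) \<partial>\<pi>)"
        using W2_power2_le_cost[OF c, of "config_dist k"] config_cost_distr[OF disjI2[OF sm] disjI2[OF sT] m] by simp
      also have "\<dots> = (\<integral>\<^sup>+ p. (\<Sum>j<k. ennreal ((dist (fst p ((j + r) mod N)) (snd p ((j + r) mod N)))\<^sup>2)) \<partial>\<pi>)"
        by (simp add: h_def)
      also have "\<dots> = (\<Sum>j<k. a ((j + r) mod N))"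
        unfolding a_def by (intro nn_integral_sum am lt)
      finally show ?thesis .
    qed
    have "of_nat N * ?w = (\<Sum>r<N. ?w)" by simp
    also have "\<dots> \<le> (\<Sum>r<N. \<Sum>j<k. a ((j + r) mod N))"
      by (rule sum_mono) (rule w)
    also have "\<dots> = (\<Sum>j<k. \<Sum>r<N. a ((j + r) mod N))" by (rule sum.swap)
    also have "\<dots> = (\<Sum>j<k. \<Sum>i<N. a i)"
      by (rule sum.cong[OF refl]) (rule sum.reindex_bij_betw[OF shift_bij_betw[OF N]])
    also have "(\<Sum>i<N. a i) = (\<integral>\<^sup>+ p. ennreal ((config_dist N (fst p) (snd p))\<^sup>2) \<partial>\<pi>)"
      unfolding a_def config_dist_power2 using nn_integral_sum[OF am, of "{..<N}"] by simp
    finally show ?thesis by simp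
  qed
  have k0: "(of_nat k :: ennreal) \<noteq> 0" "(of_nat k :: ennreal) \<noteq> top" using k by (auto simp: ennreal_of_nat_neq_top)
  have n0: "(of_nat N :: ennreal) \<noteq> 0" "(of_nat N :: ennreal) \<noteq> top" using N by (auto simp: ennreal_of_nat_neq_top)
  have "of_nat N * ?w / of_nat k \<le> (W2 (config_dist N) P (tensor_power N f))\<^sup>2"
    unfolding W2_power2[of "config_dist N"]
  proof (rule INF_greatest)
    fix \<pi> assume "\<pi> \<in> couplings P (tensor_power N f)"
    from divide_right_mono_ennreal[OF block[OF this], of "of_nat k"]
    show "of_nat N * ?w / of_nat k \<le> (\<integral>\<^sup>+ p. ennreal ((config_dist N (fst p) (snd p))\<^sup>2) \<partial>\<pi>)"
      using k0 by (simp add: mult.commute[of "of_nat k"] ennreal_mult_divide_eq)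
  qed
  then have "of_nat k * (of_nat N * ?w / of_nat k / of_nat N) \<le> of_nat k * ((W2 (config_dist N) P (tensor_power N f))\<^sup>2 / of_nat N)"
    by (intro mult_left_mono divide_right_mono_ennreal) auto
  \<comment> \<open>The cancellation includes the case of infinite cost, as \<open>k\<close> and
    \<open>N\<close> are positive and finite.\<close>
  also have "of_nat k * (of_nat N * ?w / of_nat k / of_nat N) = ?w"
    using k N by (cases ?w) (simp_all add: ennreal_of_nat_eq_real_of_nat ennreal_mult[symmetric] divide_ennreal
        ennreal_mult_top ennreal_top_divide)
  finally show ?thesis .
qed

section \<open>Propagation of symmetry\<close>

context particles
begin

text \<open>The flow commutes with relabelling everywhere: off collisions by uniqueness, and on the
  collision set because that set is invariant under relabelling and the flow is the identity
  there.\<close>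

lemma symmetric_law_at:
  fixes P0 :: "(nat \<Rightarrow> real^'n) measure"
  assumes P0: "sets P0 = sets (config_space N)" and sym: "symmetric_law N P0" and t: "0 \<le> t"
  shows "symmetric_law N (law_at \<kappa> N P0 t)"
  unfolding symmetric_law_def
proof (intro allI impI)
  fix \<sigma> assume \<sigma>: "\<sigma> permutes {..<N}"
  have fm: "flow \<kappa> N t \<in> measurable (config_space N) (config_space N :: (nat \<Rightarrow> real^'n) measure)"
    by (rule flow_measurable[OF t])
  have fP: "flow \<kappa> N t \<in> measurable P0 (config_space N)"
    using fm by (simp add: measurable_cong_sets[OF P0 refl])
  have pm: "(\<lambda>X. X \<circ> \<sigma>) \<in> measurable (config_space N) (config_space N :: (nat \<Rightarrow> real^'n) measure)"
    by (rule permute_measurable[OF \<sigma>])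
  have pP: "(\<lambda>X. X \<circ> \<sigma>) \<in> measurable P0 (config_space N)"
    using pm by (simp add: measurable_cong_sets[OF P0 refl])
  have comm: "flow \<kappa> N t X \<circ> \<sigma> = flow \<kappa> N t (X \<circ> \<sigma>)" if X: "X \<in> space P0" for X
  proof (cases "X \<in> collisions N")
    case True
    then obtain i j where ij: "i < N" "j < N" "i \<noteq> j" "X i = X j" by (auto simp: collisions_def)
    let ?i = "inv \<sigma> i" and ?j = "inv \<sigma> j"
    have "?i < N" "?j < N" using permutes_in_image[OF permutes_inv[OF \<sigma>]] ij by auto
    moreover have "?i \<noteq> ?j" using ij(3) permutes_inv_eq[OF \<sigma>] by metis
    moreover have "(X \<circ> \<sigma>) ?i = (X \<circ> \<sigma>) ?j" using ij(4) permutes_inverses[OF \<sigma>] by simp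
    ultimately have "X \<circ> \<sigma> \<in> collisions N" unfolding collisions_def by blast
    then show ?thesis using True by (simp add: flow_collisions)
  next
    case False
    have "X \<in> space (config_space N)" using X sets_eq_imp_space_eq[OF P0] by simp
    from flow_permute[OF this False \<sigma> t] show ?thesis by simp
  qed
  have "distr (law_at \<kappa> N P0 t) (config_space N) (\<lambda>X. X \<circ> \<sigma>) = distr P0 (config_space N) (\<lambda>X. flow \<kappa> N t X \<circ> \<sigma>)"
    unfolding law_at_def by (subst distr_distr[OF pm fP]) (simp add: comp_def)
  also have "\<dots> = distr P0 (config_space N) (\<lambda>X. flow \<kappa> N t (X \<circ> \<sigma>))"
    by (rule distr_cong[OF refl refl comm])
  also have "\<dots> = distr (distr P0 (config_space N) (\<lambda>X. X \<circ> \<sigma>)) (config_space N) (flow \<kappa> N t)"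
    by (subst distr_distr[OF fm pP]) (simp add: comp_def)
  also have "distr P0 (config_space N) (\<lambda>X. X \<circ> \<sigma>) = P0"
    using sym \<sigma> unfolding symmetric_law_def by blast
  finally show "distr (law_at \<kappa> N P0 t) (config_space N) (\<lambda>X. X \<circ> \<sigma>) = law_at \<kappa> N P0 t"
    by (simp only: law_at_def)
qed

end

theorem theorem1p3:
  fixes eta0 :: "real \<Rightarrow> real" and B C_com :: "real \<Rightarrow> real \<Rightarrow> real"
  assumes dim: "CARD('n::finite) \<ge> 2"
    and constants: "\<And>\<kappa>s \<Lambda>. 0 < \<kappa>s \<Longrightarrow> 0 < \<Lambda> \<Longrightarrow>
      commutator_constants TYPE('n) \<kappa>s \<Lambda> (eta0 \<kappa>s) (B \<kappa>s \<Lambda>) (C_com \<kappa>s \<Lambda>)"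
  shows "\<exists>C :: real \<Rightarrow> real \<Rightarrow> real \<Rightarrow> real.
    \<forall>T \<kappa>s \<Lambda> \<kappa> N (\<rho> :: real \<Rightarrow> real^'n \<Rightarrow> real) P0 \<eta>.
      0 < \<kappa>s \<and> 0 < \<kappa> \<and> \<kappa> \<le> \<kappa>s \<and> 0 < T \<and> 2 \<le> N \<and>
      solution \<kappa> T \<rho> \<and> Lambda_bound \<kappa> T \<rho> = ennreal \<Lambda> \<and>
      config_P2 N P0 \<and> symmetric_law N P0 \<and> 0 < \<eta> \<and> \<eta> < eta0 \<kappa>s \<and>
      total_error \<kappa> N (B \<kappa>s \<Lambda>) \<eta> P0 (\<rho> 0) < \<infinity> \<longrightarrow>
        (SUP t\<in>{0..T}. total_error \<kappa> N (B \<kappa>s \<Lambda>) \<eta> (law_at \<kappa> N P0 t) (\<rho> t)) +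
        (\<integral>\<^sup>+ t\<in>{0..T}. (\<integral>\<^sup>+ X. dissipation \<kappa> N X (\<rho> t) \<partial>law_at \<kappa> N P0 t) \<partial>lborel)
          \<le> ennreal (C T \<kappa>s \<Lambda>) * total_error \<kappa> N (B \<kappa>s \<Lambda>) \<eta> P0 (\<rho> 0) \<and>
        (SUP t\<in>{0..T}. (W2 (config_dist N) (law_at \<kappa> N P0 t) (tensor_power N (\<rho> t)))\<^sup>2 / of_nat N)
          \<le> ennreal (C T \<kappa>s \<Lambda>) * total_error \<kappa> N (B \<kappa>s \<Lambda>) \<eta> P0 (\<rho> 0) \<and>
        (\<forall>k. 1 \<le> k \<and> k \<le> N \<longrightarrow>
          (SUP t\<in>{0..T}.
             (W2 (config_dist k) (marginal k (law_at \<kappa> N P0 t)) (tensor_power k (\<rho> t)))\<^sup>2)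
          \<le> ennreal (C T \<kappa>s \<Lambda>) * of_nat k * total_error \<kappa> N (B \<kappa>s \<Lambda>) \<eta> P0 (\<rho> 0))"
proof (intro exI allI impI)
  \<comment> \<open>The exponent is \<open>rate\<close> with the commutator constant for the pair of
    \<kappa>s and \<Lambda>, times \<open>T\<close>. Neither \<open>N\<close>, \<open>k\<close> and
    \<open>\<eta>\<close> nor the individual \<kappa> and density occur.\<close>
  let ?C = "\<lambda>T \<kappa>s \<Lambda>. 2 * exp ((2 * \<Lambda> + 1 + C_com \<kappa>s \<Lambda> * \<Lambda>) * T)"
  fix T \<kappa>s \<Lambda> \<kappa> \<eta> :: real and N and \<rho> :: "real \<Rightarrow> real^'n \<Rightarrow> real" and P0 :: "(nat \<Rightarrow> real^'n) measure"
  assume H: "0 < \<kappa>s \<and> 0 < \<kappa> \<and> \<kappa> \<le> \<kappa>s \<and> 0 < T \<and> 2 \<le> N \<and>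
      solution \<kappa> T \<rho> \<and> Lambda_bound \<kappa> T \<rho> = ennreal \<Lambda> \<and>
      config_P2 N P0 \<and> symmetric_law N P0 \<and> 0 < \<eta> \<and> \<eta> < eta0 \<kappa>s \<and>
      total_error \<kappa> N (B \<kappa>s \<Lambda>) \<eta> P0 (\<rho> 0) < \<infinity>"
  interpret particles \<kappa> T \<Lambda> \<rho> N
    using H dim by unfold_locales auto
  interpret commutator_bound \<kappa> T \<Lambda> \<rho> N \<kappa>s \<eta> "eta0 \<kappa>s" "B \<kappa>s \<Lambda>" "C_com \<kappa>s \<Lambda>"
    using H Lambda_ge_1 constants by unfold_locales auto
  have P0: "prob_space P0" "sets P0 = sets (config_space N)"
    using H by (auto simp: config_P2_def)
  have fin: "total_error \<kappa> N (B \<kappa>s \<Lambda>) \<eta> P0 (\<rho> 0) < \<infinity>" using H by blast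
  let ?E = "total_error \<kappa> N (B \<kappa>s \<Lambda>) \<eta>"
  let ?K = "ennreal (?C T \<kappa>s \<Lambda>)"
  let ?W = "\<lambda>t. (W2 (config_dist N) (law_at \<kappa> N P0 t) (tensor_power N (\<rho> t)))\<^sup>2 / of_nat N"
  let ?S = "SUP t\<in>{0..T}. ?E (law_at \<kappa> N P0 t) (\<rho> t)"
  let ?D = "\<integral>\<^sup>+ t\<in>{0..T}. (\<integral>\<^sup>+ X. dissipation \<kappa> N X (\<rho> t) \<partial>law_at \<kappa> N P0 t) \<partial>lborel"
  have main: "?S + ?D \<le> ?K * ?E P0 (\<rho> 0)"
    using error_bound[OF P0 fin] by (simp only: rate_def)
  have W: "?W t \<le> ?K * ?E P0 (\<rho> 0)" if t: "t \<in> {0..T}" for t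
  proof -
    have "?W t \<le> ?E (law_at \<kappa> N P0 t) (\<rho> t)" by (simp add: total_error_def)
    also have "\<dots> \<le> ?S" by (rule SUP_upper[OF t])
    also have "\<dots> \<le> ?S + ?D" by simp
    also note main
    finally show ?thesis .
  qed
  have marg: "(W2 (config_dist k) (marginal k (law_at \<kappa> N P0 t)) (tensor_power k (\<rho> t)))\<^sup>2 \<le> ?K * of_nat k * ?E P0 (\<rho> 0)"
    if k: "1 \<le> k" "k \<le> N" and t: "t \<in> {0..T}" for k t
  proof -
    have "sets (law_at \<kappa> N P0 t) = sets (config_space N)" by (simp add: law_at_def)
    moreover have "symmetric_law N (law_at \<kappa> N P0 t)"
      using H t by (intro symmetric_law_at P0(2)) auto
    ultimately have "(W2 (config_dist k) (marginal k (law_at \<kappa> N P0 t)) (tensor_power k (\<rho> t)))\<^sup>2 \<le> of_nat k * ?W t"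
      by (rule marginal_W2_le[OF _ _ density[OF t] k])
    also have "\<dots> \<le> of_nat k * (?K * ?E P0 (\<rho> 0))"
      by (intro mult_left_mono W t) simp
    finally show ?thesis by (simp only: ac_simps)
  qed
  show "?S + ?D \<le> ?K * ?E P0 (\<rho> 0) \<and> (SUP t\<in>{0..T}. ?W t) \<le> ?K * ?E P0 (\<rho> 0) \<and>
    (\<forall>k. 1 \<le> k \<and> k \<le> N \<longrightarrow>
      (SUP t\<in>{0..T}. (W2 (config_dist k) (marginal k (law_at \<kappa> N P0 t)) (tensor_power k (\<rho> t)))\<^sup>2)
        \<le> ?K * of_nat k * ?E P0 (\<rho> 0))"
    using main W marg by (intro conjI allI impI SUP_least) auto
qed

end
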